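(* Let $J\in\{I,J_1,J_+\}$ and let $G$ be an abelian group. The cohomology groups $H_J^n(-;G)$, and likewise the cohomology groups $H_{(J,\times)}^n(-;G)$, together with their relative versions and the connecting homomorphisms of pairs, form a $(J,\times)$ cohomology theory of closure spaces.
   Context: A closure space $(X,c)$ is a set $X$ with a map $c:\mathcal P(X)\to\mathcal P(X)$ such that $c(\emptyset)=\emptyset$, $A\subseteq c(A)$, and $c(A\cup B)=c(A)\cup c(B)$. A subset $A\subseteq X$ carries the subspace closure $B\mapsto c(B)\cap A$. The interior is $i(A)=X\setminus c(X\setminus A)$, and $V$ is a neighborhood of $x$ if $x\in i(V)$. An interior cover of $X$ is a family $\mathcal U$ of subsets with $X=\bigcup_{U\in\mathcal U}i(U)$. A map $f:(X,c)\to(Y,d)$ is continuous if $f(c(A))\subseteq d(f(A))$ for all $A\subseteq X$. Topological spaces are closure spaces via the topological closure. The product $X\times Y$ is the set product with the closure for which the sets $U\times V$ ($U$ a neighborhood of $x$, $V$ of $y$) form a neighborhood base at $(x,y)$. Spaces: $I=[0,1]$ with the usual topology; $J_1=\{0,1\}$ with the indiscrete closure; $J_+=\{0,1\}$ with $c(\{0\})=\{0,1\}$, $c(\{1\})=\{1\}$. Singular simplices: $|\Delta^n|^{I}$ is the standard topological $n$-simplex; $|\Delta^n|^{J_1}$ is $\{0,\dots,n\}$ with the indiscrete closure; $|\Delta^n|^{J_+}$ is $\{0,\dots,n\}$ with $c(\{i\})=\{j: j\ge i\}$. $C^J_n(X)$ is the free abelian group on continuous maps $\sigma:|\Delta^n|^J\to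 X$, with $\partial\sigma=\sum_{i=0}^n(-1)^i\sigma\circ d^i$, $d^i$ the $i$-th face inclusion. Singular cubes: $J^{\times n}$ is the $n$-fold product (a point if $n=0$). Let $Q_n(X)$ be the free abelian group on continuous maps $\sigma:J^{\times n}\to X$ and $D_n(X)$ the subgroup generated by the degenerate $\sigma$, i.e. those that do not depend on their $i$-th coordinate for some $1\le i\le n$. Then $C^{(J,\times)}_n(X)=Q_n(X)/D_n(X)$, with $\partial\sigma=\sum_{i=1}^n(-1)^i(A_i\sigma-B_i\sigma)$, where $A_i\sigma$ (resp. $B_i\sigma$) is $\sigma$ with $0$ (resp. $1$) inserted in the $i$-th coordinate. For a subspace $A\subseteq X$, $H_J^n(X,A;G)$ and $H_{(J,\times)}^n(X,A;G)$ are the cohomology groups of the cochain complexes obtained by applying $\operatorname{Hom}_{\mathbb Z}(-,G)$ to $C^J_\bullet(X)/C^J_\bullet(A)$ and $C^{(J,\times)}_\bullet(X)/C^{(J,\times)}_\bullet(A)$; the groups of $X$ are those of $(X,\emptyset)$. Homotopy: $f,g:X\to Y$ are one-step $(J,\times)$-homotopic if there is a continuous $H:X\times J\to Y$ with $H(x,0)=f(x)$, $H(x,1)=g(x)$; $\sim_{(J,\times)}$ is the generated equivalence relation on continuous maps $X\to Y$. A $(J,\times)$ cohomology theory of closure spaces consists of a sequence of contravariant functors $H^n$ from pairs $(X,A)$ (a closure space and a subspace, with continuous maps of pairs; $H^n(X):=H^n(X,\emptyset)$) to abelian groups and natural transformations $\delta:H^n(A)\to H^{n+1}(X,A)$ such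 that: 1) (homotopy) if $f\sim_{(J,\times)}g:X\to Y$ then $f$ and $g$ induce the same map in cohomology; 2) (excision) for every interior cover $\{A,B\}$ of $X$, the inclusion $(B,A\cap B)\to(X,A)$ induces isomorphisms $H^n(X,A)\cong H^n(B,A\cap B)$ for all $n$; 3) (dimension) if $X$ is the one-point space then $H^n(X,\emptyset)=0$ for all $n\ge1$; 4) (long exact sequence) each pair $(X,A)$ induces, via the inclusions $A\to X$ and $(X,\emptyset)\to(X,A)$ and via $\delta$, a long exact sequence $\cdots\to H^n(X,A)\to H^n(X)\to H^n(A)\to H^{n+1}(X,A)\to\cdots$. *)

theory Defs
  imports "HOL-Homology.Homology"
begin

section \<open>Closure spaces\<close>

text \<open>The operator is only meaningful on subsets of \<open>points X\<close>; no definition below looks at its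
  values elsewhere.\<close>

record 'a cspace =
  points :: "'a set"
  clos :: "'a set \<Rightarrow> 'a set"

definition closure_space :: "'a cspace \<Rightarrow> bool" where
  "closure_space X \<longleftrightarrow>
     (\<forall>A. A \<subseteq> points X \<longrightarrow> clos X A \<subseteq> points X) \<and>
     clos X {} = {} \<and>
     (\<forall>A. A \<subseteq> points X \<longrightarrow> A \<subseteq> clos X A) \<and>
     (\<forall>A B. A \<subseteq> points X \<longrightarrow> B \<subseteq> points X \<longrightarrow> clos X (A \<union> B) = clos X A \<union> clos X B)"

definition subspace_of :: "'a cspace \<Rightarrow> 'a set \<Rightarrow> 'a cspace" where
  "subspace_of X A = \<lparr>points = A, clos = (\<lambda>B. clos X B \<inter> A)\<rparr>"

definition cspace_of_topology :: "'a topology \<Rightarrow> 'a cspace" where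
  "cspace_of_topology T = \<lparr>points = topspace T, clos = (\<lambda>A. T closure_of A)\<rparr>"

definition cinterior :: "'a cspace \<Rightarrow> 'a set \<Rightarrow> 'a set" where
  "cinterior X A = points X - clos X (points X - A)"

definition cnbhd :: "'a cspace \<Rightarrow> 'a \<Rightarrow> 'a set \<Rightarrow> bool" where
  "cnbhd X x V \<longleftrightarrow> V \<subseteq> points X \<and> x \<in> cinterior X V"

definition interior_cover :: "'a cspace \<Rightarrow> 'a set set \<Rightarrow> bool" where
  "interior_cover X \<U> \<longleftrightarrow> (\<forall>U\<in>\<U>. U \<subseteq> points X) \<and> points X = (\<Union>U\<in>\<U>. cinterior X U)"

definition ccont :: "'a cspace \<Rightarrow> 'b cspace \<Rightarrow> ('a \<Rightarrow> 'b) \<Rightarrow> bool" where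
  "ccont X Y f \<longleftrightarrow> f \<in> points X \<rightarrow> points Y \<and>
     (\<forall>A. A \<subseteq> points X \<longrightarrow> f ` clos X A \<subseteq> clos Y (f ` A))"

text \<open>A point lies in the closure of a set iff each basic neighbourhood of the point meets the
  set. Iterating the binary product gives the same closure as using boxes with finitely many
  factors directly, which avoids nested pair types.\<close>

definition cprod :: "'a cspace \<Rightarrow> 'b cspace \<Rightarrow> ('a \<times> 'b) cspace" where
  "cprod X Y =
     \<lparr>points = points X \<times> points Y,
      clos = (\<lambda>C. {(x, y). x \<in> points X \<and> y \<in> points Y \<and>
                (\<forall>U V. cnbhd X x U \<longrightarrow> cnbhd Y y V \<longrightarrow> (U \<times> V) \<inter> C \<noteq> {})})\<rparr>"

definition cpower :: "'a cspace \<Rightarrow> nat \<Rightarrow> (nat \<Rightarrow> 'a) cspace" where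
  "cpower X n =
     \<lparr>points = (\<Pi>\<^sub>E i\<in>{1..n}. points X),
      clos = (\<lambda>C. {p \<in> (\<Pi>\<^sub>E i\<in>{1..n}. points X).
                \<forall>U. (\<forall>i\<in>{1..n}. cnbhd X (p i) (U i)) \<longrightarrow> (\<Pi>\<^sub>E i\<in>{1..n}. U i) \<inter> C \<noteq> {}})\<rparr>"


section \<open>The intervals and their homotopy relations\<close>

datatype interval_kind = Unit_interval | J_indiscrete | J_plus

fun interval_space :: "interval_kind \<Rightarrow> real cspace" where
  "interval_space Unit_interval = cspace_of_topology (top_of_set {0..1})"
| "interval_space J_indiscrete = \<lparr>points = {0, 1}, clos = (\<lambda>A. if A = {} then {} else {0, 1})\<rparr>"
| "interval_space J_plus = \<lparr>points = {0, 1}, clos = (\<lambda>A. if 0 \<in> A then {0, 1} else A)\<rparr>"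

definition one_step_homotopic ::
    "interval_kind \<Rightarrow> 'a cspace \<Rightarrow> 'b cspace \<Rightarrow> ('a \<Rightarrow> 'b) \<Rightarrow> ('a \<Rightarrow> 'b) \<Rightarrow> bool" where
  "one_step_homotopic J X Y f g \<longleftrightarrow> ccont X Y f \<and> ccont X Y g \<and>
     (\<exists>h. ccont (cprod X (interval_space J)) Y h \<and>
          (\<forall>x\<in>points X. h (x, 0) = f x \<and> h (x, 1) = g x))"

definition J_homotopic ::
    "interval_kind \<Rightarrow> 'a cspace \<Rightarrow> 'b cspace \<Rightarrow> ('a \<Rightarrow> 'b) \<Rightarrow> ('a \<Rightarrow> 'b) \<Rightarrow> bool" where
  "J_homotopic J X Y f g \<longleftrightarrow>
     ccont X Y f \<and> ccont X Y g \<and> equivclp (one_step_homotopic J X Y) f g"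


section \<open>Chain complexes and their cohomology\<close>

text \<open>\<open>bdry K n\<close> is the boundary homomorphism from degree \<open>n + 1\<close> to degree \<open>n\<close>.\<close>

record 'c ccomplex =
  grp :: "nat \<Rightarrow> 'c monoid"
  bdry :: "nat \<Rightarrow> 'c \<Rightarrow> 'c"

text \<open>The map into \<open>H Mod N\<close> that sends the coset of \<open>c\<close> to the coset of \<open>f c\<close>.\<close>

definition coset_map :: "'d monoid \<Rightarrow> 'd set \<Rightarrow> ('c \<Rightarrow> 'd) \<Rightarrow> 'c set \<Rightarrow> 'd set" where
  "coset_map H N f S = the_elem ((\<lambda>c. N #>\<^bsub>H\<^esub> f c) ` S)"

definition quotient_complex :: "'c ccomplex \<Rightarrow> (nat \<Rightarrow> 'c set) \<Rightarrow> 'c set ccomplex" where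
  "quotient_complex K N =
     \<lparr>grp = (\<lambda>n. grp K n Mod N n),
      bdry = (\<lambda>n. coset_map (grp K n) (N n) (bdry K n))\<rparr>"

definition hom_group :: "'c monoid \<Rightarrow> 'g monoid \<Rightarrow> ('c \<Rightarrow> 'g) monoid" where
  "hom_group C G =
     \<lparr>carrier = hom C G \<inter> extensional (carrier C),
      mult = (\<lambda>\<phi> \<psi>. \<lambda>c\<in>carrier C. \<phi> c \<otimes>\<^bsub>G\<^esub> \<psi> c),
      one = (\<lambda>c\<in>carrier C. \<one>\<^bsub>G\<^esub>)\<rparr>"

abbreviation cochain_group :: "'g monoid \<Rightarrow> 'c ccomplex \<Rightarrow> nat \<Rightarrow> ('c \<Rightarrow> 'g) monoid" where
  "cochain_group G K n \<equiv> hom_group (grp K n) G"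

definition cobdry :: "'c ccomplex \<Rightarrow> nat \<Rightarrow> ('c \<Rightarrow> 'g) \<Rightarrow> 'c \<Rightarrow> 'g" where
  "cobdry K n \<phi> = (\<lambda>c\<in>carrier (grp K (Suc n)). \<phi> (bdry K n c))"

definition cocycle_group :: "'g monoid \<Rightarrow> 'c ccomplex \<Rightarrow> nat \<Rightarrow> ('c \<Rightarrow> 'g) monoid" where
  "cocycle_group G K n = (cochain_group G K n)
     \<lparr>carrier := kernel (cochain_group G K n) (cochain_group G K (Suc n)) (cobdry K n)\<rparr>"

definition coboundaries :: "'g monoid \<Rightarrow> 'c ccomplex \<Rightarrow> nat \<Rightarrow> ('c \<Rightarrow> 'g) set" where
  "coboundaries G K n =
     (case n of 0 \<Rightarrow> {\<one>\<^bsub>cochain_group G K 0\<^esub>}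
      | Suc m \<Rightarrow> cobdry K m ` carrier (cochain_group G K m))"

definition cohomology_group :: "'g monoid \<Rightarrow> 'c ccomplex \<Rightarrow> nat \<Rightarrow> ('c \<Rightarrow> 'g) set monoid" where
  "cohomology_group G K n = cocycle_group G K n Mod coboundaries G K n"

text \<open>Composition with a chain map \<open>F\<close> whose source is \<open>K\<close>.\<close>

definition cochain_map ::
    "'c ccomplex \<Rightarrow> (nat \<Rightarrow> 'c \<Rightarrow> 'd) \<Rightarrow> nat \<Rightarrow> ('d \<Rightarrow> 'g) \<Rightarrow> 'c \<Rightarrow> 'g" where
  "cochain_map K F n \<phi> = (\<lambda>c\<in>carrier (grp K n). \<phi> (F n c))"

definition cohomology_map ::
    "'g monoid \<Rightarrow> 'c ccomplex \<Rightarrow> (nat \<Rightarrow> 'c \<Rightarrow> 'd) \<Rightarrow> nat \<Rightarrow> ('d \<Rightarrow> 'g) set \<Rightarrow> ('c \<Rightarrow> 'g) set" where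
  "cohomology_map G K F n =
     coset_map (cocycle_group G K n) (coboundaries G K n) (cochain_map K F n)"

text \<open>The connecting homomorphism of the cochain sequence dual to a short exact sequence of chain
  complexes \<open>L \<rightarrow> K \<rightarrow> M\<close> with maps \<open>i\<close> and \<open>j\<close>: extend a cocycle \<open>\<phi>\<close> on \<open>L\<close> to a cochain \<open>\<eta>\<close> on
  \<open>K\<close>; the coboundary of \<open>\<eta>\<close> comes from a cochain \<open>\<psi>\<close> on \<open>M\<close>, whose class is the value.\<close>

definition connecting_map ::
    "'g monoid \<Rightarrow> 'c ccomplex \<Rightarrow> (nat \<Rightarrow> 'c \<Rightarrow> 'd) \<Rightarrow> 'd ccomplex \<Rightarrow> (nat \<Rightarrow> 'd \<Rightarrow> 'e) \<Rightarrow> 'e ccomplex \<Rightarrow>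
     nat \<Rightarrow> ('c \<Rightarrow> 'g) set \<Rightarrow> ('e \<Rightarrow> 'g) set" where
  "connecting_map G L i K j M n \<alpha> =
     the_elem {coboundaries G M (Suc n) #>\<^bsub>cocycle_group G M (Suc n)\<^esub> \<psi> | \<phi> \<eta> \<psi>.
       \<phi> \<in> \<alpha> \<and> \<eta> \<in> carrier (cochain_group G K n) \<and> \<psi> \<in> carrier (cochain_group G M (Suc n)) \<and>
       cochain_map L i n \<eta> = \<phi> \<and> cochain_map K j (Suc n) \<psi> = cobdry K n \<eta>}"


section \<open>Singular simplices\<close>

text \<open>For the two discrete intervals the point \<open>i\<close> of \<open>{0,\<dots>,n}\<close> is represented by the \<open>i\<close>-th unit
  vector, so that \<^const>\<open>simplical_face\<close> is the face inclusion in all three cases.\<close>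

definition vertex :: "nat \<Rightarrow> nat \<Rightarrow> real" where
  "vertex i = (\<lambda>k. if k = i then 1 else 0)"

fun simplex_space :: "interval_kind \<Rightarrow> nat \<Rightarrow> (nat \<Rightarrow> real) cspace" where
  "simplex_space Unit_interval n =
     cspace_of_topology (subtopology (powertop_real UNIV) (standard_simplex n))"
| "simplex_space J_indiscrete n =
     \<lparr>points = vertex ` {..n}, clos = (\<lambda>A. if A = {} then {} else vertex ` {..n})\<rparr>"
| "simplex_space J_plus n =
     \<lparr>points = vertex ` {..n}, clos = (\<lambda>A. vertex ` {j. j \<le> n \<and> (\<exists>i\<le>j. vertex i \<in> A)})\<rparr>"

definition simplices :: "interval_kind \<Rightarrow> nat \<Rightarrow> 'a cspace \<Rightarrow> ((nat \<Rightarrow> real) \<Rightarrow> 'a) set" where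
  "simplices J n X =
     {\<sigma> \<in> extensional (points (simplex_space J n)). ccont (simplex_space J n) X \<sigma>}"

definition simplex_face ::
    "interval_kind \<Rightarrow> nat \<Rightarrow> nat \<Rightarrow> ((nat \<Rightarrow> real) \<Rightarrow> 'a) \<Rightarrow> (nat \<Rightarrow> real) \<Rightarrow> 'a" where
  "simplex_face J n i \<sigma> = restrict (\<sigma> \<circ> simplical_face i) (points (simplex_space J n))"

definition simp_chains :: "interval_kind \<Rightarrow> 'a cspace \<Rightarrow> 'a chain ccomplex" where
  "simp_chains J X =
     \<lparr>grp = (\<lambda>n. free_Abelian_group (simplices J n X)),
      bdry = (\<lambda>n. frag_extend
        (\<lambda>\<sigma>. \<Sum>i\<le>Suc n. frag_cmul ((-1) ^ i) (frag_of (simplex_face J n i \<sigma>))))\<rparr>"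

definition simp_chain_map :: "interval_kind \<Rightarrow> ('a \<Rightarrow> 'b) \<Rightarrow> nat \<Rightarrow> 'a chain \<Rightarrow> 'b chain" where
  "simp_chain_map J f n =
     frag_extend (\<lambda>\<sigma>. frag_of (restrict (f \<circ> \<sigma>) (points (simplex_space J n))))"

text \<open>A simplex of a subspace \<open>A\<close> is literally a simplex of \<open>X\<close>, so the chains of \<open>A\<close> form a subgroup
  of the chains of \<open>X\<close>.\<close>

definition simp_rel_chains :: "interval_kind \<Rightarrow> 'a cspace \<Rightarrow> 'a set \<Rightarrow> 'a chain set ccomplex" where
  "simp_rel_chains J X A =
     quotient_complex (simp_chains J X) (\<lambda>n. carrier (grp (simp_chains J (subspace_of X A)) n))"

definition simp_rel_chain_map ::
    "interval_kind \<Rightarrow> 'b cspace \<Rightarrow> 'b set \<Rightarrow> ('a \<Rightarrow> 'b) \<Rightarrow> nat \<Rightarrow> 'a chain set \<Rightarrow> 'b chain set" where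
  "simp_rel_chain_map J Y B f n =
     coset_map (grp (simp_chains J Y) n) (carrier (grp (simp_chains J (subspace_of Y B)) n))
       (simp_chain_map J f n)"


section \<open>Singular cubes modulo degenerate cubes\<close>

type_synonym 'a cube_chain = "((nat \<Rightarrow> real) \<Rightarrow> 'a) \<Rightarrow>\<^sub>0 int"

definition cube_space :: "interval_kind \<Rightarrow> nat \<Rightarrow> (nat \<Rightarrow> real) cspace" where
  "cube_space J n = cpower (interval_space J) n"

definition cubes :: "interval_kind \<Rightarrow> nat \<Rightarrow> 'a cspace \<Rightarrow> ((nat \<Rightarrow> real) \<Rightarrow> 'a) set" where
  "cubes J n X = {\<sigma> \<in> extensional (points (cube_space J n)). ccont (cube_space J n) X \<sigma>}"

definition degenerate_cubes :: "interval_kind \<Rightarrow> nat \<Rightarrow> 'a cspace \<Rightarrow> ((nat \<Rightarrow> real) \<Rightarrow> 'a) set" where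
  "degenerate_cubes J n X =
     {\<sigma> \<in> cubes J n X. \<exists>i\<in>{1..n}. \<forall>p\<in>points (cube_space J n). \<forall>q\<in>points (cube_space J n).
        (\<forall>k\<in>{1..n} - {i}. p k = q k) \<longrightarrow> \<sigma> p = \<sigma> q}"

definition insert_coord :: "nat \<Rightarrow> real \<Rightarrow> (nat \<Rightarrow> real) \<Rightarrow> nat \<Rightarrow> real" where
  "insert_coord i t p = (\<lambda>k. if k < i then p k else if k = i then t else p (k - 1))"

definition cube_face ::
    "interval_kind \<Rightarrow> nat \<Rightarrow> nat \<Rightarrow> real \<Rightarrow> ((nat \<Rightarrow> real) \<Rightarrow> 'a) \<Rightarrow> (nat \<Rightarrow> real) \<Rightarrow> 'a" where
  "cube_face J n i t \<sigma> = restrict (\<sigma> \<circ> insert_coord i t) (points (cube_space J n))"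

definition free_cube_chains :: "interval_kind \<Rightarrow> 'a cspace \<Rightarrow> 'a cube_chain ccomplex" where
  "free_cube_chains J X =
     \<lparr>grp = (\<lambda>n. free_Abelian_group (cubes J n X)),
      bdry = (\<lambda>n. frag_extend
        (\<lambda>\<sigma>. \<Sum>i=1..Suc n. frag_cmul ((-1) ^ i)
               (frag_of (cube_face J n i 0 \<sigma>) - frag_of (cube_face J n i 1 \<sigma>))))\<rparr>"

definition degenerate_chains :: "interval_kind \<Rightarrow> 'a cspace \<Rightarrow> nat \<Rightarrow> 'a cube_chain set" where
  "degenerate_chains J X n =
     generate (grp (free_cube_chains J X) n) (frag_of ` degenerate_cubes J n X)"

definition cube_chains :: "interval_kind \<Rightarrow> 'a cspace \<Rightarrow> 'a cube_chain set ccomplex" where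
  "cube_chains J X = quotient_complex (free_cube_chains J X) (degenerate_chains J X)"

definition cube_chain_map ::
    "interval_kind \<Rightarrow> 'b cspace \<Rightarrow> ('a \<Rightarrow> 'b) \<Rightarrow> nat \<Rightarrow> 'a cube_chain set \<Rightarrow> 'b cube_chain set" where
  "cube_chain_map J Y f n =
     coset_map (grp (free_cube_chains J Y) n) (degenerate_chains J Y n)
       (frag_extend (\<lambda>\<sigma>. frag_of (restrict (f \<circ> \<sigma>) (points (cube_space J n)))))"

text \<open>The chains of a subspace \<open>A\<close>, being cosets of the degenerate chains of \<open>A\<close> rather than of \<open>X\<close>,
  are a subgroup of the chains of \<open>X\<close> only via the map induced by the inclusion.\<close>

definition cube_subchains :: "interval_kind \<Rightarrow> 'a cspace \<Rightarrow> 'a set \<Rightarrow> nat \<Rightarrow> 'a cube_chain set set" where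
  "cube_subchains J X A n = cube_chain_map J X id n ` carrier (grp (cube_chains J (subspace_of X A)) n)"

definition cube_rel_chains ::
    "interval_kind \<Rightarrow> 'a cspace \<Rightarrow> 'a set \<Rightarrow> 'a cube_chain set set ccomplex" where
  "cube_rel_chains J X A = quotient_complex (cube_chains J X) (cube_subchains J X A)"

definition cube_rel_chain_map ::
    "interval_kind \<Rightarrow> 'b cspace \<Rightarrow> 'b set \<Rightarrow> ('a \<Rightarrow> 'b) \<Rightarrow> nat \<Rightarrow>
     'a cube_chain set set \<Rightarrow> 'b cube_chain set set" where
  "cube_rel_chain_map J Y B f n =
     coset_map (grp (cube_chains J Y) n) (cube_subchains J Y B n) (cube_chain_map J Y f n)"


section \<open>Cohomology theories of closure spaces\<close>

definition closure_pair :: "'a cspace \<Rightarrow> 'a set \<Rightarrow> bool" where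
  "closure_pair X A \<longleftrightarrow> closure_space X \<and> A \<subseteq> points X"

definition pair_map :: "'a cspace \<Rightarrow> 'a set \<Rightarrow> 'b cspace \<Rightarrow> 'b set \<Rightarrow> ('a \<Rightarrow> 'b) \<Rightarrow> bool" where
  "pair_map X A Y B f \<longleftrightarrow> closure_pair X A \<and> closure_pair Y B \<and> ccont X Y f \<and> f ` A \<subseteq> B"

text \<open>A cohomology theory consists of groups \<open>H n X A\<close>, of maps \<open>m n X A Y B f\<close> from \<open>H n Y B\<close> to
  \<open>H n X A\<close> induced by maps of pairs \<open>f\<close> from \<open>(X, A)\<close> to \<open>(Y, B)\<close>, and of connecting maps \<open>d n X A\<close>
  from \<open>H n (subspace_of X A) {}\<close> to \<open>H (Suc n) X A\<close>.

  The type of the points of the spaces acts as a universe. Laws that involve maps between spaces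
  are formulated for spaces in possibly different universes.\<close>

type_synonym ('a, 'v) pair_groups = "nat \<Rightarrow> 'a cspace \<Rightarrow> 'a set \<Rightarrow> 'v monoid"

type_synonym ('a, 'v, 'b, 'w) pair_maps =
  "nat \<Rightarrow> 'a cspace \<Rightarrow> 'a set \<Rightarrow> 'b cspace \<Rightarrow> 'b set \<Rightarrow> ('a \<Rightarrow> 'b) \<Rightarrow> 'w \<Rightarrow> 'v"

type_synonym ('a, 'v) connecting_maps = "nat \<Rightarrow> 'a cspace \<Rightarrow> 'a set \<Rightarrow> 'v \<Rightarrow> 'v"

text \<open>The second clause says that the induced map depends only on the values of \<open>f\<close> on \<open>X\<close>.\<close>

definition induces_homs ::
    "('a, 'v) pair_groups \<Rightarrow> ('b, 'w) pair_groups \<Rightarrow> ('a, 'v, 'b, 'w) pair_maps \<Rightarrow> bool" where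
  "induces_homs H1 H2 m12 \<longleftrightarrow>
     (\<forall>n X A Y B f. pair_map X A Y B f \<longrightarrow>
        m12 n X A Y B f \<in> hom (H2 n Y B) (H1 n X A) \<and>
        (\<forall>g. (\<forall>x\<in>points X. f x = g x) \<longrightarrow>
           (\<forall>a\<in>carrier (H2 n Y B). m12 n X A Y B f a = m12 n X A Y B g a)))"

definition preserves_identities :: "('a, 'v) pair_groups \<Rightarrow> ('a, 'v, 'a, 'v) pair_maps \<Rightarrow> bool" where
  "preserves_identities H m \<longleftrightarrow>
     (\<forall>n X A. closure_pair X A \<longrightarrow> (\<forall>a\<in>carrier (H n X A). m n X A X A id a = a))"

definition preserves_composition ::
    "('c, 'z) pair_groups \<Rightarrow> ('a, 'v, 'b, 'w) pair_maps \<Rightarrow> ('b, 'w, 'c, 'z) pair_maps \<Rightarrow>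
     ('a, 'v, 'c, 'z) pair_maps \<Rightarrow> bool" where
  "preserves_composition H3 m12 m23 m13 \<longleftrightarrow>
     (\<forall>n X A Y B Z C f g. pair_map X A Y B f \<longrightarrow> pair_map Y B Z C g \<longrightarrow>
        (\<forall>a\<in>carrier (H3 n Z C).
           m13 n X A Z C (g \<circ> f) a = m12 n X A Y B f (m23 n Y B Z C g a)))"

definition connecting_homs :: "('a, 'v) pair_groups \<Rightarrow> ('a, 'v) connecting_maps \<Rightarrow> bool" where
  "connecting_homs H d \<longleftrightarrow>
     (\<forall>n X A. closure_pair X A \<longrightarrow> d n X A \<in> hom (H n (subspace_of X A) {}) (H (Suc n) X A))"

definition connecting_natural ::
    "('b, 'w) pair_groups \<Rightarrow> ('a, 'v, 'b, 'w) pair_maps \<Rightarrow>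
     ('a, 'v) connecting_maps \<Rightarrow> ('b, 'w) connecting_maps \<Rightarrow> bool" where
  "connecting_natural H2 m12 d1 d2 \<longleftrightarrow>
     (\<forall>n X A Y B f. pair_map X A Y B f \<longrightarrow>
        (\<forall>a\<in>carrier (H2 n (subspace_of Y B) {}).
           m12 (Suc n) X A Y B f (d2 n Y B a) =
           d1 n X A (m12 n (subspace_of X A) {} (subspace_of Y B) {} f a)))"

definition homotopy_axiom ::
    "interval_kind \<Rightarrow> ('b, 'w) pair_groups \<Rightarrow> ('a, 'v, 'b, 'w) pair_maps \<Rightarrow> bool" where
  "homotopy_axiom J H2 m12 \<longleftrightarrow>
     (\<forall>n X Y f g. closure_space X \<longrightarrow> closure_space Y \<longrightarrow> J_homotopic J X Y f g \<longrightarrow>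
        (\<forall>a\<in>carrier (H2 n Y {}). m12 n X {} Y {} f a = m12 n X {} Y {} g a))"

definition excision_axiom :: "('a, 'v) pair_groups \<Rightarrow> ('a, 'v, 'a, 'v) pair_maps \<Rightarrow> bool" where
  "excision_axiom H m \<longleftrightarrow>
     (\<forall>n X A B. closure_space X \<longrightarrow> interior_cover X {A, B} \<longrightarrow>
        m n (subspace_of X B) (A \<inter> B) X A id \<in> iso (H n X A) (H n (subspace_of X B) (A \<inter> B)))"

definition dimension_axiom :: "('a, 'v) pair_groups \<Rightarrow> bool" where
  "dimension_axiom H \<longleftrightarrow>
     (\<forall>n X x. closure_space X \<longrightarrow> points X = {x} \<longrightarrow> n \<ge> 1 \<longrightarrow> trivial_group (H n X {}))"

text \<open>The sequence starts with \<open>0 \<rightarrow> H 0 X A\<close>, which accounts for the injectivity clause. In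
  \<^const>\<open>exact_seq\<close> the groups and maps are listed from right to left.\<close>

definition exactness_axiom ::
    "('a, 'v) pair_groups \<Rightarrow> ('a, 'v, 'a, 'v) pair_maps \<Rightarrow> ('a, 'v) connecting_maps \<Rightarrow> bool" where
  "exactness_axiom H m d \<longleftrightarrow>
     (\<forall>X A. closure_pair X A \<longrightarrow>
        inj_on (m 0 X {} X A id) (carrier (H 0 X A)) \<and>
        (\<forall>n. exact_seq
          ([H (Suc n) X {}, H (Suc n) X A, H n (subspace_of X A) {}, H n X {}, H n X A],
           [m (Suc n) X {} X A id, d n X A, m n (subspace_of X A) {} X {} id, m n X {} X A id])))"

definition cohomology_theory ::
    "interval_kind \<Rightarrow> ('a, 'v) pair_groups \<Rightarrow> ('a, 'v, 'a, 'v) pair_maps \<Rightarrow>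
     ('a, 'v) connecting_maps \<Rightarrow> bool" where
  "cohomology_theory J H m d \<longleftrightarrow>
     (\<forall>n X A. closure_pair X A \<longrightarrow> comm_group (H n X A)) \<and>
     induces_homs H H m \<and> preserves_identities H m \<and> preserves_composition H m m m \<and>
     connecting_homs H d \<and> connecting_natural H m d d \<and>
     homotopy_axiom J H m \<and> excision_axiom H m \<and> dimension_axiom H \<and> exactness_axiom H m d"

text \<open>A polymorphic cohomology theory gives one instance of \<^const>\<open>cohomology_theory\<close> per universe.
  The following states the laws for maps between spaces in up to three different universes.\<close>

definition cohomology_theory_across ::
    "interval_kind \<Rightarrow> ('a, 'v) pair_groups \<Rightarrow> ('b, 'w) pair_groups \<Rightarrow> ('c, 'z) pair_groups \<Rightarrow>
     ('a, 'v, 'b, 'w) pair_maps \<Rightarrow> ('b, 'w, 'c, 'z) pair_maps \<Rightarrow> ('a, 'v, 'c, 'z) pair_maps \<Rightarrow>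
     ('a, 'v) connecting_maps \<Rightarrow> ('b, 'w) connecting_maps \<Rightarrow> bool" where
  "cohomology_theory_across J H1 H2 H3 m12 m23 m13 d1 d2 \<longleftrightarrow>
     induces_homs H1 H2 m12 \<and> preserves_composition H3 m12 m23 m13 \<and>
     connecting_natural H2 m12 d1 d2 \<and> homotopy_axiom J H2 m12"


section \<open>The singular simplicial and cubical cohomology groups\<close>

definition simp_cohomology ::
    "interval_kind \<Rightarrow> 'g monoid \<Rightarrow> ('a, ('a chain set \<Rightarrow> 'g) set) pair_groups" where
  "simp_cohomology J G n X A = cohomology_group G (simp_rel_chains J X A) n"

definition simp_induced ::
    "interval_kind \<Rightarrow> 'g monoid \<Rightarrow>
     ('a, ('a chain set \<Rightarrow> 'g) set, 'b, ('b chain set \<Rightarrow> 'g) set) pair_maps" where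
  "simp_induced J G n X A Y B f =
     cohomology_map G (simp_rel_chains J X A) (simp_rel_chain_map J Y B f) n"

definition simp_connecting ::
    "interval_kind \<Rightarrow> 'g monoid \<Rightarrow> ('a, ('a chain set \<Rightarrow> 'g) set) connecting_maps" where
  "simp_connecting J G n X A =
     connecting_map G (simp_rel_chains J (subspace_of X A) {}) (simp_rel_chain_map J X {} id)
       (simp_rel_chains J X {}) (simp_rel_chain_map J X A id) (simp_rel_chains J X A) n"

definition cube_cohomology ::
    "interval_kind \<Rightarrow> 'g monoid \<Rightarrow> ('a, ('a cube_chain set set \<Rightarrow> 'g) set) pair_groups" where
  "cube_cohomology J G n X A = cohomology_group G (cube_rel_chains J X A) n"

definition cube_induced ::
    "interval_kind \<Rightarrow> 'g monoid \<Rightarrow>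
     ('a, ('a cube_chain set set \<Rightarrow> 'g) set, 'b, ('b cube_chain set set \<Rightarrow> 'g) set) pair_maps" where
  "cube_induced J G n X A Y B f =
     cohomology_map G (cube_rel_chains J X A) (cube_rel_chain_map J Y B f) n"

definition cube_connecting ::
    "interval_kind \<Rightarrow> 'g monoid \<Rightarrow> ('a, ('a cube_chain set set \<Rightarrow> 'g) set) connecting_maps" where
  "cube_connecting J G n X A =
     connecting_map G (cube_rel_chains J (subspace_of X A) {}) (cube_rel_chain_map J X {} id)
       (cube_rel_chains J X {}) (cube_rel_chain_map J X A id) (cube_rel_chains J X A) n"

end

theory Submission
  imports Defs
begin

text \<open>Both chain complexes are quotients of free abelian groups by subgroups spanned by generators.
  A cochain is thus an arbitrary function on generators that vanishes on some of them, so cochains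
  of a subspace extend and the long exact sequence comes from a short exact sequence of cochain
  complexes. Homotopies act through prism operators, and on a point the constant generators cancel
  or are degenerate.

  For excision, an interior cover \<open>{A, B}\<close> of \<open>X\<close> pulls back along a singular simplex or cube to
  neighbourhoods covering the model. The models of \<open>J\<^sub>1\<close> and \<open>J\<^sub>+\<close> have a point whose only neighbourhood
  is everything, so all generators are small. For the unit interval the models are compact, and
  iterated subdivision (barycentric for simplices, halving every coordinate for cubes) makes every
  generator small. Subdividing each generator only as often as necessary gives a deformation of
  all chains into the small ones that fixes the small ones.\<close>

section \<open>Cohomology of cochain complexes of groups\<close>

text \<open>Two obstacles shape the excision proof. A cube is homotopic to its subdivision only
  modulo degenerate cubes, so the homotopy identities are stated for representatives in a free
  group, up to generators killed by the quotient; a cochain cannot see the error. And the members of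
  an interior cover need not be open in X; but their preimages in a model of the unit interval kind
  are neighbourhoods in a compact topological space, and every smallness argument takes place there.

  The deformation D vanishes on small generators, and id - (bD + Db) lands in the chains on them.
  The small generators are those in B, those in A and the degenerate ones; relative to A only those
  in B survive, with exactly the relations of the pair formed by B and the intersection. Restriction
  of cocycles can therefore be inverted by hand: extend a cochain by the neutral element and compose
  it with the retraction.\<close>

lemma coset_eq_iff:
  assumes "comm_group C" "subgroup M C" "x \<in> carrier C" "y \<in> carrier C"
  shows "M #>\<^bsub>C\<^esub> x = M #>\<^bsub>C\<^esub> y \<longleftrightarrow> (\<exists>m\<in>M. x = m \<otimes>\<^bsub>C\<^esub> y)"
proof -
  interpret comm_group C by fact
  interpret M: subgroup M C by fact
  show ?thesis
  proof
    assume "M #>\<^bsub>C\<^esub> x = M #>\<^bsub>C\<^esub> y"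
    moreover have "x \<in> M #>\<^bsub>C\<^esub> x" using assms by (intro rcos_self)
    ultimately show "\<exists>m\<in>M. x = m \<otimes>\<^bsub>C\<^esub> y" by (auto simp: r_coset_def)
  next
    assume "\<exists>m\<in>M. x = m \<otimes>\<^bsub>C\<^esub> y"
    then have "x \<in> M #>\<^bsub>C\<^esub> y" by (auto simp: r_coset_def)
    then show "M #>\<^bsub>C\<^esub> x = M #>\<^bsub>C\<^esub> y"
      using repr_independence assms by metis
  qed
qed

lemma coset_mult:
  assumes "comm_group C" "subgroup M C" "x \<in> carrier C" "y \<in> carrier C"
  shows "(M #>\<^bsub>C\<^esub> x) <#>\<^bsub>C\<^esub> (M #>\<^bsub>C\<^esub> y) = M #>\<^bsub>C\<^esub> (x \<otimes>\<^bsub>C\<^esub> y)"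
  using assms comm_group.subgroup_imp_normal normal.rcos_sum by metis

text \<open>On the coset of \<open>c\<close> the image of \<open>\<lambda>c. N #> f c\<close> is a
  singleton: a factor from \<open>M\<close> becomes a factor from \<open>N\<close>, which the coset
  absorbs. So \<open>the_elem\<close> returns the expected coset, and maps defined through
  \<open>coset_map\<close> can be computed on representatives.\<close>

lemma coset_map_coset:
  assumes "comm_group C" "subgroup M C" "comm_group H" "subgroup N H"
    and f: "f \<in> hom C H" "f ` M \<subseteq> N" and c: "c \<in> carrier C"
  shows "coset_map H N f (M #>\<^bsub>C\<^esub> c) = N #>\<^bsub>H\<^esub> f c"
proof -
  interpret C: comm_group C by fact
  interpret H: comm_group H by fact
  interpret M: subgroup M C by fact
  have "N #>\<^bsub>H\<^esub> f (m \<otimes>\<^bsub>C\<^esub> c) = N #>\<^bsub>H\<^esub> f c" if "m \<in> M" for m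
    using that assms M.mem_carrier[OF that]
    by (subst coset_eq_iff) (auto simp: hom_in_carrier hom_mult)
  moreover obtain m where "m \<in> M" using M.one_closed by blast
  ultimately have "(\<lambda>c. N #>\<^bsub>H\<^esub> f c) ` (M #>\<^bsub>C\<^esub> c) = {N #>\<^bsub>H\<^esub> f c}"
    by (auto simp: r_coset_def image_iff)
  then show ?thesis by (simp add: coset_map_def)
qed

lemma coset_map_hom:
  assumes "comm_group C" "subgroup M C" "comm_group H" "subgroup N H"
    and f: "f \<in> hom C H" "f ` M \<subseteq> N"
  shows "coset_map H N f \<in> hom (C Mod M) (H Mod N)"
proof (rule homI)
  fix x assume "x \<in> carrier (C Mod M)"
  then show "coset_map H N f x \<in> carrier (H Mod N)"
    using assms by (auto simp: carrier_FactGroup coset_map_coset hom_in_carrier)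
next
  interpret C: comm_group C by fact
  fix x y assume "x \<in> carrier (C Mod M)" "y \<in> carrier (C Mod M)"
  then obtain a b where "a \<in> carrier C" "b \<in> carrier C" "x = M #>\<^bsub>C\<^esub> a" "y = M #>\<^bsub>C\<^esub> b"
    by (auto simp: carrier_FactGroup)
  then show "coset_map H N f (x \<otimes>\<^bsub>C Mod M\<^esub> y) = coset_map H N f x \<otimes>\<^bsub>H Mod N\<^esub> coset_map H N f y"
    using assms by (simp add: coset_mult coset_map_coset hom_mult hom_in_carrier)
qed

lemma (in comm_group) conj_cancel:
  assumes "x \<in> carrier G" "y \<in> carrier G"
  shows "inv x \<otimes> y \<otimes> x = y"
  using assms m_comm[of "inv x" y] by (simp add: m_assoc)

lemma (in comm_group) mult_inv_eq_oneD:
  assumes "x \<in> carrier G" "y \<in> carrier G" "x \<otimes> inv y = \<one>"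
  shows "x = y"
  using assms inv_equality[of x "inv y"] by simp

lemma hom_one_comm:
  assumes "comm_group A" "comm_group B" "f \<in> hom A B"
  shows "f \<one>\<^bsub>A\<^esub> = \<one>\<^bsub>B\<^esub>"
  using assms by (simp add: comm_group.axioms(2) hom_one)

lemma hom_inv_comm:
  assumes "comm_group A" "comm_group B" "f \<in> hom A B" "x \<in> carrier A"
  shows "f (inv\<^bsub>A\<^esub> x) = inv\<^bsub>B\<^esub> f x"
  using assms group_hom.hom_inv[of A B f x]
  by (simp add: comm_group.axioms(2) group_hom_def group_hom_axioms_def)

text \<open>Cohomology of a bare sequence of groups with differentials. Separating it from duals of
  chain complexes keeps extensional homomorphisms out of the diagram chases. With
  \<open>A = cochains G K\<close> and \<open>d = cobdry K\<close> the definitions become those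
  behind \<open>cohomology_group\<close>.\<close>

definition cocycles :: "(nat \<Rightarrow> 'x monoid) \<Rightarrow> (nat \<Rightarrow> 'x \<Rightarrow> 'x) \<Rightarrow> nat \<Rightarrow> 'x monoid" where
  "cocycles A d n = (A n)\<lparr>carrier := kernel (A n) (A (Suc n)) (d n)\<rparr>"

definition cobds :: "(nat \<Rightarrow> 'x monoid) \<Rightarrow> (nat \<Rightarrow> 'x \<Rightarrow> 'x) \<Rightarrow> nat \<Rightarrow> 'x set" where
  "cobds A d n = (case n of 0 \<Rightarrow> {\<one>\<^bsub>A 0\<^esub>} | Suc m \<Rightarrow> d m ` carrier (A m))"

definition cohom :: "(nat \<Rightarrow> 'x monoid) \<Rightarrow> (nat \<Rightarrow> 'x \<Rightarrow> 'x) \<Rightarrow> nat \<Rightarrow> 'x set monoid" where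
  "cohom A d n = cocycles A d n Mod cobds A d n"

definition cohom_class ::
    "(nat \<Rightarrow> 'x monoid) \<Rightarrow> (nat \<Rightarrow> 'x \<Rightarrow> 'x) \<Rightarrow> nat \<Rightarrow> 'x \<Rightarrow> 'x set" where
  "cohom_class A d n x = cobds A d n #>\<^bsub>cocycles A d n\<^esub> x"

locale cochain_complex =
  fixes A :: "nat \<Rightarrow> 'x monoid" and d :: "nat \<Rightarrow> 'x \<Rightarrow> 'x"
  assumes comm: "comm_group (A n)"
    and d_hom: "d n \<in> hom (A n) (A (Suc n))"
    and dd: "x \<in> carrier (A n) \<Longrightarrow> d (Suc n) (d n x) = \<one>\<^bsub>A (Suc (Suc n))\<^esub>"
begin

lemma grp: "group (A n)"
  using comm by (rule comm_group.axioms)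

lemma d_carrier [simp]: "x \<in> carrier (A n) \<Longrightarrow> d n x \<in> carrier (A (Suc n))"
  using d_hom hom_in_carrier by metis

lemma d_one [simp]: "d n \<one>\<^bsub>A n\<^esub> = \<one>\<^bsub>A (Suc n)\<^esub>"
  using hom_one_comm[OF comm comm d_hom] .

lemma d_mult [simp]:
  "x \<in> carrier (A n) \<Longrightarrow> y \<in> carrier (A n) \<Longrightarrow> d n (x \<otimes>\<^bsub>A n\<^esub> y) = d n x \<otimes>\<^bsub>A (Suc n)\<^esub> d n y"
  using d_hom hom_mult by metis

lemma d_inv [simp]: "x \<in> carrier (A n) \<Longrightarrow> d n (inv\<^bsub>A n\<^esub> x) = inv\<^bsub>A (Suc n)\<^esub> d n x"
  using hom_inv_comm[OF comm comm d_hom] .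

lemma in_cocycles:
  "x \<in> carrier (cocycles A d n) \<longleftrightarrow> x \<in> carrier (A n) \<and> d n x = \<one>\<^bsub>A (Suc n)\<^esub>"
  by (auto simp: cocycles_def kernel_def)

lemma mult_cocycles [simp]: "monoid.mult (cocycles A d n) = monoid.mult (A n)"
  by (simp add: cocycles_def)

lemma one_cocycles [simp]: "\<one>\<^bsub>cocycles A d n\<^esub> = \<one>\<^bsub>A n\<^esub>"
  by (simp add: cocycles_def)

lemma comm_cocycles: "comm_group (cocycles A d n)"
proof -
  interpret group_hom "A n" "A (Suc n)" "d n"
    using grp d_hom by (simp add: group_hom_def group_hom_axioms_def)
  interpret comm_group "A n" by (rule comm)
  have "group (cocycles A d n)"
    unfolding cocycles_def using subgroup_kernel grp by (rule subgroup.subgroup_is_group)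
  then show ?thesis
    by (rule group.group_comm_groupI) (auto simp: in_cocycles m_comm)
qed

lemma cobds_carrier: "b \<in> cobds A d n \<Longrightarrow> b \<in> carrier (A n) \<and> d n b = \<one>\<^bsub>A (Suc n)\<^esub>"
  using group.is_monoid[OF grp] by (cases n) (auto simp: cobds_def dd monoid.one_closed)

lemma subgroup_cobds: "subgroup (cobds A d n) (cocycles A d n)"
proof -
  interpret Z: comm_group "cocycles A d n" by (rule comm_cocycles)
  interpret A: comm_group "A k" for k by (rule comm)
  have sub: "cobds A d n \<subseteq> carrier (cocycles A d n)"
    using cobds_carrier by (auto simp: in_cocycles)
  show ?thesis
  proof (rule Z.subgroupI[OF sub])
    show "cobds A d n \<noteq> {}"
      by (cases n) (auto simp: cobds_def)
    fix a assume a: "a \<in> cobds A d n"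
    \<comment> \<open>The inverse in \<open>cocycles A d n\<close> is not syntactically the one in
      \<open>A n\<close>, so an explicit inverse among the coboundaries is produced and then
      identified by uniqueness of inverses.\<close>
    then obtain b where b: "b \<in> cobds A d n" "b \<otimes>\<^bsub>A n\<^esub> a = \<one>\<^bsub>A n\<^esub>"
    proof (cases n)
      case (Suc m)
      then obtain x where "x \<in> carrier (A m)" "a = d m x"
        using a by (auto simp: cobds_def)
      then show ?thesis
        using that[of "d m (inv\<^bsub>A m\<^esub> x)"] Suc by (auto simp: cobds_def simp del: d_mult d_inv simp flip: d_mult)
    qed (auto simp: cobds_def)
    then have "inv\<^bsub>cocycles A d n\<^esub> a = b"
      using a sub by (intro Z.inv_equality) auto
    then show "inv\<^bsub>cocycles A d n\<^esub> a \<in> cobds A d n" using b by simp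
    fix b assume "b \<in> cobds A d n"
    then show "a \<otimes>\<^bsub>cocycles A d n\<^esub> b \<in> cobds A d n"
      using a by (cases n) (auto simp: cobds_def simp flip: d_mult)
  qed
qed

lemma comm_cohom: "comm_group (cohom A d n)"
  unfolding cohom_def
  using comm_group.abelian_FactGroup[OF comm_cocycles subgroup_cobds] .

lemma carrier_cohom: "carrier (cohom A d n) = cohom_class A d n ` carrier (cocycles A d n)"
  by (simp add: cohom_def cohom_class_def carrier_FactGroup)

lemma cohom_class_eq_iff:
  assumes "x \<in> carrier (cocycles A d n)" "y \<in> carrier (cocycles A d n)"
  shows "cohom_class A d n x = cohom_class A d n y \<longleftrightarrow> (\<exists>b\<in>cobds A d n. x = b \<otimes>\<^bsub>A n\<^esub> y)"
  using coset_eq_iff[OF comm_cocycles subgroup_cobds assms] by (simp add: cohom_class_def)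

lemma cohom_class_eq_one_iff:
  assumes "x \<in> carrier (cocycles A d n)"
  shows "cohom_class A d n x = \<one>\<^bsub>cohom A d n\<^esub> \<longleftrightarrow> x \<in> cobds A d n"
proof -
  interpret Z: comm_group "cocycles A d n" by (rule comm_cocycles)
  interpret B: subgroup "cobds A d n" "cocycles A d n" by (rule subgroup_cobds)
  have "cohom_class A d n x = \<one>\<^bsub>cohom A d n\<^esub> \<longleftrightarrow> cohom_class A d n x = cohom_class A d n \<one>\<^bsub>A n\<^esub>"
    using Z.coset_mult_one[of "cobds A d n"] B.subset
    by (simp add: cohom_def cohom_class_def)
  also have "\<dots> \<longleftrightarrow> x \<in> cobds A d n"
    using assms Z.one_closed Z.r_one
    by (subst cohom_class_eq_iff) (auto dest!: B.mem_carrier)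
  finally show ?thesis .
qed

lemma cohom_class_mult:
  assumes "x \<in> carrier (cocycles A d n)" "y \<in> carrier (cocycles A d n)"
  shows "cohom_class A d n x \<otimes>\<^bsub>cohom A d n\<^esub> cohom_class A d n y = cohom_class A d n (x \<otimes>\<^bsub>A n\<^esub> y)"
  using coset_mult[OF comm_cocycles subgroup_cobds assms] by (simp add: cohom_class_def cohom_def)

end

locale cochain_morphism = A: cochain_complex A d + B: cochain_complex B e
  for A :: "nat \<Rightarrow> 'x monoid" and d and B :: "nat \<Rightarrow> 'y monoid" and e +
  fixes f :: "nat \<Rightarrow> 'x \<Rightarrow> 'y"
  assumes f_hom: "f n \<in> hom (A n) (B n)"
    and f_comm: "x \<in> carrier (A n) \<Longrightarrow> f (Suc n) (d n x) = e n (f n x)"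
begin

lemma f_carrier [simp]: "x \<in> carrier (A n) \<Longrightarrow> f n x \<in> carrier (B n)"
  using f_hom hom_in_carrier by metis

lemma f_one [simp]: "f n \<one>\<^bsub>A n\<^esub> = \<one>\<^bsub>B n\<^esub>"
  using hom_one_comm[OF A.comm B.comm f_hom] .

lemma f_mult [simp]:
  "x \<in> carrier (A n) \<Longrightarrow> y \<in> carrier (A n) \<Longrightarrow> f n (x \<otimes>\<^bsub>A n\<^esub> y) = f n x \<otimes>\<^bsub>B n\<^esub> f n y"
  using f_hom hom_mult by metis

lemma f_inv [simp]: "x \<in> carrier (A n) \<Longrightarrow> f n (inv\<^bsub>A n\<^esub> x) = inv\<^bsub>B n\<^esub> f n x"
  using hom_inv_comm[OF A.comm B.comm f_hom] .

lemma f_cocycle: "x \<in> carrier (cocycles A d n) \<Longrightarrow> f n x \<in> carrier (cocycles B e n)"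
  by (auto simp: A.in_cocycles B.in_cocycles simp flip: f_comm)

lemma f_cobds: "f n ` cobds A d n \<subseteq> cobds B e n"
  by (cases n) (auto simp: cobds_def f_comm)

lemma f_hom_cocycles: "f n \<in> hom (cocycles A d n) (cocycles B e n)"
  by (rule homI) (simp_all add: f_cocycle A.in_cocycles)

definition "induced n = coset_map (cocycles B e n) (cobds B e n) (f n)"

lemma induced_class:
  assumes "x \<in> carrier (cocycles A d n)"
  shows "induced n (cohom_class A d n x) = cohom_class B e n (f n x)"
  unfolding induced_def cohom_class_def
  using A.comm_cocycles A.subgroup_cobds B.comm_cocycles B.subgroup_cobds f_hom_cocycles f_cobds assms
  by (rule coset_map_coset)

lemma induced_hom: "induced n \<in> hom (cohom A d n) (cohom B e n)"
  unfolding induced_def cohom_def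
  using A.comm_cocycles A.subgroup_cobds B.comm_cocycles B.subgroup_cobds f_hom_cocycles f_cobds
  by (rule coset_map_hom)

end

section \<open>Short exact sequences of cochain complexes and their connecting homomorphism\<close>

definition connecting ::
    "(nat \<Rightarrow> 'x monoid) \<Rightarrow> (nat \<Rightarrow> 'x \<Rightarrow> 'x) \<Rightarrow> (nat \<Rightarrow> 'y monoid) \<Rightarrow> (nat \<Rightarrow> 'y \<Rightarrow> 'y) \<Rightarrow>
     (nat \<Rightarrow> 'x \<Rightarrow> 'y) \<Rightarrow> (nat \<Rightarrow> 'y \<Rightarrow> 'z) \<Rightarrow> nat \<Rightarrow> 'z set \<Rightarrow> 'x set" where
  "connecting A dA B dB j i n \<alpha> =
     the_elem {cohom_class A dA (Suc n) \<psi> | \<phi> \<eta> \<psi>. \<phi> \<in> \<alpha> \<and> \<eta> \<in> carrier (B n) \<and>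
       \<psi> \<in> carrier (A (Suc n)) \<and> i n \<eta> = \<phi> \<and> j (Suc n) \<psi> = dB n \<eta>}"

text \<open>The order is that of cochains, opposite to that of chains: in the application
  \<open>A\<close> consists of the relative cochains, \<open>B\<close> of those of the space and
  \<open>C\<close> of those of the subspace; \<open>j\<close> is dual to the passage to relative
  chains and \<open>i\<close> is restriction.\<close>

locale short_exact = j: cochain_morphism A dA B dB j + i: cochain_morphism B dB C dC i
  for A :: "nat \<Rightarrow> 'x monoid" and dA and B :: "nat \<Rightarrow> 'y monoid" and dB
    and C :: "nat \<Rightarrow> 'z monoid" and dC and j and i +
  assumes j_inj: "x \<in> carrier (A n) \<Longrightarrow> j n x = \<one>\<^bsub>B n\<^esub> \<Longrightarrow> x = \<one>\<^bsub>A n\<^esub>"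
    and i_j: "x \<in> carrier (A n) \<Longrightarrow> i n (j n x) = \<one>\<^bsub>C n\<^esub>"
    and i_ker: "y \<in> carrier (B n) \<Longrightarrow> i n y = \<one>\<^bsub>C n\<^esub> \<Longrightarrow> \<exists>x\<in>carrier (A n). j n x = y"
    and i_surj: "z \<in> carrier (C n) \<Longrightarrow> \<exists>y\<in>carrier (B n). i n y = z"
begin

sublocale GA: comm_group "A n" for n by (rule j.A.comm)
sublocale GB: comm_group "B n" for n by (rule j.B.comm)
sublocale GC: comm_group "C n" for n by (rule i.B.comm)

abbreviation "conn \<equiv> connecting A dA B dB j i"

lemma j_eqD:
  assumes "x \<in> carrier (A n)" "y \<in> carrier (A n)" "j n x = j n y"
  shows "x = y"
proof -
  have "x \<otimes>\<^bsub>A n\<^esub> inv\<^bsub>A n\<^esub> y = \<one>\<^bsub>A n\<^esub>"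
    using assms by (intro j_inj) auto
  then show ?thesis
    using assms comm_group.mult_inv_eq_oneD[OF j.A.comm] by blast
qed

text \<open>A primitive lifts because \<open>i\<close> is surjective one degree below, and the
  coboundary of the lift lies over the given coboundary. In degree zero there is only the neutral
  element.\<close>

lemma cobds_lift:
  assumes "b \<in> cobds C dC n"
  shows "\<exists>\<beta>\<in>cobds B dB n. i n \<beta> = b"
proof (cases n)
  case 0
  then show ?thesis using assms by (auto simp: cobds_def)
next
  case (Suc m)
  then obtain c where c: "c \<in> carrier (C m)" "b = dC m c"
    using assms by (auto simp: cobds_def)
  then obtain y where "y \<in> carrier (B m)" "i m y = c" using i_surj by blast
  then show ?thesis using Suc c by (auto simp: cobds_def i.f_comm)
qed

lemma connecting_data:
  assumes "\<phi> \<in> carrier (cocycles C dC n)"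
  obtains \<eta> \<psi> where "\<eta> \<in> carrier (B n)" "\<psi> \<in> carrier (A (Suc n))" "i n \<eta> = \<phi>" "j (Suc n) \<psi> = dB n \<eta>"
proof -
  from assms have "\<phi> \<in> carrier (C n)" by (simp add: i.B.in_cocycles)
  with i_surj obtain \<eta> where \<eta>: "\<eta> \<in> carrier (B n)" "i n \<eta> = \<phi>" by blast
  with assms have "i (Suc n) (dB n \<eta>) = \<one>\<^bsub>C (Suc n)\<^esub>"
    by (simp add: i.f_comm i.B.in_cocycles)
  with i_ker \<eta> obtain \<psi> where "\<psi> \<in> carrier (A (Suc n))" "j (Suc n) \<psi> = dB n \<eta>"
    using j.B.d_carrier by blast
  with \<eta> that show thesis by blast
qed

text \<open>The injective map \<open>j\<close> sends the coboundary of \<psi> to the double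
  coboundary of \<eta>. Hence the cosets collected in \<open>connecting\<close> are cohomology
  classes.\<close>

lemma connecting_cocycle:
  assumes "\<eta> \<in> carrier (B n)" "\<psi> \<in> carrier (A (Suc n))" "j (Suc n) \<psi> = dB n \<eta>"
  shows "\<psi> \<in> carrier (cocycles A dA (Suc n))"
proof -
  have "j (Suc (Suc n)) (dA (Suc n) \<psi>) = \<one>\<^bsub>B (Suc (Suc n))\<^esub>"
    using assms by (simp add: j.f_comm j.B.dd)
  then have "dA (Suc n) \<psi> = \<one>\<^bsub>A (Suc (Suc n))\<^esub>"
    using assms by (intro j_inj) auto
  then show ?thesis using assms by (simp add: j.A.in_cocycles)
qed

text \<open>Two cochains over cohomologous cocycles differ by a lift \<beta> of the coboundary
  \<open>b\<close> and by some \<open>j n \<gamma>\<close>. Applying the differential removes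
  \<beta>, so \<psi>' and \<psi> differ by the coboundary of \<gamma>.\<close>

lemma connecting_unique:
  assumes \<eta>: "\<eta> \<in> carrier (B n)" "\<psi> \<in> carrier (A (Suc n))" "j (Suc n) \<psi> = dB n \<eta>"
    and \<eta>': "\<eta>' \<in> carrier (B n)" "\<psi>' \<in> carrier (A (Suc n))" "j (Suc n) \<psi>' = dB n \<eta>'"
    and b: "b \<in> cobds C dC n" "i n \<eta>' = b \<otimes>\<^bsub>C n\<^esub> i n \<eta>"
  shows "cohom_class A dA (Suc n) \<psi>' = cohom_class A dA (Suc n) \<psi>"
proof -
  obtain \<beta> where \<beta>: "\<beta> \<in> cobds B dB n" "i n \<beta> = b" using cobds_lift b by blast
  then have \<beta>B: "\<beta> \<in> carrier (B n)" "dB n \<beta> = \<one>\<^bsub>B (Suc n)\<^esub>" using j.B.cobds_carrier by blast+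
  \<comment> \<open>In additive terms, \<eta>' - (\<beta> + \<eta>) is killed by \<open>i\<close>
    and therefore comes from \<open>A\<close>.\<close>
  have "i n (inv\<^bsub>B n\<^esub> (\<beta> \<otimes>\<^bsub>B n\<^esub> \<eta>) \<otimes>\<^bsub>B n\<^esub> \<eta>') = \<one>\<^bsub>C n\<^esub>"
    using \<eta> \<eta>' \<beta> \<beta>B b i.B.cobds_carrier[OF b(1)] by simp
  then obtain \<gamma> where \<gamma>: "\<gamma> \<in> carrier (A n)" "j n \<gamma> = inv\<^bsub>B n\<^esub> (\<beta> \<otimes>\<^bsub>B n\<^esub> \<eta>) \<otimes>\<^bsub>B n\<^esub> \<eta>'"
    using i_ker[of "inv\<^bsub>B n\<^esub> (\<beta> \<otimes>\<^bsub>B n\<^esub> \<eta>) \<otimes>\<^bsub>B n\<^esub> \<eta>'" n] \<eta> \<eta>' \<beta>B by auto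
  have "j (Suc n) (dA n \<gamma>) = inv\<^bsub>B (Suc n)\<^esub> dB n \<eta> \<otimes>\<^bsub>B (Suc n)\<^esub> dB n \<eta>'"
    using \<gamma> \<eta> \<eta>' \<beta>B by (simp add: j.f_comm)
  then have "j (Suc n) (dA n \<gamma> \<otimes>\<^bsub>A (Suc n)\<^esub> \<psi>)
      = inv\<^bsub>B (Suc n)\<^esub> dB n \<eta> \<otimes>\<^bsub>B (Suc n)\<^esub> dB n \<eta>' \<otimes>\<^bsub>B (Suc n)\<^esub> dB n \<eta>"
    using \<gamma> \<eta> by simp
  also have "\<dots> = j (Suc n) \<psi>'"
    using \<eta> \<eta>' comm_group.conj_cancel[OF j.B.comm, of "dB n \<eta>" "Suc n" "dB n \<eta>'"] by simp
  finally have "\<psi>' = dA n \<gamma> \<otimes>\<^bsub>A (Suc n)\<^esub> \<psi>"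
    using \<gamma> \<eta> \<eta>' by (intro j_eqD[symmetric]) auto
  moreover have "dA n \<gamma> \<in> cobds A dA (Suc n)" using \<gamma> by (auto simp: cobds_def)
  ultimately show ?thesis
    using connecting_cocycle \<eta> \<eta>' by (subst j.A.cohom_class_eq_iff) auto
qed

text \<open>By \<open>connecting_unique\<close> all choices of lifts yield one class, so the set
  under \<open>the_elem\<close> is a singleton and any single choice computes the value.\<close>

lemma connecting_class:
  assumes \<phi>: "\<phi> \<in> carrier (cocycles C dC n)"
    and \<eta>: "\<eta> \<in> carrier (B n)" "\<psi> \<in> carrier (A (Suc n))" "i n \<eta> = \<phi>" "j (Suc n) \<psi> = dB n \<eta>"
  shows "conn n (cohom_class C dC n \<phi>) = cohom_class A dA (Suc n) \<psi>"
proof -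
  interpret Z: comm_group "cocycles C dC n" by (rule i.B.comm_cocycles)
  let ?S = "{cohom_class A dA (Suc n) \<psi>' | \<phi>' \<eta>' \<psi>'. \<phi>' \<in> cohom_class C dC n \<phi> \<and> \<eta>' \<in> carrier (B n) \<and>
       \<psi>' \<in> carrier (A (Suc n)) \<and> i n \<eta>' = \<phi>' \<and> j (Suc n) \<psi>' = dB n \<eta>'}"
  have "\<phi> \<in> cohom_class C dC n \<phi>"
    unfolding cohom_class_def using \<phi> i.B.subgroup_cobds by (rule Z.rcos_self)
  then have "cohom_class A dA (Suc n) \<psi> \<in> ?S" using \<eta> by blast
  moreover have "x = cohom_class A dA (Suc n) \<psi>" if "x \<in> ?S" for x
  proof -
    obtain \<eta>' \<psi>' where x: "x = cohom_class A dA (Suc n) \<psi>'" "i n \<eta>' \<in> cohom_class C dC n \<phi>"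
      and \<eta>': "\<eta>' \<in> carrier (B n)" "\<psi>' \<in> carrier (A (Suc n))" "j (Suc n) \<psi>' = dB n \<eta>'"
      using \<open>x \<in> ?S\<close> by blast
    then obtain b where "b \<in> cobds C dC n" "i n \<eta>' = b \<otimes>\<^bsub>C n\<^esub> i n \<eta>"
      using \<eta> by (auto simp: cohom_class_def r_coset_def)
    then show ?thesis unfolding x using \<eta> \<eta>' connecting_unique by metis
  qed
  ultimately have "?S = {cohom_class A dA (Suc n) \<psi>}" by blast
  then show ?thesis unfolding connecting_def by simp
qed

lemma connecting_hom: "conn n \<in> hom (cohom C dC n) (cohom A dA (Suc n))"
proof (rule homI)
  fix x assume "x \<in> carrier (cohom C dC n)"
  then obtain \<phi> where \<phi>: "\<phi> \<in> carrier (cocycles C dC n)" "x = cohom_class C dC n \<phi>"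
    by (auto simp: i.B.carrier_cohom)
  obtain \<eta> \<psi> where "\<eta> \<in> carrier (B n)" "\<psi> \<in> carrier (A (Suc n))" "i n \<eta> = \<phi>" "j (Suc n) \<psi> = dB n \<eta>"
    using connecting_data[OF \<phi>(1)] .
  with \<phi> show "conn n x \<in> carrier (cohom A dA (Suc n))"
    by (auto simp: connecting_class j.A.carrier_cohom connecting_cocycle)
next
  fix x x' assume "x \<in> carrier (cohom C dC n)" "x' \<in> carrier (cohom C dC n)"
  then obtain \<phi> \<phi>' where \<phi>: "\<phi> \<in> carrier (cocycles C dC n)" "x = cohom_class C dC n \<phi>"
    and \<phi>': "\<phi>' \<in> carrier (cocycles C dC n)" "x' = cohom_class C dC n \<phi>'"
    by (auto simp: i.B.carrier_cohom)
  obtain \<eta> \<psi> where \<eta>: "\<eta> \<in> carrier (B n)" "\<psi> \<in> carrier (A (Suc n))" "i n \<eta> = \<phi>" "j (Suc n) \<psi> = dB n \<eta>"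
    using connecting_data[OF \<phi>(1)] .
  obtain \<eta>' \<psi>' where \<eta>': "\<eta>' \<in> carrier (B n)" "\<psi>' \<in> carrier (A (Suc n))" "i n \<eta>' = \<phi>'" "j (Suc n) \<psi>' = dB n \<eta>'"
    using connecting_data[OF \<phi>'(1)] .
  interpret Z: comm_group "cocycles C dC n" by (rule i.B.comm_cocycles)
  have "\<phi> \<otimes>\<^bsub>C n\<^esub> \<phi>' \<in> carrier (cocycles C dC n)" using Z.m_closed \<phi> \<phi>' by simp
  then have "conn n (cohom_class C dC n (\<phi> \<otimes>\<^bsub>C n\<^esub> \<phi>')) = cohom_class A dA (Suc n) (\<psi> \<otimes>\<^bsub>A (Suc n)\<^esub> \<psi>')"
    using \<eta> \<eta>' by (intro connecting_class[of _ _ "\<eta> \<otimes>\<^bsub>B n\<^esub> \<eta>'"]) auto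
  then show "conn n (x \<otimes>\<^bsub>cohom C dC n\<^esub> x') = conn n x \<otimes>\<^bsub>cohom A dA (Suc n)\<^esub> conn n x'"
    using \<phi> \<phi>' \<eta> \<eta>' connecting_cocycle
    by (simp add: i.B.cohom_class_mult j.A.cohom_class_mult connecting_class)
qed

text \<open>If the restriction of a cocycle \<open>y\<close> is a coboundary, subtract a lift
  \<beta> of that coboundary to \<open>B\<close>. The rest is killed by \<open>i\<close>, hence
  equals \<open>j n \<gamma>\<close>, and injectivity of \<open>j\<close> makes \<gamma> a
  cocycle.\<close>

lemma exact_middle:
  "kernel (cohom B dB n) (cohom C dC n) (i.induced n) = j.induced n ` carrier (cohom A dA n)"
proof (intro equalityI subsetI)
  fix x assume "x \<in> kernel (cohom B dB n) (cohom C dC n) (i.induced n)"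
  then obtain y where y: "y \<in> carrier (cocycles B dB n)" "x = cohom_class B dB n y"
    and "cohom_class C dC n (i n y) = \<one>\<^bsub>cohom C dC n\<^esub>"
    by (auto simp: kernel_def j.B.carrier_cohom i.induced_class)
  then have "i n y \<in> cobds C dC n"
    using i.f_cocycle by (simp add: i.B.cohom_class_eq_one_iff)
  then obtain \<beta> where \<beta>: "\<beta> \<in> cobds B dB n" "i n \<beta> = i n y" using cobds_lift by blast
  then have \<beta>B: "\<beta> \<in> carrier (B n)" "dB n \<beta> = \<one>\<^bsub>B (Suc n)\<^esub>" using j.B.cobds_carrier by blast+
  have yB: "y \<in> carrier (B n)" "dB n y = \<one>\<^bsub>B (Suc n)\<^esub>" using y by (auto simp: j.B.in_cocycles)
  have "i n (inv\<^bsub>B n\<^esub> \<beta> \<otimes>\<^bsub>B n\<^esub> y) = \<one>\<^bsub>C n\<^esub>" using yB \<beta> \<beta>B by simp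
  then obtain \<gamma> where \<gamma>: "\<gamma> \<in> carrier (A n)" "j n \<gamma> = inv\<^bsub>B n\<^esub> \<beta> \<otimes>\<^bsub>B n\<^esub> y"
    using i_ker[of "inv\<^bsub>B n\<^esub> \<beta> \<otimes>\<^bsub>B n\<^esub> y" n] yB \<beta>B by auto
  have "j (Suc n) (dA n \<gamma>) = \<one>\<^bsub>B (Suc n)\<^esub>" using \<gamma> yB \<beta>B by (simp add: j.f_comm)
  then have "dA n \<gamma> = \<one>\<^bsub>A (Suc n)\<^esub>" using \<gamma> by (intro j_inj) auto
  then have \<gamma>Z: "\<gamma> \<in> carrier (cocycles A dA n)" using \<gamma> by (simp add: j.A.in_cocycles)
  have "y = \<beta> \<otimes>\<^bsub>B n\<^esub> j n \<gamma>" using \<gamma> yB \<beta>B by (simp flip: GB.m_assoc)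
  then have "x = cohom_class B dB n (j n \<gamma>)"
    using y \<beta> j.f_cocycle[OF \<gamma>Z] by (simp add: j.B.cohom_class_eq_iff) blast
  then show "x \<in> j.induced n ` carrier (cohom A dA n)"
    using \<gamma>Z j.induced_class j.A.carrier_cohom by (metis imageI)
next
  fix x assume "x \<in> j.induced n ` carrier (cohom A dA n)"
  then obtain y where y: "y \<in> carrier (cocycles A dA n)" "x = cohom_class B dB n (j n y)"
    by (auto simp: j.A.carrier_cohom j.induced_class)
  moreover have "\<one>\<^bsub>C n\<^esub> \<in> cobds C dC n"
    using subgroup.one_closed[OF i.B.subgroup_cobds] by simp
  then have "cohom_class C dC n (i n (j n y)) = \<one>\<^bsub>cohom C dC n\<^esub>"
    using y i.f_cocycle[OF j.f_cocycle] by (simp add: i.B.cohom_class_eq_one_iff i_j j.A.in_cocycles)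
  ultimately show "x \<in> kernel (cohom B dB n) (cohom C dC n) (i.induced n)"
    using j.f_cocycle by (simp add: kernel_def j.B.carrier_cohom i.induced_class)
qed

text \<open>If \<psi> is the coboundary of \<alpha>, correcting the extension \<eta> by
  \<open>j n \<alpha>\<close> gives a cocycle with the same restriction. Conversely, a restricted
  cocycle has a closed extension, for which \<psi> may be taken neutral.\<close>

lemma exact_right:
  "kernel (cohom C dC n) (cohom A dA (Suc n)) (conn n) = i.induced n ` carrier (cohom B dB n)"
proof (intro equalityI subsetI)
  fix x assume "x \<in> kernel (cohom C dC n) (cohom A dA (Suc n)) (conn n)"
  then obtain \<phi> where \<phi>: "\<phi> \<in> carrier (cocycles C dC n)" "x = cohom_class C dC n \<phi>"
    and 1: "conn n (cohom_class C dC n \<phi>) = \<one>\<^bsub>cohom A dA (Suc n)\<^esub>"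
    by (auto simp: kernel_def i.B.carrier_cohom)
  obtain \<eta> \<psi> where \<eta>: "\<eta> \<in> carrier (B n)" "\<psi> \<in> carrier (A (Suc n))" "i n \<eta> = \<phi>" "j (Suc n) \<psi> = dB n \<eta>"
    using connecting_data[OF \<phi>(1)] .
  have "\<psi> \<in> cobds A dA (Suc n)"
    using 1 connecting_class[OF \<phi>(1) \<eta>] connecting_cocycle \<eta> by (simp add: j.A.cohom_class_eq_one_iff)
  then obtain \<alpha> where \<alpha>: "\<alpha> \<in> carrier (A n)" "\<psi> = dA n \<alpha>" by (auto simp: cobds_def)
  define \<eta>' where "\<eta>' = inv\<^bsub>B n\<^esub> j n \<alpha> \<otimes>\<^bsub>B n\<^esub> \<eta>"
  have "dB n \<eta>' = \<one>\<^bsub>B (Suc n)\<^esub>" using \<alpha> \<eta> by (simp add: \<eta>'_def flip: j.f_comm)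
  then have "\<eta>' \<in> carrier (cocycles B dB n)" using \<alpha> \<eta> by (simp add: \<eta>'_def j.B.in_cocycles)
  moreover have "i n \<eta>' = \<phi>" using \<alpha> \<eta> \<phi> by (simp add: \<eta>'_def i_j i.B.in_cocycles)
  ultimately show "x \<in> i.induced n ` carrier (cohom B dB n)"
    using \<phi> i.induced_class j.B.carrier_cohom by (metis imageI)
next
  fix x assume "x \<in> i.induced n ` carrier (cohom B dB n)"
  then obtain \<eta> where \<eta>: "\<eta> \<in> carrier (cocycles B dB n)" "x = cohom_class C dC n (i n \<eta>)"
    by (auto simp: j.B.carrier_cohom i.induced_class)
  then have "conn n x = cohom_class A dA (Suc n) \<one>\<^bsub>A (Suc n)\<^esub>"
    using connecting_class[of "i n \<eta>" n \<eta> "\<one>\<^bsub>A (Suc n)\<^esub>"] i.f_cocycle by (simp add: j.B.in_cocycles)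
  moreover have "\<one>\<^bsub>A (Suc n)\<^esub> \<in> cobds A dA (Suc n)"
    using subgroup.one_closed[OF j.A.subgroup_cobds] by simp
  moreover have "\<one>\<^bsub>A (Suc n)\<^esub> \<in> carrier (cocycles A dA (Suc n))" by (simp add: j.A.in_cocycles)
  ultimately show "x \<in> kernel (cohom C dC n) (cohom A dA (Suc n)) (conn n)"
    using \<eta> i.f_cocycle by (auto simp: kernel_def i.B.carrier_cohom j.A.cohom_class_eq_one_iff)
qed

text \<open>A primitive \<eta> of \<open>j (Suc n) \<psi>\<close> restricts to a cocycle because
  \<open>i\<close> kills the image of \<open>j\<close>; that cocycle, extended by \<eta>, is sent to
  the class of \<psi>.\<close>

lemma exact_left:
  "kernel (cohom A dA (Suc n)) (cohom B dB (Suc n)) (j.induced (Suc n)) = conn n ` carrier (cohom C dC n)"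
proof (intro equalityI subsetI)
  fix x assume "x \<in> kernel (cohom A dA (Suc n)) (cohom B dB (Suc n)) (j.induced (Suc n))"
  then obtain \<psi> where \<psi>: "\<psi> \<in> carrier (cocycles A dA (Suc n))" "x = cohom_class A dA (Suc n) \<psi>"
    and "cohom_class B dB (Suc n) (j (Suc n) \<psi>) = \<one>\<^bsub>cohom B dB (Suc n)\<^esub>"
    by (auto simp: kernel_def j.A.carrier_cohom j.induced_class)
  then have "j (Suc n) \<psi> \<in> cobds B dB (Suc n)"
    using j.f_cocycle by (simp add: j.B.cohom_class_eq_one_iff)
  then obtain \<eta> where \<eta>: "\<eta> \<in> carrier (B n)" "j (Suc n) \<psi> = dB n \<eta>" by (auto simp: cobds_def)
  have \<psi>A: "\<psi> \<in> carrier (A (Suc n))" using \<psi> by (simp add: j.A.in_cocycles)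
  have "dC n (i n \<eta>) = \<one>\<^bsub>C (Suc n)\<^esub>"
    using \<eta> \<psi>A i_j by (simp flip: i.f_comm add: \<eta>(2)[symmetric])
  then have Z: "i n \<eta> \<in> carrier (cocycles C dC n)" using \<eta> by (simp add: i.B.in_cocycles)
  then have "x = conn n (cohom_class C dC n (i n \<eta>))"
    using \<psi> \<psi>A \<eta> connecting_class by simp
  then show "x \<in> conn n ` carrier (cohom C dC n)" using Z by (auto simp: i.B.carrier_cohom)
next
  fix x assume "x \<in> conn n ` carrier (cohom C dC n)"
  then obtain \<phi> where \<phi>: "\<phi> \<in> carrier (cocycles C dC n)" "x = conn n (cohom_class C dC n \<phi>)"
    by (auto simp: i.B.carrier_cohom)
  obtain \<eta> \<psi> where \<eta>: "\<eta> \<in> carrier (B n)" "\<psi> \<in> carrier (A (Suc n))" "i n \<eta> = \<phi>" "j (Suc n) \<psi> = dB n \<eta>"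
    using connecting_data[OF \<phi>(1)] .
  have Z: "\<psi> \<in> carrier (cocycles A dA (Suc n))" using connecting_cocycle \<eta> by blast
  have x: "x = cohom_class A dA (Suc n) \<psi>" using connecting_class[OF \<phi>(1) \<eta>] \<phi> by simp
  have "j (Suc n) \<psi> \<in> cobds B dB (Suc n)" using \<eta> by (auto simp: cobds_def)
  then show "x \<in> kernel (cohom A dA (Suc n)) (cohom B dB (Suc n)) (j.induced (Suc n))"
    using Z x j.f_cocycle[OF Z]
    by (auto simp: kernel_def j.A.carrier_cohom j.induced_class j.B.cohom_class_eq_one_iff)
qed

text \<open>In degree zero the only coboundary is the neutral element, so injectivity of
  \<open>j\<close> on cochains passes to cohomology.\<close>

lemma exact_start: "inj_on (j.induced 0) (carrier (cohom A dA 0))"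
proof -
  interpret H: group_hom "cohom A dA 0" "cohom B dB 0" "j.induced 0"
    using j.A.comm_cohom j.B.comm_cohom j.induced_hom
    by (simp add: group_hom_def group_hom_axioms_def comm_group.axioms(2))
  have "x = \<one>\<^bsub>cohom A dA 0\<^esub>" if x: "x \<in> carrier (cohom A dA 0)" "j.induced 0 x = \<one>\<^bsub>cohom B dB 0\<^esub>" for x
  proof -
    obtain y where y: "y \<in> carrier (cocycles A dA 0)" "x = cohom_class A dA 0 y"
      using x by (auto simp: j.A.carrier_cohom)
    then have "j 0 y = \<one>\<^bsub>B 0\<^esub>"
      using x j.f_cocycle[OF y(1)] by (simp add: j.induced_class j.B.cohom_class_eq_one_iff) (simp add: cobds_def)
    then have "y = \<one>\<^bsub>A 0\<^esub>" using y j_inj by (auto simp: j.A.in_cocycles)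
    then have "y \<in> cobds A dA 0" by (simp add: cobds_def)
    then show ?thesis using y by (simp add: j.A.cohom_class_eq_one_iff)
  qed
  then show ?thesis
    using H.inj_on_one_iff by auto
qed

end

text \<open>The groups of \<open>exact_seq\<close> form one list and must share a type, which forces
  a single cochain type for all three complexes. For a pair in one universe this is the
  case.\<close>

lemma long_exact_sequence:
  fixes A B C :: "nat \<Rightarrow> 'x monoid"
  assumes "short_exact A dA B dB C dC j i"
  shows "exact_seq
    ([cohom B dB (Suc n), cohom A dA (Suc n), cohom C dC n, cohom B dB n, cohom A dA n],
     [coset_map (cocycles B dB (Suc n)) (cobds B dB (Suc n)) (j (Suc n)), connecting A dA B dB j i n,
      coset_map (cocycles C dC n) (cobds C dC n) (i n), coset_map (cocycles B dB n) (cobds B dB n) (j n)])"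
proof -
  interpret short_exact A dA B dB C dC j i by fact
  have "group_hom (cohom A dA n) (cohom B dB n) (j.induced n)"
    using j.A.comm_cohom j.B.comm_cohom j.induced_hom
    by (simp add: group_hom_def group_hom_axioms_def comm_group.axioms(2))
  then show ?thesis
    using j.induced_hom[of "Suc n"] i.induced_hom[of n] connecting_hom[of n] exact_left[of n]
      exact_right[of n] exact_middle[of n] j.A.comm_cohom j.B.comm_cohom i.B.comm_cohom
    by (auto simp: j.induced_def i.induced_def comm_group.axioms(2))
qed

text \<open>The maps of complexes transport the lifting data: \<open>g n \<eta>\<close> extends
  \<open>h n \<phi>\<close>, and its coboundary comes from \<open>f (Suc n) \<psi>\<close>. Since
  any choice of lifts computes the connecting map, this one may be used.\<close>

lemma connecting_natural_square:
  assumes "short_exact A dA B dB C dC j i" "short_exact A' dA' B' dB' C' dC' j' i'"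
    and "cochain_morphism A dA A' dA' f" "cochain_morphism B dB B' dB' g" "cochain_morphism C dC C' dC' h"
    and gj: "\<And>n x. x \<in> carrier (A n) \<Longrightarrow> j' n (f n x) = g n (j n x)"
    and hi: "\<And>n y. y \<in> carrier (B n) \<Longrightarrow> i' n (g n y) = h n (i n y)"
    and a: "a \<in> carrier (cohom C dC n)"
  shows "coset_map (cocycles A' dA' (Suc n)) (cobds A' dA' (Suc n)) (f (Suc n)) (connecting A dA B dB j i n a)
    = connecting A' dA' B' dB' j' i' n (coset_map (cocycles C' dC' n) (cobds C' dC' n) (h n) a)"
proof -
  interpret s: short_exact A dA B dB C dC j i by fact
  interpret s': short_exact A' dA' B' dB' C' dC' j' i' by fact
  interpret f: cochain_morphism A dA A' dA' f by fact
  interpret g: cochain_morphism B dB B' dB' g by fact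
  interpret h: cochain_morphism C dC C' dC' h by fact
  obtain \<phi> where \<phi>: "\<phi> \<in> carrier (cocycles C dC n)" "a = cohom_class C dC n \<phi>"
    using a by (auto simp: s.i.B.carrier_cohom)
  obtain \<eta> \<psi> where \<eta>: "\<eta> \<in> carrier (B n)" "\<psi> \<in> carrier (A (Suc n))" "i n \<eta> = \<phi>" "j (Suc n) \<psi> = dB n \<eta>"
    using s.connecting_data[OF \<phi>(1)] .
  have "connecting A' dA' B' dB' j' i' n (cohom_class C' dC' n (h n \<phi>)) = cohom_class A' dA' (Suc n) (f (Suc n) \<psi>)"
    using \<eta> h.f_cocycle[OF \<phi>(1)] gj hi
    by (intro s'.connecting_class[of _ _ "g n \<eta>"]) (auto simp: g.f_comm)
  also have "\<dots> = f.induced (Suc n) (connecting A dA B dB j i n a)"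
    using f.induced_class[OF s.connecting_cocycle[OF \<eta>(1,2,4)]] s.connecting_class[OF \<phi>(1) \<eta>] \<phi>(2)
    by metis
  finally show ?thesis
    using h.induced_class[OF \<phi>(1)] \<phi>(2) by (simp add: f.induced_def h.induced_def)
qed

section \<open>Presented chain complexes\<close>

abbreviation supp :: "('s \<Rightarrow>\<^sub>0 int) \<Rightarrow> 's set" where
  "supp \<equiv> Poly_Mapping.keys"

lemma keys_diff_subset: "supp c \<subseteq> S \<Longrightarrow> supp d \<subseteq> S \<Longrightarrow> supp (c - d) \<subseteq> S"
  using keys_diff[of c d] by blast

lemma keys_add_subset: "supp c \<subseteq> S \<Longrightarrow> supp d \<subseteq> S \<Longrightarrow> supp (c + d) \<subseteq> S"
  using keys_add[of c d] by blast

lemma keys_sum_subset: "(\<And>i. i \<in> I \<Longrightarrow> supp (f i) \<subseteq> S) \<Longrightarrow> supp (sum f I) \<subseteq> S"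
  using keys_sum[of f I] by blast

lemma keys_cmul_subset: "supp c \<subseteq> S \<Longrightarrow> supp (frag_cmul k c) \<subseteq> S"
  using keys_cmul[of k c] by blast

lemma keys_frag_extend_subset:
  "(\<And>x. x \<in> S \<Longrightarrow> supp (f x) \<subseteq> T) \<Longrightarrow> supp c \<subseteq> S \<Longrightarrow> supp (frag_extend f c) \<subseteq> T"
  using keys_frag_extend[of f c] by blast

text \<open>Additivity is required on all chains, not just on those with support in a given set, so
  rewriting produces no side conditions. Differences are chosen because they match the cases of
  \<open>frag_induction\<close> and yield zero, negation and sums.\<close>

definition additive_frag :: "(('s \<Rightarrow>\<^sub>0 int) \<Rightarrow> ('t \<Rightarrow>\<^sub>0 int)) \<Rightarrow> bool" where
  "additive_frag f \<longleftrightarrow> (\<forall>c d. f (c - d) = f c - f d)"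

lemma additive_frag_diff: "additive_frag f \<Longrightarrow> f (c - d) = f c - f d"
  by (simp add: additive_frag_def)

lemma additive_frag_0: "additive_frag f \<Longrightarrow> f 0 = 0"
  using additive_frag_diff[of f 0 0] by simp

lemma additive_frag_minus: "additive_frag f \<Longrightarrow> f (- d) = - f d"
  using additive_frag_diff[of f 0 d] by (simp add: additive_frag_0)

lemma additive_frag_add: "additive_frag f \<Longrightarrow> f (c + d) = f c + f d"
  using additive_frag_diff[of f c "- d"] by (simp add: additive_frag_minus)

lemma additive_frag_extend [simp]: "additive_frag (frag_extend f)"
  by (simp add: additive_frag_def frag_extend_diff)

lemma additive_frag_id [simp]: "additive_frag (\<lambda>c. c)"
  by (simp add: additive_frag_def)

lemma additive_frag_zero [simp]: "additive_frag (\<lambda>c. 0)"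
  by (simp add: additive_frag_def)

lemma additive_frag_keysI:
  assumes f: "additive_frag f" and S: "\<And>x. x \<in> S \<Longrightarrow> supp (f (frag_of x)) \<subseteq> T"
    and c: "supp c \<subseteq> S"
  shows "supp (f c) \<subseteq> T"
  using c
  by (induction c rule: frag_induction)
    (use f S in \<open>auto simp: additive_frag_0 additive_frag_diff intro: keys_diff_subset[THEN subsetD]\<close>)

section \<open>Dual cochain complexes and homomorphisms on free abelian groups\<close>

definition is_complex :: "'c ccomplex \<Rightarrow> bool" where
  "is_complex K \<longleftrightarrow> (\<forall>n. comm_group (grp K n)) \<and>
     (\<forall>n. bdry K n \<in> hom (grp K (Suc n)) (grp K n)) \<and>
     (\<forall>n. \<forall>c\<in>carrier (grp K (Suc (Suc n))). bdry K n (bdry K (Suc n) c) = \<one>\<^bsub>grp K n\<^esub>)"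

definition is_chain_map :: "'c ccomplex \<Rightarrow> 'd ccomplex \<Rightarrow> (nat \<Rightarrow> 'c \<Rightarrow> 'd) \<Rightarrow> bool" where
  "is_chain_map K L F \<longleftrightarrow> (\<forall>n. F n \<in> hom (grp K n) (grp L n)) \<and>
     (\<forall>n. \<forall>c\<in>carrier (grp K (Suc n)). bdry L n (F (Suc n) c) = F n (bdry K n c))"

abbreviation (input) cochains :: "'g monoid \<Rightarrow> 'c ccomplex \<Rightarrow> nat \<Rightarrow> ('c \<Rightarrow> 'g) monoid" where
  "cochains G K \<equiv> (\<lambda>n. cochain_group G K n)"

lemma cohomology_group_eq: "cohomology_group G K n = cohom (cochains G K) (cobdry K) n"
  by (simp add: cohomology_group_def cohom_def cocycle_group_def cocycles_def coboundaries_def cobds_def)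

lemma cohomology_map_eq:
  "cohomology_map G K F n =
    coset_map (cocycles (cochains G K) (cobdry K) n) (cobds (cochains G K) (cobdry K) n) (cochain_map K F n)"
  by (simp add: cohomology_map_def cocycle_group_def cocycles_def coboundaries_def cobds_def)

text \<open>Dualizing reverses the sequence from \<open>L\<close> over \<open>K\<close> to
  \<open>M\<close>: the cochains of \<open>M\<close> take the first place and the map dual to
  \<open>j\<close> precedes the one dual to \<open>i\<close>.\<close>

lemma connecting_map_eq:
  "connecting_map G L i K j M n =
    connecting (cochains G M) (cobdry M) (cochains G K) (cobdry K) (cochain_map K j) (cochain_map L i) n"
  by (simp add: fun_eq_iff connecting_map_def connecting_def cohom_class_def cocycle_group_def cocycles_def
      coboundaries_def cobds_def)

locale coefficients = comm_group G for G :: "'g monoid" (structure)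
begin

lemma comm_group_hom_group:
  assumes "group C"
  shows "comm_group (hom_group C G)"
proof (rule comm_groupI)
  interpret C: group C by fact
  fix x y z
  assume x: "x \<in> carrier (hom_group C G)"
  have xc: "x c \<in> carrier G" if "c \<in> carrier C" for c
    using x that by (auto simp: hom_group_def hom_def)
  let ?y = "\<lambda>c\<in>carrier C. inv x c"
  have "?y \<in> carrier (hom_group C G)"
    using x by (auto simp: hom_group_def hom_def inv_mult Pi_iff)
  moreover have "?y \<otimes>\<^bsub>hom_group C G\<^esub> x = \<one>\<^bsub>hom_group C G\<^esub>"
    using xc by (auto simp: hom_group_def)
  ultimately show "\<exists>y\<in>carrier (hom_group C G). y \<otimes>\<^bsub>hom_group C G\<^esub> x = \<one>\<^bsub>hom_group C G\<^esub>"
    by blast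
  show "\<one>\<^bsub>hom_group C G\<^esub> \<otimes>\<^bsub>hom_group C G\<^esub> x = x"
    using x xc by (auto simp: hom_group_def extensional_def)
  assume y: "y \<in> carrier (hom_group C G)"
  have yc: "y c \<in> carrier G" if "c \<in> carrier C" for c
    using y that by (auto simp: hom_group_def hom_def)
  show "x \<otimes>\<^bsub>hom_group C G\<^esub> y \<in> carrier (hom_group C G)"
    using x y xc yc by (auto simp: hom_group_def hom_def Pi_iff m_ac)
  show "x \<otimes>\<^bsub>hom_group C G\<^esub> y = y \<otimes>\<^bsub>hom_group C G\<^esub> x"
    using xc yc by (auto simp: hom_group_def m_comm)
  assume z: "z \<in> carrier (hom_group C G)"
  have zc: "z c \<in> carrier G" if "c \<in> carrier C" for c
    using z that by (auto simp: hom_group_def hom_def)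
  show "x \<otimes>\<^bsub>hom_group C G\<^esub> y \<otimes>\<^bsub>hom_group C G\<^esub> z = x \<otimes>\<^bsub>hom_group C G\<^esub> (y \<otimes>\<^bsub>hom_group C G\<^esub> z)"
    using xc yc zc by (auto simp: hom_group_def m_assoc)
next
  interpret C: group C by fact
  show "\<one>\<^bsub>hom_group C G\<^esub> \<in> carrier (hom_group C G)"
    by (auto simp: hom_group_def hom_def)
qed

lemma cochain_complex_dual:
  assumes K: "is_complex K"
  shows "cochain_complex (cochains G K) (cobdry K)"
proof -
  have cm: "comm_group (grp K n)" and b: "bdry K n \<in> hom (grp K (Suc n)) (grp K n)" for n
    using K by (simp_all add: is_complex_def)
  note grp = comm_group.axioms(2)[OF cm]
  have bc: "c \<in> carrier (grp K (Suc n)) \<Longrightarrow> bdry K n c \<in> carrier (grp K n)" for n c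
    using hom_in_carrier[OF b] .
  have bm: "c \<in> carrier (grp K (Suc n)) \<Longrightarrow> c' \<in> carrier (grp K (Suc n)) \<Longrightarrow>
      bdry K n (c \<otimes>\<^bsub>grp K (Suc n)\<^esub> c') = bdry K n c \<otimes>\<^bsub>grp K n\<^esub> bdry K n c'" for n c c'
    using hom_mult[OF b] .
  have 1: "comm_group (cochain_group G K n)" for n
    using grp by (rule comm_group_hom_group)
  have mc: "c \<otimes>\<^bsub>grp K n\<^esub> c' \<in> carrier (grp K n)" if "c \<in> carrier (grp K n)" "c' \<in> carrier (grp K n)" for c c' n
    using that monoid.m_closed[OF group.is_monoid[OF grp]] by blast
  have 2: "cobdry K n \<in> hom (cochain_group G K n) (cochain_group G K (Suc n))" for n
    by (rule homI) (auto simp: hom_group_def hom_def cobdry_def bc bm mc Pi_iff)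
  have 3: "cobdry K (Suc n) (cobdry K n x) = \<one>\<^bsub>cochain_group G K (Suc (Suc n))\<^esub>"
    if "x \<in> carrier (cochain_group G K n)" for n x
  proof -
  have "x \<in> hom (grp K n) G" using that by (simp add: hom_group_def)
  then have "x \<one>\<^bsub>grp K n\<^esub> = \<one>" using grp is_group by (rule hom_one)
  then show ?thesis
    using K bc by (auto simp: hom_group_def cobdry_def is_complex_def)
  qed
  show ?thesis
    unfolding cochain_complex_def using 1 2 3 by blast
qed

lemma cochain_morphism_dual:
  assumes "is_complex K" "is_complex L" and F: "is_chain_map K L F"
  shows "cochain_morphism (cochains G L) (cobdry L) (cochains G K) (cobdry K) (cochain_map K F)"
proof -
  have Fh: "F n \<in> hom (grp K n) (grp L n)" for n using F by (simp add: is_chain_map_def)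
  have Fc: "c \<in> carrier (grp K n) \<Longrightarrow> F n c \<in> carrier (grp L n)" for n c
    using hom_in_carrier[OF Fh] .
  have Fm: "c \<in> carrier (grp K n) \<Longrightarrow> c' \<in> carrier (grp K n) \<Longrightarrow>
      F n (c \<otimes>\<^bsub>grp K n\<^esub> c') = F n c \<otimes>\<^bsub>grp L n\<^esub> F n c'" for n c c'
    using hom_mult[OF Fh] .
  have cm: "comm_group (grp K n)" and b: "bdry K n \<in> hom (grp K (Suc n)) (grp K n)" for n
    using assms(1) by (simp_all add: is_complex_def)
  note grp = comm_group.axioms(2)[OF cm]
  have mc: "c \<otimes>\<^bsub>grp K n\<^esub> c' \<in> carrier (grp K n)" if "c \<in> carrier (grp K n)" "c' \<in> carrier (grp K n)" for c c' n
    using that monoid.m_closed[OF group.is_monoid[OF grp]] by blast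
  have bc: "c \<in> carrier (grp K (Suc n)) \<Longrightarrow> bdry K n c \<in> carrier (grp K n)" for n c
    using hom_in_carrier[OF b] .
  have h: "cochain_map K F n \<in> hom (cochain_group G L n) (cochain_group G K n)" for n
    by (rule homI) (auto simp: hom_group_def hom_def cochain_map_def Fc Fm mc Pi_iff)
  have "cochain_map K F (Suc n) (cobdry L n x) = cobdry K n (cochain_map K F n x)"
    if "x \<in> carrier (cochain_group G L n)" for n x
    using F by (auto simp: cochain_map_def cobdry_def Fc bc is_chain_map_def)
  then show ?thesis
    using assms h by (simp add: cochain_morphism_def cochain_complex_dual cochain_morphism_axioms_def)
qed

lemma free_hom_closed: "h \<in> hom (free_Abelian_group S) G \<Longrightarrow> supp c \<subseteq> S \<Longrightarrow> h c \<in> carrier G"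
  using hom_in_carrier[of h "free_Abelian_group S" G c] by simp

lemma free_hom_zero: "h \<in> hom (free_Abelian_group S) G \<Longrightarrow> h 0 = \<one>"
  using hom_one[of h "free_Abelian_group S" G] is_group by simp

lemma free_hom_simps:
  assumes h: "h \<in> hom (free_Abelian_group S) G" and c: "supp c \<subseteq> S" and d: "supp d \<subseteq> S"
  shows "h (c + d) = h c \<otimes> h d" "h (c - d) = h c \<otimes> inv h d"
proof -
  have add: "h (c + d) = h c \<otimes> h d" if "supp d \<subseteq> S" for d
    using hom_mult[OF h] c that by simp
  have inv: "h (- c) = inv h c" if "supp c \<subseteq> S" for c
    using hom_inv_comm[OF abelian_free_Abelian_group _ h, of c] that comm_group_axioms by simp
  show "h (c + d) = h c \<otimes> h d" "h (c - d) = h c \<otimes> inv h d"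
    using add[of d] add[of "- d"] inv[of d] c d by simp_all
qed

text \<open>The form in which chain homotopy identities reach cochains: the difference is a null
  chain, on which a cochain is trivial, and the remaining terms can be separated.\<close>

lemma free_hom_diffD:
  assumes h: "h \<in> hom (free_Abelian_group S) G" and "supp x \<subseteq> S" "supp y \<subseteq> S" "supp z \<subseteq> S"
    and 1: "h (x - y - z) = \<one>"
  shows "h x = h z \<otimes> h y"
proof -
  have "h x = h (x - y - z + (z + y))" by simp
  also have "\<dots> = h (x - y - z) \<otimes> h (z + y)"
    using assms by (intro free_hom_simps(1)[OF h] keys_diff_subset keys_add_subset)
  also have "\<dots> = h z \<otimes> h y"
    using assms free_hom_closed[OF h] free_hom_simps(1)[OF h, of z y] by simp
  finally show ?thesis .
qed

lemma free_hom_eq: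
  assumes "h \<in> hom (free_Abelian_group S) G" "k \<in> hom (free_Abelian_group S) G"
    and "\<And>x. x \<in> S \<Longrightarrow> h (frag_of x) = k (frag_of x)" and c: "supp c \<subseteq> S"
  shows "h c = k c"
  using c
proof (rule free_Abelian_group_induct)
  show "h 0 = k 0" using assms(1,2) by (simp add: free_hom_zero)
  show "h (x - y) = k (x - y)"
    if "supp x \<subseteq> S" "supp y \<subseteq> S" "h x = k x" "h y = k y" for x y
    using that free_hom_simps(2)[OF assms(1)] free_hom_simps(2)[OF assms(2)] by simp
qed (rule assms(3))

lemma free_hom_vanish:
  assumes "h \<in> hom (free_Abelian_group S) G" "N \<subseteq> S"
    and "\<And>x. x \<in> N \<Longrightarrow> h (frag_of x) = \<one>" and c: "supp c \<subseteq> N"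
  shows "h c = \<one>"
proof (rule free_hom_eq[OF _ _ _ c])
  show "h \<in> hom (free_Abelian_group N) G"
  proof (rule homI)
    show "h x \<in> carrier G" if "x \<in> carrier (free_Abelian_group N)" for x
      using that assms(2) free_hom_closed[OF assms(1), of x] by auto
  qed (use assms(2) free_hom_simps(1)[OF assms(1)] in auto)
  show "(\<lambda>x. \<one>) \<in> hom (free_Abelian_group N) G" by (auto simp: hom_def)
qed (use assms in auto)

lemma free_hom_compose:
  assumes "h \<in> hom (free_Abelian_group T) G" "additive_frag f"
    and "\<And>c. supp c \<subseteq> S \<Longrightarrow> supp (f c) \<subseteq> T"
  shows "(\<lambda>c. h (f c)) \<in> hom (free_Abelian_group S) G"
proof (rule homI)
  show "h (f x) \<in> carrier G" if "x \<in> carrier (free_Abelian_group S)" for x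
    using that assms(3)[of x] free_hom_closed[OF assms(1)] by simp
qed (use assms(3) free_hom_simps(1)[OF assms(1)] in \<open>auto simp: additive_frag_add[OF assms(2)]\<close>)

end

text \<open>In each degree \<open>K\<close> is the free abelian group on \<open>S\<close> modulo the one on \<open>N\<close>, with quotient map \<open>q\<close>;
  \<open>N\<close> consists of the degenerate generators and those of a subspace. The nested quotients in the
  definition of the relative chains are flattened in this way.\<close>

locale presentation =
  fixes S N :: "nat \<Rightarrow> 's set" and b :: "nat \<Rightarrow> ('s \<Rightarrow>\<^sub>0 int) \<Rightarrow> ('s \<Rightarrow>\<^sub>0 int)"
    and K :: "'c ccomplex" and q :: "nat \<Rightarrow> ('s \<Rightarrow>\<^sub>0 int) \<Rightarrow> 'c"
  assumes comm_grp: "comm_group (grp K n)"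
    and q_hom: "q n \<in> hom (free_Abelian_group (S n)) (grp K n)"
    and q_surj: "carrier (grp K n) = q n ` {c. supp c \<subseteq> S n}"
    and q_ker: "supp c \<subseteq> S n \<Longrightarrow> q n c = \<one>\<^bsub>grp K n\<^esub> \<longleftrightarrow> supp c \<subseteq> N n"
    and N_sub: "N n \<subseteq> S n"
    and b_additive: "additive_frag (b n)"
    and b_S: "supp c \<subseteq> S (Suc n) \<Longrightarrow> supp (b n c) \<subseteq> S n"
    and b_N: "supp c \<subseteq> N (Suc n) \<Longrightarrow> supp (b n c) \<subseteq> N n"
    and bb: "supp c \<subseteq> S (Suc (Suc n)) \<Longrightarrow> supp (b n (b (Suc n) c)) \<subseteq> N n"
    and bdry_q: "supp c \<subseteq> S (Suc n) \<Longrightarrow> bdry K n (q (Suc n) c) = q n (b n c)"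
begin

lemma coefficients_grp: "coefficients (grp K n)"
  using comm_grp by (rule coefficients.intro)

lemma q_carrier: "supp c \<subseteq> S n \<Longrightarrow> q n c \<in> carrier (grp K n)"
  using q_surj by blast

lemma q_add:
  "supp c \<subseteq> S n \<Longrightarrow> supp d \<subseteq> S n \<Longrightarrow> q n (c + d) = q n c \<otimes>\<^bsub>grp K n\<^esub> q n d"
  using coefficients.free_hom_simps(1)[OF coefficients_grp q_hom] .

lemma q_eq:
  assumes "supp c \<subseteq> S n" "supp d \<subseteq> S n"
  shows "q n c = q n d \<longleftrightarrow> supp (c - d) \<subseteq> N n"
proof -
  interpret K: comm_group "grp K n" by (rule comm_grp)
  have "q n (c - d) = q n c \<otimes>\<^bsub>grp K n\<^esub> inv\<^bsub>grp K n\<^esub> q n d"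
    using coefficients.free_hom_simps(2)[OF coefficients_grp q_hom assms] .
  then have "q n c = q n d \<longleftrightarrow> q n (c - d) = \<one>\<^bsub>grp K n\<^esub>"
    using q_carrier[OF assms(1)] q_carrier[OF assms(2)] K.mult_inv_eq_oneD[of "q n c" "q n d"] by auto
  then show ?thesis using q_ker[OF keys_diff_subset[OF assms]] by blast
qed

lemma carrierE:
  assumes "x \<in> carrier (grp K n)"
  obtains c where "supp c \<subseteq> S n" "x = q n c"
  using assms unfolding q_surj by blast

lemma bdry_hom: "bdry K n \<in> hom (grp K (Suc n)) (grp K n)"
proof (rule homI)
  fix x assume "x \<in> carrier (grp K (Suc n))"
  then obtain c where c: "supp c \<subseteq> S (Suc n)" "x = q (Suc n) c" by (rule carrierE)
  then show "bdry K n x \<in> carrier (grp K n)"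
    using q_carrier[OF b_S[OF c(1)]] bdry_q[OF c(1)] by simp
  fix y assume "y \<in> carrier (grp K (Suc n))"
  then obtain d where d: "supp d \<subseteq> S (Suc n)" "y = q (Suc n) d" by (rule carrierE)
  show "bdry K n (x \<otimes>\<^bsub>grp K (Suc n)\<^esub> y) = bdry K n x \<otimes>\<^bsub>grp K n\<^esub> bdry K n y"
    using bdry_q[OF c(1)] bdry_q[OF d(1)] bdry_q[OF keys_add_subset[OF c(1) d(1)]]
      q_add[OF c(1) d(1)] q_add[OF b_S[OF c(1)] b_S[OF d(1)]] additive_frag_add[OF b_additive[of n], of c d]
    unfolding c(2) d(2) by simp
qed

lemma is_complex: "is_complex K"
proof -
  have "bdry K n (bdry K (Suc n) x) = \<one>\<^bsub>grp K n\<^esub>" if "x \<in> carrier (grp K (Suc (Suc n)))" for n x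
  proof -
    obtain c where c: "supp c \<subseteq> S (Suc (Suc n))" "x = q (Suc (Suc n)) c" using \<open>x \<in> _\<close> by (rule carrierE)
    show ?thesis
      using bdry_q[OF c(1)] bdry_q[OF b_S[OF c(1)]] q_ker[OF b_S[OF b_S[OF c(1)]]] bb[OF c(1)]
      unfolding c(2) by simp
  qed
  then show ?thesis
    using comm_grp bdry_hom unfolding is_complex_def by blast
qed

lemma hom_from_q:
  assumes "group H" and h: "h \<in> hom (free_Abelian_group (S n)) H"
    and F: "\<And>c. supp c \<subseteq> S n \<Longrightarrow> F (q n c) = h c"
  shows "F \<in> hom (grp K n) H"
proof (rule homI)
  fix x assume "x \<in> carrier (grp K n)"
  then obtain c where c: "supp c \<subseteq> S n" "x = q n c" by (rule carrierE)
  then show "F x \<in> carrier H" using hom_in_carrier[OF h, of c] F by simp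
  fix y assume "y \<in> carrier (grp K n)"
  then obtain d where d: "supp d \<subseteq> S n" "y = q n d" by (rule carrierE)
  show "F (x \<otimes>\<^bsub>grp K n\<^esub> y) = F x \<otimes>\<^bsub>H\<^esub> F y"
    using hom_mult[OF h, of c d] F[OF c(1)] F[OF d(1)] F[OF keys_add_subset[OF c(1) d(1)]] q_add[OF c(1) d(1)] c d
    by simp
qed

end

locale presentation_dual = presentation S N b K q + G: coefficients G
  for S N :: "nat \<Rightarrow> 's set" and b K and q :: "nat \<Rightarrow> ('s \<Rightarrow>\<^sub>0 int) \<Rightarrow> 'c" and G :: "'g monoid"
begin

sublocale dual: cochain_complex "cochains G K" "cobdry K"
  using is_complex by (rule G.cochain_complex_dual)

lemma cochain_hom:
  assumes "\<phi> \<in> carrier (cochain_group G K n)"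
  shows "(\<lambda>c. \<phi> (q n c)) \<in> hom (free_Abelian_group (S n)) G"
  using hom_compose[OF q_hom, of \<phi> n G] assms by (simp add: hom_group_def comp_def)

lemma cochain_null:
  assumes "\<phi> \<in> carrier (cochain_group G K n)" "supp c \<subseteq> N n"
  shows "\<phi> (q n c) = \<one>\<^bsub>G\<^esub>"
proof -
  have "q n c = q n 0" using assms N_sub[of n] by (subst q_eq) auto
  then show ?thesis using G.free_hom_zero[OF cochain_hom[OF assms(1)]] by simp
qed

lemma cochain_eqI:
  assumes "\<phi> \<in> carrier (cochain_group G K n)" "\<psi> \<in> carrier (cochain_group G K n)"
    and "\<And>c. supp c \<subseteq> S n \<Longrightarrow> \<phi> (q n c) = \<psi> (q n c)"
  shows "\<phi> = \<psi>"
proof (rule extensionalityI[of _ "carrier (grp K n)"])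
  show "\<phi> x = \<psi> x" if "x \<in> carrier (grp K n)" for x
    using that assms(3) by (auto simp: q_surj)
qed (use assms in \<open>auto simp: hom_group_def\<close>)

text \<open>The universal property of the quotient. The representative picked by \<open>SOME\<close>
  does not matter, because two representatives of an element differ by a chain on
  \<open>N n\<close>, where \<open>h\<close> is trivial.\<close>

lemma cochain_from_hom:
  assumes h: "h \<in> hom (free_Abelian_group (S n)) G"
    and N: "\<And>x. x \<in> N n \<Longrightarrow> h (frag_of x) = \<one>\<^bsub>G\<^esub>"
  shows "\<exists>\<phi>\<in>carrier (cochain_group G K n). \<forall>c. supp c \<subseteq> S n \<longrightarrow> \<phi> (q n c) = h c"
proof -
  let ?lift = "\<lambda>k. SOME c. supp c \<subseteq> S n \<and> q n c = k"
  let ?\<phi> = "\<lambda>k\<in>carrier (grp K n). h (?lift k)"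
  have \<phi>: "?\<phi> (q n c) = h c" if c: "supp c \<subseteq> S n" for c
  proof -
    have "supp (?lift (q n c)) \<subseteq> S n \<and> q n (?lift (q n c)) = q n c"
      by (rule someI[of _ c]) (use c in simp)
    then have l: "supp (?lift (q n c)) \<subseteq> S n" "supp (?lift (q n c) - c) \<subseteq> N n"
      using q_eq c by auto
    then have "h (?lift (q n c) - c) = \<one>\<^bsub>G\<^esub>"
      using G.free_hom_vanish[OF h N_sub N] by blast
    then have "h (?lift (q n c)) \<otimes>\<^bsub>G\<^esub> inv\<^bsub>G\<^esub> h c = \<one>\<^bsub>G\<^esub>"
      using G.free_hom_simps(2)[OF h l(1) c] by simp
    then have "h (?lift (q n c)) = h c"
      by (rule G.mult_inv_eq_oneD[OF G.free_hom_closed[OF h l(1)] G.free_hom_closed[OF h c]])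
    then show ?thesis using c q_carrier by simp
  qed
  have "?\<phi> \<in> hom (grp K n) G"
    using G.is_group h \<phi> by (rule hom_from_q)
  then have "?\<phi> \<in> carrier (cochain_group G K n)" by (simp add: hom_group_def)
  then show ?thesis using \<phi> by blast
qed

lemma cobdry_q:
  assumes "supp c \<subseteq> S (Suc n)"
  shows "cobdry K n \<phi> (q (Suc n) c) = \<phi> (q n (b n c))"
  using q_carrier[OF assms] bdry_q[OF assms] by (simp add: cobdry_def)

lemma mult_cochain_q:
  assumes "supp c \<subseteq> S n"
  shows "(\<phi> \<otimes>\<^bsub>cochain_group G K n\<^esub> \<psi>) (q n c) = \<phi> (q n c) \<otimes>\<^bsub>G\<^esub> \<psi> (q n c)"
  using q_carrier[OF assms] by (simp add: hom_group_def)

lemma one_cochain_q: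
  assumes "supp c \<subseteq> S n"
  shows "\<one>\<^bsub>cochain_group G K n\<^esub> (q n c) = \<one>\<^bsub>G\<^esub>"
  using q_carrier[OF assms] by (simp add: hom_group_def)

lemma cocycle_q:
  assumes "\<phi> \<in> carrier (cocycles (cochains G K) (cobdry K) n)" "supp c \<subseteq> S (Suc n)"
  shows "\<phi> (q n (b n c)) = \<one>\<^bsub>G\<^esub>"
  using assms one_cochain_q[of c "Suc n"] cobdry_q[OF assms(2), of \<phi>] by (simp add: dual.in_cocycles)

lemma cocycleI:
  assumes \<phi>: "\<phi> \<in> carrier (cochain_group G K n)"
    and "\<And>c. supp c \<subseteq> S (Suc n) \<Longrightarrow> \<phi> (q n (b n c)) = \<one>\<^bsub>G\<^esub>"
  shows "\<phi> \<in> carrier (cocycles (cochains G K) (cobdry K) n)"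
proof -
  interpret A: comm_group "cochain_group G K (Suc n)" by (rule dual.comm)
  have "cobdry K n \<phi> = \<one>\<^bsub>cochain_group G K (Suc n)\<^esub>"
    using assms dual.d_carrier[OF \<phi>] A.one_closed
    by (intro cochain_eqI[of _ "Suc n"]) (auto simp: cobdry_q one_cochain_q)
  then show ?thesis using \<phi> by (simp add: dual.in_cocycles)
qed

lemma comm_cohomology: "comm_group (cohomology_group G K n)"
  using dual.comm_cohom by (simp add: cohomology_group_eq)

end

text \<open>Commutation with the boundaries is asked for only up to chains on \<open>N'\<close>,
  since \<open>q'\<close> identifies chains with such a difference.\<close>

lemma (in presentation) chain_map_from_frags:
  assumes "presentation S' N' b' K' q'"
    and f: "\<And>n. additive_frag (f n)"
    and S: "\<And>n c. supp c \<subseteq> S n \<Longrightarrow> supp (f n c) \<subseteq> S' n"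
    and fb: "\<And>n c. supp c \<subseteq> S (Suc n) \<Longrightarrow> supp (b' n (f (Suc n) c) - f n (b n c)) \<subseteq> N' n"
    and F: "\<And>n c. supp c \<subseteq> S n \<Longrightarrow> F n (q n c) = q' n (f n c)"
  shows "is_chain_map K K' F"
  unfolding is_chain_map_def
proof (intro conjI allI ballI)
  interpret P': presentation S' N' b' K' q' by fact
  fix n
  show "F n \<in> hom (grp K n) (grp K' n)"
  proof (rule hom_from_q)
    show "group (grp K' n)" using P'.comm_grp by (rule comm_group.axioms)
    show "(\<lambda>c. q' n (f n c)) \<in> hom (free_Abelian_group (S n)) (grp K' n)"
      using P'.coefficients_grp P'.q_hom f S by (rule coefficients.free_hom_compose)
  qed (rule F)
  fix k assume "k \<in> carrier (grp K (Suc n))"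
  then obtain c where c: "supp c \<subseteq> S (Suc n)" and k: "k = q (Suc n) c"
    unfolding q_surj by blast
  have "bdry K' n (F (Suc n) k) = q' n (b' n (f (Suc n) c))"
    unfolding k F[OF c] by (rule P'.bdry_q[OF S[OF c]])
  also have "\<dots> = q' n (f n (b n c))"
    using P'.q_eq[OF P'.b_S[OF S[OF c]] S[OF b_S[OF c]]] fb[OF c] by blast
  also have "\<dots> = F n (bdry K n k)"
    unfolding k bdry_q[OF c] by (rule F[OF b_S[OF c], symmetric])
  finally show "bdry K' n (F (Suc n) k) = F n (bdry K n k)" .
qed

lemma (in presentation) dual_morphism:
  assumes "coefficients G" "presentation S' N' b' K' q'" "is_chain_map K K' F"
  shows "cochain_morphism (cochains G K') (cobdry K') (cochains G K) (cobdry K) (cochain_map K F)"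
  using coefficients.cochain_morphism_dual[OF assms(1) is_complex presentation.is_complex[OF assms(2)] assms(3)] .

text \<open>Evaluate a cocycle \<phi> on the homotopy identity. The part with the boundary outside
  vanishes because \<phi> is a cocycle, the part with the boundary inside is the coboundary of
  \<phi> composed with \<open>P\<close>, and the error on \<open>N'\<close> is invisible.\<close>

lemma (in presentation_dual) homotopic_maps:
  assumes "presentation S' N' b' K' q'"
    and chain: "is_chain_map K K' F" "is_chain_map K K' F'"
    and f: "\<And>n c. supp c \<subseteq> S n \<Longrightarrow> supp (f n c) \<subseteq> S' n"
    and f': "\<And>n c. supp c \<subseteq> S n \<Longrightarrow> supp (f' n c) \<subseteq> S' n"
    and F: "\<And>n c. supp c \<subseteq> S n \<Longrightarrow> F n (q n c) = q' n (f n c)"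
    and F': "\<And>n c. supp c \<subseteq> S n \<Longrightarrow> F' n (q n c) = q' n (f' n c)"
    and P: "\<And>n. additive_frag (P n)"
    and PS: "\<And>n c. supp c \<subseteq> S n \<Longrightarrow> supp (P n c) \<subseteq> S' (Suc n)"
    and PN: "\<And>n c. supp c \<subseteq> N n \<Longrightarrow> supp (P n c) \<subseteq> N' (Suc n)"
    and hom0: "\<And>c. supp c \<subseteq> S 0 \<Longrightarrow> supp (f 0 c - f' 0 c - b' 0 (P 0 c)) \<subseteq> N' 0"
    and homS: "\<And>n c. supp c \<subseteq> S (Suc n) \<Longrightarrow>
      supp (f (Suc n) c - f' (Suc n) c - (b' (Suc n) (P (Suc n) c) + P n (b n c))) \<subseteq> N' (Suc n)"
    and a: "a \<in> carrier (cohomology_group G K' n)"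
  shows "cohomology_map G K F n a = cohomology_map G K F' n a"
proof -
  interpret P': presentation_dual S' N' b' K' q' G
    using assms(1) G.coefficients_axioms by (simp add: presentation_dual_def)
  interpret F: cochain_morphism "cochains G K'" "cobdry K'" "cochains G K" "cobdry K" "cochain_map K F"
    by (rule dual_morphism[OF G.coefficients_axioms assms(1) chain(1)])
  interpret F': cochain_morphism "cochains G K'" "cobdry K'" "cochains G K" "cobdry K" "cochain_map K F'"
    by (rule dual_morphism[OF G.coefficients_axioms assms(1) chain(2)])
  obtain \<phi> where \<phi>: "\<phi> \<in> carrier (cocycles (cochains G K') (cobdry K') n)"
    and a': "a = cohom_class (cochains G K') (cobdry K') n \<phi>"
    using a P'.dual.carrier_cohom by (auto simp: cohomology_group_eq)
  have \<phi>c: "\<phi> \<in> carrier (cochain_group G K' n)" using \<phi> by (simp add: P'.dual.in_cocycles)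
  have Fq: "cochain_map K F n \<phi> (q n c) = \<phi> (q' n (f n c))"
    and F'q: "cochain_map K F' n \<phi> (q n c) = \<phi> (q' n (f' n c))" if "supp c \<subseteq> S n" for c :: "'s \<Rightarrow>\<^sub>0 int"
    using q_carrier[OF that] F[OF that] F'[OF that] by (simp_all add: cochain_map_def)
  have bP: "supp (b' n (P n c)) \<subseteq> S' n" if "supp c \<subseteq> S n" for c :: "'s \<Rightarrow>\<^sub>0 int"
    using P'.b_S[OF PS[OF that]] .
  have "\<exists>\<beta>\<in>cobds (cochains G K) (cobdry K) n.
    cochain_map K F n \<phi> = \<beta> \<otimes>\<^bsub>cochain_group G K n\<^esub> cochain_map K F' n \<phi>"
  proof (cases n)
    case 0
    \<comment> \<open>Degree zero has no coboundaries but the neutral one, so the two pullbacks must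
      agree on the nose.\<close>
    have "cochain_map K F n \<phi> = \<one>\<^bsub>cochain_group G K n\<^esub> \<otimes>\<^bsub>cochain_group G K n\<^esub> cochain_map K F' n \<phi>"
    proof (rule cochain_eqI[of _ n])
      interpret A: comm_group "cochain_group G K n" by (rule dual.comm)
      show "\<one>\<^bsub>cochain_group G K n\<^esub> \<otimes>\<^bsub>cochain_group G K n\<^esub> cochain_map K F' n \<phi> \<in> carrier (cochain_group G K n)"
        using F'.f_carrier[OF \<phi>c] by simp
      show "cochain_map K F n \<phi> \<in> carrier (cochain_group G K n)" using F.f_carrier[OF \<phi>c] .
      fix c :: "'s \<Rightarrow>\<^sub>0 int" assume c: "supp c \<subseteq> S n"
      have "\<phi> (q' n (f n c)) = \<phi> (q' n (b' n (P n c))) \<otimes>\<^bsub>G\<^esub> \<phi> (q' n (f' n c))"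
        using f[OF c] bP[OF c] f'[OF c] P'.cochain_null[OF \<phi>c] hom0[of c] c 0
        by (intro G.free_hom_diffD[OF P'.cochain_hom[OF \<phi>c]]) simp_all
      also have "\<dots> = \<phi> (q' n (f' n c))"
        using P'.cocycle_q[OF \<phi> PS[OF c]] G.free_hom_closed[OF P'.cochain_hom[OF \<phi>c] f'[OF c]] by simp
      finally show "cochain_map K F n \<phi> (q n c) =
          (\<one>\<^bsub>cochain_group G K n\<^esub> \<otimes>\<^bsub>cochain_group G K n\<^esub> cochain_map K F' n \<phi>) (q n c)"
        using G.free_hom_closed[OF P'.cochain_hom[OF \<phi>c] f'[OF c]]
        by (simp add: Fq[OF c] F'q[OF c] mult_cochain_q[OF c] one_cochain_q[OF c])
    qed
    then show ?thesis using 0 by (auto simp: cobds_def)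
  next
    case (Suc m)
    \<comment> \<open>This homomorphism descends to a cochain \<theta> on \<open>K\<close> because
      \<open>P\<close> carries \<open>N m\<close> into \<open>N'\<close>, where \<phi> is
      trivial.\<close>
    have "(\<lambda>c. \<phi> (q' n (P m c))) \<in> hom (free_Abelian_group (S m)) G"
      using G.free_hom_compose[OF P'.cochain_hom[OF \<phi>c] P PS[of _ m, folded Suc]] .
    moreover have "\<phi> (q' n (P m (frag_of x))) = \<one>\<^bsub>G\<^esub>" if "x \<in> N m" for x
      using that P'.cochain_null[OF \<phi>c, of "P m (frag_of x)"] PN[of "frag_of x" m] Suc by simp
    ultimately obtain \<theta> where \<theta>: "\<theta> \<in> carrier (cochain_group G K m)"
      "\<And>c. supp c \<subseteq> S m \<Longrightarrow> \<theta> (q m c) = \<phi> (q' n (P m c))"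
      using cochain_from_hom[of "\<lambda>c. \<phi> (q' n (P m c))" m] by blast
    have "cochain_map K F n \<phi> = cobdry K m \<theta> \<otimes>\<^bsub>cochain_group G K n\<^esub> cochain_map K F' n \<phi>"
    proof (rule cochain_eqI[of _ n])
      interpret A: comm_group "cochain_group G K n" by (rule dual.comm)
      show "cobdry K m \<theta> \<otimes>\<^bsub>cochain_group G K n\<^esub> cochain_map K F' n \<phi> \<in> carrier (cochain_group G K n)"
        using A.m_closed[OF _ F'.f_carrier[OF \<phi>c]] dual.d_carrier[OF \<theta>(1)] Suc by simp
      show "cochain_map K F n \<phi> \<in> carrier (cochain_group G K n)" using F.f_carrier[OF \<phi>c] .
      fix c :: "'s \<Rightarrow>\<^sub>0 int" assume c: "supp c \<subseteq> S n"
      have Pb: "supp (P m (b m c)) \<subseteq> S' n"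
        using PS[OF b_S[of c m]] c Suc by simp
      have "\<phi> (q' n (f n c)) = \<phi> (q' n (b' n (P n c) + P m (b m c))) \<otimes>\<^bsub>G\<^esub> \<phi> (q' n (f' n c))"
        using f[OF c] bP[OF c] f'[OF c] Pb P'.cochain_null[OF \<phi>c] homS[of c m] c Suc
        by (intro G.free_hom_diffD[OF P'.cochain_hom[OF \<phi>c]] keys_add_subset) simp_all
      also have "\<phi> (q' n (b' n (P n c) + P m (b m c))) = \<phi> (q' n (P m (b m c)))"
        using P'.cocycle_q[OF \<phi> PS[OF c]] G.free_hom_closed[OF P'.cochain_hom[OF \<phi>c] Pb]
          G.free_hom_simps(1)[OF P'.cochain_hom[OF \<phi>c] bP[OF c] Pb] by simp
      also have "\<phi> (q' n (P m (b m c))) = cobdry K m \<theta> (q n c)"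
        using \<theta>(2)[of "b m c"] b_S[of c m] cobdry_q[of c m \<theta>] c Suc by simp
      finally show "cochain_map K F n \<phi> (q n c) = (cobdry K m \<theta> \<otimes>\<^bsub>cochain_group G K n\<^esub> cochain_map K F' n \<phi>) (q n c)"
        by (simp add: Fq[OF c] F'q[OF c] mult_cochain_q[OF c])
    qed
    then show ?thesis using \<theta> Suc by (auto simp: cobds_def)
  qed
  then have "cohom_class (cochains G K) (cobdry K) n (cochain_map K F n \<phi>)
      = cohom_class (cochains G K) (cobdry K) n (cochain_map K F' n \<phi>)"
    using dual.cohom_class_eq_iff[OF F.f_cocycle[OF \<phi>] F'.f_cocycle[OF \<phi>]] by blast
  then show ?thesis
    using F.induced_class[OF \<phi>, unfolded F.induced_def] F'.induced_class[OF \<phi>, unfolded F'.induced_def]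
    unfolding cohomology_map_eq a' by simp
qed


text \<open>Part of a basis can be mapped arbitrarily and the rest trivially. Triviality on the new
  generators is recorded because an extended cochain must still vanish on the degenerate generators
  outside \<open>S'\<close>.\<close>

lemma (in coefficients) extend_free_hom:
  assumes k: "k \<in> hom (free_Abelian_group S') G" and "S' \<subseteq> S"
  obtains h where "h \<in> hom (free_Abelian_group S) G" "\<And>c. supp c \<subseteq> S' \<Longrightarrow> h c = k c"
    "\<And>x. x \<in> S - S' \<Longrightarrow> h (frag_of x) = \<one>"
proof -
  let ?v = "\<lambda>x. if x \<in> S' then k (frag_of x) else \<one>"
  have "?v ` S \<subseteq> carrier G" using free_hom_closed[OF k] by auto
  then obtain h where h: "h \<in> hom (free_Abelian_group S) G" "\<And>x. x \<in> S \<Longrightarrow> h (frag_of x) = ?v x"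
    using free_Abelian_group_universal by blast
  have h': "h \<in> hom (free_Abelian_group S') G"
  proof (rule homI)
    show "h x \<in> carrier G" if "x \<in> carrier (free_Abelian_group S')" for x
      using that assms(2) free_hom_closed[OF h(1), of x] by auto
  qed (use assms(2) free_hom_simps(1)[OF h(1)] in auto)
  have "h c = k c" if "supp c \<subseteq> S'" for c
    by (rule free_hom_eq[OF h' k _ that]) (use h(2) assms(2) in auto)
  with h that show thesis by simp
qed

text \<open>\<open>P\<close> is a homotopy from the identity to a map after which \<phi> is trivial,
  so \<phi> is the coboundary of its composite with \<open>P\<close>. This serves both the vanishing
  for a point and the injectivity in excision, which is why the hypothesis is about \<phi> and not
  about null chains.\<close>

lemma (in presentation_dual) cocycle_in_cobds:
  assumes \<phi>: "\<phi> \<in> carrier (cocycles (cochains G K) (cobdry K) n)"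
    and P: "\<And>n. additive_frag (P n)"
    and PS: "\<And>n c. supp c \<subseteq> S n \<Longrightarrow> supp (P n c) \<subseteq> S (Suc n)"
    and PN: "\<And>n c. supp c \<subseteq> N n \<Longrightarrow> supp (P n c) \<subseteq> N (Suc n)"
    and van: "\<And>c. supp c \<subseteq> S n \<Longrightarrow>
      \<phi> (q n (c - (b n (P n c) + (case n of 0 \<Rightarrow> 0 | Suc m \<Rightarrow> P m (b m c))))) = \<one>\<^bsub>G\<^esub>"
  shows "\<phi> \<in> cobds (cochains G K) (cobdry K) n"
proof -
  have \<phi>c: "\<phi> \<in> carrier (cochain_group G K n)" using \<phi> by (simp add: dual.in_cocycles)
  note h = cochain_hom[OF \<phi>c]
  let ?Pb = "\<lambda>c. case n of 0 \<Rightarrow> 0 | Suc m \<Rightarrow> P m (b m c)"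
  have Pb: "supp (?Pb c) \<subseteq> S n" if "supp c \<subseteq> S n" for c :: "'s \<Rightarrow>\<^sub>0 int"
    using PS[OF b_S[of c]] that by (cases n) auto
  have eq: "\<phi> (q n c) = \<phi> (q n (?Pb c))" if c: "supp c \<subseteq> S n" for c :: "'s \<Rightarrow>\<^sub>0 int"
  proof -
    have bP: "supp (b n (P n c)) \<subseteq> S n" using b_S[OF PS[OF c]] .
    have "\<phi> (q n c) = \<phi> (q n 0) \<otimes>\<^bsub>G\<^esub> \<phi> (q n (b n (P n c) + ?Pb c))"
      using van[OF c] by (intro G.free_hom_diffD[OF h]) (simp_all add: c bP Pb keys_add_subset)
    then show ?thesis
      using G.free_hom_simps(1)[OF h bP Pb[OF c]] G.free_hom_zero[OF h] cocycle_q[OF \<phi> PS[OF c]]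
        G.free_hom_closed[OF h Pb[OF c]] by simp
  qed
  show ?thesis
  proof (cases n)
    case 0
    interpret A: comm_group "cochain_group G K n" by (rule dual.comm)
    have "\<phi> = \<one>\<^bsub>cochain_group G K n\<^esub>"
    proof (rule cochain_eqI[OF \<phi>c A.one_closed])
      fix c :: "'s \<Rightarrow>\<^sub>0 int" assume c: "supp c \<subseteq> S n"
      show "\<phi> (q n c) = \<one>\<^bsub>cochain_group G K n\<^esub> (q n c)"
        unfolding eq[OF c] one_cochain_q[OF c] using G.free_hom_zero[OF h] 0 by simp
    qed
    then show ?thesis by (simp add: cobds_def 0)
  next
    case (Suc m)
    have "(\<lambda>c. \<phi> (q n (P m c))) \<in> hom (free_Abelian_group (S m)) G"
      using G.free_hom_compose[OF h P PS[of _ m, folded Suc]] .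
    moreover have "\<phi> (q n (P m (frag_of x))) = \<one>\<^bsub>G\<^esub>" if "x \<in> N m" for x
      using that cochain_null[OF \<phi>c, of "P m (frag_of x)"] PN[of "frag_of x" m] Suc by simp
    ultimately obtain \<theta> where \<theta>: "\<theta> \<in> carrier (cochain_group G K m)"
      "\<And>c. supp c \<subseteq> S m \<Longrightarrow> \<theta> (q m c) = \<phi> (q n (P m c))"
      using cochain_from_hom[of "\<lambda>c. \<phi> (q n (P m c))" m] by blast
    have "\<phi> = cobdry K m \<theta>"
    proof (rule cochain_eqI[OF \<phi>c])
      show "cobdry K m \<theta> \<in> carrier (cochain_group G K n)" using dual.d_carrier[OF \<theta>(1)] Suc by simp
      fix c :: "'s \<Rightarrow>\<^sub>0 int" assume c: "supp c \<subseteq> S n"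
      then have c': "supp c \<subseteq> S (Suc m)" using Suc by simp
      show "\<phi> (q n c) = cobdry K m \<theta> (q n c)"
        unfolding eq[OF c] using cobdry_q[OF c', of \<theta>] \<theta>(2)[OF b_S[OF c']] Suc by simp
    qed
    then show ?thesis using \<theta> Suc by (auto simp: cobds_def)
  qed
qed

lemma (in presentation_dual) trivial_cohomology:
  assumes P: "\<And>n. additive_frag (P n)"
    and PS: "\<And>n c. supp c \<subseteq> S n \<Longrightarrow> supp (P n c) \<subseteq> S (Suc n)"
    and PN: "\<And>n c. supp c \<subseteq> N n \<Longrightarrow> supp (P n c) \<subseteq> N (Suc n)"
    and contr: "\<And>c. supp c \<subseteq> S (Suc n) \<Longrightarrow>
      supp (c - (b (Suc n) (P (Suc n) c) + P n (b n c))) \<subseteq> N (Suc n)"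
  shows "trivial_group (cohomology_group G K (Suc n))"
proof -
  have "x = \<one>\<^bsub>cohomology_group G K (Suc n)\<^esub>" if x: "x \<in> carrier (cohomology_group G K (Suc n))" for x
  proof -
    obtain \<phi> where \<phi>: "\<phi> \<in> carrier (cocycles (cochains G K) (cobdry K) (Suc n))"
      and x': "x = cohom_class (cochains G K) (cobdry K) (Suc n) \<phi>"
      using x dual.carrier_cohom by (auto simp: cohomology_group_eq)
    have \<phi>c: "\<phi> \<in> carrier (cochain_group G K (Suc n))" using \<phi> by (simp add: dual.in_cocycles)
    have "\<phi> \<in> cobds (cochains G K) (cobdry K) (Suc n)"
      using \<phi> P PS PN cochain_null[OF \<phi>c contr] by (intro cocycle_in_cobds[where P = P]) simp_all
    then show ?thesis
      using dual.cohom_class_eq_one_iff[OF \<phi>] by (simp add: x' cohomology_group_eq)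
  qed
  moreover have "group (cohomology_group G K (Suc n))"
    using comm_cohomology by (rule comm_group.axioms)
  ultimately show ?thesis
    by (auto simp: trivial_group_def group.is_monoid monoid.one_closed)
qed

text \<open>Two situations are covered: a subspace inside a space, with absolute chains, and the two
  pairs compared by excision. The condition on \<open>N'\<close> says that the small complex embeds
  into the big one: a chain on \<open>S'\<close> is null there exactly if it is null here.\<close>

locale presentation_pair = big: presentation_dual S N b K q G + small: presentation_dual S' N' b K' q' G
  for S N :: "nat \<Rightarrow> 's set" and b and K :: "'c ccomplex" and q and S' N' and K' :: "'d ccomplex" and q'
    and G :: "'g monoid" +
  fixes i :: "nat \<Rightarrow> 'd \<Rightarrow> 'c"
  assumes sub: "S' n \<subseteq> S n" and N': "N' n = S' n \<inter> N n"
    and i_q: "supp c \<subseteq> S' n \<Longrightarrow> i n (q' n c) = q n c"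
begin

lemma keys_sub: "supp c \<subseteq> S' n \<Longrightarrow> supp c \<subseteq> S n"
  using sub[of n] by blast

sublocale i: cochain_morphism "cochains G K" "cobdry K" "cochains G K'" "cobdry K'" "cochain_map K' i"
proof -
  have "is_chain_map K' K i"
  proof (rule small.chain_map_from_frags[OF big.presentation_axioms, where f = "\<lambda>n c. c"])
    show "supp c \<subseteq> S n" if "supp c \<subseteq> S' n" for n and c :: "'s \<Rightarrow>\<^sub>0 int"
      using that by (rule keys_sub)
  qed (simp_all add: i_q)
  then show "cochain_morphism (cochains G K) (cobdry K) (cochains G K') (cobdry K') (cochain_map K' i)"
    by (rule small.dual_morphism[OF big.G.coefficients_axioms big.presentation_axioms])
qed

lemma restrict_q: "supp c \<subseteq> S' n \<Longrightarrow> cochain_map K' i n \<phi> (q' n c) = \<phi> (q n c)"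
  using small.q_carrier[of c n] by (simp add: cochain_map_def i_q)

text \<open>The extension has to vanish on \<open>N\<close>. Generators of \<open>N\<close> inside
  \<open>S'\<close> belong to \<open>N'\<close>, where \<open>z\<close> already vanishes; on the
  others the extension is trivial by choice.\<close>

lemma restrict_surj:
  assumes "z \<in> carrier (cochain_group G K' n)"
  shows "\<exists>y\<in>carrier (cochain_group G K n). cochain_map K' i n y = z"
proof -
  obtain h where h: "h \<in> hom (free_Abelian_group (S n)) G"
    and hz: "\<And>c. supp c \<subseteq> S' n \<Longrightarrow> h c = z (q' n c)"
    and h1: "\<And>x. x \<in> S n - S' n \<Longrightarrow> h (frag_of x) = \<one>\<^bsub>G\<^esub>"
    using big.G.extend_free_hom[OF small.cochain_hom[OF assms] sub] by blast
  have "h (frag_of x) = \<one>\<^bsub>G\<^esub>" if "x \<in> N n" for x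
  proof (cases "x \<in> S' n")
    case True
    then show ?thesis
      using that hz[of "frag_of x"] small.cochain_null[OF assms, of "frag_of x"] by (simp add: N')
  next
    case False
    then show ?thesis using that h1[of x] big.N_sub[of n] by blast
  qed
  then obtain y where y: "y \<in> carrier (cochain_group G K n)"
    "\<And>c. supp c \<subseteq> S n \<Longrightarrow> y (q n c) = h c"
    using big.cochain_from_hom[OF h] by blast
  have "cochain_map K' i n y = z"
    using y(2)[OF keys_sub] hz by (intro small.cochain_eqI[OF i.f_carrier[OF y(1)] assms]) (simp add: restrict_q)
  with y show ?thesis by blast
qed

text \<open>\<open>D\<close> is a homotopy from the identity to a retraction onto the chains on
  \<open>S' n \<union> N n\<close>. A class that restricts to zero is represented by a cocycle
  vanishing on all these generators, hence by a coboundary; a cocycle on the small complex is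
  extended as a cochain and then composed with the retraction.\<close>

lemma excision_iso:
  assumes D: "\<And>n. additive_frag (D n)"
    and DS: "\<And>n c. supp c \<subseteq> S n \<Longrightarrow> supp (D n c) \<subseteq> S (Suc n)"
    and DM: "\<And>n c. supp c \<subseteq> S' n \<union> N n \<Longrightarrow> D n c = 0"
    and retr: "\<And>n c. supp c \<subseteq> S n \<Longrightarrow>
      supp (c - (b n (D n c) + (case n of 0 \<Rightarrow> 0 | Suc m \<Rightarrow> D m (b m c)))) \<subseteq> S' n \<union> N n"
  shows "cohomology_map G K' i n \<in> iso (cohomology_group G K n) (cohomology_group G K' n)"
proof -
  \<comment> \<open>The retraction. It fixes chains on \<open>S'\<close> and chains on
    \<open>N\<close>, because \<open>D\<close> vanishes on them and on their boundaries.\<close>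
  define \<rho> where "\<rho> n c = c - (b n (D n c) + (case n of 0 \<Rightarrow> 0 | Suc m \<Rightarrow> D m (b m c)))" for n c
  note bdiff = additive_frag_diff[OF big.b_additive] and badd = additive_frag_add[OF big.b_additive]
    and b0 = additive_frag_0[OF big.b_additive]
  note Ddiff = additive_frag_diff[OF D] and D0 = additive_frag_0[OF D]
  have \<rho>_additive: "additive_frag (\<rho> n)" for n
    by (cases n) (simp_all add: additive_frag_def \<rho>_def bdiff Ddiff)
  have \<rho>_M: "supp (\<rho> n c) \<subseteq> S' n \<union> N n" if "supp c \<subseteq> S n" for n c
    unfolding \<rho>_def using that by (rule retr)
  have M_S: "S' n \<union> N n \<subseteq> S n" for n using sub[of n] big.N_sub[of n] by blast
  have \<rho>_S: "supp (\<rho> n c) \<subseteq> S n" if "supp c \<subseteq> S n" for n c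
    using \<rho>_M[OF that] M_S[of n] by blast
  have \<rho>_id: "\<rho> n c = c" if "supp c \<subseteq> S' n \<or> supp c \<subseteq> N n" for n c
  proof (cases n)
    case 0
    have "D n c = 0" using that DM[of c n] by blast
    then show ?thesis by (simp add: \<rho>_def b0 0)
  next
    case (Suc m)
    have "D n c = 0" "D m (b m c) = 0"
      using that DM[of c n] DM[of "b m c" m] small.b_S[of c m] big.b_N[of c m] Suc by blast+
    then show ?thesis by (simp add: \<rho>_def b0 Suc)
  qed
  \<comment> \<open>The defect is bb(D c) - D(bb c). Both double boundaries are null chains, and
    \<open>D\<close> is zero on null chains.\<close>
  have \<rho>_b: "supp (\<rho> n (b n c) - b n (\<rho> (Suc n) c)) \<subseteq> N n" if c: "supp c \<subseteq> S (Suc n)" for n c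
  proof -
    have "supp (b n (b (Suc n) (D (Suc n) c))) \<subseteq> N n"
      using big.bb[OF DS[OF c]] .
    moreover have "(case n of 0 \<Rightarrow> 0 | Suc m \<Rightarrow> D m (b m (b n c))) = 0"
    proof (cases n)
      case (Suc m)
      then show ?thesis using DM[of "b m (b n c)" m] big.bb[of c m] c by auto
    qed simp
    ultimately show ?thesis by (simp add: \<rho>_def bdiff badd)
  qed
  interpret H: group_hom "cohom (cochains G K) (cobdry K) n" "cohom (cochains G K') (cobdry K') n" "i.induced n"
    using big.dual.comm_cohom small.dual.comm_cohom i.induced_hom
    by (simp add: group_hom_def group_hom_axioms_def comm_group.axioms(2))
  have "x = \<one>\<^bsub>cohom (cochains G K) (cobdry K) n\<^esub>"
    if x: "x \<in> carrier (cohom (cochains G K) (cobdry K) n)" "i.induced n x = \<one>\<^bsub>cohom (cochains G K') (cobdry K') n\<^esub>" for x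
  proof -
    interpret A: comm_group "cochain_group G K n" by (rule big.dual.comm)
    interpret A': comm_group "cochain_group G K (Suc n)" by (rule big.dual.comm)
    obtain \<phi> where \<phi>: "\<phi> \<in> carrier (cocycles (cochains G K) (cobdry K) n)"
      and x': "x = cohom_class (cochains G K) (cobdry K) n \<phi>"
      using x big.dual.carrier_cohom by auto
    have "cochain_map K' i n \<phi> \<in> cobds (cochains G K') (cobdry K') n"
      using x small.dual.cohom_class_eq_one_iff[OF i.f_cocycle[OF \<phi>]] i.induced_class[OF \<phi>] x' by simp
    \<comment> \<open>The restriction of \<phi> is a coboundary on the small complex; extending its
      primitive gives a coboundary \<beta> on the big one with the same restriction.\<close>
    then obtain \<beta> where \<beta>: "\<beta> \<in> cobds (cochains G K) (cobdry K) n" "cochain_map K' i n \<beta> = cochain_map K' i n \<phi>"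
    proof (cases n)
      case 0
      then show ?thesis using \<open>_ \<in> cobds _ _ n\<close> that[of "\<one>\<^bsub>cochain_group G K n\<^esub>"] i.f_one[of n] by (simp add: cobds_def)
    next
      case (Suc m)
      then obtain z where z: "z \<in> carrier (cochain_group G K' m)" "cochain_map K' i n \<phi> = cobdry K' m z"
        using \<open>_ \<in> cobds _ _ n\<close> by (auto simp: cobds_def)
      then obtain y where "y \<in> carrier (cochain_group G K m)" "cochain_map K' i m y = z"
        using restrict_surj by blast
      then show ?thesis using that[of "cobdry K m y"] i.f_comm[of y m] z Suc by (auto simp: cobds_def)
    qed
    have \<beta>c: "\<beta> \<in> carrier (cochain_group G K n)" and \<phi>c: "\<phi> \<in> carrier (cochain_group G K n)"
      using big.dual.cobds_carrier[OF \<beta>(1)] \<phi> by (simp_all add: big.dual.in_cocycles)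
    \<comment> \<open>Cohomologous to \<phi>, but with trivial restriction; together with the
      vanishing of all cochains on \<open>N\<close> this makes it trivial on the image of the
      retraction.\<close>
    define \<psi> where "\<psi> = inv\<^bsub>cochain_group G K n\<^esub> \<beta> \<otimes>\<^bsub>cochain_group G K n\<^esub> \<phi>"
    have \<psi>c: "\<psi> \<in> carrier (cochain_group G K n)" using \<beta>c \<phi>c by (simp add: \<psi>_def)
    have \<psi>: "\<psi> \<in> carrier (cocycles (cochains G K) (cobdry K) n)"
      using big.dual.cobds_carrier[OF \<beta>(1)] \<phi> \<psi>c by (simp add: big.dual.in_cocycles) (simp add: \<psi>_def)
    have "cochain_map K' i n \<psi> = \<one>\<^bsub>cochain_group G K' n\<^esub>"
    proof -
      interpret B: comm_group "cochain_group G K' n" by (rule small.dual.comm)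
      show ?thesis
        using i.f_mult[OF A.inv_closed[OF \<beta>c] \<phi>c] i.f_inv[OF \<beta>c] \<beta>(2) B.l_inv[OF i.f_carrier[OF \<phi>c]]
        by (simp add: \<psi>_def)
    qed
    then have "\<psi> (q n c) = \<one>\<^bsub>G\<^esub>" if "supp c \<subseteq> S' n" for c
      using restrict_q[OF that, of \<psi>] small.one_cochain_q[OF that] by simp
    then have "\<psi> (q n (frag_of x)) = \<one>\<^bsub>G\<^esub>" if "x \<in> S' n \<union> N n" for x
      using that big.cochain_null[OF \<psi>c, of "frag_of x"] by auto
    then have vanish: "\<psi> (q n c) = \<one>\<^bsub>G\<^esub>" if "supp c \<subseteq> S' n \<union> N n" for c
      using big.G.free_hom_vanish[OF big.cochain_hom[OF \<psi>c] M_S _ that] by blast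
    have "\<psi> \<in> cobds (cochains G K) (cobdry K) n"
    proof (rule big.cocycle_in_cobds[where P = D, OF \<psi> D DS])
      fix n and c :: "'s \<Rightarrow>\<^sub>0 int" assume "supp c \<subseteq> N n"
      then show "supp (D n c) \<subseteq> N (Suc n)" using DM[of c n] by (simp add: le_supI2)
    qed (assumption | rule vanish retr)+
    moreover have "\<phi> = \<beta> \<otimes>\<^bsub>cochain_group G K n\<^esub> \<psi>"
      using \<beta>c \<phi>c by (simp add: \<psi>_def flip: A.m_assoc)
    ultimately have "\<phi> \<in> cobds (cochains G K) (cobdry K) n"
      using subgroup.m_closed[OF big.dual.subgroup_cobds \<beta>(1)] by simp
    then show ?thesis using big.dual.cohom_class_eq_one_iff[OF \<phi>] x' by simp
  qed
  then have "inj_on (i.induced n) (carrier (cohom (cochains G K) (cobdry K) n))"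
    using H.inj_on_one_iff by blast
  moreover have "x \<in> i.induced n ` carrier (cohom (cochains G K) (cobdry K) n)"
    if x: "x \<in> carrier (cohom (cochains G K') (cobdry K') n)" for x
  proof -
    obtain \<phi>' where \<phi>': "\<phi>' \<in> carrier (cocycles (cochains G K') (cobdry K') n)"
      and x': "x = cohom_class (cochains G K') (cobdry K') n \<phi>'"
      using x small.dual.carrier_cohom by auto
    then have \<phi>'c: "\<phi>' \<in> carrier (cochain_group G K' n)" by (simp add: small.dual.in_cocycles)
    \<comment> \<open>Merely a cochain: an extension of a cocycle need not be a cocycle. Composition
      with \<rho> repairs this.\<close>
    obtain y where y: "y \<in> carrier (cochain_group G K n)" "cochain_map K' i n y = \<phi>'"
      using restrict_surj[OF \<phi>'c] by blast
    have y_q: "y (q n c) = \<phi>' (q' n c)" if "supp c \<subseteq> S' n" for c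
      using restrict_q[OF that, of y] y(2) by simp
    note h = big.cochain_hom[OF y(1)]
    have "(\<lambda>c. y (q n (\<rho> n c))) \<in> hom (free_Abelian_group (S n)) G"
      using big.G.free_hom_compose[OF h \<rho>_additive \<rho>_S] .
    moreover have "y (q n (\<rho> n (frag_of x))) = \<one>\<^bsub>G\<^esub>" if "x \<in> N n" for x
      using that \<rho>_id[of "frag_of x" n] big.cochain_null[OF y(1), of "frag_of x"] by simp
    ultimately obtain \<phi> where \<phi>: "\<phi> \<in> carrier (cochain_group G K n)"
      "\<And>c. supp c \<subseteq> S n \<Longrightarrow> \<phi> (q n c) = y (q n (\<rho> n c))"
      using big.cochain_from_hom[of "\<lambda>c. y (q n (\<rho> n c))" n] by blast
    have "\<phi> (q n (b n c)) = \<one>\<^bsub>G\<^esub>" if c: "supp c \<subseteq> S (Suc n)" for c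
    proof -
      \<comment> \<open>On the boundary of the part in \<open>S'\<close> the extension agrees with
        \<phi>' and vanishes by the cocycle condition; on that of the part in \<open>N\<close> every
        cochain vanishes.\<close>
      obtain d e where de: "supp d \<subseteq> S' (Suc n)" "supp e \<subseteq> N (Suc n)" "d + e = \<rho> (Suc n) c"
        using frag_split[OF \<rho>_M[OF c]] by blast
      have dS: "supp (b n d) \<subseteq> S n" and eS: "supp (b n e) \<subseteq> S n"
        using small.b_S[OF de(1)] big.b_N[OF de(2)] M_S[of n] by blast+
      have "\<phi> (q n (b n c)) = y (q n (\<rho> n (b n c)))" using \<phi>(2)[OF big.b_S[OF c]] .
      also have "q n (\<rho> n (b n c)) = q n (b n (\<rho> (Suc n) c))"
        using big.q_eq[OF \<rho>_S[OF big.b_S[OF c]] big.b_S[OF \<rho>_S[OF c]]] \<rho>_b[OF c] by blast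
      also have "y (q n (b n (\<rho> (Suc n) c))) = y (q n (b n d)) \<otimes>\<^bsub>G\<^esub> y (q n (b n e))"
        using big.G.free_hom_simps(1)[OF h dS eS] by (simp add: badd flip: de(3))
      also have "\<dots> = \<one>\<^bsub>G\<^esub>"
        using y_q[OF small.b_S[OF de(1)]] small.cocycle_q[OF \<phi>' de(1)] big.cochain_null[OF y(1) big.b_N[OF de(2)]]
        by simp
      finally show ?thesis .
    qed
    then have \<phi>Z: "\<phi> \<in> carrier (cocycles (cochains G K) (cobdry K) n)"
      by (rule big.cocycleI[OF \<phi>(1)])
    have "cochain_map K' i n \<phi> = \<phi>'"
    proof (rule small.cochain_eqI[OF i.f_carrier[OF \<phi>(1)] \<phi>'c])
      fix c :: "'s \<Rightarrow>\<^sub>0 int" assume c: "supp c \<subseteq> S' n"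
      then show "cochain_map K' i n \<phi> (q' n c) = \<phi>' (q' n c)"
        using restrict_q[OF c, of \<phi>] \<phi>(2)[OF keys_sub[OF c]] y_q[OF c] \<rho>_id[of c n] by simp
    qed
    then have "x = i.induced n (cohom_class (cochains G K) (cobdry K) n \<phi>)"
      using i.induced_class[OF \<phi>Z] x' by simp
    then show ?thesis using \<phi>Z big.dual.carrier_cohom by blast
  qed
  ultimately have "i.induced n \<in> iso (cohom (cochains G K) (cobdry K) n) (cohom (cochains G K') (cobdry K') n)"
    using H.homh H.hom_closed by (auto simp: iso_def bij_betw_def)
  then show ?thesis by (simp add: cohomology_group_eq cohomology_map_eq i.induced_def)
qed

end

text \<open>The relative complex has the generators of \<open>K\<close> and the additional relations
  \<open>SA\<close>, so its cochains are those cochains of \<open>K\<close> that vanish on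
  \<open>SA\<close>: the kernel of restriction. Surjectivity of restriction is
  \<open>restrict_surj\<close>.\<close>

lemma short_exact_dual:
  assumes "presentation_pair S N b K q SA NA KA qA G i" and R: "presentation S NR b KR qR"
    and NR: "\<And>n. NR n = N n \<union> SA n"
    and j_q: "\<And>n c. supp c \<subseteq> S n \<Longrightarrow> j n (q n c) = qR n c"
  shows "short_exact (cochains G KR) (cobdry KR) (cochains G K) (cobdry K) (cochains G KA) (cobdry KA)
    (cochain_map K j) (cochain_map KA i)"
proof -
  interpret presentation_pair S N b K q SA NA KA qA G i by fact
  interpret R: presentation_dual S NR b KR qR G
    using R big.G.coefficients_axioms by (simp add: presentation_dual_def)
  have "is_chain_map K KR j"
    by (rule big.chain_map_from_frags[OF R, where f = "\<lambda>n c. c"]) (simp_all add: j_q)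
  then interpret j: cochain_morphism "cochains G KR" "cobdry KR" "cochains G K" "cobdry K" "cochain_map K j"
    by (rule big.dual_morphism[OF big.G.coefficients_axioms R])
  have jq: "cochain_map K j n x (q n c) = x (qR n c)" if "supp c \<subseteq> S n" for n x c
    using big.q_carrier[OF that] j_q[OF that] by (simp add: cochain_map_def)
  show ?thesis
  proof (intro short_exact.intro short_exact_axioms.intro)
    show "cochain_morphism (cochains G KR) (cobdry KR) (cochains G K) (cobdry K) (cochain_map K j)"
      by unfold_locales
    show "cochain_morphism (cochains G K) (cobdry K) (cochains G KA) (cobdry KA) (cochain_map KA i)"
      by unfold_locales
  next
    fix n x assume x: "x \<in> carrier (cochain_group G KR n)" "cochain_map K j n x = \<one>\<^bsub>cochain_group G K n\<^esub>"
    interpret A: comm_group "cochain_group G KR n" by (rule R.dual.comm)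
    show "x = \<one>\<^bsub>cochain_group G KR n\<^esub>"
    proof (rule R.cochain_eqI[OF x(1) A.one_closed])
      fix c :: "'a \<Rightarrow>\<^sub>0 int" assume c: "supp c \<subseteq> S n"
      show "x (qR n c) = \<one>\<^bsub>cochain_group G KR n\<^esub> (qR n c)"
        using jq[OF c, of x] x(2) big.one_cochain_q[OF c] R.one_cochain_q[OF c] by simp
    qed
  next
    fix n x assume x: "x \<in> carrier (cochain_group G KR n)"
    interpret A: comm_group "cochain_group G KA n" by (rule small.dual.comm)
    show "cochain_map KA i n (cochain_map K j n x) = \<one>\<^bsub>cochain_group G KA n\<^esub>"
    proof (rule small.cochain_eqI[OF i.f_carrier[OF j.f_carrier[OF x]] A.one_closed])
      fix c :: "'a \<Rightarrow>\<^sub>0 int" assume c: "supp c \<subseteq> SA n"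
      then have "supp c \<subseteq> NR n" by (auto simp: NR)
      then show "cochain_map KA i n (cochain_map K j n x) (qA n c) = \<one>\<^bsub>cochain_group G KA n\<^esub> (qA n c)"
        using restrict_q[OF c, of "cochain_map K j n x"] jq[OF keys_sub[OF c], of x] R.cochain_null[OF x] small.one_cochain_q[OF c] by simp
    qed
  next
    fix n y assume y: "y \<in> carrier (cochain_group G K n)" "cochain_map KA i n y = \<one>\<^bsub>cochain_group G KA n\<^esub>"
    have "y (q n (frag_of x)) = \<one>\<^bsub>G\<^esub>" if "x \<in> NR n" for x
      using that restrict_q[of "frag_of x" n y] y(2) small.one_cochain_q[of "frag_of x" n]
        big.cochain_null[OF y(1), of "frag_of x"] by (auto simp: NR)
    then obtain x where x: "x \<in> carrier (cochain_group G KR n)"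
      "\<And>c. supp c \<subseteq> S n \<Longrightarrow> x (qR n c) = y (q n c)"
      using R.cochain_from_hom[OF big.cochain_hom[OF y(1)]] by blast
    have "cochain_map K j n x = y"
      by (rule big.cochain_eqI[OF j.f_carrier[OF x(1)] y(1)]) (simp add: jq x(2))
    with x show "\<exists>x\<in>carrier (cochain_group G KR n). cochain_map K j n x = y" by blast
  next
    fix n z assume "z \<in> carrier (cochain_group G KA n)"
    then show "\<exists>y\<in>carrier (cochain_group G K n). cochain_map KA i n y = z" by (rule restrict_surj)
  qed
qed

section \<open>Closure spaces\<close>

lemma closure_spaceD:
  assumes "closure_space X"
  shows "A \<subseteq> points X \<Longrightarrow> clos X A \<subseteq> points X" "clos X {} = {}" "A \<subseteq> points X \<Longrightarrow> A \<subseteq> clos X A"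
    "A \<subseteq> points X \<Longrightarrow> B \<subseteq> points X \<Longrightarrow> clos X (A \<union> B) = clos X A \<union> clos X B"
  using assms by (auto simp: closure_space_def)

lemma clos_mono:
  assumes "closure_space X" "A \<subseteq> B" "B \<subseteq> points X"
  shows "clos X A \<subseteq> clos X B"
proof -
  have "clos X A \<subseteq> clos X (A \<union> B)" using closure_spaceD(4)[OF assms(1), of A B] assms by blast
  moreover have "A \<union> B = B" using assms by blast
  ultimately show ?thesis by simp
qed

lemma cnbhd_points: "closure_space X \<Longrightarrow> x \<in> points X \<Longrightarrow> cnbhd X x (points X)"
  by (simp add: cnbhd_def cinterior_def closure_spaceD(2))

lemma cnbhd_Int:
  assumes "closure_space X" "cnbhd X x V" "cnbhd X x W"
  shows "cnbhd X x (V \<inter> W)"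
proof -
  have "points X - V \<inter> W = (points X - V) \<union> (points X - W)" by blast
  then show ?thesis
    using assms closure_spaceD(4)[OF assms(1), of "points X - V" "points X - W"]
    by (auto simp: cnbhd_def cinterior_def)
qed

lemma cnbhd_in: "closure_space X \<Longrightarrow> cnbhd X x V \<Longrightarrow> x \<in> V"
  using closure_spaceD(3)[of X "points X - V"] by (auto simp: cnbhd_def cinterior_def)

lemma cnbhd_Inter:
  assumes "closure_space X" "x \<in> points X" "finite I" "\<And>i. i \<in> I \<Longrightarrow> cnbhd X x (V i)"
  shows "cnbhd X x {y \<in> points X. \<forall>i\<in>I. y \<in> V i}"
  using assms(3,4)
proof (induction I rule: finite_induct)
  case empty
  then show ?case using cnbhd_points assms by simp
next
  case (insert i I)
  have "{y \<in> points X. \<forall>i\<in>insert i I. y \<in> V i} = V i \<inter> {y \<in> points X. \<forall>i\<in>I. y \<in> V i}"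
    using insert.prems[of i] by (auto simp: cnbhd_def)
  then show ?case using insert cnbhd_Int[OF assms(1)] by simp
qed

text \<open>If a point is outside the closure of a set, the complement of the set is itself a
  neighbourhood of the point. The converse is monotonicity of the closure.\<close>

lemma clos_iff:
  assumes X: "closure_space X" "A \<subseteq> points X"
  shows "x \<in> clos X A \<longleftrightarrow> x \<in> points X \<and> (\<forall>V. cnbhd X x V \<longrightarrow> V \<inter> A \<noteq> {})"
proof (intro iffI conjI allI impI)
  assume x: "x \<in> clos X A"
  then show "x \<in> points X" using closure_spaceD(1)[OF X] by blast
  fix V assume V: "cnbhd X x V"
  show "V \<inter> A \<noteq> {}"
  proof
    assume "V \<inter> A = {}"
    then have "clos X A \<subseteq> clos X (points X - V)" using X by (intro clos_mono) auto
    then show False using V x by (auto simp: cnbhd_def cinterior_def)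
  qed
next
  assume r: "x \<in> points X \<and> (\<forall>V. cnbhd X x V \<longrightarrow> V \<inter> A \<noteq> {})"
  show "x \<in> clos X A"
  proof (rule ccontr)
    assume "x \<notin> clos X A"
    moreover have "points X - (points X - A) = A" using X by blast
    ultimately have "cnbhd X x (points X - A)" using r by (auto simp: cnbhd_def cinterior_def)
    then show False using r by blast
  qed
qed

lemma ccont_funcset: "ccont X Y f \<Longrightarrow> x \<in> points X \<Longrightarrow> f x \<in> points Y"
  by (auto simp: ccont_def)

lemma ccont_vimage_nbhd:
  assumes "closure_space Z" "closure_space X" "ccont Z X f" "z \<in> points Z" "cnbhd X (f z) V"
  shows "cnbhd Z z {w \<in> points Z. f w \<in> V}"
proof -
  let ?C = "points Z - {w \<in> points Z. f w \<in> V}"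
  have "f ` clos Z ?C \<subseteq> clos X (f ` ?C)" using assms(3) by (auto simp: ccont_def)
  also have "\<dots> \<subseteq> clos X (points X - V)"
    using assms by (intro clos_mono) (auto simp: ccont_def)
  finally show ?thesis using assms(4,5) by (auto simp: cnbhd_def cinterior_def)
qed

lemma ccont_compose: "ccont X Y f \<Longrightarrow> ccont Y Z g \<Longrightarrow> ccont X Z (g \<circ> f)"
  unfolding ccont_def
proof (intro conjI allI impI)
  assume f: "f \<in> points X \<rightarrow> points Y \<and> (\<forall>A\<subseteq>points X. f ` clos X A \<subseteq> clos Y (f ` A))"
    and g: "g \<in> points Y \<rightarrow> points Z \<and> (\<forall>A\<subseteq>points Y. g ` clos Y A \<subseteq> clos Z (g ` A))"
  then show "g \<circ> f \<in> points X \<rightarrow> points Z" by auto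
  fix A assume A: "A \<subseteq> points X"
  then have "f ` A \<subseteq> points Y" using f by auto
  then have "g ` clos Y (f ` A) \<subseteq> clos Z (g ` f ` A)" using g by blast
  then show "(g \<circ> f) ` clos X A \<subseteq> clos Z ((g \<circ> f) ` A)"
    using f A unfolding image_comp[symmetric] by blast
qed

lemma ccont_cong:
  assumes "closure_space X" "ccont X Y f" "\<And>x. x \<in> points X \<Longrightarrow> f x = g x"
  shows "ccont X Y g"
proof -
  have im: "g ` A = f ` A" if "A \<subseteq> points X" for A using that assms(3) by (intro image_cong) auto
  have "g ` clos X A \<subseteq> clos Y (g ` A)" if "A \<subseteq> points X" for A
    using im[OF that] im[OF closure_spaceD(1)[OF assms(1) that]] assms(2) that by (simp add: ccont_def)
  moreover have "g \<in> points X \<rightarrow> points Y" using ccont_funcset[OF assms(2)] assms(3) by auto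
  ultimately show ?thesis by (simp add: ccont_def)
qed

lemma ccont_const:
  assumes "closure_space X" "closure_space Y" "y \<in> points Y"
  shows "ccont X Y (\<lambda>x. y)"
  unfolding ccont_def
proof (intro conjI allI impI)
  fix A assume "A \<subseteq> points X"
  then show "(\<lambda>x. y) ` clos X A \<subseteq> clos Y ((\<lambda>x. y) ` A)"
    using closure_spaceD(2)[OF assms(1)] closure_spaceD(3)[OF assms(2), of "{y}"] assms(3)
    by (auto simp: image_constant_conv)
qed (use assms in auto)

lemma ccont_id: "ccont X X id"
  by (simp add: ccont_def)

lemma points_subspace [simp]: "points (subspace_of X A) = A"
  by (simp add: subspace_of_def)

lemma closure_space_subspace:
  assumes "closure_space X" "A \<subseteq> points X"
  shows "closure_space (subspace_of X A)"
  unfolding closure_space_def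
proof (intro conjI allI impI)
  fix B C assume "B \<subseteq> points (subspace_of X A)"
  then have B: "B \<subseteq> A" "B \<subseteq> points X" using assms by auto
  then show "B \<subseteq> clos (subspace_of X A) B"
    using closure_spaceD(3)[OF assms(1), of B] by (auto simp: subspace_of_def)
  assume "C \<subseteq> points (subspace_of X A)"
  then have "C \<subseteq> points X" using assms by auto
  then show "clos (subspace_of X A) (B \<union> C) = clos (subspace_of X A) B \<union> clos (subspace_of X A) C"
    using closure_spaceD(4)[OF assms(1), of B C] B by (auto simp: subspace_of_def)
qed (use closure_spaceD(2)[OF assms(1)] in \<open>auto simp: subspace_of_def\<close>)

lemma ccont_subspace:
  assumes "closure_space Z"
  shows "ccont Z (subspace_of X A) f \<longleftrightarrow> f \<in> points Z \<rightarrow> A \<and> (\<forall>B\<subseteq>points Z. f ` clos Z B \<subseteq> clos X (f ` B))"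
proof -
  have "f ` clos Z B \<subseteq> A" if "f \<in> points Z \<rightarrow> A" "B \<subseteq> points Z" for B
    using that closure_spaceD(1)[OF assms that(2)] by blast
  then show ?thesis unfolding ccont_def subspace_of_def by simp blast
qed

lemma ccont_subspace_iff:
  assumes "closure_space Z" "A \<subseteq> points X"
  shows "ccont Z (subspace_of X A) f \<longleftrightarrow> ccont Z X f \<and> f ` points Z \<subseteq> A"
  unfolding ccont_subspace[OF assms(1)] using assms(2) by (auto simp: ccont_def)

lemma ccont_subspace_id: "A \<subseteq> points X \<Longrightarrow> ccont (subspace_of X A) X id"
  by (auto simp: ccont_def subspace_of_def)

text \<open>Membership in the product closure is tested on boxes. Pulling both sides of a box back
  along \<open>f\<close> and \<open>g\<close> and intersecting gives a neighbourhood of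
  \<open>z\<close>, which meets \<open>A\<close>.\<close>

lemma ccont_pair:
  assumes Z: "closure_space Z" and X: "closure_space X" and Y: "closure_space Y"
    and f: "ccont Z X f" and g: "ccont Z Y g"
  shows "ccont Z (cprod X Y) (\<lambda>z. (f z, g z))"
  unfolding ccont_def
proof (intro conjI allI impI)
  show "(\<lambda>z. (f z, g z)) \<in> points Z \<rightarrow> points (cprod X Y)"
    using f g by (auto simp: cprod_def ccont_def)
  fix A assume A: "A \<subseteq> points Z"
  have "(f z, g z) \<in> clos (cprod X Y) ((\<lambda>z. (f z, g z)) ` A)" if z: "z \<in> clos Z A" for z
  proof -
    have zp: "z \<in> points Z" using z A closure_spaceD(1)[OF Z] by blast
    have "(U \<times> V) \<inter> (\<lambda>z. (f z, g z)) ` A \<noteq> {}" if "cnbhd X (f z) U" "cnbhd Y (g z) V" for U V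
    proof -
      have "cnbhd Z z ({w \<in> points Z. f w \<in> U} \<inter> {w \<in> points Z. g w \<in> V})"
        using that by (intro cnbhd_Int Z ccont_vimage_nbhd[OF Z X f zp] ccont_vimage_nbhd[OF Z Y g zp])
      then have "({w \<in> points Z. f w \<in> U} \<inter> {w \<in> points Z. g w \<in> V}) \<inter> A \<noteq> {}"
        using z clos_iff[OF Z A] by blast
      then show ?thesis by blast
    qed
    then show ?thesis using zp f g by (simp add: cprod_def ccont_funcset)
  qed
  then show "(\<lambda>z. (f z, g z)) ` clos Z A \<subseteq> clos (cprod X Y) ((\<lambda>z. (f z, g z)) ` A)" by blast
qed

section \<open>Finite powers of closure spaces\<close>

lemma points_cpower: "points (cpower X n) = (\<Pi>\<^sub>E i\<in>{1..n}. points X)"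
  by (simp add: cpower_def)

text \<open>Additivity is the point: if one box around a point misses \<open>A\<close> and another
  one misses \<open>B\<close>, their intersection is again a box around it and misses the
  union.\<close>

lemma closure_space_cpower:
  assumes X: "closure_space X"
  shows "closure_space (cpower X n)"
  unfolding closure_space_def
proof (intro conjI allI impI)
  fix A B
  have int: "p \<in> (\<Pi>\<^sub>E i\<in>{1..n}. U i)"
    if "p \<in> (\<Pi>\<^sub>E i\<in>{1..n}. points X)" "\<forall>i\<in>{1..n}. cnbhd X (p i) (U i)" for p U
    using that cnbhd_in[OF X] by (auto simp: PiE_iff)
  assume "A \<subseteq> points (cpower X n)"
  then have A: "A \<subseteq> (\<Pi>\<^sub>E i\<in>{1..n}. points X)" by (simp add: points_cpower)
  show "A \<subseteq> clos (cpower X n) A"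
  proof
    fix p assume "p \<in> A"
    then show "p \<in> clos (cpower X n) A" using int A unfolding cpower_def by simp blast
  qed
  have "p \<in> clos (cpower X n) A \<union> clos (cpower X n) B"
    if p: "p \<in> clos (cpower X n) (A \<union> B)" for p
  proof (rule ccontr)
    assume "\<not> ?thesis"
    moreover have pp: "p \<in> (\<Pi>\<^sub>E i\<in>{1..n}. points X)" using p by (simp add: cpower_def)
    ultimately obtain U V where
      U: "\<forall>i\<in>{1..n}. cnbhd X (p i) (U i)" "(\<Pi>\<^sub>E i\<in>{1..n}. U i) \<inter> A = {}" and
      V: "\<forall>i\<in>{1..n}. cnbhd X (p i) (V i)" "(\<Pi>\<^sub>E i\<in>{1..n}. V i) \<inter> B = {}"
      unfolding cpower_def by auto
    have "\<forall>i\<in>{1..n}. cnbhd X (p i) (U i \<inter> V i)" using U V cnbhd_Int[OF X] by blast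
    then have "(\<Pi>\<^sub>E i\<in>{1..n}. U i \<inter> V i) \<inter> (A \<union> B) \<noteq> {}"
      using p unfolding cpower_def by simp
    moreover have "(\<Pi>\<^sub>E i\<in>{1..n}. U i \<inter> V i) \<subseteq> (\<Pi>\<^sub>E i\<in>{1..n}. U i) \<inter> (\<Pi>\<^sub>E i\<in>{1..n}. V i)" by auto
    ultimately show False using U V by blast
  qed
  moreover have "clos (cpower X n) A \<union> clos (cpower X n) B \<subseteq> clos (cpower X n) (A \<union> B)"
    by (auto simp: cpower_def Int_Un_distrib)
  ultimately show "clos (cpower X n) (A \<union> B) = clos (cpower X n) A \<union> clos (cpower X n) B" by blast
next
  have "\<exists>U. \<forall>i\<in>{1..n}. cnbhd X (p i) (U i)" if "p \<in> (\<Pi>\<^sub>E i\<in>{1..n}. points X)" for p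
    using cnbhd_points[OF X] that by (intro exI[of _ "\<lambda>i. points X"]) auto
  then show "clos (cpower X n) {} = {}" by (auto simp: cpower_def)
qed (auto simp: cpower_def)

text \<open>A neighbourhood in one coordinate becomes a box that is unrestricted in all other
  coordinates.\<close>

lemma ccont_component:
  assumes X: "closure_space X" and i: "i \<in> {1..n}"
  shows "ccont (cpower X n) X (\<lambda>p. p i)"
  unfolding ccont_def
proof (intro conjI allI impI)
  show "(\<lambda>p. p i) \<in> points (cpower X n) \<rightarrow> points X" using i by (auto simp: cpower_def)
  fix C assume C: "C \<subseteq> points (cpower X n)"
  have "p i \<in> clos X ((\<lambda>p. p i) ` C)" if p: "p \<in> clos (cpower X n) C" for p
  proof -
    have pp: "p \<in> (\<Pi>\<^sub>E i\<in>{1..n}. points X)" using p by (simp add: cpower_def)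
    have "c i \<in> points X" if "c \<in> C" for c
      using C that PiE_mem[of c "{1..n}" "\<lambda>_. points X" i] i by (auto simp: points_cpower)
    then have sub: "(\<lambda>p. p i) ` C \<subseteq> points X" by blast
    have "V \<inter> (\<lambda>p. p i) ` C \<noteq> {}" if V: "cnbhd X (p i) V" for V
    proof -
      have "\<forall>j\<in>{1..n}. cnbhd X (p j) (if j = i then V else points X)"
        using V pp cnbhd_points[OF X] by auto
      then have "(\<Pi>\<^sub>E j\<in>{1..n}. if j = i then V else points X) \<inter> C \<noteq> {}"
        using p unfolding cpower_def by simp
      then obtain c where c: "c \<in> (\<Pi>\<^sub>E j\<in>{1..n}. if j = i then V else points X)" "c \<in> C" by blast
      then have "c i \<in> V" using PiE_mem[OF c(1) i] by simp
      with c show ?thesis by blast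
    qed
    then show ?thesis using clos_iff[OF X sub] pp i by auto
  qed
  then show "(\<lambda>p. p i) ` clos (cpower X n) C \<subseteq> clos X ((\<lambda>p. p i) ` C)" by blast
qed

lemma ccont_cpowerI:
  assumes Z: "closure_space Z" and X: "closure_space X"
    and f: "\<And>i. i \<in> {1..n} \<Longrightarrow> ccont Z X (\<lambda>z. f z i)"
    and ext: "\<And>z. z \<in> points Z \<Longrightarrow> f z \<in> extensional {1..n}"
  shows "ccont Z (cpower X n) f"
  unfolding ccont_def
proof (intro conjI allI impI)
  have fp: "f z \<in> (\<Pi>\<^sub>E i\<in>{1..n}. points X)" if "z \<in> points Z" for z
    using ccont_funcset[OF f that] ext[OF that] by (simp add: PiE_iff)
  then show "f \<in> points Z \<rightarrow> points (cpower X n)" by (simp add: points_cpower)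
  fix A assume A: "A \<subseteq> points Z"
  have "f z \<in> clos (cpower X n) (f ` A)" if z: "z \<in> clos Z A" for z
  proof -
    have zp: "z \<in> points Z" using z A closure_spaceD(1)[OF Z] by blast
    have "(\<Pi>\<^sub>E i\<in>{1..n}. U i) \<inter> f ` A \<noteq> {}" if U: "\<forall>i\<in>{1..n}. cnbhd X (f z i) (U i)" for U
    proof -
      have "cnbhd Z z {w \<in> points Z. \<forall>i\<in>{1..n}. w \<in> {w \<in> points Z. f w i \<in> U i}}"
        using U by (intro cnbhd_Inter[OF Z zp] ccont_vimage_nbhd[OF Z X f zp]) auto
      then have "{w \<in> points Z. \<forall>i\<in>{1..n}. w \<in> {w \<in> points Z. f w i \<in> U i}} \<inter> A \<noteq> {}"
        using z clos_iff[OF Z A] by blast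
      then obtain w where "w \<in> A" "w \<in> points Z" "\<forall>i\<in>{1..n}. f w i \<in> U i" by auto
      then have "f w \<in> (\<Pi>\<^sub>E i\<in>{1..n}. U i)" using ext by (auto simp: PiE_iff)
      with \<open>w \<in> A\<close> show ?thesis by blast
    qed
    then show ?thesis using fp[OF zp] by (simp add: cpower_def)
  qed
  then show "f ` clos Z A \<subseteq> clos (cpower X n) (f ` A)" by blast
qed

section \<open>Topological spaces as closure spaces, and pulled back interior covers\<close>

lemma points_cspace_of_topology [simp]: "points (cspace_of_topology T) = topspace T"
  by (simp add: cspace_of_topology_def)

lemma closure_space_topology: "closure_space (cspace_of_topology T)"
  by (auto simp: closure_space_def cspace_of_topology_def closure_of_subset_topspace[THEN subsetD]
      closure_of_subset[THEN subsetD])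

lemma ccont_continuous_map:
  "ccont (cspace_of_topology T) (cspace_of_topology U) f \<longleftrightarrow> continuous_map T U f"
proof
  assume "ccont (cspace_of_topology T) (cspace_of_topology U) f"
  then show "continuous_map T U f"
    unfolding continuous_map_eq_image_closure_subset_alt by (auto simp: ccont_def cspace_of_topology_def)
next
  assume "continuous_map T U f"
  then show "ccont (cspace_of_topology T) (cspace_of_topology U) f"
    using continuous_map_funspace[of T U f] continuous_map_image_closure_subset[of T U f]
    by (simp add: ccont_def cspace_of_topology_def)
qed

lemma cnbhd_topology:
  "cnbhd (cspace_of_topology T) x V \<longleftrightarrow> V \<subseteq> topspace T \<and> x \<in> T interior_of V"
  by (auto simp: cnbhd_def cinterior_def cspace_of_topology_def closure_of_complement
      dest: interior_of_subset_topspace[THEN subsetD])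

text \<open>The only way in which an interior cover is used: around each point of a model, one of
  the two preimages is a neighbourhood. What follows for all of the model is then a question about
  the model alone.\<close>

lemma interior_cover_pullback:
  assumes X: "closure_space X" "interior_cover X {A, B}" and Z: "closure_space Z" and f: "ccont Z X f" and z: "z \<in> points Z"
  shows "cnbhd Z z {w \<in> points Z. f w \<in> A} \<or> cnbhd Z z {w \<in> points Z. f w \<in> B}"
proof -
  have "f z \<in> points X" using f z by (rule ccont_funcset)
  then have "cnbhd X (f z) A \<or> cnbhd X (f z) B"
    using X(2) by (auto simp: interior_cover_def cnbhd_def)
  then show ?thesis using ccont_vimage_nbhd[OF Z X(1) f z] by blast
qed

section \<open>Iterated subdivision\<close>

text \<open>How often \<open>x\<close> has to be subdivided before it and all its iterated faces become small. The depth
  of a face is at most that of the generator, so the homotopy that subdivides each generator as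
  often as its depth demands commutes with boundaries up to small chains.\<close>

primrec depth ::
    "(nat \<Rightarrow> 's set) \<Rightarrow> (nat \<Rightarrow> ('s \<Rightarrow>\<^sub>0 int) \<Rightarrow> ('s \<Rightarrow>\<^sub>0 int)) \<Rightarrow> (nat \<Rightarrow> ('s \<Rightarrow>\<^sub>0 int) \<Rightarrow> ('s \<Rightarrow>\<^sub>0 int)) \<Rightarrow>
     nat \<Rightarrow> 's \<Rightarrow> nat" where
  "depth M b Sd 0 x = (if x \<in> M 0 then 0 else (LEAST m. supp ((Sd 0 ^^ m) (frag_of x)) \<subseteq> M 0))"
| "depth M b Sd (Suc n) x = (if x \<in> M (Suc n) then 0 else
     Max (insert (LEAST m. supp ((Sd (Suc n) ^^ m) (frag_of x)) \<subseteq> M (Suc n))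
       (depth M b Sd n ` supp (b n (frag_of x)))))"

text \<open>\<open>S\<close> are all generators, \<open>M\<close> the small ones and
  \<open>Z\<close> the degenerate ones. The identities hold modulo \<open>Z\<close> because the
  cubical homotopy ends in the given cube plus degenerate pieces; for simplices \<open>Z\<close> is
  empty and they are exact. Smallness is assumed generator by generator, with no bound on the number
  of subdivisions.\<close>

locale subdivision =
  fixes S Z M :: "nat \<Rightarrow> 's set" and b Sd T :: "nat \<Rightarrow> ('s \<Rightarrow>\<^sub>0 int) \<Rightarrow> ('s \<Rightarrow>\<^sub>0 int)"
  assumes ZM: "Z n \<subseteq> M n" and MS: "M n \<subseteq> S n"
    and b: "additive_frag (b n)" and Sd: "additive_frag (Sd n)" and T: "additive_frag (T n)"
    and b_S: "supp c \<subseteq> S (Suc n) \<Longrightarrow> supp (b n c) \<subseteq> S n"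
    and b_M: "supp c \<subseteq> M (Suc n) \<Longrightarrow> supp (b n c) \<subseteq> M n"
    and b_Z: "supp c \<subseteq> Z (Suc n) \<Longrightarrow> supp (b n c) \<subseteq> Z n"
    and Sd_S: "supp c \<subseteq> S n \<Longrightarrow> supp (Sd n c) \<subseteq> S n"
    and Sd_M: "supp c \<subseteq> M n \<Longrightarrow> supp (Sd n c) \<subseteq> M n"
    and Sd_Z: "supp c \<subseteq> Z n \<Longrightarrow> supp (Sd n c) \<subseteq> Z n"
    and T_S: "supp c \<subseteq> S n \<Longrightarrow> supp (T n c) \<subseteq> S (Suc n)"
    and T_M: "supp c \<subseteq> M n \<Longrightarrow> supp (T n c) \<subseteq> M (Suc n)"
    and T_Z: "supp c \<subseteq> Z n \<Longrightarrow> supp (T n c) \<subseteq> Z (Suc n)"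
    and b_Sd: "supp c \<subseteq> S (Suc n) \<Longrightarrow> supp (b n (Sd (Suc n) c) - Sd n (b n c)) \<subseteq> Z n"
    and htpy0: "supp c \<subseteq> S 0 \<Longrightarrow> supp (c - Sd 0 c - b 0 (T 0 c)) \<subseteq> Z 0"
    and htpy: "supp c \<subseteq> S (Suc n) \<Longrightarrow>
      supp (c - Sd (Suc n) c - (b (Suc n) (T (Suc n) c) + T n (b n c))) \<subseteq> Z (Suc n)"
    and small: "x \<in> S n \<Longrightarrow> \<exists>m. supp ((Sd n ^^ m) (frag_of x)) \<subseteq> M n"
begin

lemma pow_additive: "additive_frag (Sd n ^^ m)"
  using Sd[of n] by (induction m) (simp_all add: additive_frag_def)

lemma pow_S: "supp c \<subseteq> S n \<Longrightarrow> supp ((Sd n ^^ m) c) \<subseteq> S n"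
  by (induction m) (simp_all add: Sd_S)

lemma pow_M: "supp c \<subseteq> M n \<Longrightarrow> supp ((Sd n ^^ m) c) \<subseteq> M n"
  by (induction m) (simp_all add: Sd_M)

text \<open>Each further subdivision adds a degenerate defect of its own and subdivides the previous
  defect, which stays degenerate.\<close>

lemma b_pow:
  assumes c: "supp c \<subseteq> S (Suc n)"
  shows "supp (b n ((Sd (Suc n) ^^ m) c) - (Sd n ^^ m) (b n c)) \<subseteq> Z n"
proof (induction m)
  case (Suc m)
  let ?e = "(Sd (Suc n) ^^ m) c"
  have "b n (Sd (Suc n) ?e) - Sd n ((Sd n ^^ m) (b n c)) =
      (b n (Sd (Suc n) ?e) - Sd n (b n ?e)) + Sd n (b n ?e - (Sd n ^^ m) (b n c))"
    by (simp add: additive_frag_diff[OF Sd])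
  then have "supp (b n (Sd (Suc n) ?e) - Sd n ((Sd n ^^ m) (b n c))) \<subseteq> Z n"
    using keys_add_subset[OF b_Sd[OF pow_S[OF c, of m]] Sd_Z[OF Suc]] by (simp only:)
  then show ?case by simp
qed simp

text \<open>The sum T + T Sd + ... + T Sd^(m-1), the usual homotopy from the identity to the
  \<open>m\<close>-th power of the subdivision.\<close>

definition partial_htpy :: "nat \<Rightarrow> nat \<Rightarrow> ('s \<Rightarrow>\<^sub>0 int) \<Rightarrow> ('s \<Rightarrow>\<^sub>0 int)" where
  "partial_htpy n m c = (\<Sum>i<m. T n ((Sd n ^^ i) c))"

lemma partial_htpy_additive: "additive_frag (partial_htpy n m)"
  by (simp add: additive_frag_def partial_htpy_def additive_frag_diff[OF T] additive_frag_diff[OF pow_additive] sum_subtractf)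

lemma partial_htpy_Suc: "partial_htpy n (Suc m) c = partial_htpy n m c + T n ((Sd n ^^ m) c)"
  by (simp add: partial_htpy_def)

lemma partial_htpy_S: "supp c \<subseteq> S n \<Longrightarrow> supp (partial_htpy n m c) \<subseteq> S (Suc n)"
  unfolding partial_htpy_def by (intro keys_sum_subset T_S pow_S)

lemma partial_htpy_htpy0:
  assumes c: "supp c \<subseteq> S 0"
  shows "supp (c - (Sd 0 ^^ m) c - b 0 (partial_htpy 0 m c)) \<subseteq> Z 0"
proof (induction m)
  case 0
  then show ?case by (simp add: partial_htpy_def additive_frag_0[OF b])
next
  case (Suc m)
  let ?e = "(Sd 0 ^^ m) c"
  have "c - Sd 0 ?e - b 0 (partial_htpy 0 m c + T 0 ?e) = (c - ?e - b 0 (partial_htpy 0 m c)) + (?e - Sd 0 ?e - b 0 (T 0 ?e))"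
    by (simp add: additive_frag_add[OF b])
  then show ?case
    using keys_add_subset[OF Suc htpy0[OF pow_S[OF c, of m]]] by (simp only: partial_htpy_Suc funpow.simps comp_apply)
qed

text \<open>A telescoping sum: the step from \<open>m\<close> to \<open>Suc m\<close> adds the
  identity for \<open>T\<close> at the subdivided chain. Interchanging boundary and subdivision
  inside \<open>T\<close> costs a further degenerate term.\<close>

lemma partial_htpy_htpy:
  assumes c: "supp c \<subseteq> S (Suc n)"
  shows "supp (c - (Sd (Suc n) ^^ m) c - (b (Suc n) (partial_htpy (Suc n) m c) + partial_htpy n m (b n c))) \<subseteq> Z (Suc n)"
proof (induction m)
  case 0
  then show ?case by (simp add: partial_htpy_def additive_frag_0[OF b])
next
  case (Suc m)
  let ?e = "(Sd (Suc n) ^^ m) c"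
  have "c - Sd (Suc n) ?e - (b (Suc n) (partial_htpy (Suc n) m c + T (Suc n) ?e) + (partial_htpy n m (b n c) + T n ((Sd n ^^ m) (b n c))))
    = (c - ?e - (b (Suc n) (partial_htpy (Suc n) m c) + partial_htpy n m (b n c)))
      + ((?e - Sd (Suc n) ?e - (b (Suc n) (T (Suc n) ?e) + T n (b n ?e)))
      + T n (b n ?e - (Sd n ^^ m) (b n c)))"
    by (simp add: additive_frag_add[OF b] additive_frag_diff[OF T])
  then show ?case
    using keys_add_subset[OF Suc keys_add_subset[OF htpy[OF pow_S[OF c, of m]] T_Z[OF b_pow[OF c, of m]]]]
    by (simp only: partial_htpy_Suc funpow.simps comp_apply)
qed

abbreviation "dp \<equiv> depth M b Sd"

lemma dp_M: "x \<in> M n \<Longrightarrow> dp n x = 0"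
  by (cases n) auto

text \<open>The depth is at least the least sufficient number of subdivisions, and smallness
  persists under further subdivision.\<close>

lemma dp_small:
  assumes x: "x \<in> S n" and m: "dp n x \<le> m"
  shows "supp ((Sd n ^^ m) (frag_of x)) \<subseteq> M n"
proof (cases "x \<in> M n")
  case True
  then show ?thesis by (intro pow_M) simp
next
  case False
  let ?l = "LEAST m. supp ((Sd n ^^ m) (frag_of x)) \<subseteq> M n"
  have "?l \<le> dp n x"
  proof (cases n)
    case (Suc k)
    then show ?thesis using False by (simp add: Max_ge)
  qed (use False in simp)
  then have "(Sd n ^^ m) (frag_of x) = (Sd n ^^ (m - ?l)) ((Sd n ^^ ?l) (frag_of x))"
    using m funpow_add[of "m - ?l" ?l "Sd n"] by simp
  moreover have "supp ((Sd n ^^ ?l) (frag_of x)) \<subseteq> M n"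
    using small[OF x] by (rule LeastI_ex)
  then have "supp ((Sd n ^^ (m - ?l)) ((Sd n ^^ ?l) (frag_of x))) \<subseteq> M n"
    by (rule pow_M)
  ultimately show ?thesis by simp
qed

lemma dp_face:
  assumes "x \<notin> M (Suc n)" "y \<in> supp (b n (frag_of x))"
  shows "dp n y \<le> dp (Suc n) x"
  using assms by (simp add: Max_ge)

declare depth.simps [simp del]

text \<open>A homotopy whose number of summands depends on the generator. It is empty on small
  generators, which is what makes the resulting map a retraction.\<close>

definition contraction :: "nat \<Rightarrow> ('s \<Rightarrow>\<^sub>0 int) \<Rightarrow> ('s \<Rightarrow>\<^sub>0 int)" where
  "contraction n = frag_extend (\<lambda>x. partial_htpy n (dp n x) (frag_of x))"

lemma contraction_additive: "additive_frag (contraction n)"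
  by (simp add: contraction_def)

lemma contraction_S: "supp c \<subseteq> S n \<Longrightarrow> supp (contraction n c) \<subseteq> S (Suc n)"
  unfolding contraction_def by (rule keys_frag_extend_subset) (simp_all add: partial_htpy_S)

lemma contraction_M: "supp c \<subseteq> M n \<Longrightarrow> contraction n c = 0"
  unfolding contraction_def by (rule frag_extend_eq_0) (auto simp: dp_M partial_htpy_def)

text \<open>A face \<open>y\<close> of \<open>x\<close> is subdivided \<open>dp n y\<close> times by
  \<open>contraction\<close> but \<open>dp (Suc n) x\<close> times by the partial homotopy. The
  surplus summands apply \<open>T\<close> to iterates that are already small.\<close>

lemma partial_htpy_D:
  assumes x: "x \<in> S (Suc n)" "x \<notin> M (Suc n)"
  shows "supp (partial_htpy n (dp (Suc n) x) (b n (frag_of x)) - contraction n (b n (frag_of x))) \<subseteq> M (Suc n)"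
proof (rule additive_frag_keysI[where f = "\<lambda>c. partial_htpy n (dp (Suc n) x) c - contraction n c"])
  show "additive_frag (\<lambda>c. partial_htpy n (dp (Suc n) x) c - contraction n c)"
    by (simp add: additive_frag_def additive_frag_diff[OF partial_htpy_additive] additive_frag_diff[OF contraction_additive])
  show "supp (b n (frag_of x)) \<subseteq> supp (b n (frag_of x))" ..
  fix y assume y: "y \<in> supp (b n (frag_of x))"
  have yS: "y \<in> S n" using b_S[of "frag_of x" n] x y by auto
  have le: "dp n y \<le> dp (Suc n) x" using dp_face x y by blast
  have "{..<dp (Suc n) x} = {..<dp n y} \<union> {dp n y..<dp (Suc n) x}" using le by auto
  then have "partial_htpy n (dp (Suc n) x) (frag_of y) = partial_htpy n (dp n y) (frag_of y) + (\<Sum>i\<in>{dp n y..<dp (Suc n) x}. T n ((Sd n ^^ i) (frag_of y)))"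
    unfolding partial_htpy_def by (simp add: sum.union_disjoint ivl_disj_int_one(2))
  then have eq: "partial_htpy n (dp (Suc n) x) (frag_of y) - contraction n (frag_of y) = (\<Sum>i\<in>{dp n y..<dp (Suc n) x}. T n ((Sd n ^^ i) (frag_of y)))"
    by (simp add: contraction_def)
  show "supp (partial_htpy n (dp (Suc n) x) (frag_of y) - contraction n (frag_of y)) \<subseteq> M (Suc n)"
    unfolding eq by (intro keys_sum_subset T_M dp_small[OF yS]) simp
qed

lemma retraction:
  assumes "supp c \<subseteq> S n"
  shows "supp (c - (b n (contraction n c) + (case n of 0 \<Rightarrow> 0 | Suc m \<Rightarrow> contraction m (b m c)))) \<subseteq> M n"
  using _ _ assms
proof (rule additive_frag_keysI)
  show "additive_frag (\<lambda>c. c - (b n (contraction n c) + (case n of 0 \<Rightarrow> 0 | Suc m \<Rightarrow> contraction m (b m c))))"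
    by (cases n) (simp_all add: additive_frag_def additive_frag_diff[OF b] additive_frag_diff[OF contraction_additive])
  fix x assume x: "x \<in> S n"
  show "supp (frag_of x - (b n (contraction n (frag_of x)) + (case n of 0 \<Rightarrow> 0 | Suc m \<Rightarrow> contraction m (b m (frag_of x))))) \<subseteq> M n"
  proof (cases "x \<in> M n")
    case True
    then have "supp (frag_of x) \<subseteq> M n" by simp
    then show ?thesis
      using contraction_M[of "frag_of x" n] b_M[of "frag_of x"]
      by (cases n) (simp_all add: additive_frag_0[OF b] contraction_M)
  next
    case False
    let ?m = "dp n x"
    have xS: "supp (frag_of x) \<subseteq> S n" using x by simp
    have contraction: "contraction n (frag_of x) = partial_htpy n ?m (frag_of x)" by (simp add: contraction_def)
    have sm: "supp ((Sd n ^^ ?m) (frag_of x)) \<subseteq> M n" using dp_small[OF x] by simp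
    show ?thesis
    proof (cases n)
      case 0
      have "supp (frag_of x - (Sd 0 ^^ ?m) (frag_of x) - b 0 (partial_htpy 0 ?m (frag_of x))) \<subseteq> M 0"
        using partial_htpy_htpy0[of "frag_of x" ?m] xS ZM[of 0] 0 by auto
      then have "supp ((frag_of x - (Sd 0 ^^ ?m) (frag_of x) - b 0 (partial_htpy 0 ?m (frag_of x))) + (Sd 0 ^^ ?m) (frag_of x)) \<subseteq> M 0"
        using sm unfolding 0 by (rule keys_add_subset)
      moreover have "(frag_of x - (Sd 0 ^^ ?m) (frag_of x) - b 0 (partial_htpy 0 ?m (frag_of x))) + (Sd 0 ^^ ?m) (frag_of x)
          = frag_of x - b 0 (partial_htpy 0 ?m (frag_of x))" by simp
      ultimately show ?thesis using contraction 0 by simp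
    next
      case (Suc k)
      \<comment> \<open>\<open>?r\<close> is the degenerate defect of the homotopy with a fixed
        number of steps, \<open>?u\<close> the surplus on the faces. Adding the subdivided generator
        back leaves precisely the value of the retraction, so all three summands being small is
        enough.\<close>
      let ?r = "frag_of x - (Sd (Suc k) ^^ ?m) (frag_of x) - (b (Suc k) (partial_htpy (Suc k) ?m (frag_of x)) + partial_htpy k ?m (b k (frag_of x)))"
      let ?u = "partial_htpy k ?m (b k (frag_of x)) - contraction k (b k (frag_of x))"
      have "supp ?r \<subseteq> M n"
        using partial_htpy_htpy[of "frag_of x" k ?m] xS ZM[of n] unfolding Suc by blast
      moreover have "supp ?u \<subseteq> M n" using partial_htpy_D[of x k] x False unfolding Suc by simp
      ultimately have "supp ((?r + ?u) + (Sd (Suc k) ^^ ?m) (frag_of x)) \<subseteq> M n"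
        using sm unfolding Suc by (intro keys_add_subset)
      moreover have "(?r + ?u) + (Sd (Suc k) ^^ ?m) (frag_of x) =
          frag_of x - (b (Suc k) (partial_htpy (Suc k) ?m (frag_of x)) + contraction k (b k (frag_of x)))" by simp
      ultimately show ?thesis using contraction Suc by (simp add: diff_diff_eq)
    qed
  qed
qed

end

section \<open>Singular theories\<close>

text \<open>The common form of \<open>simplices\<close> and \<open>cubes\<close>, which differ only
  in the family of models \<open>\<Delta>\<close>.\<close>

definition gens :: "(nat \<Rightarrow> (nat \<Rightarrow> real) cspace) \<Rightarrow> nat \<Rightarrow> 'a cspace \<Rightarrow> ((nat \<Rightarrow> real) \<Rightarrow> 'a) set" where
  "gens \<Delta> n X = {\<sigma> \<in> extensional (points (\<Delta> n)). ccont (\<Delta> n) X \<sigma>}"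

definition push ::
    "(nat \<Rightarrow> (nat \<Rightarrow> real) cspace) \<Rightarrow> ('a \<Rightarrow> 'b) \<Rightarrow> nat \<Rightarrow>
     (((nat \<Rightarrow> real) \<Rightarrow> 'a) \<Rightarrow>\<^sub>0 int) \<Rightarrow> (((nat \<Rightarrow> real) \<Rightarrow> 'b) \<Rightarrow>\<^sub>0 int)" where
  "push \<Delta> f n = frag_extend (\<lambda>\<sigma>. frag_of (restrict (f \<circ> \<sigma>) (points (\<Delta> n))))"

lemma push_additive: "additive_frag (push \<Delta> f n)"
  by (simp add: push_def)

lemma gens_subspace:
  assumes "closure_space (\<Delta> n)" "A \<subseteq> points X"
  shows "gens \<Delta> n (subspace_of X A) = {\<sigma> \<in> gens \<Delta> n X. \<sigma> ` points (\<Delta> n) \<subseteq> A}"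
  using ccont_subspace_iff[OF assms] by (auto simp: gens_def)

lemma gens_push:
  assumes "closure_space (\<Delta> n)" "ccont X Y f" "\<sigma> \<in> gens \<Delta> n X"
  shows "restrict (f \<circ> \<sigma>) (points (\<Delta> n)) \<in> gens \<Delta> n Y"
proof -
  have "ccont (\<Delta> n) Y (f \<circ> \<sigma>)"
    using assms(2,3) by (intro ccont_compose[of "\<Delta> n" X]) (simp_all add: gens_def)
  then have "ccont (\<Delta> n) Y (restrict (f \<circ> \<sigma>) (points (\<Delta> n)))"
    by (rule ccont_cong[OF assms(1)]) simp
  then show ?thesis by (simp add: gens_def)
qed

lemma push_gens:
  assumes "closure_space (\<Delta> n)" "ccont X Y f" "supp c \<subseteq> gens \<Delta> n X"
  shows "supp (push \<Delta> f n c) \<subseteq> gens \<Delta> n Y"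
  unfolding push_def by (rule keys_frag_extend_subset[OF _ assms(3)]) (use gens_push[where \<Delta> = \<Delta> and n = n, OF assms(1,2)] in auto)

lemma push_cong:
  assumes "supp c \<subseteq> gens \<Delta> n X" "\<And>x. x \<in> points X \<Longrightarrow> f x = g x"
  shows "push \<Delta> f n c = push \<Delta> g n c"
  unfolding push_def
proof (rule frag_extend_eq)
  fix \<sigma> assume "\<sigma> \<in> supp c"
  then have \<sigma>: "ccont (\<Delta> n) X \<sigma>" using assms(1) by (auto simp: gens_def)
  then have "restrict (f \<circ> \<sigma>) (points (\<Delta> n)) = restrict (g \<circ> \<sigma>) (points (\<Delta> n))"
    using assms(2)[OF ccont_funcset[OF \<sigma>]] by (intro restrict_ext) simp
  then show "frag_of (restrict (f \<circ> \<sigma>) (points (\<Delta> n))) = frag_of (restrict (g \<circ> \<sigma>) (points (\<Delta> n)))"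
    by simp
qed

lemma push_id:
  assumes "supp c \<subseteq> gens \<Delta> n X"
  shows "push \<Delta> id n c = c"
proof -
  have "push \<Delta> id n c = frag_extend frag_of c"
    unfolding push_def by (rule frag_extend_eq) (use assms in \<open>auto simp: gens_def extensional_restrict\<close>)
  then show ?thesis by (simp flip: frag_expansion)
qed

lemma push_comp: "push \<Delta> (g \<circ> f) n c = push \<Delta> g n (push \<Delta> f n c)"
proof -
  have "restrict (g \<circ> restrict (f \<circ> \<sigma>) P) P = restrict (g \<circ> f \<circ> \<sigma>) P" for P :: "(nat \<Rightarrow> real) set" and \<sigma>
    by (auto simp: restrict_def)
  then show ?thesis
    unfolding push_def
    using frag_extend_compose[of "\<lambda>\<sigma>. frag_of (restrict (g \<circ> \<sigma>) (points (\<Delta> n)))" "\<lambda>\<sigma>. restrict (f \<circ> \<sigma>) (points (\<Delta> n))" c]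
    by (simp add: comp_def)
qed

lemma cohomology_map_cong:
  fixes F F' :: "nat \<Rightarrow> 'b \<Rightarrow> 'd" and G :: "'g monoid"
  assumes "\<And>c. c \<in> carrier (grp K n) \<Longrightarrow> F n c = F' n c"
  shows "cohomology_map G K F n = cohomology_map G K F' n"
proof -
  have "cochain_map K F n = (cochain_map K F' n :: ('d \<Rightarrow> 'g) \<Rightarrow> _)"
    using assms by (auto simp: cochain_map_def fun_eq_iff)
  then show ?thesis by (simp add: cohomology_map_eq)
qed

text \<open>The set \<open>dg n\<close> does not depend on the space and may contain discontinuous
  maps, hence the intersections with \<open>gens\<close>. It is empty for simplices.
  \<open>Q\<close> is the composite of all quotient maps from free chains to relative
  chains.\<close>

locale singular_objects = coefficients G for G :: "'g monoid" +
  fixes \<Delta> :: "nat \<Rightarrow> (nat \<Rightarrow> real) cspace" and dg :: "nat \<Rightarrow> ((nat \<Rightarrow> real) \<Rightarrow> 'a) set"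
    and b :: "nat \<Rightarrow> (((nat \<Rightarrow> real) \<Rightarrow> 'a) \<Rightarrow>\<^sub>0 int) \<Rightarrow> (((nat \<Rightarrow> real) \<Rightarrow> 'a) \<Rightarrow>\<^sub>0 int)"
    and Rel :: "'a cspace \<Rightarrow> 'a set \<Rightarrow> 'c ccomplex"
    and Q :: "'a cspace \<Rightarrow> 'a set \<Rightarrow> nat \<Rightarrow> (((nat \<Rightarrow> real) \<Rightarrow> 'a) \<Rightarrow>\<^sub>0 int) \<Rightarrow> 'c"
  assumes \<Delta>: "closure_space (\<Delta> n)" and \<Delta>_nonempty: "points (\<Delta> n) \<noteq> {}"
    and present: "closure_pair X A \<Longrightarrow> presentation (\<lambda>n. gens \<Delta> n X)
      (\<lambda>n. gens \<Delta> n (subspace_of X A) \<union> (gens \<Delta> n X \<inter> dg n)) b (Rel X A) (Q X A)"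
begin

abbreviation "null X A n \<equiv> gens \<Delta> n (subspace_of X A) \<union> (gens \<Delta> n X \<inter> dg n)"

lemma dual: "closure_pair X A \<Longrightarrow> presentation_dual (\<lambda>n. gens \<Delta> n X) (null X A) b (Rel X A) (Q X A) G"
  using present coefficients_axioms by (simp add: presentation_dual_def)

text \<open>A nonempty model has no map to the empty space. Relative to the empty set, therefore,
  only degenerate generators are null.\<close>

lemma gens_empty [simp]: "gens \<Delta> n (subspace_of X {}) = {}"
  using gens_subspace[where A = "{}" and X = X and n = n, OF \<Delta>] \<Delta>_nonempty by auto

lemma gens_mono: "A \<subseteq> points X \<Longrightarrow> gens \<Delta> n (subspace_of X A) \<subseteq> gens \<Delta> n X"
  using gens_subspace[where A = A and X = X and n = n, OF \<Delta>] by simp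

end

text \<open>Source and target have their own point types, so that the laws across universes come out
  of the same locale; only the models are shared. \<open>RM_Q\<close> says that the induced map of
  the nested quotients is computed by composition with \<open>f\<close> on representatives.\<close>

locale singular_maps = D: singular_objects G \<Delta> dg b Rel Q + C: singular_objects G \<Delta> dg' b' Rel' Q'
  for G :: "'g monoid" and \<Delta> and dg :: "nat \<Rightarrow> ((nat \<Rightarrow> real) \<Rightarrow> 'a) set" and b
    and Rel :: "'a cspace \<Rightarrow> 'a set \<Rightarrow> 'c ccomplex" and Q
    and dg' :: "nat \<Rightarrow> ((nat \<Rightarrow> real) \<Rightarrow> 'b) set" and b'
    and Rel' :: "'b cspace \<Rightarrow> 'b set \<Rightarrow> 'd ccomplex" and Q' +
  fixes RM :: "'b cspace \<Rightarrow> 'b set \<Rightarrow> ('a \<Rightarrow> 'b) \<Rightarrow> nat \<Rightarrow> 'c \<Rightarrow> 'd"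
  assumes RM_Q: "pair_map X A Y B f \<Longrightarrow> supp c \<subseteq> gens \<Delta> n X \<Longrightarrow>
      RM Y B f n (Q X A n c) = Q' Y B n (push \<Delta> f n c)"
    and push_b: "closure_space X \<Longrightarrow> closure_space Y \<Longrightarrow> ccont X Y f \<Longrightarrow> supp c \<subseteq> gens \<Delta> (Suc n) X \<Longrightarrow>
      b' n (push \<Delta> f (Suc n) c) = push \<Delta> f n (b n c)"
begin

abbreviation "H n X A \<equiv> cohomology_group G (Rel X A) n"
abbreviation "H' n X A \<equiv> cohomology_group G (Rel' X A) n"
abbreviation "ind n X A Y B f \<equiv> cohomology_map G (Rel X A) (RM Y B f) n"

lemma chain_map:
  assumes f: "pair_map X A Y B f"
  shows "is_chain_map (Rel X A) (Rel' Y B) (RM Y B f)"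
proof -
  have X: "closure_pair X A" "closure_space X" and Y: "closure_pair Y B" "closure_space Y" and c: "ccont X Y f"
    using f by (simp_all add: pair_map_def closure_pair_def)
  interpret PX: presentation_dual "\<lambda>n. gens \<Delta> n X" "D.null X A" b "Rel X A" "Q X A" G using X(1) by (rule D.dual)
  interpret PY: presentation_dual "\<lambda>n. gens \<Delta> n Y" "C.null Y B" b' "Rel' Y B" "Q' Y B" G using Y(1) by (rule C.dual)
  show ?thesis
  proof (rule PX.chain_map_from_frags[OF PY.presentation_axioms, where f = "push \<Delta> f"])
    fix n and c :: "((nat \<Rightarrow> real) \<Rightarrow> 'a) \<Rightarrow>\<^sub>0 int"
    show "additive_frag (push \<Delta> f n)" by (rule push_additive)
    show "supp (b' n (push \<Delta> f (Suc n) c) - push \<Delta> f n (b n c)) \<subseteq> C.null Y B n"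
      if "supp c \<subseteq> gens \<Delta> (Suc n) X"
      using push_b[OF X(2) Y(2) \<open>ccont X Y f\<close> that] by simp
    assume c: "supp c \<subseteq> gens \<Delta> n X"
    show "supp (push \<Delta> f n c) \<subseteq> gens \<Delta> n Y" using push_gens[OF D.\<Delta> \<open>ccont X Y f\<close> c] .
    show "RM Y B f n (Q X A n c) = Q' Y B n (push \<Delta> f n c)" using RM_Q[OF f c] .
  qed
qed

lemma morphism:
  assumes "pair_map X A Y B f"
  shows "cochain_morphism (cochains G (Rel' Y B)) (cobdry (Rel' Y B)) (cochains G (Rel X A)) (cobdry (Rel X A))
    (cochain_map (Rel X A) (RM Y B f))"
proof -
  have X: "closure_pair X A" and Y: "closure_pair Y B" using assms by (simp_all add: pair_map_def)
  show ?thesis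
    using presentation.dual_morphism[OF D.present[OF X] D.coefficients_axioms C.present[OF Y] chain_map[OF assms]] .
qed

lemma ind_hom:
  assumes "pair_map X A Y B f"
  shows "ind n X A Y B f \<in> hom (H' n Y B) (H n X A)"
proof -
  interpret cochain_morphism "cochains G (Rel' Y B)" "cobdry (Rel' Y B)" "cochains G (Rel X A)" "cobdry (Rel X A)"
    "cochain_map (Rel X A) (RM Y B f)" using assms by (rule morphism)
  show ?thesis using induced_hom[of n] by (simp add: induced_def cohomology_map_eq cohomology_group_eq)
qed

lemma ind_cong:
  assumes f: "pair_map X A Y B f" and eq: "\<And>x. x \<in> points X \<Longrightarrow> f x = g x"
  shows "ind n X A Y B f = ind n X A Y B g"
proof -
  have X: "closure_pair X A" using f by (simp add: pair_map_def)
  interpret PX: presentation_dual "\<lambda>n. gens \<Delta> n X" "D.null X A" b "Rel X A" "Q X A" G using X by (rule D.dual)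
  have g: "pair_map X A Y B g"
  proof -
    have X': "closure_space X" "ccont X Y f" "A \<subseteq> points X" using f by (simp_all add: pair_map_def closure_pair_def)
    then have "ccont X Y g" using ccont_cong[OF X'(1,2) eq] by simp
    moreover have "g ` A = f ` A" using eq X'(3) by (intro image_cong) (simp_all add: subset_iff)
    ultimately show ?thesis using f by (simp add: pair_map_def)
  qed
  show ?thesis
  proof (rule cohomology_map_cong)
    fix k assume "k \<in> carrier (grp (Rel X A) n)"
    then obtain c where c: "supp c \<subseteq> gens \<Delta> n X" and k: "k = Q X A n c" by (rule PX.carrierE)
    show "RM Y B f n k = RM Y B g n k"
      unfolding k RM_Q[OF f c] RM_Q[OF g c] using push_cong[OF c eq] by simp
  qed
qed

lemma induces_homs: "induces_homs H H' ind"
  unfolding induces_homs_def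
proof (intro allI impI conjI ballI)
  fix n and X :: "'a cspace" and A and Y :: "'b cspace" and B f
  assume f: "pair_map X A Y B f"
  show "ind n X A Y B f \<in> hom (H' n Y B) (H n X A)" using f by (rule ind_hom)
  fix g a assume "\<forall>x\<in>points X. f x = g x"
  then show "ind n X A Y B f a = ind n X A Y B g a" using ind_cong[OF f, of g n] by simp
qed

text \<open>The homotopy identities are exact here, since a prism needs no correction by degenerate
  generators. Preservation of degenerate generators lets the operator pass to the quotient.\<close>

definition homotopy_operator where
  "homotopy_operator X Y f g P \<longleftrightarrow> (\<forall>n. additive_frag (P n)) \<and>
    (\<forall>n c. supp c \<subseteq> gens \<Delta> n X \<longrightarrow> supp (P n c) \<subseteq> gens \<Delta> (Suc n) Y) \<and>
    (\<forall>n c. supp c \<subseteq> gens \<Delta> n X \<inter> dg n \<longrightarrow> supp (P n c) \<subseteq> dg' (Suc n)) \<and>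
    (\<forall>c. supp c \<subseteq> gens \<Delta> 0 X \<longrightarrow> push \<Delta> f 0 c - push \<Delta> g 0 c = b' 0 (P 0 c)) \<and>
    (\<forall>n c. supp c \<subseteq> gens \<Delta> (Suc n) X \<longrightarrow>
      push \<Delta> f (Suc n) c - push \<Delta> g (Suc n) c = b' (Suc n) (P (Suc n) c) + P n (b n c))"

definition homotopy_operators :: "interval_kind \<Rightarrow> bool" where
  "homotopy_operators J \<longleftrightarrow>
    (\<forall>X Y f g h. closure_space X \<longrightarrow> closure_space Y \<longrightarrow> ccont X Y f \<longrightarrow> ccont X Y g \<longrightarrow>
      ccont (cprod X (interval_space J)) Y h \<longrightarrow> (\<forall>x\<in>points X. h (x, 0) = f x \<and> h (x, 1) = g x) \<longrightarrow>
      (\<exists>P. homotopy_operator X Y f g P))"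

lemma one_step_homotopy:
  assumes J: "homotopy_operators J" and X: "closure_space X" and Y: "closure_space Y"
    and fg: "one_step_homotopic J X Y f g" and a: "a \<in> carrier (H' n Y {})"
  shows "ind n X {} Y {} f a = ind n X {} Y {} g a"
proof -
  have f: "pair_map X {} Y {} f" and g: "pair_map X {} Y {} g" and fg': "ccont X Y f" "ccont X Y g"
    using fg X Y unfolding one_step_homotopic_def pair_map_def closure_pair_def by blast+
  obtain h where h: "ccont (cprod X (interval_space J)) Y h" "\<forall>x\<in>points X. h (x, 0) = f x \<and> h (x, 1) = g x"
    using fg unfolding one_step_homotopic_def by blast
  obtain P where "homotopy_operator X Y f g P"
    using J[unfolded homotopy_operators_def, THEN spec, THEN spec, THEN spec, THEN spec, THEN spec,
        THEN mp, OF X, THEN mp, OF Y, THEN mp, OF fg'(1), THEN mp, OF fg'(2), THEN mp, OF h(1), THEN mp, OF h(2)] ..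
  note op = this[unfolded homotopy_operator_def]
  have P: "\<And>n. additive_frag (P n)"
    by (rule op[THEN conjunct1, rule_format])
  have PS: "\<And>n c. supp c \<subseteq> gens \<Delta> n X \<Longrightarrow> supp (P n c) \<subseteq> gens \<Delta> (Suc n) Y"
    by (rule op[THEN conjunct2, THEN conjunct1, rule_format])
  have PN: "\<And>n c. supp c \<subseteq> gens \<Delta> n X \<inter> dg n \<Longrightarrow> supp (P n c) \<subseteq> dg' (Suc n)"
    by (rule op[THEN conjunct2, THEN conjunct2, THEN conjunct1, rule_format])
  have P0: "\<And>c. supp c \<subseteq> gens \<Delta> 0 X \<Longrightarrow> push \<Delta> f 0 c - push \<Delta> g 0 c = b' 0 (P 0 c)"
    by (rule op[THEN conjunct2, THEN conjunct2, THEN conjunct2, THEN conjunct1, rule_format])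
  have Pn: "\<And>n c. supp c \<subseteq> gens \<Delta> (Suc n) X \<Longrightarrow>
      push \<Delta> f (Suc n) c - push \<Delta> g (Suc n) c = b' (Suc n) (P (Suc n) c) + P n (b n c)"
    by (rule op[THEN conjunct2, THEN conjunct2, THEN conjunct2, THEN conjunct2, rule_format])
  have pX: "closure_pair X {}" and pY: "closure_pair Y {}" using X Y by (simp_all add: closure_pair_def)
  interpret PX: presentation_dual "\<lambda>n. gens \<Delta> n X" "D.null X {}" b "Rel X {}" "Q X {}" G using pX by (rule D.dual)
  have fS: "supp (push \<Delta> f n c) \<subseteq> gens \<Delta> n Y" and gS: "supp (push \<Delta> g n c) \<subseteq> gens \<Delta> n Y"
    if "supp c \<subseteq> gens \<Delta> n X" for n and c :: "((nat \<Rightarrow> real) \<Rightarrow> 'a) \<Rightarrow>\<^sub>0 int"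
    using push_gens[where \<Delta> = \<Delta> and n = n, OF D.\<Delta> fg'(1) that] push_gens[where \<Delta> = \<Delta> and n = n, OF D.\<Delta> fg'(2) that] .
  show ?thesis
  proof (rule PX.homotopic_maps[where f = "push \<Delta> f" and f' = "push \<Delta> g" and P = P, OF C.present[OF pY]
        chain_map[OF f] chain_map[OF g] fS gS RM_Q[OF f] RM_Q[OF g] P PS _ _ _ a])
    fix n and c :: "((nat \<Rightarrow> real) \<Rightarrow> 'a) \<Rightarrow>\<^sub>0 int"
    assume c: "supp c \<subseteq> D.null X {} n"
    then have c': "supp c \<subseteq> gens \<Delta> n X" by simp
    show "supp (P n c) \<subseteq> C.null Y {} (Suc n)" using PN[of c n] PS[OF c'] c by simp
  next
    fix c :: "((nat \<Rightarrow> real) \<Rightarrow> 'a) \<Rightarrow>\<^sub>0 int"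
    assume c: "supp c \<subseteq> gens \<Delta> 0 X"
    show "supp (push \<Delta> f 0 c - push \<Delta> g 0 c - b' 0 (P 0 c)) \<subseteq> C.null Y {} 0" by (simp add: P0[OF c])
  next
    fix n and c :: "((nat \<Rightarrow> real) \<Rightarrow> 'a) \<Rightarrow>\<^sub>0 int"
    assume c: "supp c \<subseteq> gens \<Delta> (Suc n) X"
    show "supp (push \<Delta> f (Suc n) c - push \<Delta> g (Suc n) c - (b' (Suc n) (P (Suc n) c) + P n (b n c)))
      \<subseteq> C.null Y {} (Suc n)" by (simp add: Pn[OF c])
  qed
qed

text \<open>Inducing the same map is itself an equivalence relation, so a single homotopy step
  settles the generated relation.\<close>

lemma homotopy:
  assumes J: "homotopy_operators J"
  shows "homotopy_axiom J H' ind"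
  unfolding homotopy_axiom_def
proof (intro allI impI ballI)
  fix n and X :: "'a cspace" and Y :: "'b cspace" and f g a
  assume X: "closure_space X" and Y: "closure_space Y" and fg: "J_homotopic J X Y f g" and a: "a \<in> carrier (H' n Y {})"
  have "equivclp (one_step_homotopic J X Y) f g" using fg by (simp add: J_homotopic_def)
  then show "ind n X {} Y {} f a = ind n X {} Y {} g a"
  proof (induction rule: equivclp_induct)
    case (step y z)
    have "ind n X {} Y {} y a = ind n X {} Y {} z a"
      using step.hyps(2)
    proof
      assume "one_step_homotopic J X Y y z"
      then show ?thesis using one_step_homotopy[OF J X Y _ a] by blast
    next
      assume "one_step_homotopic J X Y z y"
      then show ?thesis using one_step_homotopy[OF J X Y _ a, of z y] by simp
    qed
    then show ?case using step.IH by simp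
  qed simp
qed

end


section \<open>Maps of pairs, and the theory within one universe\<close>

lemma pair_map_comp: "pair_map X A Y B f \<Longrightarrow> pair_map Y B Z C g \<Longrightarrow> pair_map X A Z C (g \<circ> f)"
  using ccont_compose[of X Y f Z g] by (auto simp: pair_map_def)

lemma pair_map_absolute: "pair_map X A Y B f \<Longrightarrow> pair_map X {} Y {} f"
  by (simp add: pair_map_def closure_pair_def)

lemma pair_map_restrict:
  assumes "pair_map X A Y B f"
  shows "pair_map (subspace_of X A) {} (subspace_of Y B) {} f"
proof -
  have X: "closure_space X" "A \<subseteq> points X" and Y: "closure_space Y" "B \<subseteq> points Y" and f: "ccont X Y f" "f ` A \<subseteq> B"
    using assms by (simp_all add: pair_map_def closure_pair_def)
  note XA = closure_space_subspace[OF X] and YB = closure_space_subspace[OF Y]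
  have "ccont (subspace_of X A) Y (f \<circ> id)"
    using ccont_subspace_id[OF X(2)] f(1) by (rule ccont_compose)
  then have "ccont (subspace_of X A) (subspace_of Y B) f"
    using ccont_subspace_iff[OF XA Y(2)] f(2) by simp
  then show ?thesis using XA YB by (simp add: pair_map_def closure_pair_def)
qed

text \<open>Pulled back cochains are restricted to carriers, so commutativity of the chain level
  square has to be accompanied by the membership of the intermediate values.\<close>

lemma cochain_map_square:
  assumes "\<And>k. k \<in> carrier (grp K n) \<Longrightarrow> F n k \<in> carrier (grp L n)"
    and "\<And>k. k \<in> carrier (grp K n) \<Longrightarrow> F' n k \<in> carrier (grp L' n)"
    and "\<And>k. k \<in> carrier (grp K n) \<Longrightarrow> E n (F n k) = E' n (F' n k)"
  shows "cochain_map K F n (cochain_map L E n x) = cochain_map K F' n (cochain_map L' E' n x)"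
  unfolding cochain_map_def
proof (rule restrict_ext)
  fix k assume k: "k \<in> carrier (grp K n)"
  show "(\<lambda>c\<in>carrier (grp L n). x (E n c)) (F n k) = (\<lambda>c\<in>carrier (grp L' n). x (E' n c)) (F' n k)"
    using assms(1)[OF k] assms(2)[OF k] assms(3)[OF k] by simp
qed

lemma is_chain_map_carrier: "is_chain_map K L F \<Longrightarrow> k \<in> carrier (grp K n) \<Longrightarrow> F n k \<in> carrier (grp L n)"
  unfolding is_chain_map_def using hom_in_carrier[of "F n" "grp K n" "grp L n" k] by blast

locale singular_theory = singular_maps G \<Delta> dg b Rel Q dg b Rel Q RM
  for G :: "'g monoid" and \<Delta> and dg :: "nat \<Rightarrow> ((nat \<Rightarrow> real) \<Rightarrow> 'a) set" and b
    and Rel :: "'a cspace \<Rightarrow> 'a set \<Rightarrow> 'c ccomplex" and Q and RM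
begin

definition connect :: "nat \<Rightarrow> 'a cspace \<Rightarrow> 'a set \<Rightarrow> ('c \<Rightarrow> 'g) set \<Rightarrow> ('c \<Rightarrow> 'g) set" where
  "connect n X A = connecting_map G (Rel (subspace_of X A) {}) (RM X {} id) (Rel X {}) (RM X A id) (Rel X A) n"

lemma H_comm: "closure_pair X A \<Longrightarrow> comm_group (H n X A)"
  using presentation_dual.comm_cohomology[OF D.dual] .

lemma identities: "preserves_identities H ind"
  unfolding preserves_identities_def
proof (intro allI impI ballI)
  fix n and X :: "'a cspace" and A a
  assume X: "closure_pair X A" and a: "a \<in> carrier (H n X A)"
  have f: "pair_map X A X A id" using X by (simp add: pair_map_def ccont_id)
  interpret PX: presentation_dual "\<lambda>n. gens \<Delta> n X" "D.null X A" b "Rel X A" "Q X A" G using X by (rule D.dual)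
  interpret F: cochain_morphism "cochains G (Rel X A)" "cobdry (Rel X A)" "cochains G (Rel X A)" "cobdry (Rel X A)"
    "cochain_map (Rel X A) (RM X A id)" using f by (rule morphism)
  obtain \<phi> where \<phi>: "\<phi> \<in> carrier (cocycles (cochains G (Rel X A)) (cobdry (Rel X A)) n)"
    and a': "a = cohom_class (cochains G (Rel X A)) (cobdry (Rel X A)) n \<phi>"
    using a unfolding cohomology_group_eq PX.dual.carrier_cohom by blast
  have \<phi>c: "\<phi> \<in> carrier (cochain_group G (Rel X A) n)" using \<phi> by (simp add: PX.dual.in_cocycles)
  have "cochain_map (Rel X A) (RM X A id) n \<phi> = \<phi>"
  proof (rule PX.cochain_eqI[OF F.f_carrier[OF \<phi>c] \<phi>c])
    fix c :: "((nat \<Rightarrow> real) \<Rightarrow> 'a) \<Rightarrow>\<^sub>0 int" assume c: "supp c \<subseteq> gens \<Delta> n X"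
    show "cochain_map (Rel X A) (RM X A id) n \<phi> (Q X A n c) = \<phi> (Q X A n c)"
      using PX.q_carrier[OF c] RM_Q[OF f c] push_id[OF c] by (simp add: cochain_map_def)
  qed
  then show "ind n X A X A id a = a"
    using F.induced_class[OF \<phi>] by (simp add: a' cohomology_map_eq F.induced_def)
qed

lemma absolute_pair:
  assumes "closure_pair X A"
  shows "presentation_pair (\<lambda>n. gens \<Delta> n X) (D.null X {}) b (Rel X {}) (Q X {})
    (\<lambda>n. gens \<Delta> n (subspace_of X A)) (D.null (subspace_of X A) {}) (Rel (subspace_of X A) {}) (Q (subspace_of X A) {})
    G (RM X {} id)"
proof -
  have X: "closure_space X" "A \<subseteq> points X" using assms by (simp_all add: closure_pair_def)
  have p: "closure_pair X {}" "closure_pair (subspace_of X A) {}"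
    using X closure_space_subspace[OF X] by (simp_all add: closure_pair_def)
  have f: "pair_map (subspace_of X A) {} X {} id"
    using p ccont_subspace_id[OF X(2)] by (simp add: pair_map_def)
  show ?thesis
  proof (intro presentation_pair.intro presentation_pair_axioms.intro D.dual p)
    fix n and c :: "((nat \<Rightarrow> real) \<Rightarrow> 'a) \<Rightarrow>\<^sub>0 int"
    show "gens \<Delta> n (subspace_of X A) \<subseteq> gens \<Delta> n X" using X(2) by (rule D.gens_mono)
    then show "D.null (subspace_of X A) {} n = gens \<Delta> n (subspace_of X A) \<inter> D.null X {} n" by auto
    assume c: "supp c \<subseteq> gens \<Delta> n (subspace_of X A)"
    show "RM X {} id n (Q (subspace_of X A) {} n c) = Q X {} n c"
      using RM_Q[OF f c] push_id[OF c] by simp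
  qed
qed

lemma pair_short_exact:
  assumes X: "closure_pair X A"
  shows "short_exact (cochains G (Rel X A)) (cobdry (Rel X A)) (cochains G (Rel X {})) (cobdry (Rel X {}))
    (cochains G (Rel (subspace_of X A) {})) (cobdry (Rel (subspace_of X A) {}))
    (cochain_map (Rel X {}) (RM X A id)) (cochain_map (Rel (subspace_of X A) {}) (RM X {} id))"
proof (rule short_exact_dual[OF absolute_pair[OF X] D.present[OF X]])
  have f: "pair_map X {} X A id" using X by (simp add: pair_map_def ccont_id closure_pair_def)
  fix n and c :: "((nat \<Rightarrow> real) \<Rightarrow> 'a) \<Rightarrow>\<^sub>0 int"
  show "D.null X A n = D.null X {} n \<union> gens \<Delta> n (subspace_of X A)" by auto
  assume c: "supp c \<subseteq> gens \<Delta> n X"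
  show "RM X A id n (Q X {} n c) = Q X A n c" using RM_Q[OF f c] push_id[OF c] by simp
qed

lemma connect_homs: "connecting_homs H connect"
  unfolding connecting_homs_def connect_def connecting_map_eq cohomology_group_eq
  using short_exact.connecting_hom[OF pair_short_exact] by blast

lemma exactness: "exactness_axiom H ind connect"
  unfolding exactness_axiom_def
proof (intro allI impI conjI)
  fix X :: "'a cspace" and A
  assume X: "closure_pair X A"
  interpret short_exact "cochains G (Rel X A)" "cobdry (Rel X A)" "cochains G (Rel X {})" "cobdry (Rel X {})"
    "cochains G (Rel (subspace_of X A) {})" "cobdry (Rel (subspace_of X A) {})"
    "cochain_map (Rel X {}) (RM X A id)" "cochain_map (Rel (subspace_of X A) {}) (RM X {} id)"
    using X by (rule pair_short_exact)
  show "inj_on (ind 0 X {} X A id) (carrier (H 0 X A))"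
    using exact_start by (simp add: j.induced_def cohomology_map_eq cohomology_group_eq)
  fix n
  show "exact_seq
          ([H (Suc n) X {}, H (Suc n) X A, H n (subspace_of X A) {}, H n X {}, H n X A],
           [ind (Suc n) X {} X A id, connect n X A, ind n (subspace_of X A) {} X {} id, ind n X {} X A id])"
    using long_exact_sequence[OF pair_short_exact[OF X], of n]
    unfolding cohomology_map_eq cohomology_group_eq connect_def connecting_map_eq .
qed

text \<open>Exactly what \<open>excision_iso\<close> asks of \<open>D\<close>, with the pair of
  \<open>B\<close> and \<open>A \<inter> B\<close> as small complex. The generators of
  \<open>A\<close> count as null, so small means: in \<open>B\<close>, in \<open>A\<close>, or
  degenerate.\<close>

definition excision_operator where
  "excision_operator X A B E \<longleftrightarrow> (\<forall>n. additive_frag (E n)) \<and>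
    (\<forall>n c. supp c \<subseteq> gens \<Delta> n X \<longrightarrow> supp (E n c) \<subseteq> gens \<Delta> (Suc n) X) \<and>
    (\<forall>n c. supp c \<subseteq> gens \<Delta> n (subspace_of X B) \<union> D.null X A n \<longrightarrow> E n c = 0) \<and>
    (\<forall>n c. supp c \<subseteq> gens \<Delta> n X \<longrightarrow>
      supp (c - (b n (E n c) + (case n of 0 \<Rightarrow> 0 | Suc m \<Rightarrow> E m (b m c))))
        \<subseteq> gens \<Delta> n (subspace_of X B) \<union> D.null X A n)"

definition excision_operators :: bool where
  "excision_operators \<longleftrightarrow>
    (\<forall>X A B. closure_space X \<longrightarrow> interior_cover X {A, B} \<longrightarrow> (\<exists>E. excision_operator X A B E))"

lemma excision:
  assumes "excision_operators"
  shows "excision_axiom H ind"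
  unfolding excision_axiom_def
proof (intro allI impI)
  fix n and X :: "'a cspace" and A B
  assume X: "closure_space X" and AB: "interior_cover X {A, B}"
  have sub: "A \<subseteq> points X" "B \<subseteq> points X" using AB unfolding interior_cover_def by blast+
  obtain E where "excision_operator X A B E"
    using assms[unfolded excision_operators_def, THEN spec, THEN spec, THEN spec, THEN mp, OF X, THEN mp, OF AB] ..
  note op = this[unfolded excision_operator_def]
  have E: "\<And>n. additive_frag (E n)"
    by (rule op[THEN conjunct1, rule_format])
  have ES: "\<And>n c. supp c \<subseteq> gens \<Delta> n X \<Longrightarrow> supp (E n c) \<subseteq> gens \<Delta> (Suc n) X"
    by (rule op[THEN conjunct2, THEN conjunct1, rule_format])
  have EM: "\<And>n c. supp c \<subseteq> gens \<Delta> n (subspace_of X B) \<union> D.null X A n \<Longrightarrow> E n c = 0"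
    by (rule op[THEN conjunct2, THEN conjunct2, THEN conjunct1, rule_format])
  have retr: "\<And>n c. supp c \<subseteq> gens \<Delta> n X \<Longrightarrow>
        supp (c - (b n (E n c) + (case n of 0 \<Rightarrow> 0 | Suc m \<Rightarrow> E m (b m c))))
          \<subseteq> gens \<Delta> n (subspace_of X B) \<union> D.null X A n"
    by (rule op[THEN conjunct2, THEN conjunct2, THEN conjunct2, rule_format])
  have XB: "closure_space (subspace_of X B)" using X sub(2) by (rule closure_space_subspace)
  have p: "closure_pair X A" "closure_pair (subspace_of X B) (A \<inter> B)"
    using X XB sub by (simp_all add: closure_pair_def)
  have f: "pair_map (subspace_of X B) (A \<inter> B) X A id"
    using p ccont_subspace_id[OF sub(2)] by (simp add: pair_map_def)
  interpret presentation_pair "\<lambda>n. gens \<Delta> n X" "D.null X A" b "Rel X A" "Q X A"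
    "\<lambda>n. gens \<Delta> n (subspace_of X B)" "D.null (subspace_of X B) (A \<inter> B)" "Rel (subspace_of X B) (A \<inter> B)"
    "Q (subspace_of X B) (A \<inter> B)" G "RM X A id"
  proof (intro presentation_pair.intro presentation_pair_axioms.intro D.dual p)
    fix n and c :: "((nat \<Rightarrow> real) \<Rightarrow> 'a) \<Rightarrow>\<^sub>0 int"
    show "gens \<Delta> n (subspace_of X B) \<subseteq> gens \<Delta> n X" using sub(2) by (rule D.gens_mono)
    have AB': "A \<inter> B \<subseteq> points (subspace_of X B)" by simp
    \<comment> \<open>A generator of \<open>B\<close> that is null for \<open>X\<close> relative to
      \<open>A\<close> lies in \<open>A\<close>, hence in \<open>A \<inter> B\<close>, or is
      degenerate. This is where the subspace on the intersection arises.\<close>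
    show "D.null (subspace_of X B) (A \<inter> B) n = gens \<Delta> n (subspace_of X B) \<inter> D.null X A n"
      unfolding gens_subspace[where \<Delta> = \<Delta> and n = n, OF D.\<Delta> AB']
        gens_subspace[where \<Delta> = \<Delta> and n = n, OF D.\<Delta> sub(1)] gens_subspace[where \<Delta> = \<Delta> and n = n, OF D.\<Delta> sub(2)]
      by auto
    assume c: "supp c \<subseteq> gens \<Delta> n (subspace_of X B)"
    show "RM X A id n (Q (subspace_of X B) (A \<inter> B) n c) = Q X A n c"
      using RM_Q[OF f c] push_id[OF c] by simp
  qed
  show "ind n (subspace_of X B) (A \<inter> B) X A id \<in> iso (H n X A) (H n (subspace_of X B) (A \<inter> B))"
    using E ES EM retr by (rule excision_iso)
qed

text \<open>The last clause concerns positive degrees only: a point keeps its cohomology in degree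
  zero. The identity holds up to degenerate generators, so that cubes can use the zero
  operator.\<close>

definition point_contraction where
  "point_contraction X P \<longleftrightarrow> (\<forall>n. additive_frag (P n)) \<and>
    (\<forall>n c. supp c \<subseteq> gens \<Delta> n X \<longrightarrow> supp (P n c) \<subseteq> gens \<Delta> (Suc n) X) \<and>
    (\<forall>n c. supp c \<subseteq> gens \<Delta> n X \<inter> dg n \<longrightarrow> supp (P n c) \<subseteq> dg (Suc n)) \<and>
    (\<forall>n c. supp c \<subseteq> gens \<Delta> (Suc n) X \<longrightarrow>
      supp (c - (b (Suc n) (P (Suc n) c) + P n (b n c))) \<subseteq> gens \<Delta> (Suc n) X \<inter> dg (Suc n))"

definition point_contractions :: bool where
  "point_contractions \<longleftrightarrow>
    (\<forall>X x. closure_space X \<longrightarrow> points X = {x} \<longrightarrow> (\<exists>P. point_contraction X P))"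

lemma dimension:
  assumes "point_contractions"
  shows "dimension_axiom H"
  unfolding dimension_axiom_def
proof (intro allI impI)
  fix n :: nat and X :: "'a cspace" and x
  assume X: "closure_space X" "points X = {x}" and n: "1 \<le> n"
  obtain P where "point_contraction X P"
    using assms[unfolded point_contractions_def, THEN spec, THEN spec, THEN mp, OF X(1), THEN mp, OF X(2)] ..
  note op = this[unfolded point_contraction_def]
  have P: "\<And>n. additive_frag (P n)"
    by (rule op[THEN conjunct1, rule_format])
  have PS: "\<And>n c. supp c \<subseteq> gens \<Delta> n X \<Longrightarrow> supp (P n c) \<subseteq> gens \<Delta> (Suc n) X"
    by (rule op[THEN conjunct2, THEN conjunct1, rule_format])
  have PN: "\<And>n c. supp c \<subseteq> gens \<Delta> n X \<inter> dg n \<Longrightarrow> supp (P n c) \<subseteq> dg (Suc n)"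
    by (rule op[THEN conjunct2, THEN conjunct2, THEN conjunct1, rule_format])
  have contr: "\<And>n c. supp c \<subseteq> gens \<Delta> (Suc n) X \<Longrightarrow>
      supp (c - (b (Suc n) (P (Suc n) c) + P n (b n c))) \<subseteq> gens \<Delta> (Suc n) X \<inter> dg (Suc n)"
    by (rule op[THEN conjunct2, THEN conjunct2, THEN conjunct2, rule_format])
  have pX: "closure_pair X {}" using X by (simp add: closure_pair_def)
  interpret PX: presentation_dual "\<lambda>n. gens \<Delta> n X" "D.null X {}" b "Rel X {}" "Q X {}" G using pX by (rule D.dual)
  obtain m where m: "n = Suc m" using n by (cases n) auto
  have "trivial_group (H (Suc m) X {})"
  proof (rule PX.trivial_cohomology[where P = P, OF P PS])
    fix n and c :: "((nat \<Rightarrow> real) \<Rightarrow> 'a) \<Rightarrow>\<^sub>0 int"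
    assume c: "supp c \<subseteq> D.null X {} n"
    then have c': "supp c \<subseteq> gens \<Delta> n X" by auto
    show "supp (P n c) \<subseteq> D.null X {} (Suc n)" using PN[of c n] PS[OF c'] c by auto
  next
    fix c :: "((nat \<Rightarrow> real) \<Rightarrow> 'a) \<Rightarrow>\<^sub>0 int"
    assume "supp c \<subseteq> gens \<Delta> (Suc m) X"
    then show "supp (c - (b (Suc m) (P (Suc m) c) + P m (b m c))) \<subseteq> D.null X {} (Suc m)"
      using contr by simp
  qed
  then show "trivial_group (H n X {})" by (simp add: m)
qed

end

text \<open>Stated outside the locales because three universes occur. On the class of a chain both
  sides push representatives forward along \<open>f\<close> and then along \<open>g\<close>.\<close>

lemma induced_composition:
  fixes Rel1 :: "'a cspace \<Rightarrow> 'a set \<Rightarrow> 'k ccomplex" and Rel2 :: "'b cspace \<Rightarrow> 'b set \<Rightarrow> 'l ccomplex"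
    and Rel3 :: "'c cspace \<Rightarrow> 'c set \<Rightarrow> 'm ccomplex"
  assumes "singular_maps G \<Delta> dg1 b1 Rel1 Q1 dg2 b2 Rel2 Q2 RM12"
    and "singular_maps G \<Delta> dg2 b2 Rel2 Q2 dg3 b3 Rel3 Q3 RM23"
    and "singular_maps G \<Delta> dg1 b1 Rel1 Q1 dg3 b3 Rel3 Q3 RM13"
  shows "preserves_composition (\<lambda>n X A. cohomology_group G (Rel3 X A) n)
    (\<lambda>n X A Y B f. cohomology_map G (Rel1 X A) (RM12 Y B f) n)
    (\<lambda>n X A Y B f. cohomology_map G (Rel2 X A) (RM23 Y B f) n)
    (\<lambda>n X A Y B f. cohomology_map G (Rel1 X A) (RM13 Y B f) n)"
  unfolding preserves_composition_def
proof (intro allI impI ballI)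
  interpret M12: singular_maps G \<Delta> dg1 b1 Rel1 Q1 dg2 b2 Rel2 Q2 RM12 by fact
  interpret M23: singular_maps G \<Delta> dg2 b2 Rel2 Q2 dg3 b3 Rel3 Q3 RM23 by fact
  interpret M13: singular_maps G \<Delta> dg1 b1 Rel1 Q1 dg3 b3 Rel3 Q3 RM13 by fact
  fix n and X :: "'a cspace" and A and Y :: "'b cspace" and B and Z :: "'c cspace" and C f g a
  assume f: "pair_map X A Y B f" and g: "pair_map Y B Z C g" and a: "a \<in> carrier (cohomology_group G (Rel3 Z C) n)"
  note gf = pair_map_comp[OF f g]
  interpret F: cochain_morphism "cochains G (Rel2 Y B)" "cobdry (Rel2 Y B)" "cochains G (Rel1 X A)" "cobdry (Rel1 X A)"
    "cochain_map (Rel1 X A) (RM12 Y B f)" using f by (rule M12.morphism)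
  interpret E: cochain_morphism "cochains G (Rel3 Z C)" "cobdry (Rel3 Z C)" "cochains G (Rel2 Y B)" "cobdry (Rel2 Y B)"
    "cochain_map (Rel2 Y B) (RM23 Z C g)" using g by (rule M23.morphism)
  interpret FE: cochain_morphism "cochains G (Rel3 Z C)" "cobdry (Rel3 Z C)" "cochains G (Rel1 X A)" "cobdry (Rel1 X A)"
    "cochain_map (Rel1 X A) (RM13 Z C (g \<circ> f))" using gf by (rule M13.morphism)
  have X: "closure_pair X A" and Xf: "ccont X Y f" using f by (simp_all add: pair_map_def)
  obtain \<phi> where \<phi>: "\<phi> \<in> carrier (cocycles (cochains G (Rel3 Z C)) (cobdry (Rel3 Z C)) n)"
    and a': "a = cohom_class (cochains G (Rel3 Z C)) (cobdry (Rel3 Z C)) n \<phi>"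
    using a unfolding cohomology_group_eq E.A.carrier_cohom by blast
  have "cochain_map (Rel1 X A) (RM13 Z C (g \<circ> f)) n \<phi>
      = cochain_map (Rel1 X A) (RM12 Y B f) n (cochain_map (Rel2 Y B) (RM23 Z C g) n \<phi>)"
  proof -
    have "RM13 Z C (g \<circ> f) n k = RM23 Z C g n (RM12 Y B f n k)" if k: "k \<in> carrier (grp (Rel1 X A) n)" for k
    proof -
      obtain c where c: "supp c \<subseteq> gens \<Delta> n X" and k': "k = Q1 X A n c"
        using k presentation.carrierE[OF M12.D.present[OF X]] by metis
      show ?thesis
        unfolding k' M13.RM_Q[OF gf c] M12.RM_Q[OF f c] M23.RM_Q[OF g push_gens[OF M12.D.\<Delta> Xf c]] push_comp ..
    qed
    then show ?thesis
      using is_chain_map_carrier[OF M12.chain_map[OF f], of _ n] by (simp add: cochain_map_def restrict_def fun_eq_iff)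
  qed
  then show "cohomology_map G (Rel1 X A) (RM13 Z C (g \<circ> f)) n a
      = cohomology_map G (Rel1 X A) (RM12 Y B f) n (cohomology_map G (Rel2 Y B) (RM23 Z C g) n a)"
    using FE.induced_class[OF \<phi>] E.induced_class[OF \<phi>] F.induced_class[OF E.f_cocycle[OF \<phi>]]
    unfolding a' cohomology_map_eq F.induced_def E.induced_def FE.induced_def by simp
qed

text \<open>An instance of \<open>connecting_natural_square\<close> with the maps induced by
  \<open>f\<close> on the pair, on the spaces and on the subspaces. Both squares commute because
  each composite is the push-forward along \<open>f\<close> on representatives.\<close>

lemma connecting_naturality:
  fixes Rel1 :: "'a cspace \<Rightarrow> 'a set \<Rightarrow> 'k ccomplex" and Rel2 :: "'b cspace \<Rightarrow> 'b set \<Rightarrow> 'l ccomplex"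
  assumes "singular_theory G \<Delta> dg1 b1 Rel1 Q1 RM1" "singular_theory G \<Delta> dg2 b2 Rel2 Q2 RM2"
    and "singular_maps G \<Delta> dg1 b1 Rel1 Q1 dg2 b2 Rel2 Q2 RM12"
  shows "connecting_natural (\<lambda>n X A. cohomology_group G (Rel2 X A) n)
    (\<lambda>n X A Y B f. cohomology_map G (Rel1 X A) (RM12 Y B f) n)
    (singular_theory.connect G Rel1 RM1) (singular_theory.connect G Rel2 RM2)"
  unfolding connecting_natural_def
proof (intro allI impI ballI)
  interpret T1: singular_theory G \<Delta> dg1 b1 Rel1 Q1 RM1 by fact
  interpret T2: singular_theory G \<Delta> dg2 b2 Rel2 Q2 RM2 by fact
  interpret M: singular_maps G \<Delta> dg1 b1 Rel1 Q1 dg2 b2 Rel2 Q2 RM12 by fact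
  fix n and X :: "'a cspace" and A and Y :: "'b cspace" and B f a
  assume f: "pair_map X A Y B f" and a: "a \<in> carrier (cohomology_group G (Rel2 (subspace_of Y B) {}) n)"
  have X: "closure_pair X A" and Y: "closure_pair Y B" using f by (simp_all add: pair_map_def)
  have X': "closure_space X" "A \<subseteq> points X" and Y': "closure_space Y" "B \<subseteq> points Y" and fc: "ccont X Y f"
    using f by (simp_all add: pair_map_def closure_pair_def)
  note f0 = pair_map_absolute[OF f] and fr = pair_map_restrict[OF f]
  have fcr: "ccont (subspace_of X A) (subspace_of Y B) f" using fr by (simp add: pair_map_def)
  have jX: "pair_map X {} X A id" and jY: "pair_map Y {} Y B id"
    using X Y by (simp_all add: pair_map_def ccont_id closure_pair_def)
  have p: "closure_pair X {}" "closure_pair (subspace_of X A) {}"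
    "closure_pair Y {}" "closure_pair (subspace_of Y B) {}"
    using X' Y' closure_space_subspace by (simp_all add: closure_pair_def)
  have iX: "pair_map (subspace_of X A) {} X {} id" and iY: "pair_map (subspace_of Y B) {} Y {} id"
    using p ccont_subspace_id X'(2) Y'(2) by (simp_all add: pair_map_def)
  have "coset_map (cocycles (cochains G (Rel1 X A)) (cobdry (Rel1 X A)) (Suc n))
      (cobds (cochains G (Rel1 X A)) (cobdry (Rel1 X A)) (Suc n)) (cochain_map (Rel1 X A) (RM12 Y B f) (Suc n))
      (connecting (cochains G (Rel2 Y B)) (cobdry (Rel2 Y B)) (cochains G (Rel2 Y {})) (cobdry (Rel2 Y {}))
        (cochain_map (Rel2 Y {}) (RM2 Y B id)) (cochain_map (Rel2 (subspace_of Y B) {}) (RM2 Y {} id)) n a)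
    = connecting (cochains G (Rel1 X A)) (cobdry (Rel1 X A)) (cochains G (Rel1 X {})) (cobdry (Rel1 X {}))
        (cochain_map (Rel1 X {}) (RM1 X A id)) (cochain_map (Rel1 (subspace_of X A) {}) (RM1 X {} id)) n
      (coset_map (cocycles (cochains G (Rel1 (subspace_of X A) {})) (cobdry (Rel1 (subspace_of X A) {})) n)
        (cobds (cochains G (Rel1 (subspace_of X A) {})) (cobdry (Rel1 (subspace_of X A) {})) n)
        (cochain_map (Rel1 (subspace_of X A) {}) (RM12 (subspace_of Y B) {} f) n) a)"
  proof (rule connecting_natural_square[OF T2.pair_short_exact[OF Y] T1.pair_short_exact[OF X]
        M.morphism[OF f] M.morphism[OF f0] M.morphism[OF fr]])
    fix n x
    show "cochain_map (Rel1 X {}) (RM1 X A id) n (cochain_map (Rel1 X A) (RM12 Y B f) n x)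
      = cochain_map (Rel1 X {}) (RM12 Y {} f) n (cochain_map (Rel2 Y {}) (RM2 Y B id) n x)"
    proof (rule cochain_map_square)
      fix k assume k: "k \<in> carrier (grp (Rel1 X {}) n)"
      show "RM1 X A id n k \<in> carrier (grp (Rel1 X A) n)" using T1.chain_map[OF jX] k by (rule is_chain_map_carrier)
      show "RM12 Y {} f n k \<in> carrier (grp (Rel2 Y {}) n)" using M.chain_map[OF f0] k by (rule is_chain_map_carrier)
      obtain c where c: "supp c \<subseteq> gens \<Delta> n X" and k': "k = Q1 X {} n c"
        using k presentation.carrierE[OF T1.D.present[OF p(1)]] by metis
      have c': "supp (push \<Delta> f n c) \<subseteq> gens \<Delta> n Y" using push_gens[OF T1.D.\<Delta> fc c] .
      show "RM12 Y B f n (RM1 X A id n k) = RM2 Y B id n (RM12 Y {} f n k)"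
        unfolding k' T1.RM_Q[OF jX c] M.RM_Q[OF f0 c] push_id[OF c] M.RM_Q[OF f c] T2.RM_Q[OF jY c'] push_id[OF c'] ..
    qed
  next
    fix n x
    show "cochain_map (Rel1 (subspace_of X A) {}) (RM1 X {} id) n (cochain_map (Rel1 X {}) (RM12 Y {} f) n x)
      = cochain_map (Rel1 (subspace_of X A) {}) (RM12 (subspace_of Y B) {} f) n
          (cochain_map (Rel2 (subspace_of Y B) {}) (RM2 Y {} id) n x)"
    proof (rule cochain_map_square)
      fix k assume k: "k \<in> carrier (grp (Rel1 (subspace_of X A) {}) n)"
      show "RM1 X {} id n k \<in> carrier (grp (Rel1 X {}) n)" using T1.chain_map[OF iX] k by (rule is_chain_map_carrier)
      show "RM12 (subspace_of Y B) {} f n k \<in> carrier (grp (Rel2 (subspace_of Y B) {}) n)"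
        using M.chain_map[OF fr] k by (rule is_chain_map_carrier)
      obtain c where c: "supp c \<subseteq> gens \<Delta> n (subspace_of X A)" and k': "k = Q1 (subspace_of X A) {} n c"
        using k presentation.carrierE[OF T1.D.present[OF p(2)]] by metis
      have cX: "supp c \<subseteq> gens \<Delta> n X" using c T1.D.gens_mono[OF X'(2), of n] by blast
      have c': "supp (push \<Delta> f n c) \<subseteq> gens \<Delta> n (subspace_of Y B)" using push_gens[OF T1.D.\<Delta> fcr c] .
      show "RM12 Y {} f n (RM1 X {} id n k) = RM2 Y {} id n (RM12 (subspace_of Y B) {} f n k)"
        unfolding k' T1.RM_Q[OF iX c] push_id[OF c] M.RM_Q[OF f0 cX] M.RM_Q[OF fr c] T2.RM_Q[OF iY c'] push_id[OF c'] ..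
    qed
  qed (use a in \<open>simp add: cohomology_group_eq\<close>)
  then show "cohomology_map G (Rel1 X A) (RM12 Y B f) (Suc n) (T2.connect n Y B a)
      = T1.connect n X A (cohomology_map G (Rel1 (subspace_of X A) {}) (RM12 (subspace_of Y B) {} f) n a)"
    unfolding T1.connect_def T2.connect_def cohomology_map_eq connecting_map_eq .
qed

lemma (in singular_theory) is_cohomology_theory:
  assumes "homotopy_operators J" "excision_operators" "point_contractions"
  shows "cohomology_theory J H ind connect"
  unfolding cohomology_theory_def
  using H_comm induces_homs identities
    induced_composition[OF singular_maps_axioms singular_maps_axioms singular_maps_axioms] connect_homs
    connecting_naturality[OF singular_theory_axioms singular_theory_axioms singular_maps_axioms]
    homotopy[OF assms(1)] excision[OF assms(2)] dimension[OF assms(3)] exactness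
  by blast

lemma is_cohomology_theory_across:
  assumes "singular_theory G \<Delta> dg1 b1 Rel1 Q1 RM1" "singular_theory G \<Delta> dg2 b2 Rel2 Q2 RM2"
    and "singular_maps G \<Delta> dg1 b1 Rel1 Q1 dg2 b2 Rel2 Q2 RM12"
    and "singular_maps G \<Delta> dg2 b2 Rel2 Q2 dg3 b3 Rel3 Q3 RM23"
    and "singular_maps G \<Delta> dg1 b1 Rel1 Q1 dg3 b3 Rel3 Q3 RM13"
    and "singular_maps.homotopy_operators \<Delta> dg1 b1 dg2 b2 J"
  shows "cohomology_theory_across J (\<lambda>n X A. cohomology_group G (Rel1 X A) n)
    (\<lambda>n X A. cohomology_group G (Rel2 X A) n) (\<lambda>n X A. cohomology_group G (Rel3 X A) n)
    (\<lambda>n X A Y B f. cohomology_map G (Rel1 X A) (RM12 Y B f) n)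
    (\<lambda>n X A Y B f. cohomology_map G (Rel2 X A) (RM23 Y B f) n)
    (\<lambda>n X A Y B f. cohomology_map G (Rel1 X A) (RM13 Y B f) n)
    (singular_theory.connect G Rel1 RM1) (singular_theory.connect G Rel2 RM2)"
  unfolding cohomology_theory_across_def
  using singular_maps.induces_homs[OF assms(3)] induced_composition[OF assms(3-5)]
    connecting_naturality[OF assms(1-3)] singular_maps.homotopy[OF assms(3,6)]
  by blast

text \<open>The flattening step: a quotient by the classes of chains on \<open>SA\<close> is again
  presented, with \<open>SA\<close> added to the relations. Simplicial chains take it once; cubical
  chains take it twice, for degenerate cubes and for the subspace.\<close>

lemma presentation_quotient:
  assumes "presentation S N b K q"
    and SA: "\<And>n. SA n \<subseteq> S n" and bA: "\<And>n c. supp c \<subseteq> SA (Suc n) \<Longrightarrow> supp (b n c) \<subseteq> SA n"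
    and M: "\<And>n. M n = q n ` {c. supp c \<subseteq> SA n}"
  shows "presentation S (\<lambda>n. SA n \<union> N n) b (quotient_complex K M) (\<lambda>n c. M n #>\<^bsub>grp K n\<^esub> q n c)"
    and "\<And>n. subgroup (M n) (grp K n)"
proof -
  interpret presentation S N b K q by fact
  have S: "supp c \<subseteq> S n" if "supp c \<subseteq> SA n" for n and c :: "'a \<Rightarrow>\<^sub>0 int"
    using that SA[of n] by blast
  show sub: "subgroup (M n) (grp K n)" for n
  proof -
    interpret K: comm_group "grp K n" by (rule comm_grp)
    interpret coefficients "grp K n" by (rule coefficients_grp)
    show ?thesis
    proof (rule K.subgroupI)
      show "M n \<subseteq> carrier (grp K n)" using q_carrier S unfolding M by blast
      show "M n \<noteq> {}" unfolding M by (auto intro: exI[of _ 0])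
      fix x assume "x \<in> M n"
      then obtain c where c: "supp c \<subseteq> SA n" "x = q n c" unfolding M by blast
      have "inv\<^bsub>grp K n\<^esub> x = q n (- c)"
        using hom_inv_comm[OF abelian_free_Abelian_group comm_grp q_hom, of c n] S[OF c(1)] c(2) by simp
      then show "inv\<^bsub>grp K n\<^esub> x \<in> M n" using c(1) unfolding M by auto
      fix y assume "y \<in> M n"
      then obtain d where d: "supp d \<subseteq> SA n" "y = q n d" unfolding M by blast
      have "x \<otimes>\<^bsub>grp K n\<^esub> y = q n (c + d)" using q_add[OF S[OF c(1)] S[OF d(1)]] c d by simp
      then show "x \<otimes>\<^bsub>grp K n\<^esub> y \<in> M n" using keys_add_subset[OF c(1) d(1)] unfolding M by auto
    qed
  qed
  have coset_hom: "(\<lambda>x. M n #>\<^bsub>grp K n\<^esub> x) \<in> hom (grp K n) (grp K n Mod M n)" for n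
    using normal.r_coset_hom_Mod[OF comm_group.subgroup_imp_normal[OF comm_grp sub]] .
  show "presentation S (\<lambda>n. SA n \<union> N n) b (quotient_complex K M) (\<lambda>n c. M n #>\<^bsub>grp K n\<^esub> q n c)"
  proof (rule presentation.intro)
    fix n
    show "comm_group (grp (quotient_complex K M) n)"
      unfolding quotient_complex_def using comm_group.abelian_FactGroup[OF comm_grp sub] by simp
    show "(\<lambda>c. M n #>\<^bsub>grp K n\<^esub> q n c) \<in> hom (free_Abelian_group (S n)) (grp (quotient_complex K M) n)"
      using hom_compose[OF q_hom coset_hom, of n] by (simp add: comp_def quotient_complex_def)
    show "carrier (grp (quotient_complex K M) n) = (\<lambda>c. M n #>\<^bsub>grp K n\<^esub> q n c) ` {c. supp c \<subseteq> S n}"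
      by (simp add: quotient_complex_def carrier_FactGroup q_surj image_image)
    show "SA n \<union> N n \<subseteq> S n" using SA N_sub by blast
    show "additive_frag (b n)" by (rule b_additive)
  next
    fix n and c :: "'a \<Rightarrow>\<^sub>0 int" assume c: "supp c \<subseteq> S n"
    interpret K: comm_group "grp K n" by (rule comm_grp)
    have "M n #>\<^bsub>grp K n\<^esub> q n c = M n \<longleftrightarrow> M n #>\<^bsub>grp K n\<^esub> q n c = M n #>\<^bsub>grp K n\<^esub> \<one>\<^bsub>grp K n\<^esub>"
      using K.coset_mult_one[of "M n"] subgroup.subset[OF sub] by simp
    also have "\<dots> \<longleftrightarrow> (\<exists>m\<in>M n. q n c = m \<otimes>\<^bsub>grp K n\<^esub> \<one>\<^bsub>grp K n\<^esub>)"
      using coset_eq_iff[OF comm_grp sub q_carrier[OF c] K.one_closed] .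
    also have "\<dots> \<longleftrightarrow> q n c \<in> M n"
      using subgroup.mem_carrier[OF sub[of n]] by auto
    also have "\<dots> \<longleftrightarrow> (\<exists>a. supp a \<subseteq> SA n \<and> supp (c - a) \<subseteq> N n)"
      unfolding M using q_eq[OF c S] by auto
    \<comment> \<open>A chain on a union of generator sets splits into a chain on each; this is what
      makes the relations of a double quotient a union.\<close>
    also have "\<dots> \<longleftrightarrow> supp c \<subseteq> SA n \<union> N n"
    proof
      assume "\<exists>a. supp a \<subseteq> SA n \<and> supp (c - a) \<subseteq> N n"
      then obtain a where a: "supp a \<subseteq> SA n \<union> N n" "supp (c - a) \<subseteq> SA n \<union> N n" by blast
      show "supp c \<subseteq> SA n \<union> N n" using keys_add_subset[OF a(2,1)] by simp
    next
      assume "supp c \<subseteq> SA n \<union> N n"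
      then obtain d e where "supp d \<subseteq> SA n" "supp e \<subseteq> N n" "d + e = c"
        by (rule frag_split)
      then show "\<exists>a. supp a \<subseteq> SA n \<and> supp (c - a) \<subseteq> N n"
        by (intro exI[of _ d]) auto
    qed
    finally show "M n #>\<^bsub>grp K n\<^esub> q n c = \<one>\<^bsub>grp (quotient_complex K M) n\<^esub> \<longleftrightarrow> supp c \<subseteq> SA n \<union> N n"
      by (simp add: quotient_complex_def)
  next
    fix n and c :: "'a \<Rightarrow>\<^sub>0 int" assume c: "supp c \<subseteq> S (Suc n)"
    show "supp (b n c) \<subseteq> S n" using b_S[OF c] .
    have "bdry K n ` M (Suc n) \<subseteq> M n"
    proof
      fix y assume "y \<in> bdry K n ` M (Suc n)"
      then obtain a where a: "supp a \<subseteq> SA (Suc n)" "y = bdry K n (q (Suc n) a)" unfolding M by blast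
      then have "y = q n (b n a)" using bdry_q[OF S] by simp
      then show "y \<in> M n" using bA[OF a(1)] unfolding M by blast
    qed
    then have "coset_map (grp K n) (M n) (bdry K n) (M (Suc n) #>\<^bsub>grp K (Suc n)\<^esub> q (Suc n) c)
        = M n #>\<^bsub>grp K n\<^esub> bdry K n (q (Suc n) c)"
      using c by (intro coset_map_coset comm_grp sub bdry_hom q_carrier)
    then show "bdry (quotient_complex K M) n (M (Suc n) #>\<^bsub>grp K (Suc n)\<^esub> q (Suc n) c) = M n #>\<^bsub>grp K n\<^esub> q n (b n c)"
      using bdry_q[OF c] by (simp add: quotient_complex_def)
  next
    fix n and c :: "'a \<Rightarrow>\<^sub>0 int" assume "supp c \<subseteq> SA (Suc n) \<union> N (Suc n)"
    then obtain d e where de: "supp d \<subseteq> SA (Suc n)" "supp e \<subseteq> N (Suc n)" "d + e = c"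
      by (rule frag_split)
    have "supp (b n d + b n e) \<subseteq> SA n \<union> N n"
      using bA[OF de(1)] b_N[OF de(2)] by (intro keys_add_subset) blast+
    then show "supp (b n c) \<subseteq> SA n \<union> N n"
      using additive_frag_add[OF b_additive, of n d e] de(3) by simp
  next
    fix n and c :: "'a \<Rightarrow>\<^sub>0 int" assume "supp c \<subseteq> S (Suc (Suc n))"
    then show "supp (b n (b (Suc n) c)) \<subseteq> SA n \<union> N n" using bb by blast
  qed
qed

section \<open>Alternating double sums\<close>

lemma additive_frag_eq:
  assumes "additive_frag f" "additive_frag g" "\<And>x. x \<in> S \<Longrightarrow> f (frag_of x) = g (frag_of x)" "supp c \<subseteq> S"
  shows "f c = g c"
  using assms(4)
  by (induction c rule: frag_induction)
    (simp_all add: assms(3) additive_frag_0[OF assms(1)] additive_frag_0[OF assms(2)]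
      additive_frag_diff[OF assms(1)] additive_frag_diff[OF assms(2)])

lemma additive_frag_comp: "additive_frag f \<Longrightarrow> additive_frag g \<Longrightarrow> additive_frag (\<lambda>c. f (g c))"
  by (simp add: additive_frag_def)

text \<open>With \<open>F i j\<close> the \<open>j\<close>-th face of the \<open>i\<close>-th face,
  the hypothesis is the simplicial identity. It matches the terms below the diagonal with the
  remaining ones, and the shift of one index by one reverses the sign.\<close>

lemma alternating_double_sum:
  fixes F :: "nat \<Rightarrow> nat \<Rightarrow> ('s \<Rightarrow>\<^sub>0 int)"
  assumes F: "\<And>i j. j < i \<Longrightarrow> i \<le> Suc N \<Longrightarrow> F i j = F j (i - 1)"
  shows "(\<Sum>i\<le>Suc N. \<Sum>j\<le>N. frag_cmul ((-1) ^ (i + j)) (F i j)) = 0"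
proof -
  define g where "g = (\<lambda>(i, j). frag_cmul ((-1) ^ (i + j)) (F i j))"
  let ?L = "{(i, j). i \<le> Suc N \<and> j < i}" and ?R = "{(i, j). i \<le> j \<and> j \<le> N}"
  have fin: "finite ?L" "finite ?R"
    by (rule finite_subset[of _ "{..Suc N} \<times> {..Suc N}"]; auto)+
  have un: "{..Suc N} \<times> {..N} = ?L \<union> ?R" by auto
  have "(\<Sum>i\<le>Suc N. \<Sum>j\<le>N. frag_cmul ((-1) ^ (i + j)) (F i j)) = sum g ({..Suc N} \<times> {..N})"
    unfolding g_def by (rule sum.cartesian_product)
  also have "\<dots> = sum g ?L + sum g ?R"
    unfolding un by (rule sum.union_disjoint[OF fin]) auto
  also have "sum g ?L = (\<Sum>p\<in>?R. - g p)"
  proof (rule sum.reindex_bij_witness[where i = "\<lambda>(i, j). (Suc j, i)" and j = "\<lambda>(i, j). (j, i - 1)"])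
    fix p assume "p \<in> ?L"
    then obtain k j where "p = (k, j)" "k \<le> Suc N" "j < k" by auto
    moreover then obtain i where "k = Suc i" by (cases k) auto
    ultimately have p: "p = (Suc i, j)" "Suc i \<le> Suc N" "j < Suc i" by simp_all
    show "- g (case p of (i, j) \<Rightarrow> (j, i - 1)) = g p"
      using F[of j "Suc i"] p by (simp add: g_def add.commute)
  qed auto
  finally show ?thesis by (simp add: sum_negf)
qed

text \<open>\<open>A j i\<close> stands for the \<open>j\<close>-th face of the \<open>i\<close>-th
  prism simplex. Faces with \<open>j < i\<close> or \<open>j > i + 1\<close> are prism simplices
  over faces, with opposite sign. The faces \<open>i\<close> and \<open>i + 1\<close> are the walls
  \<open>e i\<close> and \<open>e (Suc i)\<close>, whose alternating contributions telescope to the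
  two ends.\<close>

lemma prism_double_sum:
  fixes A B :: "nat \<Rightarrow> nat \<Rightarrow> ('s \<Rightarrow>\<^sub>0 int)" and e :: "nat \<Rightarrow> ('s \<Rightarrow>\<^sub>0 int)"
  assumes lo: "\<And>i j. j < i \<Longrightarrow> i \<le> n \<Longrightarrow> A j i = B j (i - 1)"
    and hi: "\<And>i j. Suc i < j \<Longrightarrow> j \<le> Suc n \<Longrightarrow> A j i = B (j - 1) i"
    and diag: "\<And>i. i \<le> n \<Longrightarrow> A i i = e i" "\<And>i. i \<le> n \<Longrightarrow> A (Suc i) i = e (Suc i)"
  shows "(\<Sum>i\<le>n. \<Sum>j\<le>Suc n. frag_cmul ((-1) ^ (i + j)) (A j i))
    = e 0 - e (Suc n) - (\<Sum>j\<le>n. \<Sum>i<n. frag_cmul ((-1) ^ (i + j)) (B j i))"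
proof -
  define g where "g = (\<lambda>(i, j). frag_cmul ((-1) ^ (i + j)) (A j i))"
  define h where "h = (\<lambda>(i, j). frag_cmul ((-1) ^ (i + j)) (B j i))"
  let ?L = "{(i, j). i \<le> n \<and> j < i}" and ?R = "{(i, j). Suc i < j \<and> j \<le> Suc n}"
  let ?L' = "{(i, j). i < n \<and> j \<le> i}" and ?R' = "{(i, j). i < j \<and> j \<le> n}"
  let ?D = "(\<lambda>i. (i, i)) ` {..n}" and ?E = "(\<lambda>i. (i, Suc i)) ` {..n}"
  have fin: "finite ?L" "finite ?R" "finite ?L'" "finite ?R'"
    by (rule finite_subset[of _ "{..Suc n} \<times> {..Suc n}"]; auto)+
  have un: "{..n} \<times> {..Suc n} = (?L \<union> ?R) \<union> (?D \<union> ?E)" by (auto simp: image_iff)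
  have un': "{..<n} \<times> {..n} = ?L' \<union> ?R'" by auto
  have "(\<Sum>i\<le>n. \<Sum>j\<le>Suc n. frag_cmul ((-1) ^ (i + j)) (A j i)) = sum g ({..n} \<times> {..Suc n})"
    unfolding g_def by (rule sum.cartesian_product)
  also have "\<dots> = (sum g ?L + sum g ?R) + (sum g ?D + sum g ?E)"
  proof -
    have "sum g ((?L \<union> ?R) \<union> (?D \<union> ?E)) = sum g (?L \<union> ?R) + sum g (?D \<union> ?E)"
      by (rule sum.union_disjoint) (auto intro!: finite_UnI fin)
    moreover have "sum g (?L \<union> ?R) = sum g ?L + sum g ?R"
      by (rule sum.union_disjoint[OF fin(1,2)]) auto
    moreover have "sum g (?D \<union> ?E) = sum g ?D + sum g ?E"
      by (rule sum.union_disjoint) auto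
    ultimately show ?thesis unfolding un by (simp only:)
  qed
  also have "sum g ?L = (\<Sum>p\<in>?L'. - h p)"
  proof (rule sum.reindex_bij_witness[where i = "\<lambda>(i, j). (Suc i, j)" and j = "\<lambda>(i, j). (i - 1, j)"])
    fix p assume "p \<in> ?L"
    then obtain k j where "p = (k, j)" "k \<le> n" "j < k" by auto
    moreover then obtain i where "k = Suc i" by (cases k) auto
    ultimately have p: "p = (Suc i, j)" "Suc i \<le> n" "j < Suc i" by simp_all
    show "- h (case p of (i, j) \<Rightarrow> (i - 1, j)) = g p"
      using lo[of j "Suc i"] p by (simp add: g_def h_def)
  qed auto
  also have "sum g ?R = (\<Sum>p\<in>?R'. - h p)"
  proof (rule sum.reindex_bij_witness[where i = "\<lambda>(i, j). (i, Suc j)" and j = "\<lambda>(i, j). (i, j - 1)"])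
    fix p assume "p \<in> ?R"
    then obtain i k where "p = (i, k)" "Suc i < k" "k \<le> Suc n" by auto
    moreover then obtain j where "k = Suc j" by (cases k) auto
    ultimately have p: "p = (i, Suc j)" "Suc i < Suc j" "Suc j \<le> Suc n" by simp_all
    show "- h (case p of (i, j) \<Rightarrow> (i, j - 1)) = g p"
      using hi[of i "Suc j"] p by (simp add: g_def h_def)
  qed auto
  also have "(\<Sum>p\<in>?L'. - h p) + (\<Sum>p\<in>?R'. - h p) = - sum h ({..<n} \<times> {..n})"
  proof -
    have "sum h (?L' \<union> ?R') = sum h ?L' + sum h ?R'" by (rule sum.union_disjoint[OF fin(3,4)]) auto
    then show ?thesis unfolding un' by (simp add: sum_negf)
  qed
  also have "sum h ({..<n} \<times> {..n}) = (\<Sum>j\<le>n. \<Sum>i<n. frag_cmul ((-1) ^ (i + j)) (B j i))"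
    unfolding h_def by (subst sum.swap) (rule sum.cartesian_product[symmetric])
  also have "sum g ?D + sum g ?E = (\<Sum>i\<le>n. e i - e (Suc i))"
  proof -
    have "(-1 :: int) ^ (i + i) = 1" for i by (simp flip: mult_2)
    then have "g (i, i) = e i" "g (i, Suc i) = - e (Suc i)" if "i \<le> n" for i
      using that diag by (simp_all add: g_def)
    then have "sum g ?D = (\<Sum>i\<le>n. e i)" "sum g ?E = (\<Sum>i\<le>n. - e (Suc i))"
      by (simp_all add: sum.reindex inj_on_def)
    then show ?thesis by (simp add: sum_negf sum_subtractf)
  qed
  also have "\<dots> = e 0 - e (Suc n)" by (rule sum_telescope)
  finally show ?thesis by simp
qed

lemma additive_frag_cmul:
  assumes f: "additive_frag f"
  shows "f (frag_cmul k c) = frag_cmul k (f c)"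
proof -
  have nat: "f (frag_cmul (int m) c) = frag_cmul (int m) (f c)" for m
    by (induction m) (simp_all add: additive_frag_0[OF f] additive_frag_add[OF f] frag_cmul_distrib)
  show ?thesis
  proof (cases k)
    case (nonneg m)
    then show ?thesis using nat by simp
  next
    case (neg m)
    have "f (- frag_cmul (int (Suc m)) c) = - frag_cmul (int (Suc m)) (f c)"
      unfolding additive_frag_minus[OF f] nat ..
    then show ?thesis by (simp add: neg)
  qed
qed

lemma additive_frag_sum:
  assumes f: "additive_frag f"
  shows "f (sum g I) = (\<Sum>i\<in>I. f (g i))"
  by (induction I rule: infinite_finite_induct) (simp_all add: additive_frag_0[OF f] additive_frag_add[OF f])

section \<open>The simplicial theory\<close>

lemma keys_frag_of_subset: "x \<in> S \<Longrightarrow> supp (frag_of x) \<subseteq> S"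
  by simp

lemma closure_space_interval: "closure_space (interval_space J)"
proof (cases J)
  case Unit_interval
  then show ?thesis using closure_space_topology by simp
qed (auto simp: closure_space_def)

lemma closure_space_simplex: "closure_space (simplex_space J n)"
proof (cases J)
  case Unit_interval
  then show ?thesis using closure_space_topology by simp
next
  case J_plus
  then show ?thesis by (auto simp: closure_space_def) blast
qed (auto simp: closure_space_def)

lemma points_simplex:
  "points (simplex_space J n) = (if J = Unit_interval then standard_simplex n else vertex ` {..n})"
  by (cases J) (auto simp: topspace_standard_simplex)

lemma simplex_nonempty: "points (simplex_space J n) \<noteq> {}"
  by (simp add: points_simplex nonempty_standard_simplex)

lemma vertex_eq_iff [simp]: "vertex i = vertex j \<longleftrightarrow> i = j"
  by (auto simp: vertex_def dest: fun_cong[of _ _ i] split: if_splits)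

abbreviation simplex_top :: "nat \<Rightarrow> (nat \<Rightarrow> real) topology" where
  "simplex_top n \<equiv> subtopology (powertop_real UNIV) (standard_simplex n)"

text \<open>One criterion for the three kinds of models: continuity of the affine map is for the
  unit interval, while the discrete models look only at vertices. Monotonicity on vertices is what
  the closure of \<open>J_plus\<close> demands.\<close>

lemma ccont_simplex_map:
  assumes cont: "continuous_map (simplex_top n) (simplex_top m) f"
    and v: "\<And>k. k \<le> n \<Longrightarrow> f (vertex k) = vertex (g k)"
    and mono: "\<And>k l. k \<le> l \<Longrightarrow> l \<le> n \<Longrightarrow> g k \<le> g l" and le: "\<And>k. k \<le> n \<Longrightarrow> g k \<le> m"
  shows "ccont (simplex_space J n) (simplex_space J m) f"
proof (cases J)
  case Unit_interval
  then show ?thesis using cont by (simp add: ccont_continuous_map)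
next
  case J_indiscrete
  then show ?thesis using v le by (auto simp: ccont_def)
next
  case J_plus
  have "f ` clos (simplex_space J n) A \<subseteq> clos (simplex_space J m) (f ` A)" for A
  proof
    fix y assume "y \<in> f ` clos (simplex_space J n) A"
    then obtain i j where "j \<le> n" "i \<le> j" "vertex i \<in> A" "y = vertex (g j)"
      using v J_plus by auto
    moreover then have "vertex (g i) \<in> f ` A" using v[of i] by (metis imageI le_trans)
    ultimately show "y \<in> clos (simplex_space J m) (f ` A)"
      using J_plus mono le by auto
  qed
  then show ?thesis using v le J_plus by (auto simp: ccont_def)
qed

text \<open>On vertices the map is a step function with threshold \<open>m\<close>, from 0 up to 1;
  it thereby respects the order that \<open>J_plus\<close> carries.\<close>

lemma ccont_simplex_interval:
  assumes cont: "continuous_map (simplex_top n) (top_of_set {0..1}) f"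
    and v: "\<And>k. k \<le> n \<Longrightarrow> f (vertex k) = (if k < m then 0 else 1)"
  shows "ccont (simplex_space J n) (interval_space J) f"
proof (cases J)
  case Unit_interval
  then show ?thesis using cont by (simp add: ccont_continuous_map)
next
  case J_indiscrete
  then show ?thesis using v by (auto simp: ccont_def split: if_splits)
next
  case J_plus
  have "f ` clos (simplex_space J n) A \<subseteq> clos (interval_space J) (f ` A)" for A
  proof
    fix y assume "y \<in> f ` clos (simplex_space J n) A"
    then obtain i j where ij: "j \<le> n" "i \<le> j" "vertex i \<in> A" "y = f (vertex j)"
      using J_plus by auto
    have fi: "f (vertex i) \<in> f ` A" using ij by simp
    show "y \<in> clos (interval_space J) (f ` A)"
    proof (cases "i < m")
      case True
      then have "0 \<in> f ` A" using fi v[of i] ij by simp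
      then show ?thesis using J_plus v[of j] ij by simp
    next
      case False
      then have "f (vertex i) = 1" "y = 1" using v[of i] v[of j] ij by simp_all
      then show ?thesis using J_plus fi by auto
    qed
  qed
  then show ?thesis using v J_plus by (auto simp: ccont_def)
qed

section \<open>Faces, degeneracies and partial sums of coordinates on the simplex\<close>

lemma continuous_map_coord: "continuous_map (simplex_top n) euclideanreal (\<lambda>x. x k)"
  by (intro continuous_map_from_subtopology continuous_map_product_projection) simp

lemma sum_face: "(\<Sum>k<m. simplical_face j t k) = (if m \<le> j then \<Sum>k<m. t k else \<Sum>k<m - 1. t k)" for t :: "nat \<Rightarrow> real"
proof (induction m)
  case (Suc m)
  then show ?case by (cases m) (auto simp: simplical_face_def not_le less_Suc_eq_le)
qed simp

lemma continuous_map_face: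
  assumes "j \<le> Suc n"
  shows "continuous_map (simplex_top n) (simplex_top (Suc n)) (simplical_face j)"
proof -
  have "continuous_map (simplex_top n) euclideanreal (\<lambda>x. simplical_face j x k)" for k
    by (cases "k < j"; cases "k = j") (simp_all add: simplical_face_def continuous_map_coord)
  then show ?thesis
    using simplical_face_in_standard_simplex[of "Suc n" j] assms
    by (auto simp: continuous_map_in_subtopology continuous_map_componentwise_UNIV)
qed

lemma face_vertex: "simplical_face j (vertex k) = vertex (if k < j then k else Suc k)"
  by (auto simp: simplical_face_def vertex_def fun_eq_iff)

lemma ccont_face:
  assumes "j \<le> Suc n"
  shows "ccont (simplex_space J n) (simplex_space J (Suc n)) (simplical_face j)"
  by (rule ccont_simplex_map[OF continuous_map_face[OF assms] face_vertex]) auto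

lemma face_points: "j \<le> Suc n \<Longrightarrow> t \<in> points (simplex_space J n) \<Longrightarrow> simplical_face j t \<in> points (simplex_space J (Suc n))"
  using ccont_funcset[OF ccont_face] .

text \<open>The affine degeneracy that identifies the vertices \<open>i\<close> and
  \<open>i + 1\<close> by adding up their coordinates.\<close>

definition degen :: "nat \<Rightarrow> (nat \<Rightarrow> real) \<Rightarrow> nat \<Rightarrow> real" where
  "degen i t = (\<lambda>k. if k < i then t k else if k = i then t i + t (Suc i) else t (Suc k))"

text \<open>On a simplex this is the sum of the coordinates from index \<open>m\<close> on. The
  complementary form mentions no dimension and so commutes with faces without a case on the last
  index.\<close>

definition tail :: "nat \<Rightarrow> (nat \<Rightarrow> real) \<Rightarrow> real" where
  "tail m t = 1 - (\<Sum>k<m. t k)"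

lemma sum_degen: "(\<Sum>k<m. degen i t k) = (if m \<le> i then \<Sum>k<m. t k else \<Sum>k<Suc m. t k)"
  by (induction m) (auto simp: degen_def not_le less_Suc_eq_le)

lemma degen_in_simplex:
  assumes i: "i \<le> n" and t: "t \<in> standard_simplex (Suc n)"
  shows "degen i t \<in> standard_simplex n"
proof -
  have pos: "0 \<le> t k" "t k \<le> 1" for k using t by (auto simp: standard_simplex_def)
  have sum: "(\<Sum>k\<le>Suc n. t k) = 1" using t by (simp add: standard_simplex_def)
  have "t i + t (Suc i) = sum t {i, Suc i}" by simp
  also have "\<dots> \<le> sum t {..Suc n}" using i pos by (intro sum_mono2) auto
  finally have "t i + t (Suc i) \<le> 1" using sum by simp
  moreover have "(\<Sum>k\<le>n. degen i t k) = 1"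
    using sum_degen[of i t "Suc n"] i sum by (simp add: lessThan_Suc_atMost)
  moreover have "degen i t k = 0" if "n < k" for k
    using t that i by (auto simp: degen_def standard_simplex_def)
  ultimately show ?thesis using pos i by (auto simp: standard_simplex_def degen_def)
qed

lemma continuous_map_degen:
  assumes "i \<le> n"
  shows "continuous_map (simplex_top (Suc n)) (simplex_top n) (degen i)"
proof -
  have "continuous_map (simplex_top (Suc n)) euclideanreal (\<lambda>x. degen i x k)" for k
    by (cases "k < i"; cases "k = i") (simp_all add: degen_def continuous_map_coord continuous_map_add)
  then show ?thesis
    using degen_in_simplex[OF assms]
    by (auto simp: continuous_map_in_subtopology continuous_map_componentwise_UNIV)
qed

lemma degen_vertex: "degen i (vertex k) = vertex (if k \<le> i then k else k - 1)"
  by (auto simp: degen_def vertex_def fun_eq_iff)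

lemma ccont_degen:
  assumes "i \<le> n"
  shows "ccont (simplex_space J (Suc n)) (simplex_space J n) (degen i)"
  by (rule ccont_simplex_map[OF continuous_map_degen[OF assms] degen_vertex]) (use assms in auto)

lemma tail_vertex: "tail m (vertex k) = (if k < m then 0 else 1)"
  by (auto simp: tail_def vertex_def)

lemma ccont_tail:
  assumes "m \<le> Suc n"
  shows "ccont (simplex_space J n) (interval_space J) (tail m)"
proof (rule ccont_simplex_interval[OF _ tail_vertex])
  have "tail m t \<in> {0..1}" if t: "t \<in> standard_simplex n" for t
  proof -
    have "sum t {..<m} \<le> sum t {..n}" using assms t by (intro sum_mono2) (auto simp: standard_simplex_def)
    moreover have "0 \<le> sum t {..<m}" using t by (intro sum_nonneg) (auto simp: standard_simplex_def)
    ultimately show ?thesis using t by (simp add: tail_def standard_simplex_def)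
  qed
  moreover have "continuous_map (simplex_top n) euclideanreal (tail m)"
    unfolding tail_def by (intro continuous_map_diff continuous_map_sum continuous_map_coord) auto
  ultimately show "continuous_map (simplex_top n) (top_of_set {0..1}) (tail m)"
    by (auto simp: continuous_map_in_subtopology)
qed

lemma degen_face_less: "j < i \<Longrightarrow> degen i (simplical_face j t) = simplical_face j (degen (i - 1) t)"
  by (rule ext) (auto simp: degen_def simplical_face_def)

lemma degen_face_eq: "degen i (simplical_face i t) = t" "degen i (simplical_face (Suc i) t) = t"
  by (rule ext; auto simp: degen_def simplical_face_def)+

lemma degen_face_greater: "Suc i < j \<Longrightarrow> degen i (simplical_face j t) = simplical_face (j - 1) (degen i t)"
  by (rule ext) (auto simp: degen_def simplical_face_def)

lemma tail_face: "tail m (simplical_face j t) = (if m \<le> j then tail m t else tail (m - 1) t)"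
  by (simp add: tail_def sum_face)

lemma face_face: "j < i \<Longrightarrow> simplical_face i (simplical_face j t) = simplical_face j (simplical_face (i - 1) t)" for t :: "nat \<Rightarrow> real"
  by (rule ext) (auto simp: simplical_face_def)

section \<open>The simplicial boundary and the presentation of relative simplicial chains\<close>

lemma push_of: "push \<Delta> f n (frag_of \<sigma>) = frag_of (restrict (f \<circ> \<sigma>) (points (\<Delta> n)))"
  unfolding push_def by (rule frag_extend_of)

definition simp_bdry :: "interval_kind \<Rightarrow> nat \<Rightarrow> 'a chain \<Rightarrow> 'a chain" where
  "simp_bdry J n = frag_extend (\<lambda>\<sigma>. \<Sum>i\<le>Suc n. frag_cmul ((-1) ^ i) (frag_of (simplex_face J n i \<sigma>)))"

lemma simp_bdry_additive: "additive_frag (simp_bdry J n)"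
  by (simp add: simp_bdry_def)

lemma simp_bdry_of: "simp_bdry J n (frag_of \<sigma>) = (\<Sum>i\<le>Suc n. frag_cmul ((-1) ^ i) (frag_of (simplex_face J n i \<sigma>)))"
  unfolding simp_bdry_def by (rule frag_extend_of)

lemma gens_simplex: "gens (simplex_space J) n X = simplices J n X"
  by (simp add: gens_def simplices_def)

lemma simplex_face_gens:
  assumes "\<sigma> \<in> gens (simplex_space J) (Suc n) X" "i \<le> Suc n"
  shows "simplex_face J n i \<sigma> \<in> gens (simplex_space J) n X"
proof -
  have "ccont (simplex_space J n) X (\<sigma> \<circ> simplical_face i)"
    using assms(1) by (intro ccont_compose[OF ccont_face[OF assms(2)]]) (simp add: gens_def)
  then have "ccont (simplex_space J n) X (simplex_face J n i \<sigma>)"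
    unfolding simplex_face_def by (rule ccont_cong[OF closure_space_simplex]) simp
  then show ?thesis by (simp add: gens_def simplex_face_def)
qed

lemma simp_bdry_gens:
  assumes "supp c \<subseteq> gens (simplex_space J) (Suc n) X"
  shows "supp (simp_bdry J n c) \<subseteq> gens (simplex_space J) n X"
  unfolding simp_bdry_def
proof (rule keys_frag_extend_subset[OF _ assms])
  fix \<sigma> assume "\<sigma> \<in> gens (simplex_space J) (Suc n) X"
  then show "supp (\<Sum>i\<le>Suc n. frag_cmul ((-1) ^ i) (frag_of (simplex_face J n i \<sigma>))) \<subseteq> gens (simplex_space J) n X"
    by (intro keys_sum_subset keys_cmul_subset keys_frag_of_subset simplex_face_gens) auto
qed

lemma simplex_face_face:
  assumes "j < i" "i \<le> Suc (Suc n)"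
  shows "simplex_face J n j (simplex_face J (Suc n) i \<sigma>) = simplex_face J n (i - 1) (simplex_face J (Suc n) j \<sigma>)"
  unfolding simplex_face_def
proof (rule restrict_ext)
  fix t assume t: "t \<in> points (simplex_space J n)"
  have "simplical_face j t \<in> points (simplex_space J (Suc n))" "simplical_face (i - 1) t \<in> points (simplex_space J (Suc n))"
    using assms face_points[OF _ t] by auto
  then show "(restrict (\<sigma> \<circ> simplical_face i) (points (simplex_space J (Suc n))) \<circ> simplical_face j) t
    = (restrict (\<sigma> \<circ> simplical_face j) (points (simplex_space J (Suc n))) \<circ> simplical_face (i - 1)) t"
    using face_face[OF assms(1), of t] by simp
qed

lemma simp_bdry_bdry: "simp_bdry J n (simp_bdry J (Suc n) c) = 0"
proof -
  have gen: "simp_bdry J n (simp_bdry J (Suc n) (frag_of \<sigma>)) = 0" for \<sigma> :: "(nat \<Rightarrow> real) \<Rightarrow> 'a"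
  proof -
    have "simp_bdry J n (simp_bdry J (Suc n) (frag_of \<sigma>))
      = (\<Sum>i\<le>Suc (Suc n). \<Sum>j\<le>Suc n. frag_cmul ((-1) ^ (i + j)) (frag_of (simplex_face J n j (simplex_face J (Suc n) i \<sigma>))))"
      by (simp only: simp_bdry_of additive_frag_sum[OF simp_bdry_additive] additive_frag_cmul[OF simp_bdry_additive]
          frag_cmul_sum frag_cmul_cmul power_add)
    also have "\<dots> = 0"
    proof (rule alternating_double_sum)
      fix i j assume "j < i" "i \<le> Suc (Suc n)"
      then show "frag_of (simplex_face J n j (simplex_face J (Suc n) i \<sigma>))
          = frag_of (simplex_face J n (i - 1) (simplex_face J (Suc n) j \<sigma>))"
        by (rule arg_cong[where f = frag_of, OF simplex_face_face])
    qed
    finally show ?thesis .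
  qed
  show ?thesis
    by (rule additive_frag_eq[where S = UNIV and g = "\<lambda>c. 0" and f = "\<lambda>c. simp_bdry J n (simp_bdry J (Suc n) c)", OF _ _ gen])
      (simp_all add: additive_frag_comp simp_bdry_additive)
qed

lemma simp_bdry_push: "simp_bdry J n (push (simplex_space J) f (Suc n) c) = push (simplex_space J) f n (simp_bdry J n c)"
proof -
  have face: "simplex_face J n i (restrict (f \<circ> \<sigma>) (points (simplex_space J (Suc n)))) = restrict (f \<circ> simplex_face J n i \<sigma>) (points (simplex_space J n))"
    if "i \<le> Suc n" for i \<sigma>
    unfolding simplex_face_def using face_points[OF that] by (auto simp: restrict_def fun_eq_iff)
  have gen: "simp_bdry J n (push (simplex_space J) f (Suc n) (frag_of \<sigma>)) = push (simplex_space J) f n (simp_bdry J n (frag_of \<sigma>))" for \<sigma>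
    unfolding push_of simp_bdry_of additive_frag_sum[OF push_additive] additive_frag_cmul[OF push_additive]
    by (rule sum.cong) (simp_all only: face atMost_iff)
  show ?thesis
    by (rule additive_frag_eq[where S = UNIV and g = "\<lambda>c. push (simplex_space J) f n (simp_bdry J n c)"
          and f = "\<lambda>c. simp_bdry J n (push (simplex_space J) f (Suc n) c)", OF _ _ gen])
      (simp_all add: additive_frag_comp simp_bdry_additive push_additive)
qed

definition simp_class :: "interval_kind \<Rightarrow> 'a cspace \<Rightarrow> 'a set \<Rightarrow> nat \<Rightarrow> 'a chain \<Rightarrow> 'a chain set" where
  "simp_class J X A n c = carrier (grp (simp_chains J (subspace_of X A)) n) #>\<^bsub>grp (simp_chains J X) n\<^esub> c"

text \<open>One quotient of a free complex without relations. The intersection with the empty set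
  gives the null generators the shape that they have in the presence of degenerate ones.\<close>

lemma simp_presentation:
  assumes "closure_pair X A"
  shows "presentation (\<lambda>n. gens (simplex_space J) n X) (\<lambda>n. gens (simplex_space J) n (subspace_of X A) \<union> (gens (simplex_space J) n X \<inter> {}))
    (simp_bdry J) (simp_rel_chains J X A) (simp_class J X A)"
    and "subgroup (carrier (grp (simp_chains J (subspace_of X A)) n)) (grp (simp_chains J X) n)"
proof -
  have base: "presentation (\<lambda>n. gens (simplex_space J) n X) (\<lambda>n. {}) (simp_bdry J) (simp_chains J X) (\<lambda>n c. c)"
  proof (rule presentation.intro)
    fix n and c :: "'a chain"
    show "comm_group (grp (simp_chains J X) n)" by (simp add: simp_chains_def abelian_free_Abelian_group)
    show "additive_frag (simp_bdry J n)" by (rule simp_bdry_additive)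
    show "(\<lambda>c. c) \<in> hom (free_Abelian_group (gens (simplex_space J) n X)) (grp (simp_chains J X) n)"
      by (simp add: simp_chains_def gens_simplex hom_def)
    show "carrier (grp (simp_chains J X) n) = (\<lambda>c. c) ` {c. supp c \<subseteq> gens (simplex_space J) n X}"
      by (auto simp: simp_chains_def gens_simplex)
    show "c = \<one>\<^bsub>grp (simp_chains J X) n\<^esub> \<longleftrightarrow> supp c \<subseteq> {}"
      by (simp add: simp_chains_def)
    show "supp (simp_bdry J n c) \<subseteq> gens (simplex_space J) n X" if "supp c \<subseteq> gens (simplex_space J) (Suc n) X"
      using that by (rule simp_bdry_gens)
    show "supp (simp_bdry J n c) \<subseteq> {}" if "supp c \<subseteq> {}"
      using that additive_frag_0[OF simp_bdry_additive, of J n] by simp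
    show "supp (simp_bdry J n (simp_bdry J (Suc n) c)) \<subseteq> {}"
      by (simp add: simp_bdry_bdry)
    show "bdry (simp_chains J X) n c = simp_bdry J n c" by (simp add: simp_chains_def simp_bdry_def)
  qed simp
  have sub: "gens (simplex_space J) n (subspace_of X A) \<subseteq> gens (simplex_space J) n X" for n
    using gens_subspace[where \<Delta> = "simplex_space J" and n = n and A = A and X = X, OF closure_space_simplex] assms
    by (simp add: closure_pair_def)
  have M: "carrier (grp (simp_chains J (subspace_of X A)) n) = (\<lambda>c. c) ` {c. supp c \<subseteq> gens (simplex_space J) n (subspace_of X A)}" for n
    by (auto simp: simp_chains_def gens_simplex)
  show "presentation (\<lambda>n. gens (simplex_space J) n X) (\<lambda>n. gens (simplex_space J) n (subspace_of X A) \<union> (gens (simplex_space J) n X \<inter> {}))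
    (simp_bdry J) (simp_rel_chains J X A) (simp_class J X A)"
    using presentation_quotient(1)[where SA = "\<lambda>n. gens (simplex_space J) n (subspace_of X A)"
        and M = "\<lambda>n. carrier (grp (simp_chains J (subspace_of X A)) n)", OF base sub simp_bdry_gens M]
    by (simp add: simp_rel_chains_def simp_class_def[abs_def])
  show "subgroup (carrier (grp (simp_chains J (subspace_of X A)) n)) (grp (simp_chains J X) n)"
    by (rule presentation_quotient(2)[where SA = "\<lambda>n. gens (simplex_space J) n (subspace_of X A)"
        and M = "\<lambda>n. carrier (grp (simp_chains J (subspace_of X A)) n)", OF base sub simp_bdry_gens M])
qed

lemma simp_objects:
  assumes "coefficients G"
  shows "singular_objects G (simplex_space J) (\<lambda>n. {}) (simp_bdry J) (simp_rel_chains J) (simp_class J)"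
  by (intro singular_objects.intro singular_objects_axioms.intro assms closure_space_simplex simplex_nonempty
      simp_presentation(1))

lemma simp_maps:
  fixes G :: "'g monoid"
  assumes "coefficients G"
  shows "singular_maps G (simplex_space J) (\<lambda>n. {}) (simp_bdry J) (simp_rel_chains J) (simp_class J)
    (\<lambda>n. {}) (simp_bdry J) (simp_rel_chains J) (simp_class J) (simp_rel_chain_map J :: 'b cspace \<Rightarrow> 'b set \<Rightarrow> ('a \<Rightarrow> 'b) \<Rightarrow> _)"
proof (intro singular_maps.intro singular_maps_axioms.intro simp_objects assms)
  fix X :: "'a cspace" and A and Y :: "'b cspace" and B f n and c :: "'a chain"
  assume f: "pair_map X A Y B f" and c: "supp c \<subseteq> gens (simplex_space J) n X"
  have p: "closure_pair X A" "closure_pair Y B" "ccont X Y f" using f by (simp_all add: pair_map_def)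
  have fr: "ccont (subspace_of X A) (subspace_of Y B) f" using pair_map_restrict[OF f] by (simp add: pair_map_def)
  have push: "simp_chain_map J f n = push (simplex_space J) f n" by (simp add: simp_chain_map_def push_def)
  have S: "supp (push (simplex_space J) f n c) \<subseteq> gens (simplex_space J) n Y" if "supp c \<subseteq> gens (simplex_space J) n X" for c
    using push_gens[where \<Delta> = "simplex_space J" and n = n, OF closure_space_simplex p(3) that] .
  have SA: "supp (push (simplex_space J) f n c) \<subseteq> gens (simplex_space J) n (subspace_of Y B)"
    if "supp c \<subseteq> gens (simplex_space J) n (subspace_of X A)" for c
    using push_gens[where \<Delta> = "simplex_space J" and n = n, OF closure_space_simplex fr that] .
  have "simp_rel_chain_map J Y B f n (simp_class J X A n c)
    = carrier (grp (simp_chains J (subspace_of Y B)) n) #>\<^bsub>grp (simp_chains J Y) n\<^esub> push (simplex_space J) f n c"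
    unfolding simp_rel_chain_map_def simp_class_def push
  proof (rule coset_map_coset[OF _ simp_presentation(2)[OF p(1)] _ simp_presentation(2)[OF p(2)]])
    show "push (simplex_space J) f n \<in> hom (grp (simp_chains J X) n) (grp (simp_chains J Y) n)"
      using S by (intro homI) (simp_all add: simp_chains_def gens_simplex additive_frag_add[OF push_additive])
    show "push (simplex_space J) f n ` carrier (grp (simp_chains J (subspace_of X A)) n) \<subseteq> carrier (grp (simp_chains J (subspace_of Y B)) n)"
      using SA by (auto simp: simp_chains_def gens_simplex)
  qed (use c in \<open>simp_all add: simp_chains_def abelian_free_Abelian_group gens_simplex\<close>)
  then show "simp_rel_chain_map J Y B f n (simp_class J X A n c) = simp_class J Y B n (push (simplex_space J) f n c)"
    by (simp add: simp_class_def)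
qed (rule simp_bdry_push)

text \<open>If some point has the whole model as its only neighbourhood, then every singular simplex or cube
  is contained in \<open>A\<close> or in \<open>B\<close> to begin with.\<close>

lemma (in singular_theory) excision_operators_focal:
  assumes focal: "\<And>n. \<exists>z\<in>points (\<Delta> n). \<forall>V. cnbhd (\<Delta> n) z V \<longrightarrow> V = points (\<Delta> n)"
  shows "excision_operators"
  unfolding excision_operators_def
proof (intro allI impI)
  fix X :: "'a cspace" and A B
  assume X: "closure_space X" and AB: "interior_cover X {A, B}"
  have sub: "A \<subseteq> points X" "B \<subseteq> points X" using AB unfolding interior_cover_def by blast+
  have pX: "closure_pair X {}" using X by (simp add: closure_pair_def)
  have small: "\<sigma> \<in> gens \<Delta> n (subspace_of X B) \<union> D.null X A n" if \<sigma>: "\<sigma> \<in> gens \<Delta> n X" for n \<sigma>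
  proof -
    obtain z where z: "z \<in> points (\<Delta> n)" "\<And>V. cnbhd (\<Delta> n) z V \<Longrightarrow> V = points (\<Delta> n)" using focal by blast
    have "ccont (\<Delta> n) X \<sigma>" using \<sigma> by (simp add: gens_def)
    then have "\<sigma> ` points (\<Delta> n) \<subseteq> A \<or> \<sigma> ` points (\<Delta> n) \<subseteq> B"
      using interior_cover_pullback[OF X AB D.\<Delta> _ z(1), of \<sigma>] z(2) by blast
    then show ?thesis
      using \<sigma> gens_subspace[where \<Delta> = \<Delta> and n = n, OF D.\<Delta> sub(1)] gens_subspace[where \<Delta> = \<Delta> and n = n, OF D.\<Delta> sub(2)]
      by auto
  qed
  interpret PX: presentation_dual "\<lambda>n. gens \<Delta> n X" "D.null X {}" b "Rel X {}" "Q X {}" G using pX by (rule D.dual)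
  \<comment> \<open>Since every generator is small, the zero deformation does.\<close>
  have "excision_operator X A B (\<lambda>n c. 0)"
    unfolding excision_operator_def
  proof (intro conjI allI impI)
    fix n and c :: "((nat \<Rightarrow> real) \<Rightarrow> 'a) \<Rightarrow>\<^sub>0 int" assume c: "supp c \<subseteq> gens \<Delta> n X"
    have "c - (b n 0 + (case n of 0 \<Rightarrow> 0 | Suc m \<Rightarrow> 0)) = c"
      by (cases n) (simp_all add: additive_frag_0[OF PX.b_additive])
    moreover have "supp c \<subseteq> gens \<Delta> n (subspace_of X B) \<union> D.null X A n" using c small by blast
    ultimately show "supp (c - (b n 0 + (case n of 0 \<Rightarrow> 0 | Suc m \<Rightarrow> 0)))
        \<subseteq> gens \<Delta> n (subspace_of X B) \<union> D.null X A n" by (simp only:)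
  qed simp_all
  then show "\<exists>E. excision_operator X A B E" by blast
qed

lemma (in singular_theory) excision_operator_subdivision:
  assumes "subdivision (\<lambda>n. gens \<Delta> n X) (\<lambda>n. gens \<Delta> n X \<inter> dg n) (\<lambda>n. gens \<Delta> n (subspace_of X B) \<union> D.null X A n) b Sd T"
  shows "\<exists>E. excision_operator X A B E"
proof -
  interpret S: subdivision "\<lambda>n. gens \<Delta> n X" "\<lambda>n. gens \<Delta> n X \<inter> dg n" "\<lambda>n. gens \<Delta> n (subspace_of X B) \<union> D.null X A n" b Sd T
    by fact
  have "excision_operator X A B S.contraction"
    unfolding excision_operator_def using S.contraction_additive S.contraction_S S.contraction_M S.retraction by blast
  then show ?thesis by blast
qed

text \<open>A map homotopic to the identity is a chain map: take the boundary of the homotopy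
  identity in degree \<open>Suc n\<close> and compare it with the identity at the boundary of
  \<open>c\<close>. Both defects lie in \<open>Z\<close>.\<close>

lemma subdivision_chain_map:
  assumes b: "\<And>n. additive_frag (b n)" and bb: "\<And>n c. b n (b (Suc n) c) = 0"
    and T: "\<And>n. additive_frag (T n)"
    and b_S: "\<And>n c. supp c \<subseteq> S (Suc n) \<Longrightarrow> supp (b n c) \<subseteq> S n"
    and b_Z: "\<And>n c. supp c \<subseteq> Z (Suc n) \<Longrightarrow> supp (b n c) \<subseteq> Z n"
    and htpy0: "\<And>c. supp c \<subseteq> S 0 \<Longrightarrow> supp (c - Sd 0 c - b 0 (T 0 c)) \<subseteq> Z 0"
    and htpy: "\<And>n c. supp c \<subseteq> S (Suc n) \<Longrightarrow>
      supp (c - Sd (Suc n) c - (b (Suc n) (T (Suc n) c) + T n (b n c))) \<subseteq> Z (Suc n)"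
    and c: "supp c \<subseteq> S (Suc n)"
  shows "supp (b n (Sd (Suc n) c) - Sd n (b n c)) \<subseteq> Z n"
proof -
  let ?r = "c - Sd (Suc n) c - (b (Suc n) (T (Suc n) c) + T n (b n c))"
  let ?s = "b n c - Sd n (b n c) - b n (T n (b n c))"
  have s: "supp ?s \<subseteq> Z n"
  proof (cases n)
    case 0
    then show ?thesis using htpy0[of "b n c"] b_S[OF c] by simp
  next
    case (Suc m)
    then show ?thesis
      using htpy[of "b n c" m] b_S[OF c] additive_frag_0[OF T] by (simp add: bb)
  qed
  have eq: "b n (Sd (Suc n) c) - Sd n (b n c) = ?s - b n ?r"
    by (simp add: additive_frag_diff[OF b] additive_frag_add[OF b] bb)
  show ?thesis unfolding eq by (rule keys_diff_subset[OF s b_Z[OF htpy[OF c]]])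
qed

section \<open>The prism operator\<close>

text \<open>The \<open>i\<close>-th simplex of the standard triangulation of the prism: vertices up
  to \<open>i\<close> go to the bottom, and each later vertex \<open>k\<close> goes to the vertex
  \<open>k - 1\<close> at the top.\<close>

definition prism_simplex ::
    "interval_kind \<Rightarrow> ('a \<times> real \<Rightarrow> 'b) \<Rightarrow> nat \<Rightarrow> nat \<Rightarrow> ((nat \<Rightarrow> real) \<Rightarrow> 'a) \<Rightarrow> (nat \<Rightarrow> real) \<Rightarrow> 'b" where
  "prism_simplex J h n i \<sigma> = (\<lambda>t\<in>points (simplex_space J (Suc n)). h (\<sigma> (degen i t), tail (Suc i) t))"

definition simp_prism :: "interval_kind \<Rightarrow> ('a \<times> real \<Rightarrow> 'b) \<Rightarrow> nat \<Rightarrow> 'a chain \<Rightarrow> 'b chain" where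
  "simp_prism J h n = frag_extend (\<lambda>\<sigma>. \<Sum>i\<le>n. frag_cmul ((-1) ^ i) (frag_of (prism_simplex J h n i \<sigma>)))"

lemma simp_prism_additive: "additive_frag (simp_prism J h n)"
  by (simp add: simp_prism_def)

lemma simp_prism_of: "simp_prism J h n (frag_of \<sigma>) = (\<Sum>i\<le>n. frag_cmul ((-1) ^ i) (frag_of (prism_simplex J h n i \<sigma>)))"
  unfolding simp_prism_def by (rule frag_extend_of)

lemma prism_simplex_gens:
  assumes X: "closure_space X" and h: "ccont (cprod X (interval_space J)) Y h"
    and \<sigma>: "\<sigma> \<in> gens (simplex_space J) n X" and i: "i \<le> n"
  shows "prism_simplex J h n i \<sigma> \<in> gens (simplex_space J) (Suc n) Y"
proof -
  have "ccont (simplex_space J (Suc n)) X (\<sigma> \<circ> degen i)"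
    using \<sigma> by (intro ccont_compose[OF ccont_degen[OF i]]) (simp add: gens_def)
  then have "ccont (simplex_space J (Suc n)) (cprod X (interval_space J)) (\<lambda>t. ((\<sigma> \<circ> degen i) t, tail (Suc i) t))"
    using ccont_pair[OF closure_space_simplex X closure_space_interval _ ccont_tail, of J "Suc n" "\<sigma> \<circ> degen i" "Suc i"] i
    by simp
  then have "ccont (simplex_space J (Suc n)) Y (h \<circ> (\<lambda>t. ((\<sigma> \<circ> degen i) t, tail (Suc i) t)))"
    using h by (rule ccont_compose)
  then have "ccont (simplex_space J (Suc n)) Y (prism_simplex J h n i \<sigma>)"
    unfolding prism_simplex_def by (rule ccont_cong[OF closure_space_simplex]) simp
  then show ?thesis by (simp add: gens_def prism_simplex_def)
qed

lemma degen_points: "i \<le> n \<Longrightarrow> t \<in> points (simplex_space J (Suc n)) \<Longrightarrow> degen i t \<in> points (simplex_space J n)"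
  using ccont_funcset[OF ccont_degen] .

lemma prism_face_less:
  assumes "j < i" "i \<le> Suc n"
  shows "simplex_face J (Suc n) j (prism_simplex J h (Suc n) i \<sigma>) = prism_simplex J h n (i - 1) (simplex_face J n j \<sigma>)"
  unfolding simplex_face_def[of J "Suc n"] prism_simplex_def[of J h n]
proof (rule restrict_ext)
  fix t assume t: "t \<in> points (simplex_space J (Suc n))"
  have "simplical_face j t \<in> points (simplex_space J (Suc (Suc n)))" using assms face_points[OF _ t] by simp
  moreover have "degen (i - 1) t \<in> points (simplex_space J n)" using assms degen_points[OF _ t, of "i - 1"] by simp
  ultimately show "(prism_simplex J h (Suc n) i \<sigma> \<circ> simplical_face j) t
      = h (simplex_face J n j \<sigma> (degen (i - 1) t), tail (Suc (i - 1)) t)"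
    using assms by (simp add: prism_simplex_def simplex_face_def degen_face_less tail_face)
qed

lemma prism_face_greater:
  assumes "Suc i < j" "j \<le> Suc (Suc n)"
  shows "simplex_face J (Suc n) j (prism_simplex J h (Suc n) i \<sigma>) = prism_simplex J h n i (simplex_face J n (j - 1) \<sigma>)"
  unfolding simplex_face_def[of J "Suc n"] prism_simplex_def[of J h n]
proof (rule restrict_ext)
  fix t assume t: "t \<in> points (simplex_space J (Suc n))"
  have "simplical_face j t \<in> points (simplex_space J (Suc (Suc n)))" using assms face_points[OF _ t] by simp
  moreover have "degen i t \<in> points (simplex_space J n)" using assms degen_points[OF _ t, of i] by simp
  ultimately show "(prism_simplex J h (Suc n) i \<sigma> \<circ> simplical_face j) t
      = h (simplex_face J n (j - 1) \<sigma> (degen i t), tail (Suc i) t)"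
    using assms by (simp add: prism_simplex_def simplex_face_def degen_face_greater tail_face)
qed

text \<open>These two faces are walls inside the prism. The wall with threshold \<open>Suc i\<close>
  also occurs in the next prism simplex, so inner walls cancel.\<close>

lemma prism_face_eq:
  assumes "i \<le> n"
  shows "simplex_face J n i (prism_simplex J h n i \<sigma>) = (\<lambda>t\<in>points (simplex_space J n). h (\<sigma> t, tail i t))"
    and "simplex_face J n (Suc i) (prism_simplex J h n i \<sigma>) = (\<lambda>t\<in>points (simplex_space J n). h (\<sigma> t, tail (Suc i) t))"
  unfolding simplex_face_def prism_simplex_def
  using face_points[of i n _ J] face_points[of "Suc i" n _ J] assms
  by (auto simp: restrict_def fun_eq_iff degen_face_eq tail_face)

text \<open>The coordinates of a point in any of the models add up to one.\<close>

lemma tail_end: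
  assumes "t \<in> points (simplex_space J n)"
  shows "tail (Suc n) t = 0"
proof (cases "J = Unit_interval")
  case True
  then show ?thesis using assms by (simp add: points_simplex standard_simplex_def tail_def lessThan_Suc_atMost)
next
  case False
  then obtain k where "k \<le> n" "t = vertex k" using assms by (auto simp: points_simplex)
  then show ?thesis by (simp add: tail_vertex)
qed

text \<open>The outermost walls survive. Threshold 0 gives the constant parameter 1, hence
  \<open>g\<close>; threshold \<open>Suc n\<close> gives the parameter 0, hence
  \<open>f\<close>.\<close>

lemma prism_boundary_of:
  assumes \<sigma>: "\<sigma> \<in> gens (simplex_space J) n X"
    and h: "\<And>x. x \<in> points X \<Longrightarrow> h (x, 0) = f x \<and> h (x, 1) = g x"
  shows "simp_bdry J n (simp_prism J h n (frag_of \<sigma>)) = push (simplex_space J) g n (frag_of \<sigma>) - push (simplex_space J) f n (frag_of \<sigma>)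
    - (case n of 0 \<Rightarrow> 0 | Suc m \<Rightarrow> simp_prism J h m (simp_bdry J m (frag_of \<sigma>)))"
proof -
  define e where "e k = frag_of (\<lambda>t\<in>points (simplex_space J n). h (\<sigma> t, tail k t))" for k
  let ?A = "\<lambda>j i. frag_of (simplex_face J n j (prism_simplex J h n i \<sigma>))"
  let ?B = "\<lambda>j i. frag_of (prism_simplex J h (n - 1) i (simplex_face J (n - 1) j \<sigma>))"
  have "simp_bdry J n (simp_prism J h n (frag_of \<sigma>)) = (\<Sum>i\<le>n. \<Sum>j\<le>Suc n. frag_cmul ((-1) ^ (i + j)) (?A j i))"
    by (simp only: simp_bdry_of simp_prism_of additive_frag_sum[OF simp_bdry_additive] additive_frag_cmul[OF simp_bdry_additive]
          frag_cmul_sum frag_cmul_cmul power_add)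
  also have "\<dots> = e 0 - e (Suc n) - (\<Sum>j\<le>n. \<Sum>i<n. frag_cmul ((-1) ^ (i + j)) (?B j i))"
  proof (rule prism_double_sum)
    fix i j
    show "?A j i = ?B j (i - 1)" if "j < i" "i \<le> n"
      using that prism_face_less[of j i "n - 1" J h \<sigma>] by (cases n) simp_all
    show "?A j i = ?B (j - 1) i" if "Suc i < j" "j \<le> Suc n"
      using that prism_face_greater[of i j "n - 1" J h \<sigma>] by (cases n) simp_all
    show "?A i i = e i" "?A (Suc i) i = e (Suc i)" if "i \<le> n"
      unfolding e_def prism_face_eq[OF that] by simp_all
  qed
  also have "(\<Sum>j\<le>n. \<Sum>i<n. frag_cmul ((-1) ^ (i + j)) (?B j i))
      = (case n of 0 \<Rightarrow> 0 | Suc m \<Rightarrow> simp_prism J h m (simp_bdry J m (frag_of \<sigma>)))"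
  proof (cases n)
    case (Suc m)
    have "simp_prism J h m (simp_bdry J m (frag_of \<sigma>)) = (\<Sum>j\<le>Suc m. \<Sum>i\<le>m. frag_cmul ((-1) ^ j * (-1) ^ i) (frag_of (prism_simplex J h m i (simplex_face J m j \<sigma>))))"
      by (simp only: simp_bdry_of simp_prism_of additive_frag_sum[OF simp_prism_additive] additive_frag_cmul[OF simp_prism_additive]
          frag_cmul_sum frag_cmul_cmul)
    then show ?thesis by (simp only: Suc lessThan_Suc_atMost power_add nat.case diff_Suc_1 mult.commute)
  qed simp
  finally have bd: "simp_bdry J n (simp_prism J h n (frag_of \<sigma>)) = e 0 - e (Suc n)
    - (case n of 0 \<Rightarrow> 0 | Suc m \<Rightarrow> simp_prism J h m (simp_bdry J m (frag_of \<sigma>)))" .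
  have e: "e 0 = push (simplex_space J) g n (frag_of \<sigma>)" "e (Suc n) = push (simplex_space J) f n (frag_of \<sigma>)"
  proof -
    have "\<sigma> t \<in> points X" if "t \<in> points (simplex_space J n)" for t
      using \<sigma> that by (auto simp: gens_def dest: ccont_funcset)
    then show "e 0 = push (simplex_space J) g n (frag_of \<sigma>)" "e (Suc n) = push (simplex_space J) f n (frag_of \<sigma>)"
      using h tail_end[of _ J n] unfolding e_def push_of
      by (auto intro!: arg_cong[where f = frag_of] restrict_ext simp: tail_def[of 0])
  qed
  show ?thesis using bd unfolding e .
qed

lemma simp_homotopy_operators:
  assumes "coefficients G"
  shows "singular_maps.homotopy_operators (simplex_space J) (\<lambda>n. {} :: ((nat \<Rightarrow> real) \<Rightarrow> 'a) set) (simp_bdry J)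
    (\<lambda>n. {} :: ((nat \<Rightarrow> real) \<Rightarrow> 'b) set) (simp_bdry J) J"
proof -
  interpret singular_maps G "simplex_space J" "\<lambda>n. {} :: ((nat \<Rightarrow> real) \<Rightarrow> 'a) set" "simp_bdry J" "simp_rel_chains J" "simp_class J"
    "\<lambda>n. {} :: ((nat \<Rightarrow> real) \<Rightarrow> 'b) set" "simp_bdry J" "simp_rel_chains J" "simp_class J" "simp_rel_chain_map J"
    using assms by (rule simp_maps)
  show ?thesis
    unfolding homotopy_operators_def
  proof (intro allI impI)
    fix X :: "'a cspace" and Y :: "'b cspace" and f g h
    assume X: "closure_space X" and h: "ccont (cprod X (interval_space J)) Y h" "\<forall>x\<in>points X. h (x, 0) = f x \<and> h (x, 1) = g x"
    \<comment> \<open>The boundary of the prism is top minus bottom, whereas the homotopy operator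
      is oriented from \<open>f\<close> to \<open>g\<close>; hence the sign.\<close>
    let ?P = "\<lambda>n c. - simp_prism J h n c"
    have P: "additive_frag (?P n)" for n
      by (simp add: additive_frag_def additive_frag_diff[OF simp_prism_additive])
    have "homotopy_operator X Y f g ?P"
      unfolding homotopy_operator_def
    proof (intro conjI allI impI)
      fix n and c :: "'a chain"
      show "additive_frag (?P n)" by (rule P)
      show "supp (?P n c) \<subseteq> gens (simplex_space J) (Suc n) Y" if c: "supp c \<subseteq> gens (simplex_space J) n X"
        unfolding keys_minus simp_prism_def
      proof (rule keys_frag_extend_subset[OF _ c])
        fix \<sigma> assume "\<sigma> \<in> gens (simplex_space J) n X"
        then show "supp (\<Sum>i\<le>n. frag_cmul ((-1) ^ i) (frag_of (prism_simplex J h n i \<sigma>))) \<subseteq> gens (simplex_space J) (Suc n) Y"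
          by (intro keys_sum_subset keys_cmul_subset keys_frag_of_subset prism_simplex_gens[OF X h(1)]) auto
      qed
      show "supp (?P n c) \<subseteq> {}" if "supp c \<subseteq> gens (simplex_space J) n X \<inter> {}"
        using that additive_frag_0[OF P] by simp
    next
      fix c :: "'a chain" assume c: "supp c \<subseteq> gens (simplex_space J) 0 X"
      show "push (simplex_space J) f 0 c - push (simplex_space J) g 0 c = simp_bdry J 0 (?P 0 c)"
      proof (rule additive_frag_eq[OF _ _ _ c])
        show "additive_frag (\<lambda>c. push (simplex_space J) f 0 c - push (simplex_space J) g 0 c)"
          by (simp add: additive_frag_def additive_frag_diff[OF push_additive])
        show "additive_frag (\<lambda>c. simp_bdry J 0 (?P 0 c))" by (rule additive_frag_comp[OF simp_bdry_additive P])
        fix \<sigma> assume "\<sigma> \<in> gens (simplex_space J) 0 X"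
        then show "push (simplex_space J) f 0 (frag_of \<sigma>) - push (simplex_space J) g 0 (frag_of \<sigma>) = simp_bdry J 0 (?P 0 (frag_of \<sigma>))"
          using prism_boundary_of[of \<sigma> J 0 X h f g] h(2) by (simp add: additive_frag_minus[OF simp_bdry_additive])
      qed
    next
      fix n and c :: "'a chain" assume c: "supp c \<subseteq> gens (simplex_space J) (Suc n) X"
      show "push (simplex_space J) f (Suc n) c - push (simplex_space J) g (Suc n) c = simp_bdry J (Suc n) (?P (Suc n) c) + ?P n (simp_bdry J n c)"
      proof (rule additive_frag_eq[OF _ _ _ c])
        show "additive_frag (\<lambda>c. push (simplex_space J) f (Suc n) c - push (simplex_space J) g (Suc n) c)"
          by (simp add: additive_frag_def additive_frag_diff[OF push_additive])
        show "additive_frag (\<lambda>c. simp_bdry J (Suc n) (?P (Suc n) c) + ?P n (simp_bdry J n c))"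
          by (simp add: additive_frag_def additive_frag_diff[OF simp_bdry_additive] additive_frag_minus[OF simp_bdry_additive]
              additive_frag_diff[OF simp_prism_additive])
        fix \<sigma> assume "\<sigma> \<in> gens (simplex_space J) (Suc n) X"
        then show "push (simplex_space J) f (Suc n) (frag_of \<sigma>) - push (simplex_space J) g (Suc n) (frag_of \<sigma>)
            = simp_bdry J (Suc n) (?P (Suc n) (frag_of \<sigma>)) + ?P n (simp_bdry J n (frag_of \<sigma>))"
          using prism_boundary_of[of \<sigma> J "Suc n" X h f g] h(2) by (simp add: additive_frag_minus[OF simp_bdry_additive])
      qed
    qed
    then show "\<exists>P. homotopy_operator X Y f g P" by (rule exI[of _ ?P])
  qed
qed

section \<open>Excision and dimension for simplices\<close>

text \<open>For \<open>J_plus\<close> the focal point is the last vertex, which is in the closure of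
  every vertex; in the indiscrete model any vertex serves.\<close>

lemma simplex_focal:
  assumes "J \<noteq> Unit_interval"
  shows "\<exists>z\<in>points (simplex_space J n). \<forall>V. cnbhd (simplex_space J n) z V \<longrightarrow> V = points (simplex_space J n)"
proof (cases J)
  case J_indiscrete
  have "V = points (simplex_space J n)" if "cnbhd (simplex_space J n) (vertex 0) V" for V
    using that J_indiscrete by (auto simp: cnbhd_def cinterior_def split: if_splits)
  moreover have "vertex 0 \<in> points (simplex_space J n)" using J_indiscrete by simp
  ultimately show ?thesis by blast
next
  case J_plus
  have "V = points (simplex_space J n)" if V: "cnbhd (simplex_space J n) (vertex n) V" for V
  proof (rule ccontr)
    assume "V \<noteq> points (simplex_space J n)"
    then obtain i where "i \<le> n" "vertex i \<in> points (simplex_space J n) - V"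
      using V J_plus by (auto simp: cnbhd_def)
    then have "vertex n \<in> clos (simplex_space J n) (points (simplex_space J n) - V)"
      using J_plus by auto
    then show False using V by (simp add: cnbhd_def cinterior_def)
  qed
  moreover have "vertex n \<in> points (simplex_space J n)" using J_plus by simp
  ultimately show ?thesis by blast
qed (use assms in simp)

abbreviation id_simplex :: "nat \<Rightarrow> (nat \<Rightarrow> real) \<Rightarrow> nat \<Rightarrow> real" where
  "id_simplex p \<equiv> restrict id (standard_simplex p)"

text \<open>Identifies push-forward with the operation of the homology library. Barycentric
  subdivision is defined there for topological spaces; it is applied to the identity simplex of the
  model only, and the result is pushed along \<sigma> into a closure space.\<close>

lemma push_chain_map: "push (simplex_space Unit_interval) f p = chain_map p f"
  by (simp add: fun_eq_iff push_def chain_map_def simplex_map_def topspace_standard_simplex o_def)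

lemma simp_bdry_chain_boundary: "simp_bdry Unit_interval n = chain_boundary (Suc n)"
  by (simp add: fun_eq_iff simp_bdry_def chain_boundary_def simplex_face_def singular_face_def topspace_standard_simplex)

lemma gens_topology: "gens (simplex_space Unit_interval) p (cspace_of_topology X) = singular_simplex_set p X"
  by (auto simp: gens_def singular_simplex_def topspace_standard_simplex ccont_continuous_map)

lemma chain_map_gens:
  assumes "singular_chain q (simplex_top p) c" "\<sigma> \<in> gens (simplex_space Unit_interval) p X"
  shows "supp (chain_map q \<sigma> c) \<subseteq> gens (simplex_space Unit_interval) q X"
proof -
  have "supp c \<subseteq> gens (simplex_space Unit_interval) q (simplex_space Unit_interval p)"
    using assms(1) gens_topology[of q "simplex_top p"] by (simp add: singular_chain_def)
  then show ?thesis
    using assms(2) unfolding push_chain_map[symmetric]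
    by (intro push_gens[where \<Delta> = "simplex_space Unit_interval" and n = q, OF closure_space_simplex]) (simp_all add: gens_def)
qed

lemma chain_map_id_simplex:
  assumes "\<sigma> \<in> extensional (standard_simplex p)"
  shows "chain_map p \<sigma> (frag_of (id_simplex p)) = frag_of \<sigma>"
proof -
  have "simplex_map p \<sigma> (id_simplex p) = \<sigma>"
    unfolding simplex_map_def using assms by (intro extensionalityI[of _ "standard_simplex p"]) auto
  then show ?thesis by simp
qed

text \<open>The homotopy \<open>subd\<close> of the identity simplex, transported along \<sigma>.
  The boundary of \<open>subd\<close> begins with subdivision minus identity, and the sign turns
  this around.\<close>

definition subdivision_homotopy :: "nat \<Rightarrow> 'a chain \<Rightarrow> 'a chain" where
  "subdivision_homotopy p = frag_extend (\<lambda>\<sigma>. - chain_map (Suc p) \<sigma> (subd p (frag_of (id_simplex p))))"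

lemma subd_singular: "singular_chain (Suc p) (simplex_top p) (subd p (frag_of (id_simplex p)))"
  by (intro simplicial_imp_singular_chain chain_homotopic_simplicial_subdivision2) simp

lemma simplicial_subdivision_singular: "singular_chain p (simplex_top p) (simplicial_subdivision p (frag_of (id_simplex p)))"
  by (intro simplicial_imp_singular_chain simplicial_chain_simplicial_subdivision) simp

text \<open>A face of the identity simplex is an affine map from the smaller standard simplex, and
  \<open>subd\<close> is natural for affine maps. Composition with \<sigma> then gives the homotopy
  of the face of \<sigma>.\<close>

lemma subd_face:
  assumes "k \<le> Suc m"
  shows "chain_map (Suc m) \<sigma> (subd m (frag_of (singular_face (Suc m) k (id_simplex (Suc m)))))
    = chain_map (Suc m) (singular_face (Suc m) k \<sigma>) (subd m (frag_of (id_simplex m)))"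
proof -
  let ?g = "singular_face (Suc m) k (id_simplex (Suc m))"
  have g: "simplicial_simplex m (standard_simplex (Suc m)) ?g"
    using simplicial_simplex_singular_face[of "Suc m" "standard_simplex (Suc m)" "id_simplex (Suc m)" k] assms by simp
  have "simplex_map m ?g (id_simplex m) = ?g"
    by (auto simp: simplex_map_def singular_face_def restrict_def fun_eq_iff)
  then have "subd m (frag_of ?g) = subd m (chain_map m ?g (frag_of (id_simplex m)))" by simp
  also have "\<dots> = chain_map (Suc m) ?g (subd m (frag_of (id_simplex m)))"
    using chain_homotopic_simplicial_subdivision1[OF _ g, of m "frag_of (id_simplex m)"] by simp
  finally have "chain_map (Suc m) \<sigma> (subd m (frag_of ?g)) = chain_map (Suc m) (\<sigma> \<circ> ?g) (subd m (frag_of (id_simplex m)))"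
    by (simp add: chain_map_compose)
  also have "\<dots> = chain_map (Suc m) (singular_face (Suc m) k \<sigma>) (subd m (frag_of (id_simplex m)))"
  proof (rule chain_map_eq[OF subd_singular])
    fix x assume x: "x \<in> topspace (simplex_top m)"
    then have "simplical_face k x \<in> standard_simplex (Suc m)"
      using simplical_face_in_standard_simplex[of "Suc m" k x] assms by (simp add: topspace_standard_simplex)
    then show "(\<sigma> \<circ> ?g) x = singular_face (Suc m) k \<sigma> x"
      using x by (simp add: singular_face_def topspace_standard_simplex)
  qed
  finally show ?thesis .
qed

lemma frag_cmul_minus: "frag_cmul k (- c) = - frag_cmul k c"
  by (rule poly_mapping_eqI) simp

lemma subd_sum: "subd p (sum f I) = (\<Sum>i\<in>I. subd p (f i))"
  by (simp add: subd_power_sum o_def)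

lemma subdivision_homotopy_of:
  "subdivision_homotopy p (frag_of \<sigma>) = - chain_map (Suc p) \<sigma> (subd p (frag_of (id_simplex p)))"
  unfolding subdivision_homotopy_def by (rule frag_extend_of)

lemma subdivision_homotopy_additive: "additive_frag (subdivision_homotopy p)"
  by (simp add: subdivision_homotopy_def)

lemma chain_map_additive: "additive_frag (chain_map p f)"
  by (simp add: additive_frag_def chain_map_diff)

lemma subdivision_additive: "additive_frag (singular_subdivision p)"
  by (simp add: additive_frag_def singular_subdivision_diff)

lemma subdivision_of: "singular_subdivision p (frag_of \<sigma>) = chain_map p \<sigma> (simplicial_subdivision p (frag_of (id_simplex p)))"
  unfolding singular_subdivision_def by (rule frag_extend_of)

lemma boundary_subdivision_homotopy:
  assumes "\<sigma> \<in> extensional (standard_simplex p)"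
  shows "chain_boundary (Suc p) (subdivision_homotopy p (frag_of \<sigma>)) = frag_of \<sigma> - singular_subdivision p (frag_of \<sigma>)
    - (case p of 0 \<Rightarrow> 0 | Suc m \<Rightarrow> subdivision_homotopy m (chain_boundary p (frag_of \<sigma>)))"
proof -
  have "chain_boundary (Suc p) (subdivision_homotopy p (frag_of \<sigma>))
      = - chain_map p \<sigma> (chain_boundary (Suc p) (subd p (frag_of (id_simplex p))))"
    by (simp add: subdivision_homotopy_of chain_boundary_minus chain_boundary_chain_map[OF subd_singular])
  also have "chain_boundary (Suc p) (subd p (frag_of (id_simplex p)))
      = simplicial_subdivision p (frag_of (id_simplex p)) - frag_of (id_simplex p)
        - subd (p - Suc 0) (chain_boundary p (frag_of (id_simplex p)))"
    by (rule chain_homotopic_simplicial_subdivision3[of p p]) simp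
  also have "chain_map p \<sigma> \<dots> = singular_subdivision p (frag_of \<sigma>) - frag_of \<sigma>
        - chain_map p \<sigma> (subd (p - Suc 0) (chain_boundary p (frag_of (id_simplex p))))"
    by (simp only: chain_map_diff subdivision_of chain_map_id_simplex[OF assms])
  \<comment> \<open>Expand the boundary of the identity simplex into faces and move each of them
    over to \<sigma> by naturality; degree zero has no such term.\<close>
  also have "chain_map p \<sigma> (subd (p - Suc 0) (chain_boundary p (frag_of (id_simplex p))))
      = - (case p of 0 \<Rightarrow> 0 | Suc m \<Rightarrow> subdivision_homotopy m (chain_boundary p (frag_of \<sigma>)))"
  proof (cases p)
    case (Suc m)
    have "chain_map (Suc m) \<sigma> (subd m (chain_boundary (Suc m) (frag_of (id_simplex (Suc m)))))
        = (\<Sum>k\<le>Suc m. frag_cmul ((-1) ^ k) (chain_map (Suc m) \<sigma> (subd m (frag_of (singular_face (Suc m) k (id_simplex (Suc m)))))))"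
      by (simp only: chain_boundary_of if_False nat.distinct subd_sum subd_power_uminus
          additive_frag_sum[OF chain_map_additive] chain_map_cmul)
    also have "\<dots> = (\<Sum>k\<le>Suc m. frag_cmul ((-1) ^ k) (chain_map (Suc m) (singular_face (Suc m) k \<sigma>) (subd m (frag_of (id_simplex m)))))"
      by (rule sum.cong[OF refl]) (simp only: subd_face atMost_iff)
    also have "\<dots> = - subdivision_homotopy m (chain_boundary (Suc m) (frag_of \<sigma>))"
      by (simp only: chain_boundary_of if_False nat.distinct additive_frag_sum[OF subdivision_homotopy_additive]
          additive_frag_cmul[OF subdivision_homotopy_additive] subdivision_homotopy_of frag_cmul_minus sum_negf minus_minus)
    finally show ?thesis by (simp add: Suc)
  qed simp
  finally show ?thesis by (simp add: algebra_simps)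
qed

lemma subdivision_power_chain_map:
  assumes c: "singular_chain p X c"
  shows "singular_chain p X ((singular_subdivision p ^^ m) c)"
    and "(singular_subdivision p ^^ m) (chain_map p g c) = chain_map p g ((singular_subdivision p ^^ m) c)"
proof -
  show *: "singular_chain p X ((singular_subdivision p ^^ m) c)" for m
    by (induction m) (simp_all add: c singular_chain_singular_subdivision)
  show "(singular_subdivision p ^^ m) (chain_map p g c) = chain_map p g ((singular_subdivision p ^^ m) c)"
    by (induction m) (simp_all add: naturality_singular_subdivision[OF *])
qed

text \<open>The Lebesgue number argument is carried out for the identity simplex of the compact
  model. Naturality of the subdivision transfers the number found there to \<sigma>.\<close>

lemma simplex_small:
  assumes X: "closure_space X" and AB: "interior_cover X {A, B}"
    and \<sigma>: "\<sigma> \<in> gens (simplex_space Unit_interval) p X"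
  shows "\<exists>m. supp ((singular_subdivision p ^^ m) (frag_of \<sigma>))
    \<subseteq> gens (simplex_space Unit_interval) p (subspace_of X B) \<union> gens (simplex_space Unit_interval) p (subspace_of X A)"
proof -
  let ?I = "Unit_interval"
  have sub: "A \<subseteq> points X" "B \<subseteq> points X" using AB unfolding interior_cover_def by blast+
  have c\<sigma>: "ccont (simplex_space ?I p) X \<sigma>" and e\<sigma>: "\<sigma> \<in> extensional (standard_simplex p)"
    using \<sigma> by (simp_all add: gens_def topspace_standard_simplex)
  \<comment> \<open>Interiors in the model: they are open and cover it, although \<open>A\<close>
    and \<open>B\<close> may fail to be open in \<open>X\<close>.\<close>
  let ?V = "\<lambda>C. simplex_top p interior_of {w \<in> standard_simplex p. \<sigma> w \<in> C}"
  have cover: "topspace (simplex_top p) \<subseteq> \<Union>{?V A, ?V B}"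
  proof
    fix z assume "z \<in> topspace (simplex_top p)"
    then have "z \<in> points (simplex_space ?I p)" by simp
    then show "z \<in> \<Union>{?V A, ?V B}"
      using interior_cover_pullback[OF X AB closure_space_simplex c\<sigma>, of z]
      by (auto simp: cnbhd_topology topspace_standard_simplex)
  qed
  have \<iota>: "singular_chain p (simplex_top p) (frag_of (id_simplex p))"
    by (intro simplicial_imp_singular_chain) simp
  have op: "openin (simplex_top p) U" if "U \<in> {?V A, ?V B}" for U using that by auto
  obtain n where n: "\<forall>f \<in> supp ((singular_subdivision p ^^ n) (frag_of (id_simplex p))).
      \<exists>V \<in> {?V A, ?V B}. f \<in> standard_simplex p \<rightarrow> V"
  proof (rule sufficient_iterated_singular_subdivision_exists[OF op cover \<iota>])
    fix n assume "\<And>m f. \<lbrakk>n \<le> m; f \<in> supp ((singular_subdivision p ^^ m) (frag_of (id_simplex p)))\<rbrakk>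
      \<Longrightarrow> \<exists>V \<in> {?V A, ?V B}. f \<in> standard_simplex p \<rightarrow> V"
    from this[OF order_refl] show thesis by (intro that ballI)
  qed
  let ?c = "(singular_subdivision p ^^ n) (frag_of (id_simplex p))"
  have "(singular_subdivision p ^^ n) (frag_of \<sigma>) = chain_map p \<sigma> ?c"
    using subdivision_power_chain_map(2)[OF \<iota>, of n \<sigma>] chain_map_id_simplex[OF e\<sigma>] by simp
  moreover have "supp (chain_map p \<sigma> ?c)
    \<subseteq> gens (simplex_space ?I) p (subspace_of X B) \<union> gens (simplex_space ?I) p (subspace_of X A)"
    unfolding chain_map_def
  proof (rule keys_frag_extend_subset)
    show "supp ?c \<subseteq> supp ?c" ..
    fix f assume f: "f \<in> supp ?c"
    have "singular_chain p (simplex_top p) (frag_of f)"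
      using subdivision_power_chain_map(1)[OF \<iota>, of n] f by (auto simp: singular_chain_def)
    then have g: "simplex_map p \<sigma> f \<in> gens (simplex_space ?I) p X"
      using chain_map_gens[OF _ \<sigma>, of p "frag_of f"] by simp
    obtain C where C: "C \<in> {A, B}" "f \<in> standard_simplex p \<rightarrow> ?V C" using bspec[OF n f] by auto
    have "simplex_map p \<sigma> f ` standard_simplex p \<subseteq> C"
      using C(2) interior_of_subset[of "simplex_top p" "{w \<in> standard_simplex p. \<sigma> w \<in> C}"]
      by (auto simp: simplex_map_def)
    then have "simplex_map p \<sigma> f \<in> gens (simplex_space ?I) p (subspace_of X C)"
      using g C(1) sub gens_subspace[where \<Delta> = "simplex_space ?I" and n = p and A = C and X = X, OF closure_space_simplex]
      by (auto simp: topspace_standard_simplex)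
    then show "supp ((frag_of \<circ> simplex_map p \<sigma>) f)
      \<subseteq> gens (simplex_space ?I) p (subspace_of X B) \<union> gens (simplex_space ?I) p (subspace_of X A)"
      using C(1) by auto
  qed
  ultimately show ?thesis by (intro exI[of _ n]) (simp only:)
qed

lemma keys_split_subset:
  assumes f: "additive_frag f"
    and "\<And>c. supp c \<subseteq> S \<Longrightarrow> supp (f c) \<subseteq> S'"
    and "\<And>c. supp c \<subseteq> T \<Longrightarrow> supp (f c) \<subseteq> T'"
    and c: "supp c \<subseteq> S \<union> T"
  shows "supp (f c) \<subseteq> S' \<union> T'"
proof -
  obtain d e where de: "supp d \<subseteq> S" "supp e \<subseteq> T" "d + e = c"
    using frag_split[OF c] .
  have "supp (f d + f e) \<subseteq> S' \<union> T'"
    using assms(2)[OF de(1)] assms(3)[OF de(2)] by (intro keys_add_subset) blast+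
  then show ?thesis using additive_frag_add[OF f, of d e] de(3) by simp
qed

lemma simp_excision_operators:
  fixes G :: "'g monoid"
  assumes "coefficients G"
  shows "singular_theory.excision_operators (simplex_space J) (\<lambda>n. {} :: ((nat \<Rightarrow> real) \<Rightarrow> 'a) set) (simp_bdry J)"
proof -
  interpret singular_theory G "simplex_space J" "\<lambda>n. {} :: ((nat \<Rightarrow> real) \<Rightarrow> 'a) set" "simp_bdry J" "simp_rel_chains J" "simp_class J"
    "simp_rel_chain_map J"
    using simp_maps[OF assms] by (rule singular_theory.intro)
  show ?thesis
  proof (cases "J = Unit_interval")
    case False
    then show ?thesis by (intro excision_operators_focal simplex_focal)
  next
    case J: True
    show ?thesis
      unfolding excision_operators_def
    proof (intro allI impI)
      fix X :: "'a cspace" and A B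
      assume X: "closure_space X" and AB: "interior_cover X {A, B}"
      let ?g = "\<lambda>n X. gens (simplex_space J) n (X :: 'a cspace)"
      have Sd: "supp (singular_subdivision n c) \<subseteq> ?g n Y" if "supp c \<subseteq> ?g n Y" for n c Y
        unfolding singular_subdivision_def
        by (rule keys_frag_extend_subset[OF _ that]) (use chain_map_gens[OF simplicial_subdivision_singular] J in simp)
      have T: "supp (subdivision_homotopy n c) \<subseteq> ?g (Suc n) Y" if "supp c \<subseteq> ?g n Y" for n c Y
        unfolding subdivision_homotopy_def
        by (rule keys_frag_extend_subset[OF _ that]) (use chain_map_gens[OF subd_singular] J in simp)
      have sub: "A \<subseteq> points X" "B \<subseteq> points X" using AB unfolding interior_cover_def by blast+
      have b: "(simp_bdry J n :: 'a chain \<Rightarrow> 'a chain) = chain_boundary (Suc n)" for n using J simp_bdry_chain_boundary by simp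
      have htpy_gen: "c - singular_subdivision n c - (simp_bdry J n (subdivision_homotopy n c)
          + (case n of 0 \<Rightarrow> 0 | Suc m \<Rightarrow> subdivision_homotopy m (simp_bdry J m c))) = 0"
        if c: "supp c \<subseteq> ?g n X" for n c
      proof (rule additive_frag_eq[where g = "\<lambda>c. 0", OF _ _ _ c])
        show "additive_frag (\<lambda>c. c - singular_subdivision n c - (simp_bdry J n (subdivision_homotopy n c)
          + (case n of 0 \<Rightarrow> 0 | Suc m \<Rightarrow> subdivision_homotopy m (simp_bdry J m c))))"
          by (cases n) (simp_all add: additive_frag_def additive_frag_diff[OF subdivision_additive]
              additive_frag_diff[OF subdivision_homotopy_additive] additive_frag_diff[OF simp_bdry_additive])
        fix \<sigma> assume "\<sigma> \<in> ?g n X"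
        then have "\<sigma> \<in> extensional (standard_simplex n)" using J by (simp add: gens_def topspace_standard_simplex)
        then show "frag_of \<sigma> - singular_subdivision n (frag_of \<sigma>) - (simp_bdry J n (subdivision_homotopy n (frag_of \<sigma>))
          + (case n of 0 \<Rightarrow> 0 | Suc m \<Rightarrow> subdivision_homotopy m (simp_bdry J m (frag_of \<sigma>)))) = 0"
          using boundary_subdivision_homotopy[of \<sigma> n] b by (cases n) simp_all
      qed simp
      have htpy0: "supp (c - singular_subdivision 0 c - simp_bdry J 0 (subdivision_homotopy 0 c)) \<subseteq> ?g 0 X \<inter> {}"
        if "supp c \<subseteq> ?g 0 X" for c
        using htpy_gen[OF that] by simp
      have htpyS: "supp (c - singular_subdivision (Suc n) c - (simp_bdry J (Suc n) (subdivision_homotopy (Suc n) c)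
          + subdivision_homotopy n (simp_bdry J n c))) \<subseteq> ?g (Suc n) X \<inter> {}"
        if "supp c \<subseteq> ?g (Suc n) X" for n c
        using htpy_gen[OF that] by simp
      \<comment> \<open>There are no degenerate simplices, so both homotopy identities hold exactly
        and the set \<open>Z\<close> is empty.\<close>
      have "subdivision (\<lambda>n. ?g n X) (\<lambda>n. ?g n X \<inter> {}) (\<lambda>n. ?g n (subspace_of X B) \<union> D.null X A n)
        (simp_bdry J) singular_subdivision subdivision_homotopy"
      proof (rule subdivision.intro)
        fix n and c :: "'a chain"
        show "?g n X \<inter> {} \<subseteq> ?g n (subspace_of X B) \<union> D.null X A n" by simp
        show "?g n (subspace_of X B) \<union> D.null X A n \<subseteq> ?g n X" using D.gens_mono[OF sub(1)] D.gens_mono[OF sub(2)] by simp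
        show "additive_frag (simp_bdry J n)" by (rule simp_bdry_additive)
        show "additive_frag (singular_subdivision n)" by (rule subdivision_additive)
        show "additive_frag (subdivision_homotopy n)" by (rule subdivision_homotopy_additive)
        show "supp (simp_bdry J n c) \<subseteq> ?g n X" if "supp c \<subseteq> ?g (Suc n) X" using that by (rule simp_bdry_gens)
        show "supp (simp_bdry J n c) \<subseteq> ?g n (subspace_of X B) \<union> D.null X A n"
          if "supp c \<subseteq> ?g (Suc n) (subspace_of X B) \<union> D.null X A (Suc n)"
          using keys_split_subset[OF simp_bdry_additive simp_bdry_gens simp_bdry_gens] that by simp
        show "supp (simp_bdry J n c) \<subseteq> ?g n X \<inter> {}" if "supp c \<subseteq> ?g (Suc n) X \<inter> {}"
          using that additive_frag_0[OF simp_bdry_additive, of J n] by simp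
        show "supp (singular_subdivision n c) \<subseteq> ?g n X" if "supp c \<subseteq> ?g n X" using that by (rule Sd)
        show "supp (singular_subdivision n c) \<subseteq> ?g n (subspace_of X B) \<union> D.null X A n"
          if "supp c \<subseteq> ?g n (subspace_of X B) \<union> D.null X A n"
          using keys_split_subset[OF subdivision_additive Sd Sd] that by simp
        show "supp (singular_subdivision n c) \<subseteq> ?g n X \<inter> {}" if "supp c \<subseteq> ?g n X \<inter> {}"
          using that by simp
        show "supp (subdivision_homotopy n c) \<subseteq> ?g (Suc n) X" if "supp c \<subseteq> ?g n X" using that by (rule T)
        show "supp (subdivision_homotopy n c) \<subseteq> ?g (Suc n) (subspace_of X B) \<union> D.null X A (Suc n)"
          if "supp c \<subseteq> ?g n (subspace_of X B) \<union> D.null X A n"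
          using keys_split_subset[OF subdivision_homotopy_additive T T] that by simp
        show "supp (subdivision_homotopy n c) \<subseteq> ?g (Suc n) X \<inter> {}" if "supp c \<subseteq> ?g n X \<inter> {}"
          using that additive_frag_0[OF subdivision_homotopy_additive, of n] by simp
        show "supp (simp_bdry J n (singular_subdivision (Suc n) c) - singular_subdivision n (simp_bdry J n c)) \<subseteq> ?g n X \<inter> {}"
          if c: "supp c \<subseteq> ?g (Suc n) X"
        proof (rule subdivision_chain_map[where S = "\<lambda>n. ?g n X" and Z = "\<lambda>n. ?g n X \<inter> {}" and b = "simp_bdry J" and T = subdivision_homotopy])
          show "supp (simp_bdry J n c) \<subseteq> ?g n X \<inter> {}" if "supp c \<subseteq> ?g (Suc n) X \<inter> {}" for n c
            using that additive_frag_0[OF simp_bdry_additive, of J n] by simp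
        qed (fact simp_bdry_additive simp_bdry_bdry subdivision_homotopy_additive simp_bdry_gens htpy0 htpyS c)+
        show "supp (c - singular_subdivision 0 c - simp_bdry J 0 (subdivision_homotopy 0 c)) \<subseteq> ?g 0 X \<inter> {}"
          if "supp c \<subseteq> ?g 0 X" using htpy0[OF that] .
        show "supp (c - singular_subdivision (Suc n) c - (simp_bdry J (Suc n) (subdivision_homotopy (Suc n) c)
          + subdivision_homotopy n (simp_bdry J n c))) \<subseteq> ?g (Suc n) X \<inter> {}"
          if "supp c \<subseteq> ?g (Suc n) X" using htpyS[OF that] .
      next
        fix n \<sigma> assume "\<sigma> \<in> ?g n X"
        then show "\<exists>m. supp ((singular_subdivision n ^^ m) (frag_of \<sigma>)) \<subseteq> ?g n (subspace_of X B) \<union> D.null X A n"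
          using simplex_small[OF X AB, of \<sigma> n] J by simp
      qed
      then show "\<exists>E. excision_operator X A B E" by (rule excision_operator_subdivision)
    qed
  qed
qed

lemma alternating_frag_sum: "(\<Sum>i\<le>m. frag_cmul ((-1) ^ i) c) = (if even m then c else 0)"
  by (induction m) (auto simp: frag_cmul_distrib)

lemma gens_point:
  assumes "closure_space (\<Delta> n)" "closure_space X" "points X = {x}"
  shows "gens \<Delta> n X = {\<lambda>t\<in>points (\<Delta> n). x}"
proof -
  have "ccont (\<Delta> n) X (\<lambda>t\<in>points (\<Delta> n). x)"
    by (rule ccont_cong[OF assms(1) ccont_const[OF assms(1,2), of x]]) (simp_all add: assms(3))
  moreover have "\<sigma> = (\<lambda>t\<in>points (\<Delta> n). x)" if "\<sigma> \<in> gens \<Delta> n X" for \<sigma>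
  proof (rule extensionalityI[of _ "points (\<Delta> n)"])
    show "\<sigma> t = (\<lambda>t\<in>points (\<Delta> n). x) t" if "t \<in> points (\<Delta> n)" for t
      using ccont_funcset[of "\<Delta> n" X \<sigma> t] \<open>\<sigma> \<in> gens \<Delta> n X\<close> that assms(3) by (simp add: gens_def)
  qed (use that in \<open>simp_all add: gens_def\<close>)
  ultimately show ?thesis by (auto simp: gens_def)
qed

text \<open>There is one simplex in each degree, and its boundary is the simplex below or zero,
  depending on parity. If the operator raises the degree, exactly one of the two terms of the
  homotopy is nonzero.\<close>

lemma simp_point_contractions:
  fixes G :: "'g monoid"
  assumes "coefficients G"
  shows "singular_theory.point_contractions (simplex_space J) (\<lambda>n. {} :: ((nat \<Rightarrow> real) \<Rightarrow> 'a) set) (simp_bdry J)"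
proof -
  interpret singular_theory G "simplex_space J" "\<lambda>n. {} :: ((nat \<Rightarrow> real) \<Rightarrow> 'a) set" "simp_bdry J" "simp_rel_chains J" "simp_class J"
    "simp_rel_chain_map J"
    using simp_maps[OF assms] by (rule singular_theory.intro)
  show ?thesis
    unfolding point_contractions_def
  proof (intro allI impI)
    fix X :: "'a cspace" and x
    assume X: "closure_space X" "points X = {x}"
    define \<kappa> where "\<kappa> n = (\<lambda>t\<in>points (simplex_space J n). x)" for n
    have g: "gens (simplex_space J) n X = {\<kappa> n}" for n
      unfolding \<kappa>_def by (rule gens_point[OF closure_space_simplex X])
    let ?P = "\<lambda>n. frag_extend (\<lambda>\<sigma>. frag_of (\<kappa> (Suc n)))"
    have "simplex_face J n i (\<kappa> (Suc n)) = \<kappa> n" if "i \<le> Suc n" for n i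
      using face_points[OF that] by (auto simp: \<kappa>_def simplex_face_def restrict_def fun_eq_iff)
    then have "simp_bdry J n (frag_of (\<kappa> (Suc n))) = (\<Sum>i\<le>Suc n. frag_cmul ((-1) ^ i) (frag_of (\<kappa> n)))" for n
      unfolding simp_bdry_of by (intro sum.cong) simp_all
    then have b: "simp_bdry J n (frag_of (\<kappa> (Suc n))) = (if even (Suc n) then frag_of (\<kappa> n) else 0)" for n
      unfolding alternating_frag_sum .
    have "point_contraction X ?P"
      unfolding point_contraction_def
    proof (intro conjI allI impI)
      fix n and c :: "'a chain"
      show "additive_frag (?P n)" by simp
      show "supp (?P n c) \<subseteq> gens (simplex_space J) (Suc n) X"
        unfolding g by (rule keys_frag_extend_subset[of UNIV]) simp_all
      show "supp (?P n c) \<subseteq> {}" if "supp c \<subseteq> gens (simplex_space J) n X \<inter> {}"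
        using that by simp
      assume c: "supp c \<subseteq> gens (simplex_space J) (Suc n) X"
      have "c - (simp_bdry J (Suc n) (?P (Suc n) c) + ?P n (simp_bdry J n c)) = 0"
      proof (rule additive_frag_eq[where g = "\<lambda>c. 0", OF _ _ _ c])
        show "additive_frag (\<lambda>c. c - (simp_bdry J (Suc n) (?P (Suc n) c) + ?P n (simp_bdry J n c)))"
          by (simp add: additive_frag_def additive_frag_diff[OF simp_bdry_additive] frag_extend_diff)
        fix \<sigma> assume "\<sigma> \<in> gens (simplex_space J) (Suc n) X"
        then show "frag_of \<sigma> - (simp_bdry J (Suc n) (?P (Suc n) (frag_of \<sigma>)) + ?P n (simp_bdry J n (frag_of \<sigma>))) = 0"
          by (simp add: g b)
      qed simp
      then show "supp (c - (simp_bdry J (Suc n) (?P (Suc n) c) + ?P n (simp_bdry J n c)))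
          \<subseteq> gens (simplex_space J) (Suc n) X \<inter> {}" by simp
    qed
    then show "\<exists>P. point_contraction X P" by blast
  qed
qed

section \<open>The cubical theory\<close>

lemma closure_space_cube: "closure_space (cube_space J n)"
  unfolding cube_space_def using closure_space_interval by (rule closure_space_cpower)

lemma points_cube: "points (cube_space J n) = (\<Pi>\<^sub>E i\<in>{1..n}. points (interval_space J))"
  by (simp add: cube_space_def points_cpower)

lemma interval_ends: "0 \<in> points (interval_space J)" "1 \<in> points (interval_space J)"
  by (cases J; simp)+

lemma cube_nonempty: "points (cube_space J n) \<noteq> {}"
  using interval_ends[of J] by (auto simp: points_cube PiE_eq_empty_iff)

lemma cube_coord: "p \<in> points (cube_space J n) \<Longrightarrow> i \<in> {1..n} \<Longrightarrow> p i \<in> points (interval_space J)"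
  by (auto simp: points_cube PiE_iff)

lemma cube_undefined: "p \<in> points (cube_space J n) \<Longrightarrow> i \<notin> {1..n} \<Longrightarrow> p i = undefined"
  by (auto simp: points_cube PiE_iff extensional_def)

lemma ccont_cube_coord: "i \<in> {1..n} \<Longrightarrow> ccont (cube_space J n) (interval_space J) (\<lambda>p. p i)"
  unfolding cube_space_def using closure_space_interval by (rule ccont_component)

lemma ccont_cubeI:
  assumes "closure_space Z" "\<And>i. i \<in> {1..n} \<Longrightarrow> ccont Z (interval_space J) (\<lambda>z. f z i)"
    and "\<And>z i. z \<in> points Z \<Longrightarrow> i \<notin> {1..n} \<Longrightarrow> f z i = undefined"
  shows "ccont Z (cube_space J n) f"
  unfolding cube_space_def
proof (rule ccont_cpowerI[OF assms(1) closure_space_interval assms(2)])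
  show "f z \<in> extensional {1..n}" if "z \<in> points Z" for z
    using assms(3)[OF that] by (simp add: extensional_def)
qed

lemma gens_cube: "gens (cube_space J) n X = cubes J n X"
  by (simp add: gens_def cubes_def)

lemma ccont_insert_coord:
  assumes i: "i \<in> {1..Suc n}" and t: "t \<in> points (interval_space J)"
  shows "ccont (cube_space J n) (cube_space J (Suc n)) (insert_coord i t)"
proof (rule ccont_cubeI[OF closure_space_cube])
  fix k assume k: "k \<in> {1..Suc n}"
  consider "k < i" | "k = i" | "i < k" by linarith
  then show "ccont (cube_space J n) (interval_space J) (\<lambda>p. insert_coord i t p k)"
  proof cases
    case 1
    then show ?thesis using ccont_cube_coord[of k n J] k i by (simp add: insert_coord_def)
  next
    case 2
    then show ?thesis using ccont_const[OF closure_space_cube closure_space_interval t] by (simp add: insert_coord_def)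
  next
    case 3
    then have "k - 1 \<in> {1..n}" using k i by auto
    then show ?thesis using ccont_cube_coord[of "k - 1" n J] 3 by (simp add: insert_coord_def)
  qed
next
  fix p k assume p: "p \<in> points (cube_space J n)" and k: "k \<notin> {1..Suc n}"
  show "insert_coord i t p k = undefined"
  proof (cases "k = 0")
    case True
    then show ?thesis using cube_undefined[OF p, of 0] i by (simp add: insert_coord_def)
  next
    case False
    then have "k > Suc n" using k by auto
    then have "k - 1 \<notin> {1..n}" "k > i" using i by auto
    then show ?thesis using cube_undefined[OF p, of "k - 1"] by (simp add: insert_coord_def)
  qed
qed

lemma insert_points:
  "i \<in> {1..Suc n} \<Longrightarrow> t \<in> points (interval_space J) \<Longrightarrow> p \<in> points (cube_space J n) \<Longrightarrow>
    insert_coord i t p \<in> points (cube_space J (Suc n))"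
  using ccont_funcset[OF ccont_insert_coord] .

lemma insert_insert: "j < i \<Longrightarrow> insert_coord i t (insert_coord j s p) = insert_coord j s (insert_coord (i - 1) t p)"
  by (rule ext) (auto simp: insert_coord_def)

lemma cube_face_gens:
  assumes "\<sigma> \<in> gens (cube_space J) (Suc n) X" "i \<in> {1..Suc n}" "t \<in> points (interval_space J)"
  shows "cube_face J n i t \<sigma> \<in> gens (cube_space J) n X"
proof -
  have "ccont (cube_space J n) X (\<sigma> \<circ> insert_coord i t)"
    using assms(1) by (intro ccont_compose[OF ccont_insert_coord[OF assms(2,3)]]) (simp add: gens_def)
  then have "ccont (cube_space J n) X (cube_face J n i t \<sigma>)"
    unfolding cube_face_def by (rule ccont_cong[OF closure_space_cube]) simp
  then show ?thesis by (simp add: gens_def cube_face_def)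
qed

lemma cube_face_face:
  assumes "j < i" "j \<in> {1..Suc n}" "i \<in> {1..Suc (Suc n)}" "s \<in> points (interval_space J)" "t \<in> points (interval_space J)"
  shows "cube_face J n j s (cube_face J (Suc n) i t \<sigma>) = cube_face J n (i - 1) t (cube_face J (Suc n) j s \<sigma>)"
  unfolding cube_face_def
proof (rule restrict_ext)
  fix p assume p: "p \<in> points (cube_space J n)"
  have "i - 1 \<in> {1..Suc n}" using assms(1-3) by auto
  then have "insert_coord j s p \<in> points (cube_space J (Suc n))" "insert_coord (i - 1) t p \<in> points (cube_space J (Suc n))"
    using insert_points[OF assms(2,4) p] insert_points[OF _ assms(5) p] by simp_all
  then show "(restrict (\<sigma> \<circ> insert_coord i t) (points (cube_space J (Suc n))) \<circ> insert_coord j s) p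
    = (restrict (\<sigma> \<circ> insert_coord j s) (points (cube_space J (Suc n))) \<circ> insert_coord (i - 1) t) p"
    using insert_insert[OF assms(1), of t s p] by simp
qed

text \<open>The difference of opposite faces taken as one operator. The cubical boundary becomes an
  alternating sum of such operators, and \<open>alternating_double_sum\<close> applies to it as for
  simplices.\<close>

definition face_diff :: "interval_kind \<Rightarrow> nat \<Rightarrow> nat \<Rightarrow> 'a cube_chain \<Rightarrow> 'a cube_chain" where
  "face_diff J n i = frag_extend (\<lambda>\<sigma>. frag_of (cube_face J n i 0 \<sigma>) - frag_of (cube_face J n i 1 \<sigma>))"

lemma face_diff_additive: "additive_frag (face_diff J n i)"
  by (simp add: face_diff_def)

lemma face_diff_of: "face_diff J n i (frag_of \<sigma>) = frag_of (cube_face J n i 0 \<sigma>) - frag_of (cube_face J n i 1 \<sigma>)"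
  unfolding face_diff_def by (rule frag_extend_of)

definition cube_bdry :: "interval_kind \<Rightarrow> nat \<Rightarrow> 'a cube_chain \<Rightarrow> 'a cube_chain" where
  "cube_bdry J n = frag_extend (\<lambda>\<sigma>. \<Sum>i=1..Suc n. frag_cmul ((-1) ^ i)
               (frag_of (cube_face J n i 0 \<sigma>) - frag_of (cube_face J n i 1 \<sigma>)))"

lemma cube_bdry_additive: "additive_frag (cube_bdry J n)"
  by (simp add: cube_bdry_def)

lemma sum_shift: "(\<Sum>i=1..Suc n. f i) = (\<Sum>i\<le>n. f (Suc i))" for f :: "nat \<Rightarrow> 'z :: comm_monoid_add"
  by (simp add: sum.atLeast_Suc_atMost_Suc_shift atMost_atLeast0 del: sum.cl_ivl_Suc)

lemma cube_bdry_of: "cube_bdry J n (frag_of \<sigma>) = (\<Sum>i\<le>n. frag_cmul ((-1) ^ Suc i) (face_diff J n (Suc i) (frag_of \<sigma>)))"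
  unfolding cube_bdry_def frag_extend_of face_diff_of by (rule sum_shift)

lemma face_diff_gens:
  assumes "i \<in> {1..Suc n}" "supp c \<subseteq> gens (cube_space J) (Suc n) X"
  shows "supp (face_diff J n i c) \<subseteq> gens (cube_space J) n X"
  unfolding face_diff_def
proof (rule keys_frag_extend_subset[OF _ assms(2)])
  fix \<sigma> assume "\<sigma> \<in> gens (cube_space J) (Suc n) X"
  then show "supp (frag_of (cube_face J n i 0 \<sigma>) - frag_of (cube_face J n i 1 \<sigma>)) \<subseteq> gens (cube_space J) n X"
    using assms(1) by (intro keys_diff_subset keys_frag_of_subset cube_face_gens interval_ends)
qed

lemma cube_bdry_gens:
  assumes "supp c \<subseteq> gens (cube_space J) (Suc n) X"
  shows "supp (cube_bdry J n c) \<subseteq> gens (cube_space J) n X"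
proof (rule additive_frag_keysI[OF cube_bdry_additive _ assms])
  fix \<sigma> assume "\<sigma> \<in> gens (cube_space J) (Suc n) X"
  then show "supp (cube_bdry J n (frag_of \<sigma>)) \<subseteq> gens (cube_space J) n X"
    unfolding cube_bdry_of by (intro keys_sum_subset keys_cmul_subset face_diff_gens keys_frag_of_subset) auto
qed

text \<open>For each choice of opposite faces this is the commutation of inserted coordinates; the
  shift to \<open>i\<close> comes from the coordinate already removed.\<close>

lemma face_diff_commute:
  assumes "j < i" "i \<le> Suc n"
  shows "face_diff J n (Suc j) (face_diff J (Suc n) (Suc i) (frag_of \<sigma>)) = face_diff J n i (face_diff J (Suc n) (Suc j) (frag_of \<sigma>))"
proof -
  have "cube_face J n (Suc j) s (cube_face J (Suc n) (Suc i) t \<sigma>) = cube_face J n i t (cube_face J (Suc n) (Suc j) s \<sigma>)"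
    if "s \<in> {0, 1}" "t \<in> {0, 1}" for s t
    using cube_face_face[of "Suc j" "Suc i" n s J t \<sigma>] assms that interval_ends[of J] by auto
  then show ?thesis by (simp add: face_diff_of additive_frag_diff[OF face_diff_additive])
qed

lemma frag_cmul_diff: "frag_cmul k (c - d) = frag_cmul k c - frag_cmul k d"
  using frag_cmul_distrib2[of k c "- d"] by (simp add: frag_cmul_minus)

lemma cube_bdry_eq: "cube_bdry J n c = (\<Sum>i\<le>n. frag_cmul ((-1) ^ Suc i) (face_diff J n (Suc i) c))"
proof (rule additive_frag_eq[where S = UNIV, OF cube_bdry_additive _ cube_bdry_of])
  show "additive_frag (\<lambda>c. \<Sum>i\<le>n. frag_cmul ((-1) ^ Suc i) (face_diff J n (Suc i) c))"
    unfolding additive_frag_def additive_frag_diff[OF face_diff_additive] frag_cmul_diff by (simp only: sum_subtractf simp_thms)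
qed simp

lemma cube_bdry_bdry: "cube_bdry J n (cube_bdry J (Suc n) c) = 0"
proof -
  have gen: "cube_bdry J n (cube_bdry J (Suc n) (frag_of \<sigma>)) = 0" for \<sigma> :: "(nat \<Rightarrow> real) \<Rightarrow> 'a"
  proof -
    have "cube_bdry J n (cube_bdry J (Suc n) (frag_of \<sigma>)) = (\<Sum>i\<le>Suc n. \<Sum>j\<le>n. frag_cmul ((-1) ^ (i + j))
        (face_diff J n (Suc j) (face_diff J (Suc n) (Suc i) (frag_of \<sigma>))))"
      unfolding cube_bdry_of[of J "Suc n"] additive_frag_sum[OF cube_bdry_additive] additive_frag_cmul[OF cube_bdry_additive]
      unfolding cube_bdry_eq
      by (simp add: frag_cmul_sum power_add del: sum.atMost_Suc)
    also have "\<dots> = 0"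
    proof (rule alternating_double_sum)
      fix i j assume ij: "j < i" "i \<le> Suc n"
      show "face_diff J n (Suc j) (face_diff J (Suc n) (Suc i) (frag_of \<sigma>))
          = face_diff J n (Suc (i - 1)) (face_diff J (Suc n) (Suc j) (frag_of \<sigma>))"
        using face_diff_commute[OF ij, of J \<sigma>] ij by simp
    qed
    finally show ?thesis .
  qed
  show ?thesis
    by (rule additive_frag_eq[where S = UNIV and g = "\<lambda>c. 0" and f = "\<lambda>c. cube_bdry J n (cube_bdry J (Suc n) c)", OF _ _ gen])
      (simp_all add: additive_frag_comp cube_bdry_additive)
qed

lemma cube_bdry_push: "cube_bdry J n (push (cube_space J) f (Suc n) c) = push (cube_space J) f n (cube_bdry J n c)"
proof -
  have face: "cube_face J n i t (restrict (f \<circ> \<sigma>) (points (cube_space J (Suc n)))) = restrict (f \<circ> cube_face J n i t \<sigma>) (points (cube_space J n))"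
    if "i \<in> {1..Suc n}" "t \<in> points (interval_space J)" for i t \<sigma>
    unfolding cube_face_def using insert_points[OF that] by (auto simp: restrict_def fun_eq_iff)
  have gen: "cube_bdry J n (push (cube_space J) f (Suc n) (frag_of \<sigma>)) = push (cube_space J) f n (cube_bdry J n (frag_of \<sigma>))" for \<sigma>
    unfolding push_of cube_bdry_of additive_frag_sum[OF push_additive] additive_frag_cmul[OF push_additive]
  proof (rule sum.cong[OF refl])
    fix i assume "i \<in> {..n}"
    then have i: "Suc i \<in> {1..Suc n}" by simp
    show "frag_cmul ((-1) ^ Suc i) (face_diff J n (Suc i) (frag_of (restrict (f \<circ> \<sigma>) (points (cube_space J (Suc n))))))
      = frag_cmul ((-1) ^ Suc i) (push (cube_space J) f n (face_diff J n (Suc i) (frag_of \<sigma>)))"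
      unfolding face_diff_of additive_frag_diff[OF push_additive] push_of
        face[OF i interval_ends(1)] face[OF i interval_ends(2)] ..
  qed
  show ?thesis
    by (rule additive_frag_eq[where S = UNIV and g = "\<lambda>c. push (cube_space J) f n (cube_bdry J n c)"
          and f = "\<lambda>c. cube_bdry J n (push (cube_space J) f (Suc n) c)", OF _ _ gen])
      (simp_all add: additive_frag_comp cube_bdry_additive push_additive)
qed

section \<open>Degenerate cubes\<close>

definition constant_in :: "interval_kind \<Rightarrow> nat \<Rightarrow> nat \<Rightarrow> ((nat \<Rightarrow> real) \<Rightarrow> 'a) \<Rightarrow> bool" where
  "constant_in J n i \<sigma> \<longleftrightarrow> (\<forall>p\<in>points (cube_space J n). \<forall>q\<in>points (cube_space J n).
    (\<forall>k\<in>{1..n} - {i}. p k = q k) \<longrightarrow> \<sigma> p = \<sigma> q)"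

definition degenerate :: "interval_kind \<Rightarrow> nat \<Rightarrow> ((nat \<Rightarrow> real) \<Rightarrow> 'a) set" where
  "degenerate J n = {\<sigma>. \<exists>i\<in>{1..n}. constant_in J n i \<sigma>}"

lemma degenerate_cubes_eq: "degenerate_cubes J n X = gens (cube_space J) n X \<inter> degenerate J n"
  by (auto simp: degenerate_cubes_def degenerate_def constant_in_def gens_cube)

lemma constant_inI:
  assumes "\<And>p q. p \<in> points (cube_space J n) \<Longrightarrow> q \<in> points (cube_space J n) \<Longrightarrow> (\<And>k. k \<noteq> i \<Longrightarrow> p k = q k) \<Longrightarrow> \<sigma> p = \<sigma> q"
  shows "constant_in J n i \<sigma>"
  unfolding constant_in_def
proof (intro ballI impI)
  fix p q assume p: "p \<in> points (cube_space J n)" and q: "q \<in> points (cube_space J n)" and e: "\<forall>k\<in>{1..n} - {i}. p k = q k"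
  have "p k = q k" if "k \<noteq> i" for k
  proof (cases "k \<in> {1..n}")
    case True
    then show ?thesis using e that by blast
  next
    case False
    then show ?thesis using cube_undefined[OF p False] cube_undefined[OF q False] by simp
  qed
  then show "\<sigma> p = \<sigma> q" by (rule assms[OF p q])
qed

lemma constant_inD:
  assumes "constant_in J n i \<sigma>" "p \<in> points (cube_space J n)" "q \<in> points (cube_space J n)" "\<And>k. k \<noteq> i \<Longrightarrow> p k = q k"
  shows "\<sigma> p = \<sigma> q"
proof (rule assms(1)[unfolded constant_in_def, THEN bspec, OF assms(2), THEN bspec, OF assms(3), THEN mp])
  show "\<forall>k\<in>{1..n} - {i}. p k = q k" by (rule ballI, rule assms(4)) simp
qed

text \<open>If only coordinate \<open>i\<close> of the image depends on coordinate \<open>j\<close>,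
  points differing in \<open>j\<close> alone have images that \<sigma> cannot distinguish. Faces and
  cylinders of degenerate cubes are instances.\<close>

lemma constant_in_pullback:
  assumes \<sigma>: "constant_in J n i \<sigma>"
    and F: "\<And>p. p \<in> points (cube_space J m) \<Longrightarrow> F p \<in> points (cube_space J n)"
    and eq: "\<And>p q k. (\<And>l. l \<noteq> j \<Longrightarrow> p l = q l) \<Longrightarrow> k \<noteq> i \<Longrightarrow> F p k = F q k"
  shows "constant_in J m j (restrict (\<sigma> \<circ> F) (points (cube_space J m)))"
proof (rule constant_inI)
  fix p q assume p: "p \<in> points (cube_space J m)" and q: "q \<in> points (cube_space J m)" and "\<And>k. k \<noteq> j \<Longrightarrow> p k = q k"
  then have "\<sigma> (F p) = \<sigma> (F q)" by (intro constant_inD[OF \<sigma> F[OF p] F[OF q]] eq) auto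
  then show "restrict (\<sigma> \<circ> F) (points (cube_space J m)) p = restrict (\<sigma> \<circ> F) (points (cube_space J m)) q"
    using p q by simp
qed

text \<open>Faces in other directions keep the constant direction. Removing coordinate
  \<open>j\<close> lowers its index by one if \<open>j\<close> comes before it.\<close>

lemma degenerate_face:
  assumes \<sigma>: "constant_in J (Suc n) i \<sigma>" and i: "i \<in> {1..Suc n}" and j: "j \<in> {1..Suc n}" "j \<noteq> i"
    and t: "t \<in> points (interval_space J)"
  shows "cube_face J n j t \<sigma> \<in> degenerate J n"
proof -
  let ?l = "if i < j then i else i - 1"
  have "constant_in J n ?l (cube_face J n j t \<sigma>)"
    unfolding cube_face_def
  proof (rule constant_in_pullback[OF \<sigma>])
    show "insert_coord j t p \<in> points (cube_space J (Suc n))" if "p \<in> points (cube_space J n)" for p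
      using insert_points[OF j(1) t that] .
    fix p q :: "nat \<Rightarrow> real" and k
    assume eq: "\<And>l. l \<noteq> ?l \<Longrightarrow> p l = q l" and k: "k \<noteq> i"
    consider "k < j" | "k = j" | "j < k" by linarith
    then show "insert_coord j t p k = insert_coord j t q k"
    proof cases
      case 1
      then have "k \<noteq> ?l" using k j(2) by (simp split: if_split; linarith)
      then show ?thesis using eq[of k] 1 by (simp add: insert_coord_def)
    next
      case 3
      then have "k - 1 \<noteq> ?l" using k j i by (simp split: if_split; linarith)
      then show ?thesis using eq[of "k - 1"] 3 by (simp add: insert_coord_def)
    qed (simp add: insert_coord_def)
  qed
  moreover have "?l \<in> {1..n}" using i j by auto
  ultimately show ?thesis unfolding degenerate_def by blast
qed

lemma constant_face_eq:
  assumes \<sigma>: "constant_in J (Suc n) i \<sigma>" and i: "i \<in> {1..Suc n}"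
  shows "cube_face J n i 0 \<sigma> = cube_face J n i 1 \<sigma>"
  unfolding cube_face_def
proof (rule restrict_ext)
  fix p assume p: "p \<in> points (cube_space J n)"
  have "\<sigma> (insert_coord i 0 p) = \<sigma> (insert_coord i 1 p)"
    by (rule constant_inD[OF \<sigma> insert_points[OF i interval_ends(1) p] insert_points[OF i interval_ends(2) p]])
      (simp add: insert_coord_def)
  then show "(\<sigma> \<circ> insert_coord i 0) p = (\<sigma> \<circ> insert_coord i 1) p" by simp
qed

text \<open>In the constant direction the opposite faces are equal and cancel; in every other
  direction the faces are degenerate themselves.\<close>

lemma cube_bdry_degenerate:
  assumes c: "supp c \<subseteq> gens (cube_space J) (Suc n) X \<inter> degenerate J (Suc n)"
  shows "supp (cube_bdry J n c) \<subseteq> gens (cube_space J) n X \<inter> degenerate J n"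
proof (rule additive_frag_keysI[OF cube_bdry_additive _ c])
  fix \<sigma> assume \<sigma>: "\<sigma> \<in> gens (cube_space J) (Suc n) X \<inter> degenerate J (Suc n)"
  then obtain i where i: "i \<in> {1..Suc n}" "constant_in J (Suc n) i \<sigma>" unfolding degenerate_def by blast
  have "supp (face_diff J n j (frag_of \<sigma>)) \<subseteq> gens (cube_space J) n X \<inter> degenerate J n" if j: "j \<in> {1..Suc n}" for j
  proof (cases "j = i")
    case True
    then show ?thesis using constant_face_eq[OF i(2,1)] by (simp add: face_diff_of)
  next
    case False
    have "cube_face J n j t \<sigma> \<in> gens (cube_space J) n X \<inter> degenerate J n" if "t \<in> points (interval_space J)" for t
      using cube_face_gens[OF _ j that, of \<sigma> X] degenerate_face[OF i(2,1) j False that] \<sigma> by simp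
    from keys_diff_subset[OF keys_frag_of_subset[OF this[OF interval_ends(1)]] keys_frag_of_subset[OF this[OF interval_ends(2)]]]
    show ?thesis unfolding face_diff_of .
  qed
  then show "supp (cube_bdry J n (frag_of \<sigma>)) \<subseteq> gens (cube_space J) n X \<inter> degenerate J n"
    unfolding cube_bdry_of by (intro keys_sum_subset keys_cmul_subset) auto
qed

text \<open>Translates the generated subgroup of degenerate chains into a condition on supports, the
  only form in which relations enter a presentation.\<close>

lemma generate_frag_of: "S \<subseteq> T \<Longrightarrow> generate (free_Abelian_group T) (frag_of ` S) = {c. supp c \<subseteq> S}"
proof (intro equalityI subsetI)
  assume ST: "S \<subseteq> T"
  interpret group "free_Abelian_group T" by simp
  fix c
  show "c \<in> {c. supp c \<subseteq> S}" if "c \<in> generate (free_Abelian_group T) (frag_of ` S)"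
    using that
  proof (induction rule: generate.induct)
    case (inv h)
    then obtain x where "x \<in> S" "h = frag_of x" by auto
    then show ?case using ST by (auto simp: inv_free_Abelian_group)
  next
    case (eng h1 h2)
    then show ?case using keys_add_subset by simp
  qed auto
  assume "c \<in> {c. supp c \<subseteq> S}"
  then have "supp c \<subseteq> S" by simp
  moreover have sub: "subgroup (generate (free_Abelian_group T) (frag_of ` S)) (free_Abelian_group T)"
    by (rule generate_is_subgroup) (use ST in auto)
  ultimately show "c \<in> generate (free_Abelian_group T) (frag_of ` S)"
  proof (induction c rule: frag_induction)
    case zero
    then show ?case using subgroup.one_closed[OF sub] by simp
  next
    case (one x)
    then show ?case by (auto intro: generate.incl)
  next
    case (diff a b)
    have "supp b \<subseteq> T" using subgroup.mem_carrier[OF sub diff(2)[OF sub]] by simp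
    then have "- b \<in> generate (free_Abelian_group T) (frag_of ` S)"
      using subgroup.m_inv_closed[OF sub diff(2)[OF sub]] by simp
    then show ?case using subgroup.m_closed[OF sub diff(1)[OF sub]] by fastforce
  qed
qed

section \<open>The presentation of relative cubical chains\<close>

abbreviation cube_gens :: "interval_kind \<Rightarrow> nat \<Rightarrow> 'a cspace \<Rightarrow> ((nat \<Rightarrow> real) \<Rightarrow> 'a) set" where
  "cube_gens J n X \<equiv> gens (cube_space J) n X"

definition cube_class1 :: "interval_kind \<Rightarrow> 'a cspace \<Rightarrow> nat \<Rightarrow> 'a cube_chain \<Rightarrow> 'a cube_chain set" where
  "cube_class1 J X n c = degenerate_chains J X n #>\<^bsub>grp (free_cube_chains J X) n\<^esub> c"

definition cube_class :: "interval_kind \<Rightarrow> 'a cspace \<Rightarrow> 'a set \<Rightarrow> nat \<Rightarrow> 'a cube_chain \<Rightarrow> 'a cube_chain set set" where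
  "cube_class J X A n c = cube_subchains J X A n #>\<^bsub>grp (cube_chains J X) n\<^esub> cube_class1 J X n c"

lemma grp_free_cube [simp]: "grp (free_cube_chains J X) n = free_Abelian_group (cube_gens J n X)"
  by (simp add: free_cube_chains_def gens_cube)

lemma degenerate_chains_eq: "degenerate_chains J X n = {c. supp c \<subseteq> cube_gens J n X \<inter> degenerate J n}"
  unfolding degenerate_chains_def degenerate_cubes_eq grp_free_cube by (rule generate_frag_of) simp

lemma cube_presentation1:
  shows "presentation (\<lambda>n. cube_gens J n X) (\<lambda>n. (cube_gens J n X \<inter> degenerate J n) \<union> {}) (cube_bdry J) (cube_chains J X) (cube_class1 J X)"
    and "subgroup (degenerate_chains J X n) (grp (free_cube_chains J X) n)"
proof -
  have base: "presentation (\<lambda>n. cube_gens J n X) (\<lambda>n. {}) (cube_bdry J) (free_cube_chains J X) (\<lambda>n c. c)"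
  proof (rule presentation.intro)
    fix n and c :: "'a cube_chain"
    show "comm_group (grp (free_cube_chains J X) n)" by (simp add: abelian_free_Abelian_group)
    show "additive_frag (cube_bdry J n)" by (rule cube_bdry_additive)
    show "(\<lambda>c. c) \<in> hom (free_Abelian_group (cube_gens J n X)) (grp (free_cube_chains J X) n)" by (simp add: hom_def)
    show "carrier (grp (free_cube_chains J X) n) = (\<lambda>c. c) ` {c. supp c \<subseteq> cube_gens J n X}" by auto
    show "c = \<one>\<^bsub>grp (free_cube_chains J X) n\<^esub> \<longleftrightarrow> supp c \<subseteq> {}" by simp
    show "supp (cube_bdry J n c) \<subseteq> cube_gens J n X" if "supp c \<subseteq> cube_gens J (Suc n) X"
      using that by (rule cube_bdry_gens)
    show "supp (cube_bdry J n c) \<subseteq> {}" if "supp c \<subseteq> {}"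
      using that additive_frag_0[OF cube_bdry_additive, of J n] by simp
    show "supp (cube_bdry J n (cube_bdry J (Suc n) c)) \<subseteq> {}" by (simp add: cube_bdry_bdry)
    show "bdry (free_cube_chains J X) n c = cube_bdry J n c" by (simp only: free_cube_chains_def cube_bdry_def ccomplex.simps)
  qed simp
  have M: "degenerate_chains J X n = (\<lambda>c. c) ` {c. supp c \<subseteq> cube_gens J n X \<inter> degenerate J n}" for n
    by (simp add: degenerate_chains_eq)
  have sub: "cube_gens J n X \<inter> degenerate J n \<subseteq> cube_gens J n X" for n by simp
  show "presentation (\<lambda>n. cube_gens J n X) (\<lambda>n. (cube_gens J n X \<inter> degenerate J n) \<union> {}) (cube_bdry J) (cube_chains J X) (cube_class1 J X)"
    using presentation_quotient(1)[where SA = "\<lambda>n. cube_gens J n X \<inter> degenerate J n" and M = "degenerate_chains J X",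
        OF base sub cube_bdry_degenerate M]
    unfolding cube_chains_def cube_class1_def[abs_def] .
  show "subgroup (degenerate_chains J X n) (grp (free_cube_chains J X) n)"
    by (rule presentation_quotient(2)[where SA = "\<lambda>n. cube_gens J n X \<inter> degenerate J n" and M = "degenerate_chains J X",
        OF base sub cube_bdry_degenerate M])
qed

lemma push_degenerate:
  assumes f: "ccont X Y f" and c: "supp c \<subseteq> cube_gens J n X \<inter> degenerate J n"
  shows "supp (push (cube_space J) f n c) \<subseteq> cube_gens J n Y \<inter> degenerate J n"
proof (rule additive_frag_keysI[OF push_additive _ c])
  fix \<sigma> :: "(nat \<Rightarrow> real) \<Rightarrow> 'a" assume \<sigma>: "\<sigma> \<in> cube_gens J n X \<inter> degenerate J n"
  then obtain i where i: "i \<in> {1..n}" "constant_in J n i \<sigma>" unfolding degenerate_def by blast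
  have "constant_in J n i (restrict (f \<circ> \<sigma>) (points (cube_space J n)))"
  proof (rule constant_inI)
    fix p q assume "p \<in> points (cube_space J n)" "q \<in> points (cube_space J n)" "\<And>k. k \<noteq> i \<Longrightarrow> p k = q k"
    then show "restrict (f \<circ> \<sigma>) (points (cube_space J n)) p = restrict (f \<circ> \<sigma>) (points (cube_space J n)) q"
      using constant_inD[OF i(2), of p q] by simp
  qed
  then have "restrict (f \<circ> \<sigma>) (points (cube_space J n)) \<in> degenerate J n" using i(1) unfolding degenerate_def by blast
  moreover have "restrict (f \<circ> \<sigma>) (points (cube_space J n)) \<in> cube_gens J n Y"
    using gens_push[where \<Delta> = "cube_space J" and n = n, OF closure_space_cube f] \<sigma> by simp
  ultimately show "supp (push (cube_space J) f n (frag_of \<sigma>)) \<subseteq> cube_gens J n Y \<inter> degenerate J n"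
    by (simp add: push_of)
qed

lemma cube_chain_map_class1:
  assumes f: "ccont X Y f" and c: "supp c \<subseteq> cube_gens J n X"
  shows "cube_chain_map J Y f n (cube_class1 J X n c) = cube_class1 J Y n (push (cube_space J) f n c)"
proof -
  have push: "frag_extend (\<lambda>\<sigma>. frag_of (restrict (f \<circ> \<sigma>) (points (cube_space J n)))) = push (cube_space J) f n"
    by (simp add: push_def)
  have S: "supp (push (cube_space J) f n c) \<subseteq> cube_gens J n Y" if "supp c \<subseteq> cube_gens J n X" for c
    using push_gens[where \<Delta> = "cube_space J" and n = n, OF closure_space_cube f that] .
  show ?thesis
    unfolding cube_chain_map_def cube_class1_def push
  proof (rule coset_map_coset[OF _ cube_presentation1(2) _ cube_presentation1(2)])
    show "push (cube_space J) f n \<in> hom (grp (free_cube_chains J X) n) (grp (free_cube_chains J Y) n)"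
      using S by (intro homI) (simp_all add: additive_frag_add[OF push_additive])
    show "push (cube_space J) f n ` degenerate_chains J X n \<subseteq> degenerate_chains J Y n"
      unfolding degenerate_chains_eq using push_degenerate[OF f] by blast
  qed (use c in \<open>simp_all add: abelian_free_Abelian_group\<close>)
qed

text \<open>Chains of the subspace are cosets of other degenerate chains and enter through the map
  induced by the inclusion. That map keeps representatives, so the image consists of the classes of
  chains on cubes in \<open>A\<close>.\<close>

lemma cube_subchains_eq:
  assumes A: "A \<subseteq> points X"
  shows "cube_subchains J X A n = cube_class1 J X n ` {c. supp c \<subseteq> cube_gens J n (subspace_of X A)}"
proof -
  have "cube_chain_map J X id n (cube_class1 J (subspace_of X A) n c) = cube_class1 J X n c"
    if "supp c \<subseteq> cube_gens J n (subspace_of X A)" for c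
    unfolding cube_chain_map_class1[OF ccont_subspace_id[OF A] that] push_id[OF that] ..
  then show ?thesis
    unfolding cube_subchains_def presentation.q_surj[OF cube_presentation1(1)] image_image by (intro image_cong) auto
qed

lemma cube_presentation:
  assumes "closure_pair X A"
  shows "presentation (\<lambda>n. cube_gens J n X) (\<lambda>n. cube_gens J n (subspace_of X A) \<union> (cube_gens J n X \<inter> degenerate J n))
    (cube_bdry J) (cube_rel_chains J X A) (cube_class J X A)"
    and "subgroup (cube_subchains J X A n) (grp (cube_chains J X) n)"
proof -
  have A: "A \<subseteq> points X" using assms by (simp add: closure_pair_def)
  have sub: "cube_gens J n (subspace_of X A) \<subseteq> cube_gens J n X" for n
    using gens_subspace[where \<Delta> = "cube_space J" and n = n, OF closure_space_cube A] by simp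
  show "presentation (\<lambda>n. cube_gens J n X) (\<lambda>n. cube_gens J n (subspace_of X A) \<union> (cube_gens J n X \<inter> degenerate J n))
    (cube_bdry J) (cube_rel_chains J X A) (cube_class J X A)"
    using presentation_quotient(1)[where SA = "\<lambda>n. cube_gens J n (subspace_of X A)" and M = "cube_subchains J X A",
        OF cube_presentation1(1) sub cube_bdry_gens cube_subchains_eq[OF A]]
    unfolding cube_rel_chains_def cube_class_def[abs_def] by simp
  show "subgroup (cube_subchains J X A n) (grp (cube_chains J X) n)"
    by (rule presentation_quotient(2)[where SA = "\<lambda>n. cube_gens J n (subspace_of X A)" and M = "cube_subchains J X A",
        OF cube_presentation1(1) sub cube_bdry_gens cube_subchains_eq[OF A]])
qed

lemma cube_objects:
  assumes "coefficients G"
  shows "singular_objects G (cube_space J) (degenerate J) (cube_bdry J) (cube_rel_chains J) (cube_class J)"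
  by (intro singular_objects.intro singular_objects_axioms.intro assms closure_space_cube cube_nonempty
      cube_presentation(1))

lemma cube_maps:
  fixes G :: "'g monoid"
  assumes "coefficients G"
  shows "singular_maps G (cube_space J) (degenerate J) (cube_bdry J) (cube_rel_chains J) (cube_class J)
    (degenerate J) (cube_bdry J) (cube_rel_chains J) (cube_class J) (cube_rel_chain_map J :: 'b cspace \<Rightarrow> 'b set \<Rightarrow> ('a \<Rightarrow> 'b) \<Rightarrow> _)"
proof (intro singular_maps.intro singular_maps_axioms.intro cube_objects assms)
  fix X :: "'a cspace" and A and Y :: "'b cspace" and B f n and c :: "'a cube_chain"
  assume f: "pair_map X A Y B f" and c: "supp c \<subseteq> cube_gens J n X"
  have p: "closure_pair X A" "closure_pair Y B" and fc: "ccont X Y f" using f by (simp_all add: pair_map_def)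
  have sub: "A \<subseteq> points X" "B \<subseteq> points Y" using p by (simp_all add: closure_pair_def)
  have fr: "ccont (subspace_of X A) (subspace_of Y B) f" using pair_map_restrict[OF f] by (simp add: pair_map_def)
  interpret PX: presentation "\<lambda>n. cube_gens J n X" "\<lambda>n. (cube_gens J n X \<inter> degenerate J n) \<union> {}" "cube_bdry J" "cube_chains J X" "cube_class1 J X"
    by (rule cube_presentation1)
  interpret PY: presentation "\<lambda>n. cube_gens J n Y" "\<lambda>n. (cube_gens J n Y \<inter> degenerate J n) \<union> {}" "cube_bdry J" "cube_chains J Y" "cube_class1 J Y"
    by (rule cube_presentation1)
  have S: "supp (push (cube_space J) f n c) \<subseteq> cube_gens J n Y" if "supp c \<subseteq> cube_gens J n X" for c
    using push_gens[where \<Delta> = "cube_space J" and n = n, OF closure_space_cube fc that] .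
  have SA: "supp (push (cube_space J) f n c) \<subseteq> cube_gens J n (subspace_of Y B)"
    if "supp c \<subseteq> cube_gens J n (subspace_of X A)" for c
    using push_gens[where \<Delta> = "cube_space J" and n = n, OF closure_space_cube fr that] .
  have subg: "cube_gens J n (subspace_of X A) \<subseteq> cube_gens J n X"
    using gens_subspace[where \<Delta> = "cube_space J" and n = n, OF closure_space_cube sub(1)] by simp
  have "cube_rel_chain_map J Y B f n (cube_class J X A n c)
    = cube_subchains J Y B n #>\<^bsub>grp (cube_chains J Y) n\<^esub> cube_chain_map J Y f n (cube_class1 J X n c)"
    unfolding cube_rel_chain_map_def cube_class_def
  proof (rule coset_map_coset[OF PX.comm_grp cube_presentation(2)[OF p(1)] PY.comm_grp cube_presentation(2)[OF p(2)]])
    show "cube_chain_map J Y f n \<in> hom (grp (cube_chains J X) n) (grp (cube_chains J Y) n)"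
    proof (rule PX.hom_from_q[OF comm_group.axioms(2)[OF PY.comm_grp]])
      show "(\<lambda>c. cube_class1 J Y n (push (cube_space J) f n c)) \<in> hom (free_Abelian_group (cube_gens J n X)) (grp (cube_chains J Y) n)"
        by (rule coefficients.free_hom_compose[OF PY.coefficients_grp PY.q_hom push_additive S])
    qed (rule cube_chain_map_class1[OF fc])
    show "cube_chain_map J Y f n ` cube_subchains J X A n \<subseteq> cube_subchains J Y B n"
    proof
      fix y assume "y \<in> cube_chain_map J Y f n ` cube_subchains J X A n"
      then obtain a where a: "supp a \<subseteq> cube_gens J n (subspace_of X A)" "y = cube_chain_map J Y f n (cube_class1 J X n a)"
        unfolding cube_subchains_eq[OF sub(1)] by blast
      have "supp a \<subseteq> cube_gens J n X" using a(1) subg by blast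
      then have "y = cube_class1 J Y n (push (cube_space J) f n a)" using cube_chain_map_class1[OF fc] a(2) by simp
      then show "y \<in> cube_subchains J Y B n" unfolding cube_subchains_eq[OF sub(2)] using SA[OF a(1)] by blast
    qed
    show "cube_class1 J X n c \<in> carrier (grp (cube_chains J X) n)" using PX.q_carrier[OF c] .
  qed
  then show "cube_rel_chain_map J Y B f n (cube_class J X A n c) = cube_class J Y B n (push (cube_space J) f n c)"
    unfolding cube_class_def cube_chain_map_class1[OF fc c] .
qed (rule cube_bdry_push)

section \<open>Homotopy and dimension for cubes\<close>

text \<open>The shape shared by the prism and the subdivision homotopy: a cylinder with time as
  first coordinate, whose faces in the later directions are cylinders over faces. The shift of the
  directions by one changes the sign of these terms.\<close>

lemma cube_bdry_cylinder:
  assumes "additive_frag P" "\<And>i. i \<le> m \<Longrightarrow> face_diff J (Suc m) (Suc (Suc i)) d = P (face_diff J m (Suc i) c)"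
  shows "cube_bdry J (Suc m) d = - face_diff J (Suc m) 1 d - P (cube_bdry J m c)"
proof -
  have "cube_bdry J (Suc m) d = - face_diff J (Suc m) 1 d
      + (\<Sum>i\<le>m. frag_cmul ((-1) ^ Suc (Suc i)) (face_diff J (Suc m) (Suc (Suc i)) d))"
    unfolding cube_bdry_eq sum.atMost_Suc_shift by simp
  also have "(\<Sum>i\<le>m. frag_cmul ((-1) ^ Suc (Suc i)) (face_diff J (Suc m) (Suc (Suc i)) d))
      = (\<Sum>i\<le>m. - P (frag_cmul ((-1) ^ Suc i) (face_diff J m (Suc i) c)))"
    by (rule sum.cong[OF refl]) (simp add: assms(2) additive_frag_cmul[OF assms(1)] additive_frag_minus[OF assms(1)])
  also have "\<dots> = - P (cube_bdry J m c)"
    unfolding cube_bdry_eq additive_frag_sum[OF assms(1)] by (rule sum_negf)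
  finally show ?thesis by simp
qed

lemma cube_bdry_0: "cube_bdry J 0 d = - face_diff J 0 1 d"
  by (simp add: cube_bdry_eq)

text \<open>Forgets the first coordinate and shifts the others down. Index 0 lies outside the range
  of coordinates and must stay \<open>undefined\<close> for the result to be extensional.\<close>

definition drop_coord :: "(nat \<Rightarrow> real) \<Rightarrow> nat \<Rightarrow> real" where
  "drop_coord p = (\<lambda>k. if k = 0 then undefined else p (Suc k))"

lemma ccont_drop_coord: "ccont (cube_space J (Suc n)) (cube_space J n) drop_coord"
proof (rule ccont_cubeI[OF closure_space_cube])
  fix i assume "i \<in> {1..n}"
  then have "Suc i \<in> {1..Suc n}" "i \<noteq> 0" by auto
  then show "ccont (cube_space J (Suc n)) (interval_space J) (\<lambda>p. drop_coord p i)"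
    using ccont_cube_coord[of "Suc i" "Suc n" J] by (simp add: drop_coord_def)
next
  fix p i assume p: "p \<in> points (cube_space J (Suc n))" and i: "i \<notin> {1..n}"
  show "drop_coord p i = undefined"
  proof (cases "i = 0")
    case False
    then have "Suc i \<notin> {1..Suc n}" using i by auto
    then show ?thesis using cube_undefined[OF p, of "Suc i"] False by (simp add: drop_coord_def)
  qed (simp add: drop_coord_def)
qed

lemma drop_points: "p \<in> points (cube_space J (Suc n)) \<Longrightarrow> drop_coord p \<in> points (cube_space J n)"
  using ccont_funcset[OF ccont_drop_coord] .

lemma drop_insert_first: "p \<in> points (cube_space J n) \<Longrightarrow> drop_coord (insert_coord 1 t p) = p"
  by (rule ext) (auto simp: drop_coord_def insert_coord_def cube_undefined[of p J n 0])

lemma drop_insert: "drop_coord (insert_coord (Suc (Suc i)) t p) = insert_coord (Suc i) t (drop_coord p)"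
  by (rule ext) (auto simp: drop_coord_def insert_coord_def)

lemma insert_at: "insert_coord i t p i = t"
  by (simp add: insert_coord_def)

lemma insert_below: "k < i \<Longrightarrow> insert_coord i t p k = p k"
  by (simp add: insert_coord_def)

definition prism_cube :: "interval_kind \<Rightarrow> ('a \<times> real \<Rightarrow> 'b) \<Rightarrow> nat \<Rightarrow> ((nat \<Rightarrow> real) \<Rightarrow> 'a) \<Rightarrow> (nat \<Rightarrow> real) \<Rightarrow> 'b" where
  "prism_cube J h n \<sigma> = (\<lambda>p\<in>points (cube_space J (Suc n)). h (\<sigma> (drop_coord p), p 1))"

definition cube_prism :: "interval_kind \<Rightarrow> ('a \<times> real \<Rightarrow> 'b) \<Rightarrow> nat \<Rightarrow> 'a cube_chain \<Rightarrow> 'b cube_chain" where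
  "cube_prism J h n = frag_extend (\<lambda>\<sigma>. frag_of (prism_cube J h n \<sigma>))"

lemma cube_prism_additive: "additive_frag (cube_prism J h n)"
  by (simp add: cube_prism_def)

lemma cube_prism_of: "cube_prism J h n (frag_of \<sigma>) = frag_of (prism_cube J h n \<sigma>)"
  unfolding cube_prism_def by (rule frag_extend_of)

lemma prism_cube_gens:
  assumes X: "closure_space X" and h: "ccont (cprod X (interval_space J)) Y h"
    and \<sigma>: "\<sigma> \<in> cube_gens J n X"
  shows "prism_cube J h n \<sigma> \<in> cube_gens J (Suc n) Y"
proof -
  have "ccont (cube_space J (Suc n)) X (\<sigma> \<circ> drop_coord)"
    using \<sigma> by (intro ccont_compose[OF ccont_drop_coord]) (simp add: gens_def)
  then have "ccont (cube_space J (Suc n)) (cprod X (interval_space J)) (\<lambda>p. ((\<sigma> \<circ> drop_coord) p, p 1))"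
    by (rule ccont_pair[OF closure_space_cube X closure_space_interval]) (rule ccont_cube_coord, simp)
  then have "ccont (cube_space J (Suc n)) Y (h \<circ> (\<lambda>p. ((\<sigma> \<circ> drop_coord) p, p 1)))"
    using h by (rule ccont_compose)
  then have "ccont (cube_space J (Suc n)) Y (prism_cube J h n \<sigma>)"
    unfolding prism_cube_def by (rule ccont_cong[OF closure_space_cube]) simp
  then show ?thesis by (simp add: gens_def prism_cube_def)
qed

lemma prism_cube_degenerate:
  assumes "\<sigma> \<in> degenerate J n"
  shows "prism_cube J h n \<sigma> \<in> degenerate J (Suc n)"
proof -
  obtain i where i: "i \<in> {1..n}" "constant_in J n i \<sigma>" using assms unfolding degenerate_def by blast
  have "constant_in J (Suc n) (Suc i) (prism_cube J h n \<sigma>)"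
  proof (rule constant_inI)
    fix p q assume p: "p \<in> points (cube_space J (Suc n))" and q: "q \<in> points (cube_space J (Suc n))"
      and eq: "\<And>k. k \<noteq> Suc i \<Longrightarrow> p k = q k"
    have "\<sigma> (drop_coord p) = \<sigma> (drop_coord q)"
    proof (rule constant_inD[OF i(2) drop_points[OF p] drop_points[OF q]])
      show "drop_coord p k = drop_coord q k" if "k \<noteq> i" for k
        using eq[of "Suc k"] that by (simp add: drop_coord_def)
    qed
    moreover have "p 1 = q 1" using i(1) by (intro eq) simp
    ultimately show "prism_cube J h n \<sigma> p = prism_cube J h n \<sigma> q" using p q by (simp add: prism_cube_def)
  qed
  moreover have "Suc i \<in> {1..Suc n}" using i(1) by simp
  ultimately show ?thesis unfolding degenerate_def by blast
qed

text \<open>Fixing the time coordinate leaves \<sigma> followed by one end of the homotopy. These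
  are the only faces that are not prisms over faces.\<close>

lemma prism_cube_first_face:
  assumes \<sigma>: "\<sigma> \<in> cube_gens J n X" and t: "t \<in> points (interval_space J)"
    and f: "\<And>x. x \<in> points X \<Longrightarrow> h (x, t) = f x"
  shows "cube_face J n 1 t (prism_cube J h n \<sigma>) = restrict (f \<circ> \<sigma>) (points (cube_space J n))"
  unfolding cube_face_def
proof (rule restrict_ext)
  fix p assume p: "p \<in> points (cube_space J n)"
  have "insert_coord 1 t p \<in> points (cube_space J (Suc n))" using insert_points[OF _ t p, of 1] by simp
  moreover have "\<sigma> p \<in> points X" using \<sigma> p by (auto simp: gens_def dest: ccont_funcset)
  ultimately show "(prism_cube J h n \<sigma> \<circ> insert_coord 1 t) p = (f \<circ> \<sigma>) p"
    using f drop_insert_first[OF p, of t] insert_at[of 1 t p] by (simp add: prism_cube_def)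
qed

lemma prism_cube_face:
  assumes i: "i \<le> n" and t: "t \<in> points (interval_space J)"
  shows "cube_face J (Suc n) (Suc (Suc i)) t (prism_cube J h (Suc n) \<sigma>) = prism_cube J h n (cube_face J n (Suc i) t \<sigma>)"
  unfolding cube_face_def[of J "Suc n"] prism_cube_def[of J h n]
proof (rule restrict_ext)
  fix p assume p: "p \<in> points (cube_space J (Suc n))"
  have "insert_coord (Suc (Suc i)) t p \<in> points (cube_space J (Suc (Suc n)))" using i by (intro insert_points[OF _ t p]) simp
  then show "(prism_cube J h (Suc n) \<sigma> \<circ> insert_coord (Suc (Suc i)) t) p = h (cube_face J n (Suc i) t \<sigma> (drop_coord p), p 1)"
    using drop_points[OF p] by (simp add: prism_cube_def cube_face_def drop_insert insert_below)
qed

lemma cube_prism_boundary_of: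
  assumes \<sigma>: "\<sigma> \<in> cube_gens J n X"
    and h: "\<And>x. x \<in> points X \<Longrightarrow> h (x, 0) = f x \<and> h (x, 1) = g x"
  shows "cube_bdry J n (cube_prism J h n (frag_of \<sigma>)) = push (cube_space J) g n (frag_of \<sigma>) - push (cube_space J) f n (frag_of \<sigma>)
    - (case n of 0 \<Rightarrow> 0 | Suc m \<Rightarrow> cube_prism J h m (cube_bdry J m (frag_of \<sigma>)))"
proof -
  have first: "face_diff J n 1 (cube_prism J h n (frag_of \<sigma>)) = push (cube_space J) f n (frag_of \<sigma>) - push (cube_space J) g n (frag_of \<sigma>)"
    unfolding cube_prism_of face_diff_of push_of
    using prism_cube_first_face[OF \<sigma> interval_ends(1), of h f] prism_cube_first_face[OF \<sigma> interval_ends(2), of h g] h by simp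
  show ?thesis
  proof (cases n)
    case 0
    then show ?thesis using first by (simp add: cube_bdry_0)
  next
    case (Suc m)
    have "face_diff J (Suc m) (Suc (Suc i)) (cube_prism J h (Suc m) (frag_of \<sigma>)) = cube_prism J h m (face_diff J m (Suc i) (frag_of \<sigma>))"
      if "i \<le> m" for i
      unfolding cube_prism_of face_diff_of additive_frag_diff[OF cube_prism_additive]
        prism_cube_face[OF that interval_ends(1)] prism_cube_face[OF that interval_ends(2)] ..
    from cube_bdry_cylinder[OF cube_prism_additive this]
    show ?thesis using first by (simp add: Suc)
  qed
qed

lemma cube_homotopy_operators:
  assumes "coefficients G"
  shows "singular_maps.homotopy_operators (cube_space J) (degenerate J :: nat \<Rightarrow> ((nat \<Rightarrow> real) \<Rightarrow> 'a) set) (cube_bdry J)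
    (degenerate J :: nat \<Rightarrow> ((nat \<Rightarrow> real) \<Rightarrow> 'b) set) (cube_bdry J) J"
proof -
  interpret singular_maps G "cube_space J" "degenerate J :: nat \<Rightarrow> ((nat \<Rightarrow> real) \<Rightarrow> 'a) set" "cube_bdry J" "cube_rel_chains J" "cube_class J"
    "degenerate J :: nat \<Rightarrow> ((nat \<Rightarrow> real) \<Rightarrow> 'b) set" "cube_bdry J" "cube_rel_chains J" "cube_class J" "cube_rel_chain_map J"
    using assms by (rule cube_maps)
  show ?thesis
    unfolding homotopy_operators_def
  proof (intro allI impI)
    fix X :: "'a cspace" and Y :: "'b cspace" and f g h
    assume X: "closure_space X" and h: "ccont (cprod X (interval_space J)) Y h" "\<forall>x\<in>points X. h (x, 0) = f x \<and> h (x, 1) = g x"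
    \<comment> \<open>The boundary of the prism produces \<open>g\<close> minus \<open>f\<close>, so
      the operator is negated.\<close>
    let ?P = "\<lambda>n c. - cube_prism J h n c"
    have P: "additive_frag (?P n)" for n
      by (simp add: additive_frag_def additive_frag_diff[OF cube_prism_additive])
    have "homotopy_operator X Y f g ?P"
      unfolding homotopy_operator_def
    proof (intro conjI allI impI)
      fix n and c :: "'a cube_chain"
      show "additive_frag (?P n)" by (rule P)
      show "supp (?P n c) \<subseteq> cube_gens J (Suc n) Y" if c: "supp c \<subseteq> cube_gens J n X"
        unfolding keys_minus cube_prism_def
        by (rule keys_frag_extend_subset[OF _ c]) (use prism_cube_gens[OF X h(1)] in simp)
      show "supp (?P n c) \<subseteq> degenerate J (Suc n)" if c: "supp c \<subseteq> cube_gens J n X \<inter> degenerate J n"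
        unfolding keys_minus cube_prism_def
        by (rule keys_frag_extend_subset[OF _ c]) (simp add: prism_cube_degenerate)
    next
      fix c :: "'a cube_chain" assume c: "supp c \<subseteq> cube_gens J 0 X"
      show "push (cube_space J) f 0 c - push (cube_space J) g 0 c = cube_bdry J 0 (?P 0 c)"
      proof (rule additive_frag_eq[OF _ _ _ c])
        show "additive_frag (\<lambda>c. push (cube_space J) f 0 c - push (cube_space J) g 0 c)"
          by (simp add: additive_frag_def additive_frag_diff[OF push_additive])
        show "additive_frag (\<lambda>c. cube_bdry J 0 (?P 0 c))" by (rule additive_frag_comp[OF cube_bdry_additive P])
        fix \<sigma> assume "\<sigma> \<in> cube_gens J 0 X"
        then show "push (cube_space J) f 0 (frag_of \<sigma>) - push (cube_space J) g 0 (frag_of \<sigma>) = cube_bdry J 0 (?P 0 (frag_of \<sigma>))"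
          using cube_prism_boundary_of[of \<sigma> J 0 X h f g] h(2) by (simp add: additive_frag_minus[OF cube_bdry_additive])
      qed
    next
      fix n and c :: "'a cube_chain" assume c: "supp c \<subseteq> cube_gens J (Suc n) X"
      show "push (cube_space J) f (Suc n) c - push (cube_space J) g (Suc n) c = cube_bdry J (Suc n) (?P (Suc n) c) + ?P n (cube_bdry J n c)"
      proof (rule additive_frag_eq[OF _ _ _ c])
        show "additive_frag (\<lambda>c. push (cube_space J) f (Suc n) c - push (cube_space J) g (Suc n) c)"
          by (simp add: additive_frag_def additive_frag_diff[OF push_additive])
        show "additive_frag (\<lambda>c. cube_bdry J (Suc n) (?P (Suc n) c) + ?P n (cube_bdry J n c))"
          by (simp add: additive_frag_def additive_frag_diff[OF cube_bdry_additive] additive_frag_minus[OF cube_bdry_additive]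
              additive_frag_diff[OF cube_prism_additive])
        fix \<sigma> assume "\<sigma> \<in> cube_gens J (Suc n) X"
        then show "push (cube_space J) f (Suc n) (frag_of \<sigma>) - push (cube_space J) g (Suc n) (frag_of \<sigma>)
            = cube_bdry J (Suc n) (?P (Suc n) (frag_of \<sigma>)) + ?P n (cube_bdry J n (frag_of \<sigma>))"
          using cube_prism_boundary_of[of \<sigma> J "Suc n" X h f g] h(2) by (simp add: additive_frag_minus[OF cube_bdry_additive])
      qed
    qed
    then show "\<exists>P. homotopy_operator X Y f g P" by (rule exI[of _ ?P])
  qed
qed

text \<open>A cube of positive dimension in a point is constant, hence degenerate. All chains in
  positive degrees are null and the zero operator contracts them.\<close>

lemma cube_point_contractions:
  fixes G :: "'g monoid"
  assumes "coefficients G"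
  shows "singular_theory.point_contractions (cube_space J) (degenerate J :: nat \<Rightarrow> ((nat \<Rightarrow> real) \<Rightarrow> 'a) set) (cube_bdry J)"
proof -
  interpret singular_theory G "cube_space J" "degenerate J :: nat \<Rightarrow> ((nat \<Rightarrow> real) \<Rightarrow> 'a) set" "cube_bdry J" "cube_rel_chains J" "cube_class J"
    "cube_rel_chain_map J"
    using cube_maps[OF assms] by (rule singular_theory.intro)
  show ?thesis
    unfolding point_contractions_def
  proof (intro allI impI)
    fix X :: "'a cspace" and x
    assume X: "closure_space X" "points X = {x}"
    have deg: "cube_gens J (Suc n) X \<subseteq> degenerate J (Suc n)" for n
    proof
      fix \<sigma> assume "\<sigma> \<in> cube_gens J (Suc n) X"
      then have "\<sigma> = (\<lambda>t\<in>points (cube_space J (Suc n)). x)" unfolding gens_point[OF closure_space_cube X] by simp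
      then have "constant_in J (Suc n) 1 \<sigma>" by (intro constant_inI) simp
      moreover have "1 \<in> {1..Suc n}" by simp
      ultimately show "\<sigma> \<in> degenerate J (Suc n)" unfolding degenerate_def by blast
    qed
    have "point_contraction X (\<lambda>n c. 0)"
      unfolding point_contraction_def
    proof (intro conjI allI impI)
      fix n and c :: "'a cube_chain" assume "supp c \<subseteq> cube_gens J (Suc n) X"
      then show "supp (c - (cube_bdry J (Suc n) 0 + 0)) \<subseteq> cube_gens J (Suc n) X \<inter> degenerate J (Suc n)"
        using deg[of n] by (simp add: additive_frag_0[OF cube_bdry_additive] subset_trans)
    qed simp_all
    then show "\<exists>P. point_contraction X P" by (rule exI[of _ "\<lambda>n c. 0"])
  qed
qed

text \<open>Open boxes are among the boxes that test the product closure, so a point of that closure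
  lies in the closure for the product topology. This brings ordinary continuity in two variables to
  the cylinder maps.\<close>

lemma ccont_cprod_topology:
  assumes f: "continuous_map (prod_topology T U) V f"
  shows "ccont (cprod (cspace_of_topology T) (cspace_of_topology U)) (cspace_of_topology V) f"
  unfolding ccont_def
proof (intro conjI allI impI image_subsetI)
  show "f \<in> points (cprod (cspace_of_topology T) (cspace_of_topology U)) \<rightarrow> points (cspace_of_topology V)"
    using continuous_map_funspace[OF f] by (simp add: cprod_def)
  fix A p assume "p \<in> clos (cprod (cspace_of_topology T) (cspace_of_topology U)) A"
  then obtain x y where p: "p = (x, y)" "x \<in> topspace T" "y \<in> topspace U"
    and meet: "\<forall>P Q. cnbhd (cspace_of_topology T) x P \<longrightarrow> cnbhd (cspace_of_topology U) y Q \<longrightarrow> (P \<times> Q) \<inter> A \<noteq> {}"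
    unfolding cprod_def by auto
  have "(x, y) \<in> prod_topology T U closure_of A"
    unfolding in_closure_of
  proof (intro conjI allI impI)
    fix W assume "(x, y) \<in> W \<and> openin (prod_topology T U) W"
    then obtain P Q where PQ: "openin T P" "openin U Q" "x \<in> P" "y \<in> Q" "P \<times> Q \<subseteq> W"
      unfolding openin_prod_topology_alt by blast
    then have "cnbhd (cspace_of_topology T) x P" "cnbhd (cspace_of_topology U) y Q"
      by (simp_all add: cnbhd_topology interior_of_openin openin_subset)
    then have "(P \<times> Q) \<inter> A \<noteq> {}" using meet by blast
    then show "\<exists>z. z \<in> A \<and> z \<in> W" using PQ(5) by blast
  qed (use p in simp)
  then show "f p \<in> clos (cspace_of_topology V) (f ` A)"
    using continuous_map_image_closure_subset[OF f, of A] p(1) by (auto simp: cspace_of_topology_def)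
qed

text \<open>In \<open>J_plus\<close> the point 1 lies in the closure of 0, so a neighbourhood of 1
  has to contain 0.\<close>

lemma interval_focal:
  assumes "J \<noteq> Unit_interval"
  shows "\<exists>z\<in>points (interval_space J). \<forall>V. cnbhd (interval_space J) z V \<longrightarrow> V = points (interval_space J)"
proof (cases J)
  case J_indiscrete
  have "V = points (interval_space J)" if "cnbhd (interval_space J) 0 V" for V
    using that J_indiscrete by (auto simp: cnbhd_def cinterior_def split: if_splits)
  then show ?thesis using interval_ends(1) by blast
next
  case J_plus
  have "V = points (interval_space J)" if V: "cnbhd (interval_space J) 1 V" for V
    using V J_plus by (auto simp: cnbhd_def cinterior_def split: if_splits)
  then show ?thesis using interval_ends(2) by blast
qed (use assms in simp)

text \<open>A point is interior to \<open>V\<close> if it is outside the closure of the complement;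
  read off from the definition of the power, this says that some box around it misses the
  complement.\<close>

lemma cpower_box:
  assumes X: "closure_space X" and V: "cnbhd (cpower X n) p V"
  shows "\<exists>U. (\<forall>i\<in>{1..n}. cnbhd X (p i) (U i)) \<and> (\<Pi>\<^sub>E i\<in>{1..n}. U i) \<subseteq> V"
proof -
  have p: "p \<in> (\<Pi>\<^sub>E i\<in>{1..n}. points X)" "p \<notin> clos (cpower X n) (points (cpower X n) - V)"
    using V by (auto simp: cnbhd_def cinterior_def points_cpower)
  then obtain U where U: "\<forall>i\<in>{1..n}. cnbhd X (p i) (U i)" "(\<Pi>\<^sub>E i\<in>{1..n}. U i) \<inter> (points (cpower X n) - V) = {}"
    unfolding cpower_def by auto
  have "U i \<subseteq> points X" if "i \<in> {1..n}" for i using U(1) that by (auto simp: cnbhd_def)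
  then have "(\<Pi>\<^sub>E i\<in>{1..n}. U i) \<subseteq> points (cpower X n)" unfolding points_cpower by (rule PiE_mono)
  then show ?thesis using U by blast
qed

lemma cube_focal:
  assumes "J \<noteq> Unit_interval"
  shows "\<exists>z\<in>points (cube_space J n). \<forall>V. cnbhd (cube_space J n) z V \<longrightarrow> V = points (cube_space J n)"
proof -
  obtain z where z: "z \<in> points (interval_space J)" "\<forall>V. cnbhd (interval_space J) z V \<longrightarrow> V = points (interval_space J)"
    using interval_focal[OF assms] by blast
  let ?z = "\<lambda>i\<in>{1..n}. z"
  have "V = points (cube_space J n)" if V: "cnbhd (cube_space J n) ?z V" for V
  proof -
    obtain U where U: "\<forall>i\<in>{1..n}. cnbhd (interval_space J) (?z i) (U i)" "(\<Pi>\<^sub>E i\<in>{1..n}. U i) \<subseteq> V"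
      using cpower_box[OF closure_space_interval V[unfolded cube_space_def]] by blast
    have "U i = points (interval_space J)" if "i \<in> {1..n}" for i
      using z(2)[THEN spec, of "U i"] bspec[OF U(1) that] that by simp
    then have "(\<Pi>\<^sub>E i\<in>{1..n}. U i) = points (cube_space J n)" unfolding points_cube by (rule PiE_cong)
    then show ?thesis using U(2) V by (auto simp: cnbhd_def)
  qed
  moreover have "?z \<in> points (cube_space J n)" using z(1) by (auto simp: points_cube)
  ultimately show ?thesis by blast
qed

section \<open>Subdivision of cubes\<close>

abbreviation unit_cube :: "nat \<Rightarrow> (nat \<Rightarrow> real) cspace" where
  "unit_cube \<equiv> cube_space Unit_interval"

text \<open>The affine parametrization of the segment from 0 to \<open>m\<close> or of the one from
  \<open>m\<close> to 1. At \<open>m = 1/2\<close> these are the halves; at \<open>m = 1\<close> the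
  lower one is the identity and the upper one is constant.\<close>

definition part :: "real \<Rightarrow> bool \<Rightarrow> real \<Rightarrow> real" where
  "part m upper x = (if upper then m + (1 - m) * x else m * x)"

definition cube_part :: "nat \<Rightarrow> real \<Rightarrow> nat set \<Rightarrow> (nat \<Rightarrow> real) \<Rightarrow> nat \<Rightarrow> real" where
  "cube_part n m e p = (\<lambda>k\<in>{1..n}. part m (k \<in> e) (p k))"

lemma part_range: "m \<in> {0..1} \<Longrightarrow> x \<in> {0..1} \<Longrightarrow> part m a x \<in> {0..1}"
proof -
  assume m: "m \<in> {0..1}" and x: "x \<in> {0..1}"
  have "(1 - m) * x \<le> 1 - m" "m * x \<le> m" using m x by (simp_all add: mult_left_le)
  moreover have "0 \<le> (1 - m) * x" "0 \<le> m * x" using m x by simp_all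
  ultimately show ?thesis using m by (auto simp: part_def)
qed

text \<open>A homotopy through subdivisions with moving division point. As the time
  \<open>p 1\<close> runs from 0 to 1, the point of division runs from 1/2 to 1, so the lower piece
  grows to the whole cube while all others collapse.\<close>

definition cyl_map :: "nat \<Rightarrow> nat set \<Rightarrow> (nat \<Rightarrow> real) \<Rightarrow> nat \<Rightarrow> real" where
  "cyl_map n e p = cube_part n ((1 + p 1) / 2) e (drop_coord p)"

lemma ccont_cyl_map: "ccont (unit_cube (Suc n)) (unit_cube n) (cyl_map n e)"
proof (rule ccont_cubeI[OF closure_space_cube])
  fix k assume k: "k \<in> {1..n}"
  let ?I = "interval_space Unit_interval"
  \<comment> \<open>Each coordinate of the cylinder map depends on the time and on one further
    coordinate only, so continuity reduces to a function on a square.\<close>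
  have "ccont (unit_cube (Suc n)) (cprod ?I ?I) (\<lambda>p. (p 1, p (Suc k)))"
    using k by (intro ccont_pair closure_space_cube closure_space_interval ccont_cube_coord) auto
  moreover have "ccont (cprod ?I ?I) ?I (\<lambda>(s, x). part ((1 + s) / 2) (k \<in> e) x)"
    unfolding interval_space.simps
  proof (rule ccont_cprod_topology)
    have "(\<lambda>(s, x). part ((1 + s) / 2) (k \<in> e) x) \<in> {0..1} \<times> {0..1} \<rightarrow> {0..1}"
      using part_range[of "(1 + _) / 2"] by auto
    moreover have "continuous_on ({0..1} \<times> {0..1}) (\<lambda>(s, x). part ((1 + s) / 2) (k \<in> e) x)"
      unfolding part_def case_prod_unfold by (cases "k \<in> e") (auto intro!: continuous_intros)
    ultimately show "continuous_map (prod_topology (top_of_set {0..1}) (top_of_set {0..1})) (top_of_set {0..1})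
        (\<lambda>(s, x). part ((1 + s) / 2) (k \<in> e) x)" by simp
  qed
  ultimately have "ccont (unit_cube (Suc n)) ?I ((\<lambda>(s, x). part ((1 + s) / 2) (k \<in> e) x) \<circ> (\<lambda>p. (p 1, p (Suc k))))"
    by (rule ccont_compose)
  then show "ccont (unit_cube (Suc n)) ?I (\<lambda>p. cyl_map n e p k)"
    by (rule ccont_cong[OF closure_space_cube]) (use k in \<open>simp add: cyl_map_def cube_part_def drop_coord_def\<close>)
qed (auto simp: cyl_map_def cube_part_def)

lemma cyl_points: "p \<in> points (unit_cube (Suc n)) \<Longrightarrow> cyl_map n e p \<in> points (unit_cube n)"
  using ccont_funcset[OF ccont_cyl_map] .

definition cube_cyl :: "nat \<Rightarrow> nat set \<Rightarrow> ((nat \<Rightarrow> real) \<Rightarrow> 'a) \<Rightarrow> (nat \<Rightarrow> real) \<Rightarrow> 'a" where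
  "cube_cyl n e \<sigma> = restrict (\<sigma> \<circ> cyl_map n e) (points (unit_cube (Suc n)))"

definition cube_piece :: "nat \<Rightarrow> real \<Rightarrow> nat set \<Rightarrow> ((nat \<Rightarrow> real) \<Rightarrow> 'a) \<Rightarrow> (nat \<Rightarrow> real) \<Rightarrow> 'a" where
  "cube_piece n m e \<sigma> = restrict (\<sigma> \<circ> cube_part n m e) (points (unit_cube n))"

lemma cube_cyl_gens:
  assumes "\<sigma> \<in> cube_gens Unit_interval n X"
  shows "cube_cyl n e \<sigma> \<in> cube_gens Unit_interval (Suc n) X"
proof -
  have "ccont (unit_cube (Suc n)) X (\<sigma> \<circ> cyl_map n e)"
    using assms by (intro ccont_compose[OF ccont_cyl_map]) (simp add: gens_def)
  then have "ccont (unit_cube (Suc n)) X (cube_cyl n e \<sigma>)"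
    unfolding cube_cyl_def by (rule ccont_cong[OF closure_space_cube]) simp
  then show ?thesis by (simp add: gens_def cube_cyl_def)
qed

lemma cyl_first_face:
  assumes t: "t \<in> points (interval_space Unit_interval)"
  shows "cube_face Unit_interval n 1 t (cube_cyl n e \<sigma>) = cube_piece n ((1 + t) / 2) e \<sigma>"
  unfolding cube_face_def cube_piece_def
proof (rule restrict_ext)
  fix p assume p: "p \<in> points (unit_cube n)"
  have "insert_coord 1 t p \<in> points (unit_cube (Suc n))" using insert_points[OF _ t p, of 1] by simp
  then show "(cube_cyl n e \<sigma> \<circ> insert_coord 1 t) p = (\<sigma> \<circ> cube_part n ((1 + t) / 2) e) p"
    using drop_insert_first[OF p, of t] insert_at[of 1 t p] by (simp add: cube_cyl_def cyl_map_def)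
qed

lemma cube_piece_gens:
  assumes "\<sigma> \<in> cube_gens Unit_interval n X"
  shows "cube_piece n (1 / 2) e \<sigma> \<in> cube_gens Unit_interval n X" "cube_piece n 1 e \<sigma> \<in> cube_gens Unit_interval n X"
proof -
  have "1 \<in> {1..Suc n}" by simp
  note face = cube_face_gens[OF cube_cyl_gens[OF assms] this]
  show "cube_piece n (1 / 2) e \<sigma> \<in> cube_gens Unit_interval n X"
    using face[OF interval_ends(1), of e] unfolding cyl_first_face[OF interval_ends(1)] by simp
  show "cube_piece n 1 e \<sigma> \<in> cube_gens Unit_interval n X"
    using face[OF interval_ends(2), of e] unfolding cyl_first_face[OF interval_ends(2)] by simp
qed

lemma cube_cyl_constant:
  assumes i: "i \<in> {1..n}" and \<sigma>: "constant_in Unit_interval n i \<sigma>"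
  shows "constant_in Unit_interval (Suc n) (Suc i) (cube_cyl n e \<sigma>)"
  unfolding cube_cyl_def
proof (rule constant_in_pullback[OF \<sigma> cyl_points])
  fix p q :: "nat \<Rightarrow> real" and k
  assume eq: "\<And>l. l \<noteq> Suc i \<Longrightarrow> p l = q l" and k: "k \<noteq> i"
  have "p 1 = q 1" using i by (intro eq) simp
  moreover have "drop_coord p k = drop_coord q k" using eq[of "Suc k"] k by (simp add: drop_coord_def)
  ultimately show "cyl_map n e p k = cyl_map n e q k" by (simp add: cyl_map_def cube_part_def restrict_def)
qed

lemma cube_cyl_degenerate: "\<sigma> \<in> degenerate Unit_interval n \<Longrightarrow> cube_cyl n e \<sigma> \<in> degenerate Unit_interval (Suc n)"
proof -
  assume "\<sigma> \<in> degenerate Unit_interval n"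
  then obtain i where i: "i \<in> {1..n}" "constant_in Unit_interval n i \<sigma>" unfolding degenerate_def by blast
  have "Suc i \<in> {1..Suc n}" using i(1) by simp
  then show ?thesis using cube_cyl_constant[OF i, of e] unfolding degenerate_def by blast
qed

lemma cube_piece_degenerate:
  assumes "\<sigma> \<in> degenerate Unit_interval n"
  shows "cube_piece n (1 / 2) e \<sigma> \<in> degenerate Unit_interval n"
proof -
  obtain i where i: "i \<in> {1..n}" "constant_in Unit_interval n i \<sigma>" using assms unfolding degenerate_def by blast
  have "Suc i \<in> {1..Suc n}" "1 \<in> {1..Suc n}" "1 \<noteq> Suc i" using i(1) by simp_all
  then have "cube_face Unit_interval n 1 0 (cube_cyl n e \<sigma>) \<in> degenerate Unit_interval n"
    using degenerate_face[OF cube_cyl_constant[OF i, of e] _ _ _ interval_ends(1)] by blast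
  then show ?thesis unfolding cyl_first_face[OF interval_ends(1)] by simp
qed

text \<open>With division point 1 an upper piece is constant in each direction of \<open>e\<close>,
  while the piece with no upper direction is all of \<sigma>.\<close>

lemma cube_piece_top:
  assumes \<sigma>: "\<sigma> \<in> cube_gens Unit_interval n X" and e: "e \<subseteq> {1..n}"
  shows "e \<noteq> {} \<Longrightarrow> cube_piece n 1 e \<sigma> \<in> degenerate Unit_interval n"
    and "cube_piece n 1 {} \<sigma> = \<sigma>"
proof -
  have cp: "cube_part n 1 e p \<in> points (unit_cube n)" if p: "p \<in> points (unit_cube n)" for p e
    using cube_coord[OF p] by (auto simp: points_cube cube_part_def part_def)
  show "cube_piece n 1 e \<sigma> \<in> degenerate Unit_interval n" if "e \<noteq> {}"
  proof -
    obtain i where i: "i \<in> e" using \<open>e \<noteq> {}\<close> by blast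
    have "constant_in Unit_interval n i (cube_piece n 1 e \<sigma>)"
    proof (rule constant_inI)
      fix p q :: "nat \<Rightarrow> real" assume p: "p \<in> points (unit_cube n)" and q: "q \<in> points (unit_cube n)"
        and eq: "\<And>k. k \<noteq> i \<Longrightarrow> p k = q k"
      have "cube_part n 1 e p k = cube_part n 1 e q k" for k
        using eq[of k] i by (cases "k = i") (simp_all add: cube_part_def part_def restrict_def)
      then have "cube_part n 1 e p = cube_part n 1 e q" by (rule ext)
      then show "cube_piece n 1 e \<sigma> p = cube_piece n 1 e \<sigma> q" using p q by (simp add: cube_piece_def)
    qed
    then show ?thesis using i e unfolding degenerate_def by blast
  qed
  show "cube_piece n 1 {} \<sigma> = \<sigma>"
  proof (rule extensionalityI[of _ "points (unit_cube n)"])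
    fix p assume p: "p \<in> points (unit_cube n)"
    have "cube_part n 1 {} p k = p k" for k
      using cube_undefined[OF p, of k] by (simp add: cube_part_def part_def restrict_def)
    then have "cube_part n 1 {} p = p" by (rule ext)
    then show "cube_piece n 1 {} \<sigma> p = \<sigma> p" using p by (simp add: cube_piece_def)
  qed (use \<sigma> in \<open>simp_all add: cube_piece_def gens_def\<close>)
qed

text \<open>The increasing injection that omits \<open>i\<close>: it renames the coordinates of a
  face as coordinates of the cube.\<close>

definition bump :: "nat \<Rightarrow> nat \<Rightarrow> nat" where
  "bump i k = (if k < i then k else Suc k)"

lemma bump_range: "i \<in> {1..Suc n} \<Longrightarrow> {1..Suc n} = insert i (bump i ` {1..n})"
proof (intro equalityI subsetI)
  fix k assume i: "i \<in> {1..Suc n}" and k: "k \<in> {1..Suc n}"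
  consider "k < i" | "k = i" | "i < k" by linarith
  then show "k \<in> insert i (bump i ` {1..n})"
  proof cases
    case 1
    then show ?thesis using i k by (intro insertI2 image_eqI[of _ _ k]) (auto simp: bump_def)
  next
    case 3
    then show ?thesis using i k by (intro insertI2 image_eqI[of _ _ "k - 1"]) (auto simp: bump_def)
  qed simp
qed (auto simp: bump_def)

lemma inj_bump: "inj (bump i)"
  by (rule injI) (auto simp: bump_def split: if_splits)

lemma bump_neq: "bump i k \<noteq> i"
  by (auto simp: bump_def)

text \<open>Pairs the pieces that agree in all directions but \<open>i\<close>. The two members of a
  pair lie on either side of the division in direction \<open>i\<close>.\<close>

lemma sum_Pow_bump:
  fixes f :: "nat set \<Rightarrow> 'z :: comm_monoid_add"
  assumes i: "i \<in> {1..Suc n}"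
  shows "(\<Sum>e\<in>Pow {1..Suc n}. f e) = (\<Sum>e\<in>Pow {1..n}. f (bump i ` e) + f (insert i (bump i ` e)))"
proof -
  have Pow: "Pow {1..Suc n} = image (bump i) ` Pow {1..n} \<union> insert i ` image (bump i) ` Pow {1..n}"
    unfolding bump_range[OF i] Pow_insert image_Pow_surj[OF refl] ..
  have ni: "i \<notin> bump i ` e" for e using bump_neq[of i] by (metis imageE)
  have inj1: "inj_on (image (bump i)) (Pow {1..n})"
    using inj_bump[of i] by (intro inj_onI) (simp add: inj_image_eq_iff)
  have "inj_on (insert i) (image (bump i) ` Pow {1..n})"
  proof (rule inj_onI)
    fix x y assume "x \<in> image (bump i) ` Pow {1..n}" "y \<in> image (bump i) ` Pow {1..n}" "insert i x = insert i y"
    then show "x = y" using ni insert_ident[of i x y] by auto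
  qed
  with inj1 have inj2: "inj_on (insert i \<circ> image (bump i)) (Pow {1..n})" by (rule comp_inj_on)
  have "(\<Sum>e\<in>Pow {1..Suc n}. f e) = sum f (image (bump i) ` Pow {1..n}) + sum f ((insert i \<circ> image (bump i)) ` Pow {1..n})"
    unfolding Pow image_comp
  proof (rule sum.union_disjoint)
    have "i \<notin> x" if "x \<in> image (bump i) ` Pow {1..n}" for x using that ni by blast
    moreover have "i \<in> x" if "x \<in> (insert i \<circ> image (bump i)) ` Pow {1..n}" for x using that by auto
    ultimately show "image (bump i) ` Pow {1..n} \<inter> (insert i \<circ> image (bump i)) ` Pow {1..n} = {}" by blast
  qed simp_all
  then show ?thesis unfolding sum.reindex[OF inj1] sum.reindex[OF inj2] by (simp add: sum.distrib)
qed

text \<open>Subdivision acts coordinatewise, so an inserted coordinate is subdivided on its own and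
  the others keep their halves under the renaming by \<open>bump\<close>.\<close>

lemma cube_part_insert:
  assumes i: "i \<in> {1..Suc n}" and e: "\<And>k. bump i k \<in> e \<longleftrightarrow> k \<in> e'"
  shows "cube_part (Suc n) m e (insert_coord i t p) = insert_coord i (part m (i \<in> e) t) (cube_part n m e' p)"
proof (rule ext)
  fix k
  consider "k < i" | "k = i" | "i < k" by linarith
  then show "cube_part (Suc n) m e (insert_coord i t p) k = insert_coord i (part m (i \<in> e) t) (cube_part n m e' p) k"
  proof cases
    case 1
    then have "k \<in> {1..Suc n} \<longleftrightarrow> k \<in> {1..n}" "k \<in> e \<longleftrightarrow> k \<in> e'" using i e[of k] by (auto simp: bump_def)
    then show ?thesis using 1 by (simp add: cube_part_def insert_coord_def restrict_def del: atLeastAtMost_iff)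
  next
    case 2
    then show ?thesis using i by (simp add: cube_part_def insert_coord_def)
  next
    case 3
    then have "bump i (k - 1) = k" by (simp add: bump_def)
    then have "k \<in> {1..Suc n} \<longleftrightarrow> k - 1 \<in> {1..n}" "k \<in> e \<longleftrightarrow> k - 1 \<in> e'" using 3 i e[of "k - 1"] by auto
    then show ?thesis using 3 by (simp add: cube_part_def insert_coord_def restrict_def del: atLeastAtMost_iff)
  qed
qed

text \<open>The inner wall of the cylinder in direction \<open>i\<close>: that coordinate is held at
  the division point \<open>(1 + p 1) / 2\<close>, which moves with time.\<close>

definition cyl_slice :: "nat \<Rightarrow> nat \<Rightarrow> nat set \<Rightarrow> ((nat \<Rightarrow> real) \<Rightarrow> 'a) \<Rightarrow> (nat \<Rightarrow> real) \<Rightarrow> 'a" where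
  "cyl_slice n i e \<sigma> = (\<lambda>p\<in>points (unit_cube (Suc n)). \<sigma> (insert_coord i ((1 + p 1) / 2) (cyl_map n e p)))"

lemma cyl_face:
  assumes i: "i \<le> n" and t: "t \<in> points (interval_space Unit_interval)" and e: "\<And>k. bump (Suc i) k \<in> e \<longleftrightarrow> k \<in> e'"
  shows "cube_face Unit_interval (Suc n) (Suc (Suc i)) t (cube_cyl (Suc n) e \<sigma>)
    = (\<lambda>p\<in>points (unit_cube (Suc n)). \<sigma> (insert_coord (Suc i) (part ((1 + p 1) / 2) (Suc i \<in> e) t) (cyl_map n e' p)))"
  unfolding cube_face_def
proof (rule restrict_ext)
  fix p assume p: "p \<in> points (unit_cube (Suc n))"
  have i': "Suc i \<in> {1..Suc n}" using i by simp
  have "insert_coord (Suc (Suc i)) t p \<in> points (unit_cube (Suc (Suc n)))" using i by (intro insert_points[OF _ t p]) simp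
  then show "(cube_cyl (Suc n) e \<sigma> \<circ> insert_coord (Suc (Suc i)) t) p
      = \<sigma> (insert_coord (Suc i) (part ((1 + p 1) / 2) (Suc i \<in> e) t) (cyl_map n e' p))"
    by (simp add: cube_cyl_def cyl_map_def drop_insert cube_part_insert[OF i' e] insert_below)
qed

text \<open>If the end \<open>t\<close> of the segment does not move with the division point, the
  face lies over a face of \<sigma> and is the cylinder of that face.\<close>

lemma cyl_face_outer:
  assumes i: "i \<le> n" and t: "t \<in> points (interval_space Unit_interval)"
    and t': "\<And>m. part m (Suc i \<in> e) t = t" and e: "\<And>k. bump (Suc i) k \<in> e \<longleftrightarrow> k \<in> e'"
  shows "cube_face Unit_interval (Suc n) (Suc (Suc i)) t (cube_cyl (Suc n) e \<sigma>)
    = cube_cyl n e' (cube_face Unit_interval n (Suc i) t \<sigma>)"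
  unfolding cyl_face[OF i t e] t' cube_cyl_def[of n]
proof (rule restrict_ext)
  fix p assume "p \<in> points (unit_cube (Suc n))"
  then show "\<sigma> (insert_coord (Suc i) t (cyl_map n e' p)) = (cube_face Unit_interval n (Suc i) t \<sigma> \<circ> cyl_map n e') p"
    using cyl_points[of p n e'] by (simp add: cube_face_def)
qed

text \<open>If the end \<open>t\<close> of the segment is the division point itself, the face is an
  inner wall. The upper end of a lower segment and the lower end of an upper one give the same
  wall.\<close>

lemma cyl_face_inner:
  assumes i: "i \<le> n" and t: "t \<in> points (interval_space Unit_interval)"
    and t': "\<And>m. part m (Suc i \<in> e) t = m" and e: "\<And>k. bump (Suc i) k \<in> e \<longleftrightarrow> k \<in> e'"
  shows "cube_face Unit_interval (Suc n) (Suc (Suc i)) t (cube_cyl (Suc n) e \<sigma>) = cyl_slice n (Suc i) e' \<sigma>"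
  unfolding cyl_face[OF i t e] t' cyl_slice_def ..

definition cube_subdivision :: "nat \<Rightarrow> 'a cube_chain \<Rightarrow> 'a cube_chain" where
  "cube_subdivision n = frag_extend (\<lambda>\<sigma>. \<Sum>e\<in>Pow {1..n}. frag_of (cube_piece n (1 / 2) e \<sigma>))"

definition cube_subdivision_homotopy :: "nat \<Rightarrow> 'a cube_chain \<Rightarrow> 'a cube_chain" where
  "cube_subdivision_homotopy n = frag_extend (\<lambda>\<sigma>. \<Sum>e\<in>Pow {1..n}. frag_of (cube_cyl n e \<sigma>))"

lemma cube_subdivision_additive: "additive_frag (cube_subdivision n)"
  by (simp add: cube_subdivision_def)

lemma cube_subdivision_homotopy_additive: "additive_frag (cube_subdivision_homotopy n)"
  by (simp add: cube_subdivision_homotopy_def)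

lemma cube_subdivision_of: "cube_subdivision n (frag_of \<sigma>) = (\<Sum>e\<in>Pow {1..n}. frag_of (cube_piece n (1 / 2) e \<sigma>))"
  unfolding cube_subdivision_def by (rule frag_extend_of)

lemma cube_subdivision_homotopy_of: "cube_subdivision_homotopy n (frag_of \<sigma>) = (\<Sum>e\<in>Pow {1..n}. frag_of (cube_cyl n e \<sigma>))"
  unfolding cube_subdivision_homotopy_def by (rule frag_extend_of)

lemma cube_subdivision_keys:
  assumes "\<And>\<sigma> e. \<sigma> \<in> S \<Longrightarrow> cube_piece n (1 / 2) e \<sigma> \<in> T" "supp c \<subseteq> S"
  shows "supp (cube_subdivision n c) \<subseteq> T"
  unfolding cube_subdivision_def
  by (rule keys_frag_extend_subset[OF _ assms(2)]) (intro keys_sum_subset keys_frag_of_subset assms(1))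

lemma cube_subdivision_homotopy_keys:
  assumes "\<And>\<sigma> e. \<sigma> \<in> S \<Longrightarrow> cube_cyl n e \<sigma> \<in> T" "supp c \<subseteq> S"
  shows "supp (cube_subdivision_homotopy n c) \<subseteq> T"
  unfolding cube_subdivision_homotopy_def
  by (rule keys_frag_extend_subset[OF _ assms(2)]) (intro keys_sum_subset keys_frag_of_subset assms(1))

text \<open>The slices at the subdivision level occur once with either sign and cancel.\<close>

lemma cube_subdivision_homotopy_face:
  assumes i: "i \<le> n"
  shows "face_diff Unit_interval (Suc n) (Suc (Suc i)) (cube_subdivision_homotopy (Suc n) c)
    = cube_subdivision_homotopy n (face_diff Unit_interval n (Suc i) c)"
proof -
  let ?I = Unit_interval
  have i': "Suc i \<in> {1..Suc n}" using i by simp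
  have gen: "face_diff ?I (Suc n) (Suc (Suc i)) (cube_subdivision_homotopy (Suc n) (frag_of \<sigma>))
    = cube_subdivision_homotopy n (face_diff ?I n (Suc i) (frag_of \<sigma>))" for \<sigma> :: "(nat \<Rightarrow> real) \<Rightarrow> 'a"
  proof -
    let ?b = "\<lambda>e. bump (Suc i) ` e"
    let ?d = "\<lambda>e. face_diff ?I (Suc n) (Suc (Suc i)) (frag_of (cube_cyl (Suc n) e \<sigma>))"
    have e1: "bump (Suc i) k \<in> ?b e \<longleftrightarrow> k \<in> e" for k e using inj_image_mem_iff[OF inj_bump] .
    have e2: "bump (Suc i) k \<in> insert (Suc i) (?b e) \<longleftrightarrow> k \<in> e" for k e using e1[of k e] bump_neq[of "Suc i" k] by simp
    have n1: "Suc i \<notin> ?b e" for e using bump_neq[of "Suc i"] by (metis imageE)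
    have pair: "?d (?b e) + ?d (insert (Suc i) (?b e))
        = frag_of (cube_cyl n e (cube_face ?I n (Suc i) 0 \<sigma>)) - frag_of (cube_cyl n e (cube_face ?I n (Suc i) 1 \<sigma>))" for e
    proof -
      have p1: "part m (Suc i \<in> ?b e) 0 = 0" "part m (Suc i \<in> ?b e) 1 = m" for m using n1 by (simp_all add: part_def)
      have 1: "?d (?b e) = frag_of (cube_cyl n e (cube_face ?I n (Suc i) 0 \<sigma>)) - frag_of (cyl_slice n (Suc i) e \<sigma>)"
        unfolding face_diff_of cyl_face_outer[OF i interval_ends(1) p1(1) e1] cyl_face_inner[OF i interval_ends(2) p1(2) e1] ..
      have p2: "part m (Suc i \<in> insert (Suc i) (?b e)) 1 = 1" "part m (Suc i \<in> insert (Suc i) (?b e)) 0 = m" for m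
        by (simp_all add: part_def)
      have 2: "?d (insert (Suc i) (?b e)) = frag_of (cyl_slice n (Suc i) e \<sigma>) - frag_of (cube_cyl n e (cube_face ?I n (Suc i) 1 \<sigma>))"
        unfolding face_diff_of cyl_face_outer[OF i interval_ends(2) p2(1) e2] cyl_face_inner[OF i interval_ends(1) p2(2) e2] ..
      show ?thesis unfolding 1 2 by simp
    qed
    have "face_diff ?I (Suc n) (Suc (Suc i)) (cube_subdivision_homotopy (Suc n) (frag_of \<sigma>)) = (\<Sum>e\<in>Pow {1..Suc n}. ?d e)"
      unfolding cube_subdivision_homotopy_of additive_frag_sum[OF face_diff_additive] ..
    also have "\<dots> = (\<Sum>e\<in>Pow {1..n}. ?d (?b e) + ?d (insert (Suc i) (?b e)))"
      by (rule sum_Pow_bump[OF i'])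
    also have "\<dots> = cube_subdivision_homotopy n (face_diff ?I n (Suc i) (frag_of \<sigma>))"
      unfolding pair
      unfolding face_diff_of additive_frag_diff[OF cube_subdivision_homotopy_additive] cube_subdivision_homotopy_of
      by (rule sum_subtractf)
    finally show ?thesis .
  qed
  show ?thesis
    by (rule additive_frag_eq[where S = UNIV and f = "\<lambda>c. face_diff ?I (Suc n) (Suc (Suc i)) (cube_subdivision_homotopy (Suc n) c)"
          and g = "\<lambda>c. cube_subdivision_homotopy n (face_diff ?I n (Suc i) c)", OF _ _ gen])
      (simp_all add: additive_frag_comp face_diff_additive cube_subdivision_homotopy_additive)
qed

text \<open>At time 0 the cylinders form the subdivision. At time 1 the cylinder without upper
  directions is the given generator and the rest is degenerate; here the identities of the cubical
  subdivision become approximate.\<close>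

lemma cube_subdivision_homotopy_first_face:
  assumes c: "supp c \<subseteq> cube_gens Unit_interval n X"
  shows "supp (c - cube_subdivision n c + face_diff Unit_interval n 1 (cube_subdivision_homotopy n c))
    \<subseteq> cube_gens Unit_interval n X \<inter> degenerate Unit_interval n"
proof (rule additive_frag_keysI[where f = "\<lambda>c. c - cube_subdivision n c + face_diff Unit_interval n 1 (cube_subdivision_homotopy n c)", OF _ _ c])
  show "additive_frag (\<lambda>c. c - cube_subdivision n c + face_diff Unit_interval n 1 (cube_subdivision_homotopy n c))"
    by (simp add: additive_frag_def additive_frag_diff[OF cube_subdivision_additive] additive_frag_diff[OF face_diff_additive]
        additive_frag_diff[OF cube_subdivision_homotopy_additive])
  fix \<sigma> assume \<sigma>: "\<sigma> \<in> cube_gens Unit_interval n X"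
  have "face_diff Unit_interval n 1 (cube_subdivision_homotopy n (frag_of \<sigma>))
      = cube_subdivision n (frag_of \<sigma>) - (\<Sum>e\<in>Pow {1..n}. frag_of (cube_piece n 1 e \<sigma>))"
    unfolding cube_subdivision_homotopy_of additive_frag_sum[OF face_diff_additive] face_diff_of
      cyl_first_face[OF interval_ends(1)] cyl_first_face[OF interval_ends(2)] cube_subdivision_of
    by (simp add: sum_subtractf)
  also have "(\<Sum>e\<in>Pow {1..n}. frag_of (cube_piece n 1 e \<sigma>)) = frag_of \<sigma> + (\<Sum>e\<in>Pow {1..n} - {{}}. frag_of (cube_piece n 1 e \<sigma>))"
    using sum.remove[of "Pow {1..n}" "{}" "\<lambda>e. frag_of (cube_piece n 1 e \<sigma>)"] cube_piece_top(2)[OF \<sigma>, of "{}"] by simp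
  finally have eq: "frag_of \<sigma> - cube_subdivision n (frag_of \<sigma>) + face_diff Unit_interval n 1 (cube_subdivision_homotopy n (frag_of \<sigma>))
      = - (\<Sum>e\<in>Pow {1..n} - {{}}. frag_of (cube_piece n 1 e \<sigma>))" by simp
  have "cube_piece n 1 e \<sigma> \<in> cube_gens Unit_interval n X \<inter> degenerate Unit_interval n" if "e \<in> Pow {1..n} - {{}}" for e
    using cube_piece_gens(2)[OF \<sigma>] cube_piece_top(1)[OF \<sigma>, of e] that by simp
  then show "supp (frag_of \<sigma> - cube_subdivision n (frag_of \<sigma>)
      + face_diff Unit_interval n 1 (cube_subdivision_homotopy n (frag_of \<sigma>))) \<subseteq> cube_gens Unit_interval n X \<inter> degenerate Unit_interval n"
    unfolding eq keys_minus by (intro keys_sum_subset keys_frag_of_subset)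
qed

lemma cube_subdivision_htpy:
  shows "supp c \<subseteq> cube_gens Unit_interval 0 X \<Longrightarrow>
    supp (c - cube_subdivision 0 c - cube_bdry Unit_interval 0 (cube_subdivision_homotopy 0 c))
      \<subseteq> cube_gens Unit_interval 0 X \<inter> degenerate Unit_interval 0"
    and "supp c \<subseteq> cube_gens Unit_interval (Suc n) X \<Longrightarrow>
    supp (c - cube_subdivision (Suc n) c - (cube_bdry Unit_interval (Suc n) (cube_subdivision_homotopy (Suc n) c)
      + cube_subdivision_homotopy n (cube_bdry Unit_interval n c)))
      \<subseteq> cube_gens Unit_interval (Suc n) X \<inter> degenerate Unit_interval (Suc n)"
proof -
  assume c: "supp c \<subseteq> cube_gens Unit_interval 0 X"
  show "supp (c - cube_subdivision 0 c - cube_bdry Unit_interval 0 (cube_subdivision_homotopy 0 c))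
      \<subseteq> cube_gens Unit_interval 0 X \<inter> degenerate Unit_interval 0"
    using cube_subdivision_homotopy_first_face[OF c] by (simp only: cube_bdry_0 diff_minus_eq_add)
next
  assume c: "supp c \<subseteq> cube_gens Unit_interval (Suc n) X"
  have bd: "cube_bdry Unit_interval (Suc n) (cube_subdivision_homotopy (Suc n) c)
    = - face_diff Unit_interval (Suc n) 1 (cube_subdivision_homotopy (Suc n) c) - cube_subdivision_homotopy n (cube_bdry Unit_interval n c)"
    by (rule cube_bdry_cylinder[OF cube_subdivision_homotopy_additive cube_subdivision_homotopy_face])
  have "c - cube_subdivision (Suc n) c - (cube_bdry Unit_interval (Suc n) (cube_subdivision_homotopy (Suc n) c)
      + cube_subdivision_homotopy n (cube_bdry Unit_interval n c))
    = c - cube_subdivision (Suc n) c + face_diff Unit_interval (Suc n) 1 (cube_subdivision_homotopy (Suc n) c)"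
    using bd by simp
  then show "supp (c - cube_subdivision (Suc n) c - (cube_bdry Unit_interval (Suc n) (cube_subdivision_homotopy (Suc n) c)
      + cube_subdivision_homotopy n (cube_bdry Unit_interval n c)))
      \<subseteq> cube_gens Unit_interval (Suc n) X \<inter> degenerate Unit_interval (Suc n)"
    using cube_subdivision_homotopy_first_face[OF c] by (simp only:)
qed

lemma unit_interval_nbhd:
  assumes "cnbhd (interval_space Unit_interval) x V"
  shows "\<exists>\<epsilon>>0. \<forall>y\<in>{0..1}. \<bar>y - x\<bar> < \<epsilon> \<longrightarrow> y \<in> V"
proof -
  have "x \<in> top_of_set {0..1} interior_of V" using assms by (simp add: cnbhd_topology)
  then obtain W where W: "openin (top_of_set {0..1}) W" "x \<in> W" "W \<subseteq> V" unfolding interior_of_def by blast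
  then obtain O' where O: "open O'" "W = {0..1} \<inter> O'" unfolding openin_open by blast
  then obtain \<epsilon> where "\<epsilon> > 0" "\<forall>y. dist y x < \<epsilon> \<longrightarrow> y \<in> O'" using W(2) unfolding open_dist by blast
  then show ?thesis using O(2) W(3) by (auto simp: dist_real_def)
qed

text \<open>The subcube with corner \<open>a\<close> and side \<open>r\<close>. Iterated halving
  leads to such maps only, so a piece at any stage is described by a corner and a side.\<close>

definition subcube :: "nat \<Rightarrow> real \<Rightarrow> (nat \<Rightarrow> real) \<Rightarrow> (nat \<Rightarrow> real) \<Rightarrow> nat \<Rightarrow> real" where
  "subcube n r a p = (\<lambda>k\<in>{1..n}. a k + r * p k)"

lemma cube_piece_subcube:
  "cube_piece n (1 / 2) e (restrict (\<sigma> \<circ> subcube n r a) (points (unit_cube n)))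
    = restrict (\<sigma> \<circ> subcube n (r / 2) (\<lambda>k. a k + (if k \<in> e then r / 2 else 0))) (points (unit_cube n))"
  unfolding cube_piece_def
proof (rule restrict_ext)
  fix p assume p: "p \<in> points (unit_cube n)"
  have "cube_part n (1 / 2) e p \<in> points (unit_cube n)"
    using cube_coord[OF p] part_range[of "1 / 2"] by (auto simp: points_cube cube_part_def)
  moreover have "subcube n r a (cube_part n (1 / 2) e p) k = subcube n (r / 2) (\<lambda>k. a k + (if k \<in> e then r / 2 else 0)) p k" for k
    by (simp add: subcube_def cube_part_def part_def restrict_def algebra_simps)
  then have "subcube n r a (cube_part n (1 / 2) e p) = subcube n (r / 2) (\<lambda>k. a k + (if k \<in> e then r / 2 else 0)) p"
    by (rule ext)
  ultimately show "(restrict (\<sigma> \<circ> subcube n r a) (points (unit_cube n)) \<circ> cube_part n (1 / 2) e) p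
      = (\<sigma> \<circ> subcube n (r / 2) (\<lambda>k. a k + (if k \<in> e then r / 2 else 0))) p" by simp
qed

text \<open>Finitely many pieces admit a common number of further subdivisions. It is used
  contrapositively: a generator that never becomes small has a piece that never does.\<close>

lemma cube_small_step:
  assumes M: "\<And>c. supp c \<subseteq> M \<Longrightarrow> supp (cube_subdivision n c) \<subseteq> M"
    and small: "\<And>e. e \<subseteq> {1..n} \<Longrightarrow> \<exists>m. supp ((cube_subdivision n ^^ m) (frag_of (cube_piece n (1 / 2) e \<sigma>))) \<subseteq> M"
  shows "\<exists>m. supp ((cube_subdivision n ^^ m) (frag_of \<sigma>)) \<subseteq> M"
proof -
  have add: "additive_frag (cube_subdivision n ^^ m)" for m
    by (induction m) (simp_all add: additive_frag_def additive_frag_diff[OF cube_subdivision_additive])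
  have "\<forall>e\<in>Pow {1..n}. \<exists>m. supp ((cube_subdivision n ^^ m) (frag_of (cube_piece n (1 / 2) e \<sigma>))) \<subseteq> M"
    using small by blast
  from bchoice[OF this] obtain m where
    m: "\<forall>e\<in>Pow {1..n}. supp ((cube_subdivision n ^^ m e) (frag_of (cube_piece n (1 / 2) e \<sigma>))) \<subseteq> M" by blast
  \<comment> \<open>A sum of natural numbers bounds each summand; additional subdivisions keep small
    chains small.\<close>
  define N where "N = sum m (Pow {1..n})"
  have "supp ((cube_subdivision n ^^ N) (frag_of (cube_piece n (1 / 2) e \<sigma>))) \<subseteq> M" if e: "e \<in> Pow {1..n}" for e
  proof -
    have "m e \<le> N" unfolding N_def using e by (intro member_le_sum) simp_all
    then obtain k where k: "N = k + m e" using le_Suc_ex by (metis add.commute)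
    have "supp ((cube_subdivision n ^^ k) c) \<subseteq> M" if "supp c \<subseteq> M" for c
      using that M by (induction k) simp_all
    then show ?thesis using m e unfolding k funpow_add by simp
  qed
  moreover have "(cube_subdivision n ^^ Suc N) (frag_of \<sigma>)
      = (\<Sum>e\<in>Pow {1..n}. (cube_subdivision n ^^ N) (frag_of (cube_piece n (1 / 2) e \<sigma>)))"
    unfolding funpow_Suc_right comp_apply cube_subdivision_of additive_frag_sum[OF add] ..
  ultimately have "supp ((cube_subdivision n ^^ Suc N) (frag_of \<sigma>)) \<subseteq> M"
    by (simp only: keys_sum_subset)
  then show ?thesis by (rule exI[of _ "Suc N"])
qed

text \<open>Lower ends increase, upper ends decrease, and the lengths tend to zero, so both
  sequences have the same limit.\<close>

lemma nested_intervals: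
  fixes a :: "nat \<Rightarrow> real"
  assumes "\<And>j. a j \<le> a (Suc j)" "\<And>j. a (Suc j) + (1 / 2) ^ Suc j \<le> a j + (1 / 2) ^ j"
  shows "\<exists>x. \<forall>j. a j \<le> x \<and> x \<le> a j + (1 / 2) ^ j"
proof -
  have "(\<lambda>j. a j - (a j + (1 / 2) ^ j)) \<longlonglongrightarrow> 0"
    using tendsto_minus[OF LIMSEQ_realpow_zero[of "1 / 2"]] by simp
  moreover have "\<forall>j. a j \<le> a j + (1 / 2) ^ j" by simp
  ultimately show ?thesis
    using nested_sequence_unique[of a "\<lambda>j. a j + (1 / 2) ^ j", OF allI[OF assms(1)] allI[OF assms(2)]] by blast
qed

text \<open>By bisection: a cube none of whose iterated subdivisions is small has a shrinking sequence
  of faulty subcubes, but all of these close to the limit point lie in \<open>A\<close> or in \<open>B\<close>.\<close>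

lemma cube_small:
  assumes X: "closure_space X" and AB: "interior_cover X {A, B}"
    and \<sigma>: "\<sigma> \<in> cube_gens Unit_interval n X"
  shows "\<exists>m. supp ((cube_subdivision n ^^ m) (frag_of \<sigma>))
    \<subseteq> cube_gens Unit_interval n (subspace_of X B) \<union> cube_gens Unit_interval n (subspace_of X A)"
proof (rule ccontr)
  let ?P = "points (unit_cube n)"
  let ?M = "cube_gens Unit_interval n (subspace_of X B) \<union> cube_gens Unit_interval n (subspace_of X A)"
  let ?s = "\<lambda>j a. restrict (\<sigma> \<circ> subcube n ((1 / 2) ^ j) a) ?P"
  define small where "small \<tau> \<longleftrightarrow> (\<exists>m. supp ((cube_subdivision n ^^ m) (frag_of \<tau>)) \<subseteq> ?M)" for \<tau>
  \<comment> \<open>A faulty subcube with corner \<open>a\<close> and side \<open>(1/2)^j\<close>.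
    The bounds on the corner keep it inside the unit cube, and membership in the generators of
    \<open>X\<close> is carried along for use at the limit.\<close>
  define bad where "bad j a \<longleftrightarrow> ?s j a \<in> cube_gens Unit_interval n X \<and> \<not> small (?s j a) \<and>
    (\<forall>k\<in>{1..n}. 0 \<le> a k \<and> a k + (1 / 2) ^ j \<le> 1)" for j and a :: "nat \<Rightarrow> real"
  assume "\<not> (\<exists>m. supp ((cube_subdivision n ^^ m) (frag_of \<sigma>)) \<subseteq> ?M)"
  then have ns: "\<not> small \<sigma>" unfolding small_def .
  have sub: "A \<subseteq> points X" "B \<subseteq> points X" using AB unfolding interior_cover_def by blast+
  have M: "supp (cube_subdivision n c) \<subseteq> ?M" if c: "supp c \<subseteq> ?M" for c
  proof (rule cube_subdivision_keys[OF _ c])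
    fix \<tau> e assume "\<tau> \<in> ?M"
    then show "cube_piece n (1 / 2) e \<tau> \<in> ?M" using cube_piece_gens(1)[of \<tau> n _ e] by blast
  qed
  have s0: "?s 0 (\<lambda>k. 0) = \<sigma>"
  proof (rule extensionalityI[of _ ?P])
    fix p assume p: "p \<in> ?P"
    have "subcube n ((1 / 2) ^ 0) (\<lambda>k. 0) p k = p k" for k using cube_undefined[OF p, of k] by (simp add: subcube_def restrict_def)
    then have "subcube n ((1 / 2) ^ 0) (\<lambda>k. 0) p = p" by (rule ext)
    then show "?s 0 (\<lambda>k. 0) p = \<sigma> p" using p by simp
  qed (use \<sigma> in \<open>simp_all add: gens_def\<close>)
  have "\<exists>f. \<forall>j. bad j (f j) \<and> (\<forall>k\<in>{1..n}. f j k \<le> f (Suc j) k \<and> f (Suc j) k + (1 / 2) ^ Suc j \<le> f j k + (1 / 2) ^ j)"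
  proof (rule dependent_nat_choice)
    show "\<exists>a. bad 0 a" unfolding bad_def by (rule exI[of _ "\<lambda>k. 0"]) (use \<sigma> ns s0 in simp)
    fix a j assume bad: "bad j a"
    then have "\<not> small (?s j a)" unfolding bad_def by blast
    then obtain e where e: "e \<subseteq> {1..n}" "\<not> small (cube_piece n (1 / 2) e (?s j a))"
      using cube_small_step[OF M, of "?s j a"] unfolding small_def by blast
    \<comment> \<open>Upper directions move the corner by half of the old side; in the other
      directions it stays.\<close>
    define a' where "a' k = a k + (if k \<in> e then (1 / 2) ^ j / 2 else 0)" for k
    have eq: "cube_piece n (1 / 2) e (?s j a) = ?s (Suc j) a'"
      unfolding cube_piece_subcube a'_def[abs_def] by simp
    have "?s (Suc j) a' \<in> cube_gens Unit_interval n X"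
      using cube_piece_gens(1)[of "?s j a" n X e] bad unfolding eq bad_def by blast
    moreover have "0 \<le> a' k \<and> a' k + (1 / 2) ^ Suc j \<le> 1" if k: "k \<in> {1..n}" for k
    proof -
      have "0 \<le> a k" "a k + (1 / 2) ^ j \<le> 1" using bad k unfolding bad_def by blast+
      moreover have "(0 :: real) \<le> (1 / 2) ^ j" by simp
      ultimately show ?thesis unfolding a'_def by (simp add: field_simps)
    qed
    ultimately have "bad (Suc j) a'" unfolding bad_def using e(2) eq by simp
    moreover have "a k \<le> a' k \<and> a' k + (1 / 2) ^ Suc j \<le> a k + (1 / 2) ^ j" for k
      unfolding a'_def by (simp add: field_simps)
    ultimately show "\<exists>a'. bad (Suc j) a' \<and> (\<forall>k\<in>{1..n}. a k \<le> a' k \<and> a' k + (1 / 2) ^ Suc j \<le> a k + (1 / 2) ^ j)"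
      by blast
  qed
  then obtain f where "\<forall>j. bad j (f j) \<and> (\<forall>k\<in>{1..n}. f j k \<le> f (Suc j) k \<and> f (Suc j) k + (1 / 2) ^ Suc j \<le> f j k + (1 / 2) ^ j)"
    by (rule exE)
  note f' = this[THEN spec]
  have f: "bad j (f j)" for j using f' by (rule conjunct1)
  have step: "f j k \<le> f (Suc j) k \<and> f (Suc j) k + (1 / 2) ^ Suc j \<le> f j k + (1 / 2) ^ j" if "k \<in> {1..n}" for j k
    using conjunct2[OF f'] that by (rule bspec)
  have "\<forall>k\<in>{1..n}. \<exists>x. \<forall>j. f j k \<le> x \<and> x \<le> f j k + (1 / 2) ^ j"
  proof
    fix k assume k: "k \<in> {1..n}"
    show "\<exists>x. \<forall>j. f j k \<le> x \<and> x \<le> f j k + (1 / 2) ^ j"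
      by (rule nested_intervals[of "\<lambda>j. f j k"]) (use step[OF k] in \<open>simp_all only:\<close>)
  qed
  from bchoice[OF this] obtain x where x: "\<forall>k\<in>{1..n}. \<forall>j. f j k \<le> x k \<and> x k \<le> f j k + (1 / 2) ^ j" by blast
  have f01: "0 \<le> f j k \<and> f j k + (1 / 2) ^ j \<le> 1" if "k \<in> {1..n}" for j k using f[of j] that unfolding bad_def by blast
  let ?z = "\<lambda>k\<in>{1..n}. x k"
  have z: "?z \<in> ?P"
  proof -
    have "x k \<in> {0..1}" if "k \<in> {1..n}" for k
      using bspec[OF x that, THEN spec, of 0] f01[OF that, of 0] by simp
    then show ?thesis by (auto simp: points_cube)
  qed
  have "ccont (unit_cube n) X \<sigma>" using \<sigma> by (simp add: gens_def)
  then obtain C where C: "C \<in> {A, B}" "cnbhd (unit_cube n) ?z {w \<in> ?P. \<sigma> w \<in> C}"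
    using interior_cover_pullback[OF X AB closure_space_cube _ z, of \<sigma>] by blast
  obtain U where U: "\<forall>k\<in>{1..n}. cnbhd (interval_space Unit_interval) (?z k) (U k)" "(\<Pi>\<^sub>E k\<in>{1..n}. U k) \<subseteq> {w \<in> ?P. \<sigma> w \<in> C}"
    using cpower_box[OF closure_space_interval C(2)[unfolded cube_space_def]] unfolding cube_space_def by blast
  have "\<forall>k\<in>{1..n}. \<exists>\<epsilon>>0. \<forall>y\<in>{0..1}. \<bar>y - x k\<bar> < \<epsilon> \<longrightarrow> y \<in> U k"
  proof
    fix k assume k: "k \<in> {1..n}"
    show "\<exists>\<epsilon>>0. \<forall>y\<in>{0..1}. \<bar>y - x k\<bar> < \<epsilon> \<longrightarrow> y \<in> U k"
      using unit_interval_nbhd[OF bspec[OF U(1) k]] k by simp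
  qed
  from bchoice[OF this] obtain \<epsilon> where \<epsilon>: "\<forall>k\<in>{1..n}. \<epsilon> k > 0 \<and> (\<forall>y\<in>{0..1}. \<bar>y - x k\<bar> < \<epsilon> k \<longrightarrow> y \<in> U k)" by blast
  \<comment> \<open>The smallest of the radii around the limit point. The extra element 1 keeps the
    minimum meaningful in dimension zero.\<close>
  define \<delta> where "\<delta> = Min (insert 1 (\<epsilon> ` {1..n}))"
  have "\<delta> > 0" unfolding \<delta>_def using \<epsilon> by (subst Min_gr_iff) auto
  then obtain j where j: "(1 / 2) ^ j < \<delta>" using real_arch_pow_inv[of \<delta> "1 / 2"] by auto
  have "\<sigma> (subcube n ((1 / 2) ^ j) (f j) p) \<in> C" if p: "p \<in> ?P" for p
  proof -
    have "f j k + (1 / 2) ^ j * p k \<in> U k" if k: "k \<in> {1..n}" for k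
    proof -
      have "p k \<in> {0..1}" using cube_coord[OF p k] by simp
      then have "0 \<le> (1 / 2) ^ j * p k" "(1 / 2) ^ j * p k \<le> (1 / 2) ^ j" by (simp_all add: mult_left_le)
      moreover have "f j k \<le> x k \<and> x k \<le> f j k + (1 / 2) ^ j" using bspec[OF x k] ..
      \<comment> \<open>The limit and every point of the subcube share the interval of length
        \<open>(1/2)^j\<close> in each coordinate, which bounds their distance.\<close>
      ultimately have "\<bar>f j k + (1 / 2) ^ j * p k - x k\<bar> \<le> (1 / 2) ^ j" "f j k + (1 / 2) ^ j * p k \<in> {0..1}"
        unfolding atLeastAtMost_iff using f01[OF k, of j] by linarith+
      moreover have "\<delta> \<le> \<epsilon> k" unfolding \<delta>_def using k by (intro Min_le) auto
      ultimately show ?thesis using bspec[OF \<epsilon> k] j by auto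
    qed
    then have "subcube n ((1 / 2) ^ j) (f j) p \<in> (\<Pi>\<^sub>E k\<in>{1..n}. U k)" by (simp add: subcube_def)
    then show ?thesis using U(2) by blast
  qed
  then have "?s j (f j) ` ?P \<subseteq> C" by auto
  moreover have "?s j (f j) \<in> cube_gens Unit_interval n X" using f[of j] unfolding bad_def by blast
  moreover have "C \<subseteq> points X" using C(1) sub by blast
  ultimately have "?s j (f j) \<in> cube_gens Unit_interval n (subspace_of X C)"
    using gens_subspace[where \<Delta> = unit_cube and n = n and A = C and X = X, OF closure_space_cube] by blast
  \<comment> \<open>The faulty subcube is already small with no subdivision at all, contradicting
    its choice.\<close>
  then have "small (?s j (f j))" unfolding small_def using C(1) by (intro exI[of _ 0]) auto
  then show False using f[of j] unfolding bad_def by blast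
qed

lemma cube_excision_operators:
  fixes G :: "'g monoid"
  assumes "coefficients G"
  shows "singular_theory.excision_operators (cube_space J) (degenerate J :: nat \<Rightarrow> ((nat \<Rightarrow> real) \<Rightarrow> 'a) set) (cube_bdry J)"
proof -
  interpret singular_theory G "cube_space J" "degenerate J :: nat \<Rightarrow> ((nat \<Rightarrow> real) \<Rightarrow> 'a) set" "cube_bdry J" "cube_rel_chains J" "cube_class J"
    "cube_rel_chain_map J"
    using cube_maps[OF assms] by (rule singular_theory.intro)
  show ?thesis
  proof (cases "J = Unit_interval")
    case False
    then show ?thesis by (intro excision_operators_focal cube_focal)
  next
    case J: True
    show ?thesis
      unfolding excision_operators_def
    proof (intro allI impI)
      fix X :: "'a cspace" and A B
      assume X: "closure_space X" and AB: "interior_cover X {A, B}"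
      let ?g = "\<lambda>n X. cube_gens J n (X :: 'a cspace)"
      let ?Z = "\<lambda>n. ?g n X \<inter> degenerate J n"
      have Sd: "supp (cube_subdivision n c) \<subseteq> ?g n Y" if "supp c \<subseteq> ?g n Y" for n c Y
        by (rule cube_subdivision_keys[OF _ that]) (simp add: J cube_piece_gens(1))
      have T: "supp (cube_subdivision_homotopy n c) \<subseteq> ?g (Suc n) Y" if "supp c \<subseteq> ?g n Y" for n c Y
        by (rule cube_subdivision_homotopy_keys[OF _ that]) (simp add: J cube_cyl_gens)
      have SdZ: "supp (cube_subdivision n c) \<subseteq> ?Z n" if "supp c \<subseteq> ?Z n" for n c
        by (rule cube_subdivision_keys[OF _ that]) (simp add: J cube_piece_gens(1) cube_piece_degenerate)
      have TZ: "supp (cube_subdivision_homotopy n c) \<subseteq> ?Z (Suc n)" if "supp c \<subseteq> ?Z n" for n c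
        by (rule cube_subdivision_homotopy_keys[OF _ that]) (simp add: J cube_cyl_gens cube_cyl_degenerate)
      have sub: "A \<subseteq> points X" "B \<subseteq> points X" using AB unfolding interior_cover_def by blast+
      \<comment> \<open>Small chains split into a part in \<open>B\<close>, a part in
        \<open>A\<close> and a degenerate part. An operator that respects subspaces and degenerate
        chains respects each summand.\<close>
      have null: "supp (F c) \<subseteq> ?g k (subspace_of X B) \<union> D.null X A k"
        if F: "additive_frag F" "\<And>Y c. supp c \<subseteq> ?g n Y \<Longrightarrow> supp (F c) \<subseteq> ?g k Y"
          "\<And>c. supp c \<subseteq> ?Z n \<Longrightarrow> supp (F c) \<subseteq> ?Z k"
          and c: "supp c \<subseteq> ?g n (subspace_of X B) \<union> D.null X A n" for F c n k
        by (rule keys_split_subset[OF F(1,2) keys_split_subset[OF F(1,2,3)] c])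
      have htpy0: "supp (c - cube_subdivision 0 c - cube_bdry J 0 (cube_subdivision_homotopy 0 c)) \<subseteq> ?Z 0"
        if "supp c \<subseteq> ?g 0 X" for c
        unfolding J by (rule cube_subdivision_htpy(1)[OF that[unfolded J]])
      have htpyS: "supp (c - cube_subdivision (Suc n) c - (cube_bdry J (Suc n) (cube_subdivision_homotopy (Suc n) c)
          + cube_subdivision_homotopy n (cube_bdry J n c))) \<subseteq> ?Z (Suc n)"
        if "supp c \<subseteq> ?g (Suc n) X" for n c
        unfolding J by (rule cube_subdivision_htpy(2)[OF that[unfolded J]])
      have "subdivision (\<lambda>n. ?g n X) ?Z (\<lambda>n. ?g n (subspace_of X B) \<union> D.null X A n)
        (cube_bdry J) cube_subdivision cube_subdivision_homotopy"
      proof (rule subdivision.intro)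
        fix n and c :: "'a cube_chain"
        show "?Z n \<subseteq> ?g n (subspace_of X B) \<union> D.null X A n" by blast
        show "?g n (subspace_of X B) \<union> D.null X A n \<subseteq> ?g n X" using D.gens_mono[OF sub(1), of n] D.gens_mono[OF sub(2), of n] by blast
        show "additive_frag (cube_bdry J n)" by (rule cube_bdry_additive)
        show "additive_frag (cube_subdivision n)" by (rule cube_subdivision_additive)
        show "additive_frag (cube_subdivision_homotopy n)" by (rule cube_subdivision_homotopy_additive)
        show "supp (cube_bdry J n c) \<subseteq> ?g n X" if "supp c \<subseteq> ?g (Suc n) X" using that by (rule cube_bdry_gens)
        show "supp (cube_bdry J n c) \<subseteq> ?g n (subspace_of X B) \<union> D.null X A n"
          if "supp c \<subseteq> ?g (Suc n) (subspace_of X B) \<union> D.null X A (Suc n)"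
          by (rule null[OF cube_bdry_additive cube_bdry_gens cube_bdry_degenerate that])
        show "supp (cube_bdry J n c) \<subseteq> ?Z n" if "supp c \<subseteq> ?Z (Suc n)" using that by (rule cube_bdry_degenerate)
        show "supp (cube_subdivision n c) \<subseteq> ?g n X" if "supp c \<subseteq> ?g n X" using that by (rule Sd)
        show "supp (cube_subdivision n c) \<subseteq> ?g n (subspace_of X B) \<union> D.null X A n"
          if "supp c \<subseteq> ?g n (subspace_of X B) \<union> D.null X A n"
          by (rule null[OF cube_subdivision_additive Sd SdZ that])
        show "supp (cube_subdivision n c) \<subseteq> ?Z n" if "supp c \<subseteq> ?Z n" using that by (rule SdZ)
        show "supp (cube_subdivision_homotopy n c) \<subseteq> ?g (Suc n) X" if "supp c \<subseteq> ?g n X" using that by (rule T)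
        show "supp (cube_subdivision_homotopy n c) \<subseteq> ?g (Suc n) (subspace_of X B) \<union> D.null X A (Suc n)"
          if "supp c \<subseteq> ?g n (subspace_of X B) \<union> D.null X A n"
          by (rule null[OF cube_subdivision_homotopy_additive T TZ that])
        show "supp (cube_subdivision_homotopy n c) \<subseteq> ?Z (Suc n)" if "supp c \<subseteq> ?Z n" using that by (rule TZ)
        show "supp (cube_bdry J n (cube_subdivision (Suc n) c) - cube_subdivision n (cube_bdry J n c)) \<subseteq> ?Z n"
          if c: "supp c \<subseteq> ?g (Suc n) X"
          by (rule subdivision_chain_map[where S = "\<lambda>n. ?g n X" and Z = ?Z and b = "cube_bdry J" and T = cube_subdivision_homotopy])
            (fact cube_bdry_additive cube_bdry_bdry cube_subdivision_homotopy_additive cube_bdry_gens cube_bdry_degenerate htpy0 htpyS c)+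
        show "supp (c - cube_subdivision 0 c - cube_bdry J 0 (cube_subdivision_homotopy 0 c)) \<subseteq> ?Z 0"
          if "supp c \<subseteq> ?g 0 X" using htpy0[OF that] .
        show "supp (c - cube_subdivision (Suc n) c - (cube_bdry J (Suc n) (cube_subdivision_homotopy (Suc n) c)
          + cube_subdivision_homotopy n (cube_bdry J n c))) \<subseteq> ?Z (Suc n)"
          if "supp c \<subseteq> ?g (Suc n) X" using htpyS[OF that] .
      next
        fix n \<sigma> assume "\<sigma> \<in> ?g n X"
        then have "\<exists>m. supp ((cube_subdivision n ^^ m) (frag_of \<sigma>)) \<subseteq> ?g n (subspace_of X B) \<union> ?g n (subspace_of X A)"
          using cube_small[OF X AB, of \<sigma> n] unfolding J by blast
        then show "\<exists>m. supp ((cube_subdivision n ^^ m) (frag_of \<sigma>)) \<subseteq> ?g n (subspace_of X B) \<union> D.null X A n"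
          by blast
      qed
      then show "\<exists>E. excision_operator X A B E" by (rule excision_operator_subdivision)
    qed
  qed
qed

section \<open>Assembly of the two theories from the generic locale\<close>

lemma simp_theory: "coefficients G \<Longrightarrow>
  singular_theory G (simplex_space J) (\<lambda>n. {}) (simp_bdry J) (simp_rel_chains J) (simp_class J) (simp_rel_chain_map J)"
  using simp_maps by (rule singular_theory.intro)

lemma simp_cohomology_eq: "simp_cohomology J G = (\<lambda>n X A. cohomology_group G (simp_rel_chains J X A) n)"
  by (simp add: fun_eq_iff simp_cohomology_def)

lemma simp_induced_eq:
  "simp_induced J G = (\<lambda>n X A Y B f. cohomology_map G (simp_rel_chains J X A) (simp_rel_chain_map J Y B f) n)"
  by (simp add: fun_eq_iff simp_induced_def)

lemma simp_connecting_eq: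
  "coefficients G \<Longrightarrow> simp_connecting J G = singular_theory.connect G (simp_rel_chains J) (simp_rel_chain_map J)"
  by (simp add: fun_eq_iff simp_connecting_def singular_theory.connect_def[OF simp_theory])

lemma cube_theory: "coefficients G \<Longrightarrow>
  singular_theory G (cube_space J) (degenerate J) (cube_bdry J) (cube_rel_chains J) (cube_class J) (cube_rel_chain_map J)"
  using cube_maps by (rule singular_theory.intro)

lemma cube_cohomology_eq: "cube_cohomology J G = (\<lambda>n X A. cohomology_group G (cube_rel_chains J X A) n)"
  by (simp add: fun_eq_iff cube_cohomology_def)

lemma cube_induced_eq:
  "cube_induced J G = (\<lambda>n X A Y B f. cohomology_map G (cube_rel_chains J X A) (cube_rel_chain_map J Y B f) n)"
  by (simp add: fun_eq_iff cube_induced_def)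

lemma cube_connecting_eq:
  "coefficients G \<Longrightarrow> cube_connecting J G = singular_theory.connect G (cube_rel_chains J) (cube_rel_chain_map J)"
  by (simp add: fun_eq_iff cube_connecting_def singular_theory.connect_def[OF cube_theory])

theorem theorem6p12:
  fixes J :: interval_kind and G :: "'g monoid"
  assumes "comm_group G"
  shows
    "cohomology_theory J
       (simp_cohomology J G :: ('a, _) pair_groups)
       (simp_induced J G :: ('a, _, 'a, _) pair_maps)
       (simp_connecting J G :: ('a, _) connecting_maps) \<and>
     cohomology_theory_across J
       (simp_cohomology J G :: ('a, _) pair_groups)
       (simp_cohomology J G :: ('b, _) pair_groups)
       (simp_cohomology J G :: ('c, _) pair_groups)
       (simp_induced J G :: ('a, _, 'b, _) pair_maps)
       (simp_induced J G :: ('b, _, 'c, _) pair_maps)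
       (simp_induced J G :: ('a, _, 'c, _) pair_maps)
       (simp_connecting J G :: ('a, _) connecting_maps)
       (simp_connecting J G :: ('b, _) connecting_maps) \<and>
     cohomology_theory J
       (cube_cohomology J G :: ('a, _) pair_groups)
       (cube_induced J G :: ('a, _, 'a, _) pair_maps)
       (cube_connecting J G :: ('a, _) connecting_maps) \<and>
     cohomology_theory_across J
       (cube_cohomology J G :: ('a, _) pair_groups)
       (cube_cohomology J G :: ('b, _) pair_groups)
       (cube_cohomology J G :: ('c, _) pair_groups)
       (cube_induced J G :: ('a, _, 'b, _) pair_maps)
       (cube_induced J G :: ('b, _, 'c, _) pair_maps)
       (cube_induced J G :: ('a, _, 'c, _) pair_maps)
       (cube_connecting J G :: ('a, _) connecting_maps)
       (cube_connecting J G :: ('b, _) connecting_maps)"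
proof -
  have G: "coefficients G" using assms by (rule coefficients.intro)
  show ?thesis
    unfolding simp_cohomology_eq simp_induced_eq simp_connecting_eq[OF G] cube_cohomology_eq cube_induced_eq cube_connecting_eq[OF G]
    by (intro conjI
        singular_theory.is_cohomology_theory[OF simp_theory[OF G] simp_homotopy_operators[OF G] simp_excision_operators[OF G] simp_point_contractions[OF G]]
        singular_theory.is_cohomology_theory[OF cube_theory[OF G] cube_homotopy_operators[OF G] cube_excision_operators[OF G] cube_point_contractions[OF G]]
        is_cohomology_theory_across[OF simp_theory[OF G] simp_theory[OF G] simp_maps[OF G] simp_maps[OF G] simp_maps[OF G] simp_homotopy_operators[OF G]]
        is_cohomology_theory_across[OF cube_theory[OF G] cube_theory[OF G] cube_maps[OF G] cube_maps[OF G] cube_maps[OF G] cube_homotopy_operators[OF G]])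
qed

end
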